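(* Let $n$ be an odd positive integer and let $M_{\triangle^n}$ be the Dirac matrix factorization associated with the standard $n$-simplex $\triangle^n$. Then, as graded modules, $$H^*(\mathrm{End}(M_{\triangle^n})_0)\cong H^*(\mathbb{R}P^n;(R_{\triangle^n})_0),$$ so $M_{\triangle^n}$ is a spherical object, i.e. $H^*(\mathrm{End}(M_{\triangle^n})_0)\cong H^*(S^n;(R_{\triangle^n})_0)$ where $S^n$ is the $n$-sphere.
   Context: $R=R_{\triangle^n}=\{\sum_{i\ge0}a_iT^{\beta_i}\mid a_i\in\mathbb R,\ \beta_i\in\frac1{n+1}\mathbb Z,\ \lim\beta_i=\infty\}$, graded by $|T^\beta|=2(n+1)\beta$, with trivial differential and valuation $\nu_R(\sum a_iT^{\beta_i})=\inf_{a_i\ne0}\beta_i$. $S=S_{\triangle^n}=R\langle z_0,\dots,z_n\rangle/\langle(-1)^{n(n+1)/2}z_0\cdots z_n-T\rangle$ (quotient of the Tate algebra over $R$), $|z_i|=2$. Let $P$ be the interior of $\{\zeta\in\mathbb R^{n+1}\mid\sum\zeta_i=1,\ \zeta_i\ge0\}$ (identified with the interior of $\triangle^n$). For $\zeta\in P$, $\nu^S_\zeta$ is the valuation on $S$ with $\nu^S_\zeta(z_i)=\zeta_i$ for which the monomials $\prod z_i^{d_i}$ (with $\min_id_i=0$) form an orthogonal Schauder basis over $R$, i.e. $\nu^S_\zeta(\sum_d r_dz^d)=\inf_d\{\nu_R(r_d)+\sum d_i\zeta_i\}$. The superpotential is $W_{\triangle^n}=z_0+\cdots+z_n$. $\mathrm{Cl}(\triangle^n)$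 is the graded $S$-algebra generated by $e_0,\dots,e_n$, $|e_i|=1$, with relations $e_ie_j+e_je_i=2\delta_{ij}z_i$. It carries valuations $\nu_\zeta$ determined by $\nu_\zeta(e_i)=\frac12\zeta_i$ and by the basis $\{e_{i_0}\cdots e_{i_k}\}_{i_0<\cdots<i_k}$ being orthogonal over $(S,\nu_\zeta^S)$. The Dirac factorization is $M_{\triangle^n}=\mathrm{Cl}(\triangle^n)/\langle e_0\cdots e_n-T^{1/2}\rangle$ (quotient by the left ideal), a free $S$-module with the induced valuations $\nu^M_\zeta$, together with $D$ = left multiplication by $e_0+\cdots+e_n$, so that $D^2=W_{\triangle^n}$. $\mathrm{End}(M_{\triangle^n})$ is the graded algebra of $S$-linear endomorphisms, with differential $\delta(\Phi)=D\Phi-(-1)^{|\Phi|}\Phi D$ and norm $\nu_M(\Phi)=\inf_{\zeta\in P}\inf_{m\ne0}\{\nu^M_\zeta(\Phi(m))-\nu^M_\zeta(m)\}$. Put $\mathrm{End}(M_{\triangle^n})_0=\{\Phi\mid\nu_M(\Phi)\ge0\}/\{\Phi\mid\nu_M(\Phi)>0\}$ with the differential induced by $\delta$ (which satisfies $\nu_M(\delta\Phi)\ge\nu_M(\Phi)$), and $R_0=\{\nu_R\ge0\}/\{\nu_R>0\}$ ($=\mathbb R$). *)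

theory Defs
  imports
    "HOL-Homology.Homology"
    "HOL-Algebra.QuotRing"
    "HOL-Algebra.Module"
    "HOL-Computational_Algebra.Formal_Laurent_Series"
    "HOL-Library.Extended_Real"
begin

section \<open>Quotient modules, cochain complexes and their cohomology\<close>

text \<open>
  The record \<^type>\<open>module\<close> extends the ring record; its fields for the product and the unit
  carry no meaning for a module and are left unspecified. The submodule is a set, and \<open>V\<close> may be
  a left module over a noncommutative ring.
\<close>

definition quot_module :: "('a, 'b, 'm) module_scheme \<Rightarrow> 'b set \<Rightarrow> ('a, 'b set) module" where
  "quot_module V N =
    \<lparr>carrier = a_rcosets\<^bsub>V\<^esub> N, monoid.mult = (\<lambda>_ _. undefined), one = undefined,
     zero = N, add = set_add V,
     module.smult = (\<lambda>r A. \<Union>x\<in>A. N +>\<^bsub>V\<^esub> (r \<odot>\<^bsub>V\<^esub> x))\<rparr>"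

text \<open>A \<open>\<int>\<close>-graded module is a family of modules indexed by \<^typ>\<open>int\<close>.\<close>

definition cohomology ::
  "(int \<Rightarrow> ('a, 'b) module) \<Rightarrow> (int \<Rightarrow> 'b \<Rightarrow> 'b) \<Rightarrow> int \<Rightarrow> ('a, 'b set) module" where
  "cohomology C \<delta> p =
    quot_module ((C p)\<lparr>carrier := {x \<in> carrier (C p). \<delta> p x = \<zero>\<^bsub>C (p + 1)\<^esub>}\<rparr>)
      (\<delta> (p - 1) ` carrier (C (p - 1)))"

definition graded_module_iso ::
  "(int \<Rightarrow> ('a, 'b) module) \<Rightarrow> (int \<Rightarrow> ('a, 'c) module) \<Rightarrow> bool" where
  "graded_module_iso V W \<longleftrightarrow>
    (\<forall>p. \<exists>h. h \<in> iso (add_monoid (V p)) (add_monoid (W p)) \<and>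
      (\<forall>r. \<forall>x\<in>carrier (V p). h (r \<odot>\<^bsub>V p\<^esub> x) = r \<odot>\<^bsub>W p\<^esub> h x))"

section \<open>Singular cohomology with real coefficients\<close>

text \<open>
  Degree \<open>p \<ge> 0\<close> consists of the homomorphisms from the group of singular \<open>p\<close>-chains to \<open>\<real>\<close>;
  negative degrees are zero.
\<close>

definition singular_cochains :: "'a topology \<Rightarrow> int \<Rightarrow> (real, 'a chain \<Rightarrow> real) module" where
  "singular_cochains X p =
    (let A = carrier (chain_group (nat p) X) in
     \<lparr>carrier = {\<phi> \<in> extensional A.
        (\<forall>x\<in>A. \<forall>y\<in>A. \<phi> (x + y) = \<phi> x + \<phi> y) \<and> (p < 0 \<longrightarrow> (\<forall>x\<in>A. \<phi> x = 0))},
      monoid.mult = (\<lambda>_ _. undefined), one = undefined,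
      zero = (\<lambda>x\<in>A. 0), add = (\<lambda>\<phi> \<psi>. \<lambda>x\<in>A. \<phi> x + \<psi> x),
      module.smult = (\<lambda>r \<phi>. \<lambda>x\<in>A. r * \<phi> x)\<rparr>)"

definition singular_coboundary ::
  "'a topology \<Rightarrow> int \<Rightarrow> ('a chain \<Rightarrow> real) \<Rightarrow> 'a chain \<Rightarrow> real" where
  "singular_coboundary X p \<phi> =
    (\<lambda>x\<in>carrier (chain_group (nat (p + 1)) X). \<phi> (chain_boundary (nat (p + 1)) x))"

definition singular_cohomology ::
  "'a topology \<Rightarrow> int \<Rightarrow> (real, ('a chain \<Rightarrow> real) set) module" where
  "singular_cohomology X = cohomology (singular_cochains X) (singular_coboundary X)"

definition antipodal_class :: "(nat \<Rightarrow> real) \<Rightarrow> (nat \<Rightarrow> real) set" where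
  "antipodal_class x = {x, \<lambda>i. - x i}"

definition projective_space :: "nat \<Rightarrow> (nat \<Rightarrow> real) set topology" where
  "projective_space n = topology (\<lambda>U. U \<subseteq> antipodal_class ` topspace (nsphere n) \<and>
     openin (nsphere n) {x \<in> topspace (nsphere n). antipodal_class x \<in> U})"

lemma openin_projective_space:
  "openin (projective_space n) U \<longleftrightarrow> U \<subseteq> antipodal_class ` topspace (nsphere n) \<and>
     openin (nsphere n) {x \<in> topspace (nsphere n). antipodal_class x \<in> U}"
proof -
  let ?X = "nsphere n" and ?q = antipodal_class
  let ?L = "\<lambda>U. U \<subseteq> ?q ` topspace ?X \<and> openin ?X {x \<in> topspace ?X. ?q x \<in> U}"
  have "istopology ?L"
    unfolding istopology_def
  proof (intro conjI allI impI)
    fix U V assume U: "?L U" and V: "?L V"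
    have "{x \<in> topspace ?X. ?q x \<in> U \<inter> V}
        = {x \<in> topspace ?X. ?q x \<in> U} \<inter> {x \<in> topspace ?X. ?q x \<in> V}" by auto
    then show "openin ?X {x \<in> topspace ?X. ?q x \<in> U \<inter> V}"
      using U V by (simp add: openin_Int)
    show "U \<inter> V \<subseteq> ?q ` topspace ?X" using U by blast
  next
    fix K assume K: "\<forall>U\<in>K. ?L U"
    have "{x \<in> topspace ?X. ?q x \<in> \<Union>K} = (\<Union>U\<in>K. {x \<in> topspace ?X. ?q x \<in> U})" by auto
    then show "openin ?X {x \<in> topspace ?X. ?q x \<in> \<Union>K}"
      using K by (auto intro!: openin_Union)
    show "\<Union>K \<subseteq> ?q ` topspace ?X" using K by blast
  qed
  then show ?thesis
    by (simp add: projective_space_def topology_inverse')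
qed

lemma quotient_map_antipodal_class:
  "quotient_map (nsphere n) (projective_space n) antipodal_class"
proof -
  let ?A = "antipodal_class ` topspace (nsphere n)"
  have "{x \<in> topspace (nsphere n). antipodal_class x \<in> ?A} = topspace (nsphere n)"
    by blast
  then have "openin (projective_space n) ?A"
    unfolding openin_projective_space by simp
  moreover have "topspace (projective_space n) \<subseteq> ?A"
    using openin_topspace[of "projective_space n"] unfolding openin_projective_space by (rule conjunct1)
  ultimately have "topspace (projective_space n) = ?A"
    by (intro subset_antisym openin_subset)
  then show ?thesis
    by (simp add: quotient_map_def openin_projective_space)
qed

section \<open>The coefficient ring \<open>R\<close>\<close>

text \<open>
  For fixed \<open>n\<close>, the field \<open>R\<close> is the field of real Laurent series in \<open>X = T^(1/(n+1))\<close>: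
  the coefficient of \<open>T\<^sup>\<beta>\<close> for \<open>\<beta> = k / (n + 1)\<close> is \<open>fls_nth r k\<close>. In particular \<open>|X\<^sup>k| = 2 k\<close>.
\<close>

definition nu_R :: "nat \<Rightarrow> real fls \<Rightarrow> ereal" where
  "nu_R n r = (INF k\<in>{k. fls_nth r k \<noteq> 0}. ereal (of_int k / of_nat (n + 1)))"

definition hom_R :: "int \<Rightarrow> real fls \<Rightarrow> bool" where
  "hom_R p r \<longleftrightarrow> (\<forall>k. fls_nth r k \<noteq> 0 \<longrightarrow> 2 * k = p)"

definition T_R :: "nat \<Rightarrow> real fls" where
  "T_R n = fls_X ^ (n + 1)"

text \<open>The square root \<open>T^(1/2)\<close>, which lies in \<open>R\<close> for odd \<open>n\<close> only.\<close>

definition sqrt_T_R :: "nat \<Rightarrow> real fls" where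
  "sqrt_T_R n = fls_X ^ ((n + 1) div 2)"

lemma nu_R_ge_iff: "ereal (of_int j / of_nat (n + 1)) \<le> nu_R n r \<longleftrightarrow> (\<forall>k<j. fls_nth r k = 0)"
proof -
  have "ereal (of_int j / of_nat (n + 1)) \<le> ereal (of_int k / of_nat (n + 1)) \<longleftrightarrow> j \<le> k" for k
    by (simp add: divide_le_cancel)
  then show ?thesis
    unfolding nu_R_def le_INF_iff by (auto simp: not_le[symmetric])
qed

text \<open>
  Taking the coefficient of \<open>T\<^sup>0\<close> identifies \<open>R\<^sub>0 = {\<nu>\<^sub>R \<ge> 0} / {\<nu>\<^sub>R > 0}\<close> with the field \<open>\<real>\<close>,
  concentrated in degree \<open>0\<close>. Accordingly \<open>R\<^sub>0\<close>-modules are modules with scalars in \<^typ>\<open>real\<close>.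
\<close>

lemma nu_R_pos_iff: "0 < nu_R n r \<longleftrightarrow> 0 \<le> nu_R n r \<and> fls_nth r 0 = 0"
proof
  assume pos: "0 < nu_R n r"
  have "fls_nth r 0 = 0"
  proof (rule ccontr)
    assume "fls_nth r 0 \<noteq> 0"
    then have "nu_R n r \<le> ereal (of_int 0 / of_nat (n + 1))"
      unfolding nu_R_def by (intro INF_lower) simp
    with pos show False by (simp add: zero_ereal_def[symmetric])
  qed
  with pos show "0 \<le> nu_R n r \<and> fls_nth r 0 = 0" by simp
next
  assume a: "0 \<le> nu_R n r \<and> fls_nth r 0 = 0"
  then have "\<forall>k<0. fls_nth r k = 0"
    using nu_R_ge_iff[of 0 n r] by (simp add: zero_ereal_def[symmetric])
  with a have "fls_nth r k = 0" if "k < 1" for k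
    using that by (cases "k = 0") auto
  then have "ereal (of_int 1 / of_nat (n + 1)) \<le> nu_R n r"
    using nu_R_ge_iff by blast
  moreover have "0 < ereal (of_int 1 / of_nat (n + 1))" by simp
  ultimately show "0 < nu_R n r" by (rule less_le_trans[rotated])
qed

lemma residue_mult:
  assumes "0 \<le> nu_R n r" "0 \<le> nu_R n s"
  shows "fls_nth (r * s) 0 = fls_nth r 0 * fls_nth s 0"
proof -
  have r: "\<forall>k<0. fls_nth r k = 0" and s: "\<forall>k<0. fls_nth s k = 0"
    using assms nu_R_ge_iff[of 0] by (simp_all add: zero_ereal_def[symmetric])
  have "r = fps_to_fls (fls_regpart r)" "s = fps_to_fls (fls_regpart s)"
    using r s by (auto simp: fls_eq_iff)
  then have "fls_nth (r * s) 0 = fls_nth (fps_to_fls (fls_regpart r * fls_regpart s)) 0"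
    by (metis fls_times_fps_to_fls)
  then show ?thesis by simp
qed

lemma residue_const: "0 \<le> nu_R n (fls_const c)" "fls_nth (fls_const c) 0 = c"
  using nu_R_ge_iff[of 0 n "fls_const c"] by (simp_all add: zero_ereal_def[symmetric])

section \<open>The Tate algebra and \<open>S\<close>\<close>

text \<open>
  Multi-indices are finitely supported maps \<open>d\<close> with support in \<open>{0..n}\<close>; the function \<open>f\<close>
  stands for the series \<open>\<Sum>d. f d z\<^sup>d\<close>.
\<close>

type_synonym tate = "(nat \<Rightarrow>\<^sub>0 nat) \<Rightarrow> real fls"

definition tate_algebra :: "nat \<Rightarrow> tate ring" where
  "tate_algebra n =
    \<lparr>carrier = {f. (\<forall>d. f d \<noteq> 0 \<longrightarrow> Poly_Mapping.keys d \<subseteq> {..n}) \<and>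
                   (\<forall>c::real. finite {d. nu_R n (f d) < ereal c})},
     monoid.mult = (\<lambda>f g d. \<Sum>(a, b)\<in>{(a, b). a + b = d}. f a * g b),
     one = (\<lambda>d. if d = 0 then 1 else 0),
     zero = (\<lambda>d. 0),
     add = (\<lambda>f g d. f d + g d)\<rparr>"

definition tate_monom :: "real fls \<Rightarrow> (nat \<Rightarrow>\<^sub>0 nat) \<Rightarrow> tate" where
  "tate_monom r d = (\<lambda>d'. if d' = d then r else 0)"

definition hom_tate :: "nat \<Rightarrow> int \<Rightarrow> tate \<Rightarrow> bool" where
  "hom_tate n p f \<longleftrightarrow> f \<in> carrier (tate_algebra n) \<and>
    (\<forall>d. hom_R (p - 2 * int (\<Sum>i\<le>n. Poly_Mapping.lookup d i)) (f d))"

definition S_ideal :: "nat \<Rightarrow> tate set" where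
  "S_ideal n = Idl\<^bsub>tate_algebra n\<^esub>
    {tate_monom ((-1) ^ (n * (n + 1) div 2)) (\<Sum>i\<le>n. Poly_Mapping.single i 1)
       \<ominus>\<^bsub>tate_algebra n\<^esub> tate_monom (T_R n) 0}"

definition S_ring :: "nat \<Rightarrow> tate set ring" where
  "S_ring n = tate_algebra n Quot S_ideal n"

definition S_const :: "nat \<Rightarrow> real fls \<Rightarrow> tate set" where
  "S_const n r = S_ideal n +>\<^bsub>tate_algebra n\<^esub> tate_monom r 0"

definition S_var :: "nat \<Rightarrow> nat \<Rightarrow> tate set" where
  "S_var n i = S_ideal n +>\<^bsub>tate_algebra n\<^esub> tate_monom 1 (Poly_Mapping.single i 1)"

definition hom_S :: "nat \<Rightarrow> int \<Rightarrow> tate set \<Rightarrow> bool" where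
  "hom_S n p s \<longleftrightarrow> s \<in> carrier (S_ring n) \<and> (\<exists>f\<in>s. hom_tate n p f)"

definition open_simplex :: "nat \<Rightarrow> (nat \<Rightarrow> real) set" where
  "open_simplex n = {\<zeta>. (\<forall>i\<le>n. 0 < \<zeta> i) \<and> (\<forall>i>n. \<zeta> i = 0) \<and> (\<Sum>i\<le>n. \<zeta> i) = 1}"

text \<open>
  The coordinates of \<open>s\<close> in the Schauder basis of monomials \<open>z\<^sup>d\<close> with \<open>min\<^sub>i d\<^sub>i = 0\<close> are the
  coefficients of the unique representative of \<open>s\<close> in which only such monomials occur.
\<close>

definition S_coords :: "nat \<Rightarrow> tate set \<Rightarrow> tate" where
  "S_coords n s = (THE f. f \<in> s \<and> (\<forall>d. f d \<noteq> 0 \<longrightarrow> (\<exists>i\<le>n. Poly_Mapping.lookup d i = 0)))"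

definition nu_S :: "nat \<Rightarrow> (nat \<Rightarrow> real) \<Rightarrow> tate set \<Rightarrow> ereal" where
  "nu_S n \<zeta> s =
    (INF d. nu_R n (S_coords n s d) + ereal (\<Sum>i\<le>n. real (Poly_Mapping.lookup d i) * \<zeta> i))"

section \<open>The Clifford algebra\<close>

text \<open>
  The free algebra on \<open>e\<^sub>0, \<dots>, e\<^sub>n\<close> over a commutative ring \<open>S\<close>: finitely supported families of
  coefficients indexed by the words in the letters \<open>0, \<dots>, n\<close>, with the concatenation product.
\<close>

definition free_algebra :: "('s, 'm) ring_scheme \<Rightarrow> nat \<Rightarrow> (nat list \<Rightarrow> 's) ring" where
  "free_algebra S n =
    \<lparr>carrier = {f. (\<forall>w. f w \<in> carrier S) \<and> finite {w. f w \<noteq> \<zero>\<^bsub>S\<^esub>} \<and>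
                   (\<forall>w. f w \<noteq> \<zero>\<^bsub>S\<^esub> \<longrightarrow> set w \<subseteq> {..n})},
     monoid.mult = (\<lambda>f g w. \<Oplus>\<^bsub>S\<^esub>k\<in>{..length w}. f (take k w) \<otimes>\<^bsub>S\<^esub> g (drop k w)),
     one = (\<lambda>w. if w = [] then \<one>\<^bsub>S\<^esub> else \<zero>\<^bsub>S\<^esub>),
     zero = (\<lambda>w. \<zero>\<^bsub>S\<^esub>),
     add = (\<lambda>f g w. f w \<oplus>\<^bsub>S\<^esub> g w)\<rparr>"

definition free_word :: "('s, 'm) ring_scheme \<Rightarrow> 's \<Rightarrow> nat list \<Rightarrow> nat list \<Rightarrow> 's" where
  "free_word S s w = (\<lambda>v. if v = w then s else \<zero>\<^bsub>S\<^esub>)"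

type_synonym free = "nat list \<Rightarrow> tate set"

definition clifford_relation :: "nat \<Rightarrow> nat \<Rightarrow> nat \<Rightarrow> free" where
  "clifford_relation n i j =
    (let S = S_ring n; F = free_algebra S n in
     (free_word S \<one>\<^bsub>S\<^esub> [i, j] \<oplus>\<^bsub>F\<^esub> free_word S \<one>\<^bsub>S\<^esub> [j, i])
       \<ominus>\<^bsub>F\<^esub> free_word S (if i = j then S_var n i \<oplus>\<^bsub>S\<^esub> S_var n i else \<zero>\<^bsub>S\<^esub>) [])"

definition clifford_ideal :: "nat \<Rightarrow> free set" where
  "clifford_ideal n =
    Idl\<^bsub>free_algebra (S_ring n) n\<^esub> {clifford_relation n i j | i j. i \<le> n \<and> j \<le> n}"

definition clifford :: "nat \<Rightarrow> free set ring" where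
  "clifford n = free_algebra (S_ring n) n Quot clifford_ideal n"

text \<open>The class of \<open>s e\<^sub>w\<close>, where \<open>e\<^sub>w\<close> is the product of the generators along the word \<open>w\<close>.\<close>

definition clifford_word :: "nat \<Rightarrow> tate set \<Rightarrow> nat list \<Rightarrow> free set" where
  "clifford_word n s w =
    clifford_ideal n +>\<^bsub>free_algebra (S_ring n) n\<^esub> free_word (S_ring n) s w"

definition clifford_scalar :: "nat \<Rightarrow> tate set \<Rightarrow> free set" where
  "clifford_scalar n s = clifford_word n s []"

definition clifford_gen :: "nat \<Rightarrow> nat \<Rightarrow> free set" where
  "clifford_gen n i = clifford_word n \<one>\<^bsub>S_ring n\<^esub> [i]"

definition hom_clifford :: "nat \<Rightarrow> int \<Rightarrow> free set \<Rightarrow> bool" where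
  "hom_clifford n p x \<longleftrightarrow> x \<in> carrier (clifford n) \<and>
    (\<exists>f\<in>x. \<forall>w. hom_S n (p - int (length w)) (f w))"

text \<open>
  The coordinates in the \<open>S\<close>-basis \<open>e\<^bsub>i\<^sub>0\<^esub> \<cdots> e\<^bsub>i\<^sub>k\<^esub>\<close>, \<open>i\<^sub>0 < \<cdots> < i\<^sub>k\<close>; this basis element has
  valuation \<open>(\<zeta>\<^bsub>i\<^sub>0\<^esub> + \<cdots> + \<zeta>\<^bsub>i\<^sub>k\<^esub>) / 2\<close>.
\<close>

definition clifford_coords :: "nat \<Rightarrow> free set \<Rightarrow> free" where
  "clifford_coords n x =
    (THE f. f \<in> x \<and> (\<forall>w. f w \<noteq> \<zero>\<^bsub>S_ring n\<^esub> \<longrightarrow> sorted_wrt (<) w))"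

definition nu_clifford :: "nat \<Rightarrow> (nat \<Rightarrow> real) \<Rightarrow> free set \<Rightarrow> ereal" where
  "nu_clifford n \<zeta> x =
    (INF w. nu_S n \<zeta> (clifford_coords n x w) + ereal (\<Sum>i\<leftarrow>w. \<zeta> i / 2))"

section \<open>The Dirac factorization\<close>

definition clifford_self_module :: "nat \<Rightarrow> (free set, free set) module" where
  "clifford_self_module n =
    \<lparr>carrier = carrier (clifford n), monoid.mult = monoid.mult (clifford n), one = one (clifford n),
     zero = zero (clifford n), add = add (clifford n), module.smult = monoid.mult (clifford n)\<rparr>"

definition dirac_ideal :: "nat \<Rightarrow> free set set" where
  "dirac_ideal n =
    {a \<otimes>\<^bsub>clifford n\<^esub> (clifford_word n \<one>\<^bsub>S_ring n\<^esub> [0..<n + 1]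
        \<ominus>\<^bsub>clifford n\<^esub> clifford_scalar n (S_const n (sqrt_T_R n))) | a. a \<in> carrier (clifford n)}"

text \<open>
  \<open>M\<close> as a left module over the Clifford algebra; \<open>S\<close> acts on it through \<^const>\<open>clifford_scalar\<close>.
\<close>

definition dirac_module :: "nat \<Rightarrow> (free set, free set set) module" where
  "dirac_module n = quot_module (clifford_self_module n) (dirac_ideal n)"

definition dirac_op :: "nat \<Rightarrow> free set set \<Rightarrow> free set set" where
  "dirac_op n m = (\<Oplus>\<^bsub>clifford n\<^esub>i\<in>{..n}. clifford_gen n i) \<odot>\<^bsub>dirac_module n\<^esub> m"

definition hom_dirac :: "nat \<Rightarrow> int \<Rightarrow> free set set \<Rightarrow> bool" where
  "hom_dirac n p m \<longleftrightarrow> m \<in> carrier (dirac_module n) \<and> (\<exists>x\<in>m. hom_clifford n p x)"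

text \<open>The quotient valuation: the best valuation among the representatives.\<close>

definition nu_dirac :: "nat \<Rightarrow> (nat \<Rightarrow> real) \<Rightarrow> free set set \<Rightarrow> ereal" where
  "nu_dirac n \<zeta> m = (SUP x\<in>m. nu_clifford n \<zeta> x)"

section \<open>The endomorphism complex and its reduction\<close>

type_synonym endo = "free set set \<Rightarrow> free set set"

text \<open>The \<open>S\<close>-linear endomorphisms of degree \<open>p\<close>, with the constants \<open>\<real> \<subseteq> R\<close> as scalars.\<close>

definition End_module :: "nat \<Rightarrow> int \<Rightarrow> (real, endo) module" where
  "End_module n p =
    (let M = dirac_module n; A = carrier M in
     \<lparr>carrier = {\<Phi> \<in> A \<rightarrow>\<^sub>E A.
        (\<forall>x\<in>A. \<forall>y\<in>A. \<Phi> (x \<oplus>\<^bsub>M\<^esub> y) = \<Phi> x \<oplus>\<^bsub>M\<^esub> \<Phi> y) \<and>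
        (\<forall>s\<in>carrier (S_ring n). \<forall>x\<in>A.
           \<Phi> (clifford_scalar n s \<odot>\<^bsub>M\<^esub> x) = clifford_scalar n s \<odot>\<^bsub>M\<^esub> \<Phi> x) \<and>
        (\<forall>q x. hom_dirac n q x \<longrightarrow> hom_dirac n (q + p) (\<Phi> x))},
      monoid.mult = (\<lambda>_ _. undefined), one = undefined,
      zero = (\<lambda>x\<in>A. \<zero>\<^bsub>M\<^esub>), add = (\<lambda>\<Phi> \<Psi>. \<lambda>x\<in>A. \<Phi> x \<oplus>\<^bsub>M\<^esub> \<Psi> x),
      module.smult = (\<lambda>r \<Phi>. \<lambda>x\<in>A. clifford_scalar n (S_const n (fls_const r)) \<odot>\<^bsub>M\<^esub> \<Phi> x)\<rparr>)"

definition End_diff :: "nat \<Rightarrow> int \<Rightarrow> endo \<Rightarrow> endo" where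
  "End_diff n p \<Phi> =
    (\<lambda>x\<in>carrier (dirac_module n).
      if even p then dirac_op n (\<Phi> x) \<ominus>\<^bsub>dirac_module n\<^esub> \<Phi> (dirac_op n x)
      else dirac_op n (\<Phi> x) \<oplus>\<^bsub>dirac_module n\<^esub> \<Phi> (dirac_op n x))"

definition nu_End :: "nat \<Rightarrow> endo \<Rightarrow> ereal" where
  "nu_End n \<Phi> =
    (INF \<zeta>\<in>open_simplex n. INF x\<in>carrier (dirac_module n) - {\<zero>\<^bsub>dirac_module n\<^esub>}.
       nu_dirac n \<zeta> (\<Phi> x) - nu_dirac n \<zeta> x)"

definition End_ge0 :: "nat \<Rightarrow> int \<Rightarrow> endo set" where
  "End_ge0 n p = {\<Phi> \<in> carrier (End_module n p). 0 \<le> nu_End n \<Phi>}"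

definition End_gt0 :: "nat \<Rightarrow> int \<Rightarrow> endo set" where
  "End_gt0 n p = {\<Phi> \<in> carrier (End_module n p). 0 < nu_End n \<Phi>}"

definition End0 :: "nat \<Rightarrow> int \<Rightarrow> (real, endo set) module" where
  "End0 n p = quot_module ((End_module n p)\<lparr>carrier := End_ge0 n p\<rparr>) (End_gt0 n p)"

definition End0_diff :: "nat \<Rightarrow> int \<Rightarrow> endo set \<Rightarrow> endo set" where
  "End0_diff n p A =
    (\<Union>\<Phi>\<in>A. End_gt0 n (p + 1) +>\<^bsub>End_module n (p + 1)\<^esub> End_diff n p \<Phi>)"

end

theory Submission
  imports Defs "HOL-Library.Poly_Mapping"
begin

text \<open>
  Put \<open>X = T\<^bsup>1/(n+1)\<^esup>\<close> and embed \<open>S\<close> into a ring of Laurent series with exponents in \<open>\<int>\<^bsup>n+1\<^esup>\<close> by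
  \<open>X \<mapsto> (1, \<dots>, 1)\<close> and \<open>z\<^sub>i \<mapsto> (n + 1) \<epsilon>\<^sub>i\<close>; up to signs, \<open>e\<^sub>i\<close> then acts on the Dirac module as the translation by
  \<open>(n + 1)/2 \<epsilon>\<^sub>i\<close>, and the valuation of a monomial at \<open>\<zeta>\<close> is linear in its exponent. Hence an endomorphism
  has nonnegative norm iff it lowers no component of an exponent, and modulo positive norm
  only the shifts on the boundary of the orthant survive. In each degree these leading coefficients
  are functions \<open>f b X\<close> with \<open>b \<in> \<nat>\<^bsup>n+1\<^esup>\<close>, \<open>min b = 0\<close> and \<open>X \<subseteq> {0..n}\<close> up to complement, and the
  supercommutator with \<open>D\<close> becomes a cubical differential. Dropping the condition \<open>min b = 0\<close> gives a
  complex that is contractible in every coordinate direction, with cohomology \<open>\<real>\<close> in degree \<open>0\<close>; the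
  functions supported on \<open>b \<ge> 1\<close> form a copy of it shifted by \<open>n + 1\<close>. The quotient therefore has
  cohomology \<open>\<real>\<close> in degrees \<open>0\<close> and \<open>n\<close>.

  On the topological side \<open>\<real>\<close> is injective, so real cohomology is read off from integral homology up to
  torsion. For \<open>\<real>P\<^sup>n\<close> the transfer of the double cover reduces this to \<open>S\<^sup>n\<close>, because for odd \<open>n\<close> the
  antipode is homotopic to the identity.
\<close>

text \<open>No map between the algebraic and the topological side is constructed: every degree of
  the three graded modules has dimension at most one, so it is enough to find a functional on the
  cocycles whose kernel is the space of coboundaries, and to compare ranges. The main obstacle is
  that an endomorphism of norm at least 0 sits on top of three nested quotients (Tate, Clifford,
  Dirac), with degrees and valuations defined through representatives. Each quotient is therefore
  identified with the fibres of an evaluation into Laurent series; equality, degree and valuation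
  then become statements about supports. A generator \<open>e_i\<close> does not act as
  multiplication by a series, because its sign depends on the parities of the letters already
  present. These parities also separate the supports of the basis elements, and without this
  separation cancellation could spoil the valuations. Oddness of \<open>n\<close> makes
  \<open>(n + 1) / 2\<close> an integer, makes the alternating class in degree \<open>n + 1\<close>
  invariant under complement, and provides the complex structure that rotates the antipode to the
  identity.\<close>

abbreviation lookup where "lookup \<equiv> Poly_Mapping.lookup"
abbreviation single where "single \<equiv> Poly_Mapping.single"
abbreviation keys where "keys \<equiv> Poly_Mapping.keys"
abbreviation TA where "TA \<equiv> tate_algebra"
abbreviation TC where "TC n \<equiv> carrier (tate_algebra n)"
abbreviation SC where "SC n \<equiv> carrier (S_ring n)"
abbreviation DC where "DC n \<equiv> carrier (dirac_module n)"
abbreviation fw where "fw n \<equiv> free_word (S_ring n)"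
abbreviation half :: "nat \<Rightarrow> int" where "half n \<equiv> int ((n + 1) div 2)"
abbreviation zcycle where "zcycle q X \<equiv> singular_relcycle q X {}"
abbreviation zboundary where "zboundary q X \<equiv> singular_relboundary q X {}"

section \<open>Modules with real coordinates\<close>

text \<open>Only closure and linearity are required, no module axioms. Injectivity is kept apart,
  because leading coefficients are coordinates with a kernel, and that kernel is the submodule to be
  divided out.\<close>

definition real_coordinates :: "(real, 'b) module \<Rightarrow> ('b \<Rightarrow> 'k \<Rightarrow> real) \<Rightarrow> bool" where
 "real_coordinates V \<kappa> \<longleftrightarrow>
  (\<forall>x\<in>carrier V. \<forall>y\<in>carrier V. x \<oplus>\<^bsub>V\<^esub> y \<in> carrier V \<and> (\<forall>k. \<kappa> (x \<oplus>\<^bsub>V\<^esub> y) k = \<kappa> x k + \<kappa> y k)) \<and>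
  (\<forall>r. \<forall>x\<in>carrier V. r \<odot>\<^bsub>V\<^esub> x \<in> carrier V \<and> (\<forall>k. \<kappa> (r \<odot>\<^bsub>V\<^esub> x) k = r * \<kappa> x k)) \<and>
  \<zero>\<^bsub>V\<^esub> \<in> carrier V \<and> (\<forall>k. \<kappa> \<zero>\<^bsub>V\<^esub> k = 0)"

lemma real_coordinatesD:
 assumes "real_coordinates V \<kappa>"
 shows "x \<in> carrier V \<Longrightarrow> y \<in> carrier V \<Longrightarrow> x \<oplus>\<^bsub>V\<^esub> y \<in> carrier V"
  "x \<in> carrier V \<Longrightarrow> y \<in> carrier V \<Longrightarrow> \<kappa> (x \<oplus>\<^bsub>V\<^esub> y) k = \<kappa> x k + \<kappa> y k"
  "x \<in> carrier V \<Longrightarrow> r \<odot>\<^bsub>V\<^esub> x \<in> carrier V"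
  "x \<in> carrier V \<Longrightarrow> \<kappa> (r \<odot>\<^bsub>V\<^esub> x) k = r * \<kappa> x k"
  "\<zero>\<^bsub>V\<^esub> \<in> carrier V" "\<kappa> \<zero>\<^bsub>V\<^esub> k = 0"
 using assms by (auto simp: real_coordinates_def)

text \<open>The laws hold in the function space and pull back along the injective
  \<open>\<kappa>\<close>; the inverse of \<open>x\<close> is its multiple by -1.\<close>

lemma abelian_group_of_coordinates:
 assumes c: "real_coordinates V \<kappa>" and inj: "inj_on \<kappa> (carrier V)"
 shows "abelian_group V"
proof (rule abelian_groupI)
 note D = real_coordinatesD[OF c]
 have eq: "x = y" if "x \<in> carrier V" "y \<in> carrier V" "\<And>k. \<kappa> x k = \<kappa> y k" for x y
  using inj that by (auto simp: inj_on_def fun_eq_iff)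
 show "\<And>x y. x \<in> carrier V \<Longrightarrow> y \<in> carrier V \<Longrightarrow> x \<oplus>\<^bsub>V\<^esub> y \<in> carrier V" by (rule D)
 show "\<zero>\<^bsub>V\<^esub> \<in> carrier V" by (rule D)
 show "x \<oplus>\<^bsub>V\<^esub> y \<oplus>\<^bsub>V\<^esub> z = x \<oplus>\<^bsub>V\<^esub> (y \<oplus>\<^bsub>V\<^esub> z)"
  if "x \<in> carrier V" "y \<in> carrier V" "z \<in> carrier V" for x y z
  by (rule eq) (simp_all add: D that)
 show "x \<oplus>\<^bsub>V\<^esub> y = y \<oplus>\<^bsub>V\<^esub> x" if "x \<in> carrier V" "y \<in> carrier V" for x y
  by (rule eq) (simp_all add: D that)
 show "\<zero>\<^bsub>V\<^esub> \<oplus>\<^bsub>V\<^esub> x = x" if "x \<in> carrier V" for x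
  by (rule eq) (simp_all add: D that)
 show "\<exists>y\<in>carrier V. y \<oplus>\<^bsub>V\<^esub> x = \<zero>\<^bsub>V\<^esub>" if "x \<in> carrier V" for x
 proof
  show "((-1) \<odot>\<^bsub>V\<^esub> x) \<oplus>\<^bsub>V\<^esub> x = \<zero>\<^bsub>V\<^esub>" by (rule eq) (simp_all add: D that)
 qed (simp add: D that)
qed

lemma quot_module_simps:
 "carrier (quot_module V N) = (\<lambda>x. N +>\<^bsub>V\<^esub> x) ` carrier V"
 "\<zero>\<^bsub>quot_module V N\<^esub> = N"
 "A \<oplus>\<^bsub>quot_module V N\<^esub> B = set_add V A B"
 "r \<odot>\<^bsub>quot_module V N\<^esub> A = (\<Union>x\<in>A. N +>\<^bsub>V\<^esub> (r \<odot>\<^bsub>V\<^esub> x))"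
 by (auto simp: quot_module_def A_RCOSETS_def')

lemma mem_a_r_coset: "y \<in> N +>\<^bsub>V\<^esub> x \<longleftrightarrow> (\<exists>h\<in>N. y = h \<oplus>\<^bsub>V\<^esub> x)"
 by (auto simp: a_r_coset_def')

text \<open>Since \<open>N\<close> is the common kernel of the coordinates, its cosets are exactly
  the fibres of \<open>\<kappa>\<close>. Any chosen representative therefore gives the same
  coordinates, and on the quotient they are injective with unchanged image.\<close>

lemma quot_module_coordinates:
 fixes V :: "(real, 'b) module" and \<kappa> :: "'b \<Rightarrow> 'k \<Rightarrow> real"
 assumes V: "abelian_group V" and c: "real_coordinates V \<kappa>"
  and N: "N = {x \<in> carrier V. \<forall>k. \<kappa> x k = 0}"
 defines "\<kappa>' \<equiv> \<lambda>A. \<kappa> (SOME y. y \<in> A)"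
 shows "real_coordinates (quot_module V N) \<kappa>'"
  and "inj_on \<kappa>' (carrier (quot_module V N))"
  and "x \<in> carrier V \<Longrightarrow> \<kappa>' (N +>\<^bsub>V\<^esub> x) = \<kappa> x"
  and "\<kappa>' ` carrier (quot_module V N) = \<kappa> ` carrier V"
  and "x \<in> carrier V \<Longrightarrow> N +>\<^bsub>V\<^esub> x = {y \<in> carrier V. \<kappa> y = \<kappa> x}"
proof -
 interpret abelian_group V by (rule V)
 note D = real_coordinatesD[OF c]
 have neg: "\<kappa> (\<ominus>\<^bsub>V\<^esub> x) k = - \<kappa> x k" if "x \<in> carrier V" for x k
  using D(2)[of "\<ominus>\<^bsub>V\<^esub> x" x k] that by (simp add: l_neg D(6))
 have cls: "N +>\<^bsub>V\<^esub> x = {y \<in> carrier V. \<kappa> y = \<kappa> x}" if x: "x \<in> carrier V" for x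
 proof (intro Set.set_eqI iffI)
  fix y assume "y \<in> {y \<in> carrier V. \<kappa> y = \<kappa> x}"
  then have y: "y \<in> carrier V" "\<kappa> y = \<kappa> x" by auto
  have "y = (y \<ominus>\<^bsub>V\<^esub> x) \<oplus>\<^bsub>V\<^esub> x" using x y by (simp add: minus_eq a_assoc l_neg)
  moreover have "y \<ominus>\<^bsub>V\<^esub> x \<in> N" using x y by (simp add: N minus_eq D neg)
  ultimately show "y \<in> N +>\<^bsub>V\<^esub> x" unfolding mem_a_r_coset by blast
 qed (use x in \<open>auto simp: mem_a_r_coset N D fun_eq_iff\<close>)
 have k: "\<kappa>' (N +>\<^bsub>V\<^esub> x) = \<kappa> x" if x: "x \<in> carrier V" for x
 proof -
  have "x \<in> N +>\<^bsub>V\<^esub> x" using x by (simp add: cls)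
  then have "(SOME y. y \<in> N +>\<^bsub>V\<^esub> x) \<in> N +>\<^bsub>V\<^esub> x" by (rule someI)
  then show ?thesis using x unfolding \<kappa>'_def by (simp add: cls)
 qed
 have add: "set_add V (N +>\<^bsub>V\<^esub> x) (N +>\<^bsub>V\<^esub> y) = N +>\<^bsub>V\<^esub> (x \<oplus>\<^bsub>V\<^esub> y)"
  if x: "x \<in> carrier V" and y: "y \<in> carrier V" for x y
 proof (intro Set.set_eqI iffI)
  fix z assume "z \<in> N +>\<^bsub>V\<^esub> (x \<oplus>\<^bsub>V\<^esub> y)"
  then have z: "z \<in> carrier V" "\<kappa> z = \<kappa> (x \<oplus>\<^bsub>V\<^esub> y)" using x y by (auto simp: cls D)
  have "z = x \<oplus>\<^bsub>V\<^esub> (\<ominus>\<^bsub>V\<^esub> x \<oplus>\<^bsub>V\<^esub> z)" using x z by (simp add: a_assoc[symmetric] r_neg)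
  moreover have "\<ominus>\<^bsub>V\<^esub> x \<oplus>\<^bsub>V\<^esub> z \<in> N +>\<^bsub>V\<^esub> y" using x y z by (simp add: cls D neg fun_eq_iff)
  moreover have "x \<in> N +>\<^bsub>V\<^esub> x" using x by (simp add: cls)
  ultimately show "z \<in> set_add V (N +>\<^bsub>V\<^esub> x) (N +>\<^bsub>V\<^esub> y)" unfolding set_add_def' by blast
 qed (use x y in \<open>auto simp: set_add_def' cls D fun_eq_iff\<close>)
 have sm: "(\<Union>y\<in>N +>\<^bsub>V\<^esub> x. N +>\<^bsub>V\<^esub> (r \<odot>\<^bsub>V\<^esub> y)) = N +>\<^bsub>V\<^esub> (r \<odot>\<^bsub>V\<^esub> x)"
  if x: "x \<in> carrier V" for x r
 proof -
  have "N +>\<^bsub>V\<^esub> (r \<odot>\<^bsub>V\<^esub> y) = N +>\<^bsub>V\<^esub> (r \<odot>\<^bsub>V\<^esub> x)" if "y \<in> N +>\<^bsub>V\<^esub> x" for y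
   using that x by (auto simp: cls D fun_eq_iff)
  moreover have "x \<in> N +>\<^bsub>V\<^esub> x" using x by (simp add: cls)
  ultimately show ?thesis by blast
 qed
 have N0: "N = N +>\<^bsub>V\<^esub> \<zero>\<^bsub>V\<^esub>" by (auto simp: cls N D fun_eq_iff)
 have k0: "\<kappa>' N l = 0" for l
  using k[of "\<zero>\<^bsub>V\<^esub>"] D(6) by (metis N0 zero_closed)
 show "real_coordinates (quot_module V N) \<kappa>'"
  unfolding real_coordinates_def quot_module_simps
  using N0 k0 by (auto simp: add sm k D)
 show "inj_on \<kappa>' (carrier (quot_module V N))"
  unfolding quot_module_simps by (auto simp: inj_on_def k) (simp_all add: cls)
 show "x \<in> carrier V \<Longrightarrow> \<kappa>' (N +>\<^bsub>V\<^esub> x) = \<kappa> x" by (rule k)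
 show "\<kappa>' ` carrier (quot_module V N) = \<kappa> ` carrier V"
  unfolding quot_module_simps by (auto simp: k image_iff)
 show "x \<in> carrier V \<Longrightarrow> N +>\<^bsub>V\<^esub> x = {y \<in> carrier V. \<kappa> y = \<kappa> x}" by (rule cls)
qed

text \<open>Both modules are copies of one and the same subspace of a function space;
  \<open>h\<close> reads coordinates in \<open>V\<close> and looks them up in
  \<open>W\<close>.\<close>

lemma module_iso_of_coordinates:
 assumes V: "real_coordinates V \<kappa>" "inj_on \<kappa> (carrier V)"
  and W: "real_coordinates W \<mu>" "inj_on \<mu> (carrier W)"
  and img: "\<kappa> ` carrier V = \<mu> ` carrier W"
 shows "\<exists>h. h \<in> iso (add_monoid V) (add_monoid W) \<and>
   (\<forall>r. \<forall>x\<in>carrier V. h (r \<odot>\<^bsub>V\<^esub> x) = r \<odot>\<^bsub>W\<^esub> h x)"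
proof -
 note DV = real_coordinatesD[OF V(1)] and DW = real_coordinatesD[OF W(1)]
 define h where "h = (\<lambda>x. inv_into (carrier W) \<mu> (\<kappa> x))"
 have h: "h x \<in> carrier W" "\<mu> (h x) = \<kappa> x" if "x \<in> carrier V" for x
 proof -
  have "\<kappa> x \<in> \<mu> ` carrier W" using that img by blast
  then show "h x \<in> carrier W" "\<mu> (h x) = \<kappa> x"
   unfolding h_def by (auto intro: inv_into_into f_inv_into_f)
 qed
 have eq: "x = y" if "x \<in> carrier W" "y \<in> carrier W" "\<And>k. \<mu> x k = \<mu> y k" for x y
  using W(2) that by (auto simp: inj_on_def fun_eq_iff)
 have "bij_betw h (carrier V) (carrier W)"
 proof (rule bij_betw_imageI)
  show "inj_on h (carrier V)"
  proof (rule inj_onI)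
   fix x y assume "x \<in> carrier V" "y \<in> carrier V" "h x = h y"
   then show "x = y" using h(2)[of x] h(2)[of y] V(2) by (simp add: inj_on_def)
  qed
  show "h ` carrier V = carrier W"
  proof (intro Set.set_eqI iffI)
   fix y assume y: "y \<in> carrier W"
   then obtain x where x: "x \<in> carrier V" "\<mu> y = \<kappa> x" using img by blast
   then have "y = h x" using y h[of x] by (intro eq) auto
   then show "y \<in> h ` carrier V" using x by blast
  qed (auto simp: h)
 qed
 moreover have "h (x \<oplus>\<^bsub>V\<^esub> y) = h x \<oplus>\<^bsub>W\<^esub> h y" if "x \<in> carrier V" "y \<in> carrier V" for x y
  using that by (intro eq) (simp_all add: h DV DW)
 moreover have "h (r \<odot>\<^bsub>V\<^esub> x) = r \<odot>\<^bsub>W\<^esub> h x" if "x \<in> carrier V" for x r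
  using that by (intro eq) (simp_all add: h DV DW)
 ultimately show ?thesis
  using h(1) by (intro exI[of _ h]) (auto simp: iso_def hom_def)
qed

text \<open>A presentation of a space of dimension at most one by a faithful functional. The image
  \<open>I\<close> is \<open>UNIV\<close> or \<open>{0}\<close> in all uses and determines the
  isomorphism type; the index type \<open>unit\<close> makes a single functional fit
  \<open>real_coordinates\<close>.\<close>

definition real_range :: "(real, 'b) module \<Rightarrow> real set \<Rightarrow> bool" where
 "real_range V I \<longleftrightarrow> (\<exists>l. real_coordinates V (\<lambda>x (k::unit). l x) \<and> inj_on l (carrier V) \<and>
   l ` carrier V = I)"

lemma graded_module_iso_real_range:
 assumes "\<And>p. real_range (V p) (I p)" "\<And>p. real_range (W p) (I p)"
 shows "graded_module_iso V W"
 unfolding graded_module_iso_def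
proof
 fix p
 obtain l where l: "real_coordinates (V p) (\<lambda>x (k::unit). l x)" "inj_on l (carrier (V p))"
  "l ` carrier (V p) = I p"
  using assms(1)[of p] unfolding real_range_def by blast
 obtain m where m: "real_coordinates (W p) (\<lambda>x (k::unit). m x)" "inj_on m (carrier (W p))"
  "m ` carrier (W p) = I p"
  using assms(2)[of p] unfolding real_range_def by blast
 have img: "(\<lambda>x (k::unit). l x) ` carrier (V p) = (\<lambda>x (k::unit). m x) ` carrier (W p)"
  using l(3) m(3) by (metis image_image)
 show "\<exists>h. h \<in> iso (add_monoid (V p)) (add_monoid (W p)) \<and>
   (\<forall>r. \<forall>x\<in>carrier (V p). h (r \<odot>\<^bsub>V p\<^esub> x) = r \<odot>\<^bsub>W p\<^esub> h x)"
  using l m img by (intro module_iso_of_coordinates[where \<kappa> = "\<lambda>x (k::unit). l x" and \<mu> = "\<lambda>x (k::unit). m x"])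
   (auto simp: inj_on_def fun_eq_iff)
qed

text \<open>This is the form in which all cohomology is computed: a functional on the cocycles that
  vanishes exactly on the coboundaries descends to a faithful coordinate of the quotient.\<close>

lemma real_range_cohomology:
 fixes C :: "int \<Rightarrow> (real, 'b) module" and \<delta> :: "int \<Rightarrow> 'b \<Rightarrow> 'b" and \<kappa> :: "'b \<Rightarrow> 'k \<Rightarrow> real" and l :: "'b \<Rightarrow> real"
 assumes C: "real_coordinates (C p) \<kappa>" "inj_on \<kappa> (carrier (C p))"
 defines "Z \<equiv> {x \<in> carrier (C p). \<delta> p x = \<zero>\<^bsub>C (p + 1)\<^esub>}"
 assumes l: "real_coordinates ((C p)\<lparr>carrier := Z\<rparr>) (\<lambda>x (k::unit). l x)"
  and B: "\<delta> (p - 1) ` carrier (C (p - 1)) = {x \<in> Z. l x = 0}"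
  and I: "l ` Z = I"
 shows "real_range (cohomology C \<delta> p) I"
proof -
 let ?V = "(C p)\<lparr>carrier := Z\<rparr>"
 have "real_coordinates ?V \<kappa>"
  using C(1) l unfolding real_coordinates_def by (auto simp: Z_def)
 moreover have "inj_on \<kappa> (carrier ?V)"
  using C(2) by (rule inj_on_subset) (auto simp: Z_def)
 ultimately have V: "abelian_group ?V" by (rule abelian_group_of_coordinates)
 have N: "\<delta> (p - 1) ` carrier (C (p - 1)) = {x \<in> carrier ?V. \<forall>k::unit. l x = 0}"
  using B by simp
 define L where "L A = l (SOME y. y \<in> A)" for A
 note Q = quot_module_coordinates[OF V l N, folded L_def]
 have c: "cohomology C \<delta> p = quot_module ?V (\<delta> (p - 1) ` carrier (C (p - 1)))"
  by (simp add: cohomology_def Z_def)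
 have "(\<lambda>f. f ()) ` (\<lambda>A (k::unit). L A) ` carrier (cohomology C \<delta> p) = (\<lambda>f. f ()) ` (\<lambda>x (k::unit). l x) ` Z"
  using Q(4) unfolding c by simp
 then have "L ` carrier (cohomology C \<delta> p) = I"
  using I by (simp add: image_image)
 moreover have "inj_on L (carrier (cohomology C \<delta> p))"
  using Q(2) unfolding c by (auto simp: inj_on_def fun_eq_iff)
 ultimately show ?thesis
  unfolding real_range_def using Q(1) c by auto
qed

section \<open>A cubical complex\<close>

text \<open>Symmetric difference with \<open>{i}\<close>: the effect of one more factor
  \<open>e_i\<close> on the parities of the letters.\<close>

definition flip :: "nat \<Rightarrow> nat set \<Rightarrow> nat set" where
 "flip i X = (if i \<in> X then X - {i} else insert i X)"

text \<open>The sign of moving \<open>e_i\<close> to the front past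
  \<open>e_0^(b 0) ... e_(i-1)^(b (i-1))\<close>; see \<open>word_sign_expword\<close>.\<close>

definition expsign :: "(nat \<Rightarrow> nat) \<Rightarrow> nat \<Rightarrow> real" where
 "expsign b i = (-1) ^ (\<Sum>j<i. b j)"

type_synonym cochain = "(nat \<Rightarrow> nat) \<Rightarrow> nat set \<Rightarrow> real"

definition cub_part :: "nat \<Rightarrow> cochain \<Rightarrow> cochain" where
 "cub_part i f b X = (if 1 \<le> b i
   then expsign b i * (f (b(i := b i - 1)) X + (-1) ^ b i * f (b(i := b i - 1)) (flip i X)) else 0)"

definition cub_diff :: "nat \<Rightarrow> cochain \<Rightarrow> cochain" where
 "cub_diff n f b X = (\<Sum>i\<le>n. cub_part i f b X)"

text \<open>The factor 1/4 is chosen so that \<open>cub_part i\<close> and this map compose, in the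
  two orders, to the complementary projections 1/2 (1 + s F) and 1/2 (1 - s F), where F flips
  \<open>X\<close> at \<open>i\<close> and s is the sign of \<open>b i\<close>.\<close>

definition cub_homotopy :: "nat \<Rightarrow> nat \<Rightarrow> cochain \<Rightarrow> cochain" where
 "cub_homotopy m i f b X = (if m \<le> b i
   then 1/4 * expsign b i * (f (b(i := b i + 1)) X - (-1) ^ b i * f (b(i := b i + 1)) (flip i X)) else 0)"

definition cub_proj :: "nat \<Rightarrow> nat \<Rightarrow> cochain \<Rightarrow> cochain" where
 "cub_proj m i f b X = (if b i = m then 1/2 * (f b X + (-1) ^ m * f b (flip i X)) else 0)"

text \<open>The bound \<open>m\<close> is 0 for the full complex and 1 for the subcomplex supported
  on positive exponents; one treatment serves both.\<close>

definition cub :: "nat \<Rightarrow> nat \<Rightarrow> int \<Rightarrow> cochain \<Rightarrow> bool" where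
 "cub n m p f \<longleftrightarrow>
  (\<forall>b X. f b X \<noteq> 0 \<longrightarrow> X \<subseteq> {..n} \<and> (\<forall>i\<le>n. m \<le> b i) \<and> (\<forall>i>n. b i = 0) \<and> int (\<Sum>i\<le>n. b i) = p) \<and>
  (\<forall>b X. X \<subseteq> {..n} \<longrightarrow> f b ({..n} - X) = f b X)"

lemma flip_flip [simp]: "flip i (flip i X) = X"
 by (auto simp: flip_def)

lemma flip_commute: "flip i (flip j X) = flip j (flip i X)"
 by (auto simp: flip_def)

lemma flip_subset_iff: "i \<le> n \<Longrightarrow> flip i X \<subseteq> {..n} \<longleftrightarrow> X \<subseteq> {..n}"
 by (auto simp: flip_def)

lemma flip_Diff: "i \<le> n \<Longrightarrow> flip i ({..n} - X) = {..n} - flip i X"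
 by (auto simp: flip_def)

lemma sum_fun_upd_nat:
 "(i::nat) \<le> n \<Longrightarrow> (\<Sum>j\<le>n. (b(i := c)) j) + b i = (\<Sum>j\<le>n. b j) + (c::nat)"
 by (subst (1 2) sum.remove[of _ i]) auto

lemma expsign_upd_less:
 assumes "j < i"
 shows "expsign (b(j := Suc (b j))) i = - expsign b i"
  "1 \<le> b j \<Longrightarrow> expsign (b(j := b j - Suc 0)) i = - expsign b i"
proof -
 have *: "(\<Sum>k<i. (b(j := c)) k) = (\<Sum>k\<in>{..<i} - {j}. b k) + c" for c
  using assms by (subst sum.remove[of _ j]) auto
 have **: "(\<Sum>k<i. b k) = (\<Sum>k\<in>{..<i} - {j}. b k) + b j"
  using assms by (subst sum.remove[of _ j]) auto
 show "expsign (b(j := Suc (b j))) i = - expsign b i"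
  unfolding expsign_def * ** by simp
 show "1 \<le> b j \<Longrightarrow> expsign (b(j := b j - Suc 0)) i = - expsign b i"
  unfolding expsign_def * ** by (cases "b j") auto
qed

lemma expsign_upd_ge: "\<not> j < i \<Longrightarrow> expsign (b(j := c)) i = expsign b i"
 by (auto simp: expsign_def intro!: arg_cong[of _ _ "\<lambda>k. (-1) ^ k"] sum.cong)

lemma expsign_square: "expsign b i * expsign b i = 1"
 by (simp add: expsign_def flip: power_mult_distrib)

lemma expsign_square': "expsign b i * (expsign b i * x) = x"
 by (simp add: expsign_square flip: mult.assoc)

lemma power_neg_one_square: "(-1::real) ^ k * ((-1) ^ k * x) = x"
 by (simp flip: mult.assoc power_mult_distrib)

lemma expsign_swap:
 assumes "i \<noteq> j" "1 \<le> b i" "1 \<le> b j"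
 shows "expsign b i * expsign (b(i := b i - Suc 0)) j
    = - (expsign b j * expsign (b(j := b j - Suc 0)) i)"
 using assms by (cases "i < j") (auto simp: expsign_upd_less expsign_upd_ge not_less)

text \<open>Lowering \<open>b j\<close> for \<open>j < i\<close> changes the parity of the prefix
  sum in \<open>expsign b i\<close>, while lowering \<open>b i\<close> leaves
  \<open>expsign b j\<close> alone. Interchanging the two steps therefore costs exactly one
  sign.\<close>

lemma cub_part_swap:
 assumes "i \<noteq> j"
 shows "cub_part i (cub_part j f) b X = - cub_part j (cub_part i f) b X"
proof (cases "1 \<le> b i \<and> 1 \<le> b j")
 case True
 let ?b = "b(i := b i - Suc 0, j := b j - Suc 0)"
 let ?F = "f ?b X + (-1) ^ b j * f ?b (flip j X)
   + (-1) ^ b i * (f ?b (flip i X) + (-1) ^ b j * f ?b (flip j (flip i X)))"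
 have 1: "cub_part i (cub_part j f) b X = (expsign b i * expsign (b(i := b i - Suc 0)) j) * ?F"
  using True assms by (simp add: cub_part_def algebra_simps)
 have tw: "b(j := b j - Suc 0, i := b i - Suc 0) = ?b"
  using assms by (rule fun_upd_twist[symmetric])
 have 2: "cub_part j (cub_part i f) b X = (expsign b j * expsign (b(j := b j - Suc 0)) i) * ?F"
  using True assms by (simp add: cub_part_def tw flip_commute[of i j] algebra_simps)
 show ?thesis
  unfolding 1 2 using expsign_swap[of i j b] True assms by simp
qed (use assms in \<open>auto simp: cub_part_def\<close>)

text \<open>Consecutive values of \<open>b i\<close> carry opposite signs, so the product is (1 + s
  F)(1 - s F), which vanishes because the flip F is an involution.\<close>

lemma cub_part_square: "cub_part i (cub_part i f) b X = 0"
proof (cases "2 \<le> b i")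
 case True
 then have "b i = Suc (Suc (b i - 2))" by linarith
 then obtain k where k: "b i = Suc (Suc k)" ..
 show ?thesis by (simp add: cub_part_def k algebra_simps flip: power_add)
next
 case False
 then show ?thesis by (simp add: cub_part_def)
qed

lemma cub_part_sum:
 "cub_part i (\<lambda>b X. \<Sum>j\<in>J. g j b X) b X = (\<Sum>j\<in>J. cub_part i (g j) b X)"
 by (cases "1 \<le> b i") (simp_all add: cub_part_def sum.distrib sum_distrib_left distrib_left)

lemma cub_homotopy_sum:
 "cub_homotopy m i (\<lambda>b X. \<Sum>j\<in>J. g j b X) b X = (\<Sum>j\<in>J. cub_homotopy m i (g j) b X)"
 by (cases "m \<le> b i")
  (simp_all add: cub_homotopy_def sum_subtractf sum_distrib_left right_diff_distrib sum_divide_distrib diff_divide_distrib)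

lemma cub_diff_linear:
 "cub_diff n (\<lambda>b X. r * f b X + s * g b X) b X = r * cub_diff n f b X + s * cub_diff n g b X"
 by (simp add: cub_diff_def cub_part_def sum_distrib_left algebra_simps if_distrib flip: sum.distrib cong: if_cong)

lemma cub_diff_minus: "cub_diff n (\<lambda>b X. f b X - g b X) b X = cub_diff n f b X - cub_diff n g b X"
 using cub_diff_linear[of n 1 f "-1" g] by simp

lemma cub_diff_add: "cub_diff n (\<lambda>b X. f b X + g b X) b X = cub_diff n f b X + cub_diff n g b X"
 using cub_diff_linear[of n 1 f 1 g] by simp

lemma cub_diff_square: "cub_diff n (cub_diff n f) b X = 0"
proof -
 have "cub_diff n (cub_diff n f) b X = (\<Sum>i\<le>n. \<Sum>j\<le>n. cub_part i (cub_part j f) b X)" (is "_ = ?S")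
  unfolding cub_diff_def cub_part_sum ..
 moreover have "?S = - ?S"
 proof -
  have "?S = (\<Sum>j\<le>n. \<Sum>i\<le>n. cub_part i (cub_part j f) b X)" by (rule sum.swap)
  also have "\<dots> = (\<Sum>j\<le>n. \<Sum>i\<le>n. - cub_part j (cub_part i f) b X)"
  proof (intro sum.cong refl)
   show "cub_part i (cub_part j f) b X = - cub_part j (cub_part i f) b X" for i j
    by (cases "i = j") (auto simp: cub_part_square intro: cub_part_swap)
  qed
  finally show ?thesis by (simp add: sum_negf)
 qed
 ultimately show ?thesis by simp
qed

text \<open>The same sign count as for two parts of the differential: raising \<open>b i\<close> and
  lowering \<open>b j\<close> disturb exactly one of the two prefix sums.\<close>

lemma cub_homotopy_swap:
 assumes "i \<noteq> j"
 shows "cub_part j (cub_homotopy m i f) b X = - cub_homotopy m i (cub_part j f) b X"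
proof (cases "m \<le> b i \<and> 1 \<le> b j")
 case True
 let ?b = "b(i := Suc (b i), j := b j - Suc 0)"
 let ?F = "f ?b X - (-1) ^ b i * f ?b (flip i X)
   + (-1) ^ b j * (f ?b (flip j X) - (-1) ^ b i * f ?b (flip i (flip j X)))"
 have tw: "b(j := b j - Suc 0, i := Suc (b i)) = ?b"
  using assms by (rule fun_upd_twist[symmetric])
 have 1: "cub_part j (cub_homotopy m i f) b X
   = 1/4 * (expsign b j * expsign (b(j := b j - Suc 0)) i) * ?F"
  using True assms by (simp add: cub_part_def cub_homotopy_def tw) (simp add: algebra_simps)
 have 2: "cub_homotopy m i (cub_part j f) b X
   = 1/4 * (expsign b i * expsign (b(i := Suc (b i))) j) * ?F"
  using True assms by (simp add: cub_part_def cub_homotopy_def flip_commute[of j i]) (simp add: algebra_simps)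
 have "expsign b j * expsign (b(j := b j - Suc 0)) i = - (expsign b i * expsign (b(i := Suc (b i))) j)"
  using assms True by (cases "i < j") (auto simp: expsign_upd_less expsign_upd_ge not_less)
 then show ?thesis unfolding 1 2 by simp
qed (use assms in \<open>auto simp: cub_part_def cub_homotopy_def\<close>)

text \<open>Above the layer \<open>b i = m\<close> the two composites are complementary projections
  and add up to the identity. On the layer itself the first composite is missing, because it would
  pass through \<open>b i = m - 1\<close>; what remains is \<open>cub_proj\<close>.\<close>

lemma cub_homotopy_part:
 assumes "\<And>b X. b i < m \<Longrightarrow> f b X = 0"
 shows "cub_part i (cub_homotopy m i f) b X + cub_homotopy m i (cub_part i f) b X
   = f b X - cub_proj m i f b X"
proof -
 have s: "expsign (b(i := c)) i = expsign b i" for c by (simp add: expsign_upd_ge)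
 have P: "cub_part i (cub_homotopy m i f) b X = 1/2 * (f b X + (-1) ^ b i * f b (flip i X))"
  if "m < b i"
 proof -
  have "b i = Suc (b i - 1)" using that by linarith
  then obtain k where k: "b i = Suc k" ..
  have u: "b(i := Suc k) = b" using k by (metis fun_upd_triv)
  show ?thesis using that k
   by (simp add: cub_part_def cub_homotopy_def s expsign_square' power_neg_one_square u algebra_simps)
 qed
 have P0: "cub_part i (cub_homotopy m i f) b X = 0" if "b i \<le> m"
  using that by (auto simp: cub_part_def cub_homotopy_def)
 have H: "cub_homotopy m i (cub_part i f) b X = 1/2 * (f b X - (-1) ^ b i * f b (flip i X))"
  if "m \<le> b i"
  using that by (simp add: cub_part_def cub_homotopy_def s expsign_square' power_neg_one_square algebra_simps)
 consider "m < b i" | "m = b i" | "b i < m" by linarith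
 then show ?thesis
 proof cases
  case 1
  then show ?thesis using P H by (simp add: cub_proj_def field_simps)
 next
  case 2
  then have "cub_part i (cub_homotopy m i f) b X = 0"
   "cub_homotopy m i (cub_part i f) b X = 1/2 * (f b X - (-1) ^ b i * f b (flip i X))"
   using P0 H by simp_all
  then show ?thesis using 2 by (simp add: cub_proj_def field_simps)
 next
  case 3
  then show ?thesis using P0 by (simp add: assms cub_homotopy_def cub_proj_def)
 qed
qed

lemma cub_homotopy:
 assumes "i \<le> n" "\<And>b X. b i < m \<Longrightarrow> f b X = 0"
 shows "cub_diff n (cub_homotopy m i f) b X + cub_homotopy m i (cub_diff n f) b X
   = f b X - cub_proj m i f b X"
proof -
 have "cub_diff n (cub_homotopy m i f) b X + cub_homotopy m i (cub_diff n f) b X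
  = (\<Sum>j\<le>n. cub_part j (cub_homotopy m i f) b X + cub_homotopy m i (cub_part j f) b X)"
  unfolding cub_diff_def cub_homotopy_sum sum.distrib ..
 also have "\<dots> = (\<Sum>j\<le>n. if j = i then f b X - cub_proj m i f b X else 0)"
  using cub_homotopy_swap[of i _ m f b X] cub_homotopy_part[of i m f b X] assms
  by (intro sum.cong refl) auto
 finally show ?thesis using assms by simp
qed

section \<open>Cohomology of the complexes with exponents bounded below\<close>

lemma cubD:
 assumes "cub n m p f" "f b X \<noteq> 0"
 shows "X \<subseteq> {..n}" "i \<le> n \<Longrightarrow> m \<le> b i" "i > n \<Longrightarrow> b i = 0" "int (\<Sum>i\<le>n. b i) = p"
 using assms unfolding cub_def by blast+

lemma cub_compl: "cub n m p f \<Longrightarrow> X \<subseteq> {..n} \<Longrightarrow> f b ({..n} - X) = f b X"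
 by (simp add: cub_def)

lemma cub_zeroI: "cub n m p f \<Longrightarrow> i \<le> n \<Longrightarrow> b i < m \<Longrightarrow> f b X = 0"
 by (meson cubD(2) not_le)

lemma cubI:
 assumes "\<And>b X. f b X \<noteq> 0 \<Longrightarrow> X \<subseteq> {..n} \<and> (\<forall>i\<le>n. m \<le> b i) \<and> (\<forall>i>n. b i = 0) \<and> int (\<Sum>i\<le>n. b i) = p"
  and "\<And>b X. X \<subseteq> {..n} \<Longrightarrow> f b ({..n} - X) = f b X"
 shows "cub n m p f"
 using assms unfolding cub_def by blast

lemma cub_mono: "cub n m p f \<Longrightarrow> k \<le> m \<Longrightarrow> cub n k p f"
 unfolding cub_def by (meson le_trans)

lemma cub_linear:
 assumes f: "cub n m p f" and g: "cub n m p g"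
 shows "cub n m p (\<lambda>b X. r * f b X + s * g b X)"
proof (rule cubI)
 fix b X assume "r * f b X + s * g b X \<noteq> 0"
 then have "f b X \<noteq> 0 \<or> g b X \<noteq> 0" by auto
 then show "X \<subseteq> {..n} \<and> (\<forall>i\<le>n. m \<le> b i) \<and> (\<forall>i>n. b i = 0) \<and> int (\<Sum>i\<le>n. b i) = p"
  using cubD[OF f, of b X] cubD[OF g, of b X] by (elim disjE) simp_all
qed (simp add: cub_compl[OF f] cub_compl[OF g])

lemma cub_minus: "cub n m p f \<Longrightarrow> cub n m p g \<Longrightarrow> cub n m p (\<lambda>b X. f b X - g b X)"
 using cub_linear[of n m p f g 1 "-1"] by simp

lemma cub_add: "cub n m p f \<Longrightarrow> cub n m p g \<Longrightarrow> cub n m p (\<lambda>b X. f b X + g b X)"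
 using cub_linear[of n m p f g 1 1] by simp

lemma cub_cub_diff:
 assumes f: "cub n m p f"
 shows "cub n m (p + 1) (cub_diff n f)"
proof (rule cubI)
 fix b X assume "cub_diff n f b X \<noteq> 0"
 then obtain i where i: "i \<le> n" "cub_part i f b X \<noteq> 0"
  unfolding cub_diff_def by (metis atMost_iff sum.neutral)
 then have b: "1 \<le> b i" and "f (b(i := b i - 1)) X \<noteq> 0 \<or> f (b(i := b i - 1)) (flip i X) \<noteq> 0"
  by (auto simp: cub_part_def split: if_splits)
 then obtain Y where Y: "f (b(i := b i - 1)) Y \<noteq> 0" "Y \<subseteq> {..n} \<longrightarrow> X \<subseteq> {..n}"
  using flip_subset_iff[OF i(1), of X] by blast
 note D = cubD[OF f, of "b(i := b i - 1)" Y, OF Y(1)]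
 have "m \<le> b j" if "j \<le> n" for j using D(2)[OF that] by (cases "j = i") auto
 moreover have "b j = 0" if "j > n" for j using D(3)[OF that] i that by auto
 moreover have "int (\<Sum>j\<le>n. b j) = p + 1"
  using D(4) sum_fun_upd_nat[OF i(1), of b "b i - 1"] b by linarith
 ultimately show "X \<subseteq> {..n} \<and> (\<forall>i\<le>n. m \<le> b i) \<and> (\<forall>i>n. b i = 0) \<and> int (\<Sum>i\<le>n. b i) = p + 1"
  using D(1) Y by blast
next
 fix b X assume "X \<subseteq> {..n}"
 then show "cub_diff n f b ({..n} - X) = cub_diff n f b X"
  unfolding cub_diff_def cub_part_def
  by (intro sum.cong refl) (simp add: flip_Diff flip_subset_iff cub_compl[OF f])
qed

lemma cub_cub_homotopy:
 assumes f: "cub n m p f" and i: "i \<le> n"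
 shows "cub n m (p - 1) (cub_homotopy m i f)"
proof (rule cubI)
 fix b X assume "cub_homotopy m i f b X \<noteq> 0"
 then have b: "m \<le> b i" and "f (b(i := b i + 1)) X \<noteq> 0 \<or> f (b(i := b i + 1)) (flip i X) \<noteq> 0"
  by (auto simp: cub_homotopy_def split: if_splits)
 then obtain Y where Y: "f (b(i := b i + 1)) Y \<noteq> 0" "Y \<subseteq> {..n} \<longrightarrow> X \<subseteq> {..n}"
  using flip_subset_iff[OF i, of X] by blast
 note D = cubD[OF f, of "b(i := b i + 1)" Y, OF Y(1)]
 have "m \<le> b j" if "j \<le> n" for j using D(2)[OF that] b by (cases "j = i") auto
 moreover have "b j = 0" if "j > n" for j using D(3)[OF that] i that by auto
 moreover have "int (\<Sum>j\<le>n. b j) = p - 1"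
  using D(4) sum_fun_upd_nat[OF i(1), of b "b i + 1"] b by linarith
 ultimately show "X \<subseteq> {..n} \<and> (\<forall>i\<le>n. m \<le> b i) \<and> (\<forall>i>n. b i = 0) \<and> int (\<Sum>i\<le>n. b i) = p - 1"
  using D(1) Y by blast
next
 fix b X assume "X \<subseteq> {..n}"
 then show "cub_homotopy m i f b ({..n} - X) = cub_homotopy m i f b X"
  unfolding cub_homotopy_def using i
  by (simp add: flip_Diff flip_subset_iff cub_compl[OF f])
qed

text \<open>The cochain on the single exponent \<open>(m, ..., m)\<close> that every
  \<open>cub_proj m i\<close> fixes. It spans the cohomology: constant in \<open>X\<close> for even
  \<open>m\<close>, alternating for odd \<open>m\<close>.\<close>

definition cub_gen :: "nat \<Rightarrow> nat \<Rightarrow> cochain" where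
 "cub_gen n m b X = (if (\<forall>i. b i = (if i \<le> n then m else 0)) \<and> X \<subseteq> {..n} then (-1) ^ (m * card X) else 0)"

text \<open>For odd \<open>n\<close> the set \<open>{..n}\<close> has an even number of elements, so
  a subset and its complement have sizes of equal parity and the alternating function is
  invariant.\<close>

lemma cub_cub_gen:
 assumes "odd n"
 shows "cub n m (int (m * (n + 1))) (cub_gen n m)"
proof (rule cubI)
 fix b X assume "X \<subseteq> {..n}"
 then have "card ({..n} - X) = Suc n - card X" "card X \<le> Suc n"
  by (auto simp: card_Diff_subset finite_subset dest: card_mono[rotated])
 then have "even (m * card ({..n} - X)) = even (m * card X)" using assms by auto
 then show "cub_gen n m b ({..n} - X) = cub_gen n m b X"
  using \<open>X \<subseteq> {..n}\<close> by (auto simp: cub_gen_def minus_one_power_iff)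
qed (auto simp: cub_gen_def algebra_simps split: if_splits)

lemma flip_power:
 assumes "X \<subseteq> {..n}"
 shows "(-1::real) ^ (m * card (flip i X)) = (-1) ^ m * (-1) ^ (m * card X)"
proof (cases "i \<in> X")
 case True
 have "finite X" using assms finite_subset by blast
 then obtain k where "card X = Suc k" "card (X - {i}) = k" using True by (metis card_Suc_Diff1)
 then show ?thesis using True
  by (simp del: card_Diff_insert add: flip_def power_add power_neg_one_square)
next
 case False
 have "finite X" using assms finite_subset by blast
 then show ?thesis using False by (simp add: flip_def power_add)
qed

text \<open>A part \<open>i\<close> can be nonzero only where \<open>b i = m + 1\<close>; there the
  sign of the flipped term is opposite to the one by which the generator changes under
  \<open>flip\<close>, and the two terms cancel.\<close>

lemma cub_diff_gen: "cub_diff n (cub_gen n m) b X = 0"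
 unfolding cub_diff_def
proof (rule sum.neutral, rule ballI)
 fix i assume "i \<in> {..n}"
 then have i: "i \<le> n" by simp
 show "cub_part i (cub_gen n m) b X = 0"
 proof (cases "1 \<le> b i \<and> X \<subseteq> {..n} \<and> (\<forall>j. (b(i := b i - 1)) j = (if j \<le> n then m else 0))")
  case True
  then have bi: "b i = Suc m" using i by (auto dest: spec[of _ i])
  have "cub_gen n m (b(i := b i - 1)) X = (-1) ^ (m * card X)"
   "cub_gen n m (b(i := b i - 1)) (flip i X) = (-1) ^ m * (-1) ^ (m * card X)"
   using True i by (simp_all add: cub_gen_def flip_subset_iff flip_power[of X n])
  then show ?thesis unfolding cub_part_def bi by (simp add: power_neg_one_square)
 next
  case False
  then have "\<not> 1 \<le> b i \<or> cub_gen n m (b(i := b i - 1)) X = 0 \<and> cub_gen n m (b(i := b i - 1)) (flip i X) = 0"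
   using i by (auto simp only: cub_gen_def flip_subset_iff if_False split: if_splits)
  then show ?thesis by (auto simp: cub_part_def)
 qed
qed

text \<open>Coordinates are contracted one at a time. Subtracting the boundary of the homotopy in
  direction \<open>k\<close> replaces the cocycle by its projection in that direction, and what was
  gained for \<open>i < k\<close> survives because flips commute.\<close>

lemma cub_exact_step:
 assumes f: "cub n m p f" and z: "\<And>b X. cub_diff n f b X = 0" and k: "k \<le> Suc n"
 shows "\<exists>g. cub n m (p - 1) g \<and> (\<forall>b X. \<forall>i<k.
   (f b X - cub_diff n g b X \<noteq> 0 \<longrightarrow> b i = m) \<and>
   f b (flip i X) - cub_diff n g b (flip i X) = (-1) ^ m * (f b X - cub_diff n g b X))"
 using k
proof (induction k)
 case 0
 have "cub n m (p - 1) (\<lambda>b X. 0)" by (rule cubI) auto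
 then show ?case by auto
next
 case (Suc k)
 then obtain g where g: "cub n m (p - 1) g" and G: "\<And>b X i. i < k \<Longrightarrow>
   (f b X - cub_diff n g b X \<noteq> 0 \<longrightarrow> b i = m) \<and>
   f b (flip i X) - cub_diff n g b (flip i X) = (-1) ^ m * (f b X - cub_diff n g b X)" by auto
 have kn: "k \<le> n" using Suc by simp
 define f' where "f' = (\<lambda>b X. f b X - cub_diff n g b X)"
 have f': "cub n m p f'" unfolding f'_def
  using cub_minus[OF f] cub_cub_diff[OF g] by simp
 have z': "cub_diff n f' = (\<lambda>b X. 0)" unfolding f'_def cub_diff_minus[abs_def]
  by (simp add: z cub_diff_square)
 define h where "h = cub_homotopy m k f'"
 have h: "cub n m (p - 1) h" unfolding h_def by (rule cub_cub_homotopy[OF f' kn])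
 have "cub_homotopy m k (cub_diff n f') b X = 0" for b X
  unfolding z' by (simp add: cub_homotopy_def)
 then have pr: "f' b X - cub_diff n h b X = cub_proj m k f' b X" for b X
  using cub_homotopy[OF kn, of m f' b X] cub_zeroI[OF f' kn] by (simp add: h_def)
 have eq: "f b X - cub_diff n (\<lambda>b X. g b X + h b X) b X = cub_proj m k f' b X" for b X
  using pr[of b X] by (simp add: cub_diff_add f'_def)
 have "cub n m (p - 1) (\<lambda>b X. g b X + h b X)" by (rule cub_add[OF g h])
 moreover have pm: "(cub_proj m k f' b X \<noteq> 0 \<longrightarrow> b i = m) \<and>
   cub_proj m k f' b (flip i X) = (-1) ^ m * cub_proj m k f' b X" if "i < Suc k" for b X i
 proof (cases "i = k")
  case True
  then show ?thesis by (simp add: cub_proj_def algebra_simps flip: power_add)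
 next
  case False
  then have "i < k" using that by simp
  from G[OF this, of b X] G[OF this, of b "flip k X"]
  have "f' b X \<noteq> 0 \<longrightarrow> b i = m" "f' b (flip i X) = (-1) ^ m * f' b X"
   "f' b (flip k X) \<noteq> 0 \<longrightarrow> b i = m" "f' b (flip i (flip k X)) = (-1) ^ m * f' b (flip k X)"
   by (simp_all add: f'_def)
  then show ?thesis by (auto simp: cub_proj_def flip_commute[of k i] algebra_simps)
 qed
 ultimately show ?case
  apply -
  apply (rule exI[of _ "\<lambda>b X. g b X + h b X"], rule conjI, assumption)
  apply (intro allI impI)
  apply (unfold eq)
  apply (rule pm)
  apply assumption
  done
qed

text \<open>After all coordinates are contracted the remainder lives on one exponent and is
  determined by its value at the empty set, since flips reach every subset of \<open>{..n}\<close>.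
  Hence it is a multiple of \<open>cub_gen\<close>.\<close>

lemma cub_exact:
 assumes f: "cub n m p f" and z: "\<And>b X. cub_diff n f b X = 0"
 obtains g c where "cub n m (p - 1) g" "\<And>b X. f b X = cub_diff n g b X + c * cub_gen n m b X"
  "p \<noteq> int (m * (n + 1)) \<Longrightarrow> c = 0"
proof -
 obtain g where g: "cub n m (p - 1) g" and G: "\<And>b X i. i \<le> n \<Longrightarrow>
   (f b X - cub_diff n g b X \<noteq> 0 \<longrightarrow> b i = m) \<and>
   f b (flip i X) - cub_diff n g b (flip i X) = (-1) ^ m * (f b X - cub_diff n g b X)"
  using cub_exact_step[OF f z order_refl] by (auto simp: less_Suc_eq_le)
 define u where "u = (\<lambda>b X. f b X - cub_diff n g b X)"
 have u: "cub n m p u" unfolding u_def using cub_minus[OF f] cub_cub_diff[OF g] by simp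
 define b0 where "b0 = (\<lambda>i. if i \<le> n then m else 0)"
 have b0: "b = b0" if "u b X \<noteq> 0" for b X
  proof
  fix i
  show "b i = b0 i"
   using G[of i b X] cubD(3)[OF u that, of i] that by (cases "i \<le> n") (simp_all add: b0_def u_def)
 qed
 have "u b0 X = (-1) ^ (m * card X) * u b0 {}" if "X \<subseteq> {..n}" for X
 proof -
  have "finite X" using that finite_subset by blast
  then show ?thesis using that
  proof (induction X rule: finite_induct)
   case (insert x F)
   have "u b0 (flip x F) = (-1) ^ m * u b0 F" using G[of x b0 F] insert by (simp add: u_def)
   moreover have "flip x F = insert x F" using insert by (simp add: flip_def)
   ultimately show ?case using insert by (simp add: power_add)
  qed simp
 qed
 note pw = this
 have gen: "cub_gen n m b X = (if b = b0 \<and> X \<subseteq> {..n} then (-1) ^ (m * card X) else 0)" for b X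
  by (simp add: cub_gen_def b0_def fun_eq_iff)
 have c: "u b X = u b0 {} * cub_gen n m b X" for b X
 proof (cases "b = b0 \<and> X \<subseteq> {..n}")
  case True
  then show ?thesis using pw[of X] by (simp add: gen mult.commute)
 next
  case False
  then have "u b X = 0" using b0[of b X] cubD(1)[OF u, of b X] by blast
  then show ?thesis using False by (simp only: gen if_False mult_zero_right)
 qed
 have "u b0 {} = 0" if "p \<noteq> int (m * (n + 1))"
  using cubD(4)[OF u, of b0 "{}"] that by (auto simp: b0_def algebra_simps)
 then show ?thesis using g c by (intro that[of g "u b0 {}"]) (auto simp: u_def algebra_simps)
qed

text \<open>
 The quotient of the complex of all cochains by the subcomplex of those supported on \<open>b \<ge> 1\<close>.
 Both complexes have one-dimensional cohomology, in degrees \<open>0\<close> and \<open>n + 1\<close>; the long exact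
 sequence puts the cohomology of the quotient in degrees \<open>0\<close> and \<open>n\<close>.
\<close>

definition bdr :: "nat \<Rightarrow> (nat \<Rightarrow> nat) \<Rightarrow> bool" where
 "bdr n b \<longleftrightarrow> (\<exists>i\<le>n. b i = 0)"

definition qcub :: "nat \<Rightarrow> int \<Rightarrow> cochain \<Rightarrow> bool" where
 "qcub n p f \<longleftrightarrow> cub n 0 p f \<and> (\<forall>b X. \<not> bdr n b \<longrightarrow> f b X = 0)"

definition qrestr :: "nat \<Rightarrow> cochain \<Rightarrow> cochain" where
 "qrestr n f b X = (if bdr n b then f b X else 0)"

definition qdiff :: "nat \<Rightarrow> cochain \<Rightarrow> cochain" where
 "qdiff n f = qrestr n (cub_diff n f)"

text \<open>In degree 0 this is evaluation at the generator. In the other degrees it is the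
  connecting map of the long exact sequence: lift to the full complex, apply its differential, and
  read the coefficient of \<open>cub_gen n 1\<close>, whose value at \<open>(1, ..., 1)\<close> and
  \<open>{}\<close> is 1.\<close>

definition qfun :: "nat \<Rightarrow> int \<Rightarrow> cochain \<Rightarrow> real" where
 "qfun n p f = (if p = 0 then f (\<lambda>i. 0) {} else cub_diff n f (\<lambda>i. if i \<le> n then 1 else 0) {})"

lemma bdr_dec: "bdr n b \<Longrightarrow> bdr n (b(i := b i - 1))"
 by (auto simp: bdr_def)

text \<open>Lowering an exponent keeps a vanishing component, so at a point with a zero component
  the differential only sees such points. Restriction thus commutes with the differential.\<close>

lemma qdiff_qrestr: "bdr n b \<Longrightarrow> cub_diff n (qrestr n f) b X = cub_diff n f b X"
 unfolding cub_diff_def cub_part_def qrestr_def by (intro sum.cong refl) (simp add: bdr_dec[simplified])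

lemma qcub_qrestr:
 assumes "cub n 0 p f" shows "qcub n p (qrestr n f)"
proof -
 have "cub n 0 p (qrestr n f)"
  by (rule cubI) (use assms in \<open>auto simp: qrestr_def cub_compl dest: cubD split: if_splits\<close>)
 then show ?thesis by (simp add: qcub_def qrestr_def)
qed

lemma cub_sub_qrestr:
 assumes f: "cub n 0 p f" shows "cub n 1 p (\<lambda>b X. f b X - qrestr n f b X)"
proof (rule cubI)
 fix b X assume "f b X - qrestr n f b X \<noteq> 0"
 then have "\<not> bdr n b" "f b X \<noteq> 0" by (auto simp: qrestr_def split: if_splits)
 then show "X \<subseteq> {..n} \<and> (\<forall>i\<le>n. 1 \<le> b i) \<and> (\<forall>i>n. b i = 0) \<and> int (\<Sum>i\<le>n. b i) = p"
  using cubD[OF f, of b X] by (auto simp: bdr_def)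
qed (simp add: qrestr_def cub_compl[OF f])

lemma qcub_qdiff: "qcub n p f \<Longrightarrow> qcub n (p + 1) (qdiff n f)"
 unfolding qdiff_def by (intro qcub_qrestr cub_cub_diff) (simp add: qcub_def)

lemma qdiff_square: "qdiff n (qdiff n f) b X = 0"
 using qdiff_qrestr[of n b "cub_diff n f" X] by (simp add: qdiff_def qrestr_def cub_diff_square)

lemma qdiff_linear: "qdiff n (\<lambda>b X. r * f b X + s * g b X) b X = r * qdiff n f b X + s * qdiff n g b X"
 by (simp add: qdiff_def qrestr_def cub_diff_linear)

lemma qfun_linear: "qfun n p (\<lambda>b X. r * f b X + s * g b X) = r * qfun n p f + s * qfun n p g"
 by (simp add: qfun_def cub_diff_linear)

text \<open>From \<open>(1, ..., 1)\<close> the differential only reaches exponents with a zero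
  component, where a cochain of the subcomplex vanishes.\<close>

lemma cub_diff_ones:
 assumes "cub n 1 p y"
 shows "cub_diff n y (\<lambda>i. if i \<le> n then 1 else 0) X = 0"
 unfolding cub_diff_def
proof (rule sum.neutral, rule ballI)
 fix i assume "i \<in> {..n}"
 then have "y ((\<lambda>i. if i \<le> n then 1 else 0)(i := 0)) Y = 0" for Y
  by (intro cub_zeroI[OF assms, of i]) auto
 then show "cub_part i y (\<lambda>i. if i \<le> n then 1 else 0) X = 0" by (simp add: cub_part_def)
qed

lemma cub_diff_zero: "cub_diff n y (\<lambda>i. 0) X = 0"
 by (simp add: cub_diff_def cub_part_def)

text \<open>The full differential of \<open>w\<close> differs from its restriction by a cochain of
  the subcomplex. The latter does not affect \<open>qfun\<close>, and the square of the full
  differential is zero.\<close>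

lemma qfun_qdiff:
 assumes "qcub n (p - 1) w"
 shows "qfun n p (qdiff n w) = 0"
proof (cases "p = 0")
 case True
 then show ?thesis by (simp add: qfun_def qdiff_def qrestr_def cub_diff_zero)
next
 case False
 have "cub n 1 p (\<lambda>b X. cub_diff n w b X - qdiff n w b X)"
  unfolding qdiff_def using assms cub_cub_diff[of n 0 "p - 1" w] by (intro cub_sub_qrestr) (simp add: qcub_def)
 from cub_diff_ones[OF this] show ?thesis
  using False by (simp add: qfun_def cub_diff_minus cub_diff_square)
qed

text \<open>Diagram chase: \<open>cub_diff n x\<close> lies in the subcomplex and equals
  \<open>cub_diff n y\<close> there up to a multiple of its generator, and then \<open>x - y\<close>
  is a cocycle of the full complex. The two multiples obstruct only in degrees \<open>n\<close> and
  0, where \<open>qfun\<close> detects them.\<close>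

lemma qfun_exact:
 assumes n: "odd n" and x: "qcub n p x" and z: "\<And>b X. qdiff n x b X = 0" and l: "qfun n p x = 0"
 obtains w where "qcub n (p - 1) w" "\<And>b X. x b X = qdiff n w b X"
proof -
 let ?ones = "\<lambda>i. if i \<le> n then 1 else 0 :: nat"
 have x0: "cub n 0 p x" using x by (simp add: qcub_def)
 have dx: "cub n 1 (p + 1) (cub_diff n x)"
  using cub_sub_qrestr[OF cub_cub_diff[OF x0]] z by (simp add: qdiff_def)
 obtain y c where y: "cub n 1 (p + 1 - 1) y"
  and yc: "\<And>b X. cub_diff n x b X = cub_diff n y b X + c * cub_gen n 1 b X"
  and c0: "p + 1 \<noteq> int (1 * (n + 1)) \<Longrightarrow> c = 0"
  using cub_exact[OF dx] cub_diff_square by blast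
 have "c = cub_diff n x ?ones {}"
  using yc[of ?ones "{}"] cub_diff_ones[OF y] by (simp add: cub_gen_def)
 \<comment> \<open>In degree \<open>n\<close> the hypothesis on \<open>qfun\<close> gives the claim;
   this uses that \<open>n\<close> is not 0, so that \<open>qfun\<close> is the connecting map
   there.\<close>
 then have c: "c = 0" using c0 l n by (cases "p = int n") (auto simp: qfun_def split: if_splits)
 have y0: "cub n 0 p y" using y cub_mono by force
 have xy: "cub n 0 p (\<lambda>b X. x b X - y b X)" by (rule cub_minus[OF x0 y0])
 obtain w d where w: "cub n 0 (p - 1) w"
  and wd: "\<And>b X. x b X - y b X = cub_diff n w b X + d * cub_gen n 0 b X"
  and d0: "p \<noteq> int (0 * (n + 1)) \<Longrightarrow> d = 0"
  using cub_exact[OF xy] yc c by (simp add: cub_diff_minus) blast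
 have "y (\<lambda>i. 0) {} = 0" by (rule cub_zeroI[OF y, of 0]) auto
 then have "d = x (\<lambda>i. 0) {}"
  using wd[of "\<lambda>i. 0" "{}"] by (simp add: cub_gen_def cub_diff_zero)
 then have d: "d = 0" using d0 l by (cases "p = 0") (auto simp: qfun_def)
 show ?thesis
 proof
  show "qcub n (p - 1) (qrestr n w)" by (rule qcub_qrestr[OF w])
  show "x b X = qdiff n (qrestr n w) b X" for b X
  proof (cases "bdr n b")
   case True
   then have "y b X = 0" by (auto simp: bdr_def intro: cub_zeroI[OF y])
   then show ?thesis using wd[of b X] d True by (simp add: qdiff_def qrestr_def[of n "cub_diff n _"] qdiff_qrestr)
  next
   case False
   then show ?thesis using x by (simp add: qdiff_def qrestr_def qcub_def)
  qed
 qed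
qed

lemma qfun_range:
 assumes n: "odd n" and x: "qcub n p x" and p: "p \<noteq> 0" "p \<noteq> int n"
 shows "qfun n p x = 0"
proof (rule ccontr)
 assume "qfun n p x \<noteq> 0"
 then have "cub_diff n x (\<lambda>i. if i \<le> n then 1 else 0) {} \<noteq> 0" using p by (simp add: qfun_def)
 moreover have "cub n 0 (p + 1) (cub_diff n x)" using x by (auto simp: qcub_def intro: cub_cub_diff)
 ultimately show False using cubD(4) p by fastforce
qed

text \<open>Degree 0 has the constant cochain. In degree \<open>n\<close>, the generator of the
  subcomplex becomes exact in the full complex, since it sits in degree \<open>n + 1\<close>, which
  is not 0; a primitive, restricted to exponents with a zero component, is the required
  class.\<close>

lemma qfun_surj:
 assumes n: "odd n" and p: "p = 0 \<or> p = int n"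
 obtains x where "qcub n p x" "\<And>b X. qdiff n x b X = 0" "qfun n p x = 1"
proof (cases "p = 0")
 case True
 have "cub n 0 p (cub_gen n 0)" using cub_cub_gen[OF n, of 0] True by simp
 then have "qcub n p (cub_gen n 0)" by (auto simp: qcub_def cub_gen_def bdr_def)
 moreover have "qdiff n (cub_gen n 0) b X = 0" for b X
  by (simp add: qdiff_def qrestr_def cub_diff_gen)
 moreover have "qfun n p (cub_gen n 0) = 1" using True by (simp add: qfun_def cub_gen_def)
 ultimately show ?thesis by (rule that)
next
 case False
 then have p: "p = int n" using p by simp
 have e: "cub n 0 (int (1 * (n + 1))) (cub_gen n 1)" using cub_cub_gen[OF n, of 1] cub_mono by blast
 obtain x c where x: "cub n 0 (int (1 * (n + 1)) - 1) x"
  and xc: "\<And>b X. cub_gen n 1 b X = cub_diff n x b X + c * cub_gen n 0 b X"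
  and c: "int (1 * (n + 1)) \<noteq> int (0 * (n + 1)) \<Longrightarrow> c = 0"
  using cub_exact[OF e cub_diff_gen] by blast
 have x: "cub n 0 p x" and xe: "cub_diff n x b X = cub_gen n 1 b X" for b X
  using x xc[of b X] c p by simp_all
 have "qdiff n (qrestr n x) b X = 0" for b X
  by (auto simp: qdiff_def qrestr_def[of n "cub_diff n _"] qdiff_qrestr xe cub_gen_def bdr_def)
 moreover have "qfun n p (qrestr n x) = 1"
 proof -
  have "cub_gen n 1 (\<lambda>i. if i \<le> n then 1 else 0) {} = 1" by (simp add: cub_gen_def)
  then show ?thesis
   using cub_diff_ones[OF cub_sub_qrestr[OF x], of "{}"] False
   by (simp add: qfun_def cub_diff_minus xe)
 qed
 ultimately show ?thesis using qcub_qrestr[OF x] that by blast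
qed

section \<open>Real cohomology and integral homology\<close>

lemma additive_frag_cmul:
 fixes f :: "('a \<Rightarrow>\<^sub>0 int) \<Rightarrow> 'r::comm_ring_1"
 assumes add: "\<And>x y. x \<in> B \<Longrightarrow> y \<in> B \<Longrightarrow> f (x + y) = f x + f y"
  and cmul: "\<And>k x. x \<in> B \<Longrightarrow> frag_cmul k x \<in> B" and x: "x \<in> B"
 shows "f (frag_cmul k x) = of_int k * f x"
proof -
 have 0: "f 0 = 0"
  using add[OF cmul[OF x, of 0] cmul[OF x, of 0]] by simp
 have nat: "f (frag_cmul (int m) x) = of_nat m * f x" for m
 proof (induction m)
  case (Suc m)
  have "frag_cmul (int (Suc m)) x = x + frag_cmul (int m) x"
   by (simp add: frag_cmul_distrib)
  then show ?case using add[OF x cmul[OF x, of "int m"]] Suc by (simp add: algebra_simps)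
 qed (simp add: 0)
 show ?thesis
 proof (cases "0 \<le> k")
  case True
  then show ?thesis using nat[of "nat k"] by simp
 next
  case False
  have "frag_cmul k x + frag_cmul (int (nat (- k))) x = 0"
   using False by (simp flip: frag_cmul_distrib)
  then have "f (frag_cmul k x) + f (frag_cmul (int (nat (- k))) x) = 0"
   using add[OF cmul[OF x] cmul[OF x]] 0 by metis
  moreover have "(of_nat (nat (- k)) :: 'r) = - of_int k"
   using False by (metis int_nat_eq nat_0_le not_le less_imp_le neg_0_le_iff_le of_int_minus of_int_of_nat_eq)
  ultimately show ?thesis unfolding nat by (simp add: eq_neg_iff_add_eq_0)
 qed
qed

text \<open>The group \<open>\<real>\<close> is injective, by Zorn's lemma applied to graphs of partial homomorphisms.\<close>

lemma additive_extension:
 fixes f :: "('a \<Rightarrow>\<^sub>0 int) \<Rightarrow> real"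
 assumes add: "\<And>x y. x \<in> B \<Longrightarrow> y \<in> B \<Longrightarrow> f (x + y) = f x + f y"
  and B0: "0 \<in> B" and Badd: "\<And>x y. x \<in> B \<Longrightarrow> y \<in> B \<Longrightarrow> x + y \<in> B"
  and Bcmul: "\<And>k x. x \<in> B \<Longrightarrow> frag_cmul k x \<in> B"
 shows "\<exists>H. (\<forall>x y. H (x + y) = H x + H y) \<and> (\<forall>x\<in>B. H x = f x)"
proof -
 define S where "S = {G. (\<lambda>x. (x, f x)) ` B \<subseteq> G
   \<and> (\<forall>x s y t. (x, s) \<in> G \<longrightarrow> (y, t) \<in> G \<longrightarrow> (x + y, s + t) \<in> G)
   \<and> (\<forall>k x s. (x, s) \<in> G \<longrightarrow> (frag_cmul k x, of_int k * s) \<in> G)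
   \<and> (\<forall>s. (0, s) \<in> G \<longrightarrow> s = (0::real))}"
 have f0: "f 0 = 0" using add[OF B0 B0] by simp
 have "(\<lambda>x. (x, f x)) ` B \<in> S"
  using f0 by (auto simp: S_def add Badd Bcmul additive_frag_cmul[where B = B and f = f])
 then have ne: "S \<noteq> {}" by blast
 have ch: "\<Union>C \<in> S" if C: "C \<noteq> {}" "subset.chain S C" for C
 proof -
  have CS: "C \<subseteq> S" and lin: "\<And>X Y. X \<in> C \<Longrightarrow> Y \<in> C \<Longrightarrow> X \<subseteq> Y \<or> Y \<subseteq> X"
   using C by (auto simp: subset_chain_def)
  have "(x + y, s + t) \<in> \<Union>C" if xs: "(x, s) \<in> X" "X \<in> C" and yt: "(y, t) \<in> Y" "Y \<in> C" for x s y t X Y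
  proof -
   obtain Z where "Z \<in> C" "(x, s) \<in> Z" "(y, t) \<in> Z" using lin[of X Y] xs yt by blast
   then show ?thesis using CS unfolding S_def by blast
  qed
  then have 2: "\<forall>x s y t. (x, s) \<in> \<Union>C \<longrightarrow> (y, t) \<in> \<Union>C \<longrightarrow> (x + y, s + t) \<in> \<Union>C" by blast
  have 1: "(\<lambda>x. (x, f x)) ` B \<subseteq> \<Union>C" using C(1) CS unfolding S_def by blast
  have 3: "\<forall>k x s. (x, s) \<in> \<Union>C \<longrightarrow> (frag_cmul k x, of_int k * s) \<in> \<Union>C"
   using CS unfolding S_def by blast
  have 4: "\<forall>s. (0, s) \<in> \<Union>C \<longrightarrow> s = 0" using CS unfolding S_def by blast
  show ?thesis unfolding S_def mem_Collect_eq using 1 2 3 4 by (intro conjI)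
 qed
 obtain M where M: "M \<in> S" and max: "\<And>X. X \<in> S \<Longrightarrow> M \<subseteq> X \<Longrightarrow> X = M"
  using subset_Zorn_nonempty[OF ne ch] by metis
 have MB: "x \<in> B \<Longrightarrow> (x, f x) \<in> M"
  and Madd: "(x, s) \<in> M \<Longrightarrow> (y, t) \<in> M \<Longrightarrow> (x + y, s + t) \<in> M"
  and Mcmul: "(x, s) \<in> M \<Longrightarrow> (frag_cmul k x, of_int k * s) \<in> M"
  and M0: "(0, s) \<in> M \<Longrightarrow> s = 0" for x y s t k
  using M unfolding S_def by blast+
 have uniq: "s = t" if "(x, s) \<in> M" "(x, t) \<in> M" for x s t
 proof -
  have "(x + frag_cmul (-1) x, s + of_int (-1) * t) \<in> M" using that by (intro Madd Mcmul)
  then show ?thesis using M0[of "s - t"] by simp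
 qed
 have total: "\<exists>s. (x, s) \<in> M" for x
 proof -
  \<comment> \<open>The value to assign to \<open>x\<close>: it is forced when a nonzero multiple of
    \<open>x\<close> is already in the domain, which is where division in \<real> is used, and
    otherwise 0 serves.\<close>
  define r where "r = (SOME r. \<forall>k s. (frag_cmul k x, s) \<in> M \<longrightarrow> s = of_int k * r)"
  have ex: "\<exists>r. \<forall>k s. (frag_cmul k x, s) \<in> M \<longrightarrow> s = of_int k * r"
  proof (cases "\<exists>k s. k \<noteq> 0 \<and> (frag_cmul k x, s) \<in> M")
   case True
   then obtain k s where k: "k \<noteq> 0" "(frag_cmul k x, s) \<in> M" by blast
   have "t = of_int l * (s / of_int k)" if "(frag_cmul l x, t) \<in> M" for l t
   proof -
    have "(frag_cmul (k * l) x, of_int k * t) \<in> M" using Mcmul[OF that, of k] by simp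
    moreover have "(frag_cmul (k * l) x, of_int l * s) \<in> M"
     using Mcmul[OF k(2), of l] by (simp add: mult.commute)
    ultimately have "of_int k * t = of_int l * s" by (rule uniq)
    then show ?thesis using k(1) by (simp add: field_simps)
   qed
   then show ?thesis by blast
  next
   case False
   have "s = of_int k * 0" if "(frag_cmul k x, s) \<in> M" for k s
   proof -
    have "k = 0" using False that by blast
    then show ?thesis using M0[of s] that by simp
   qed
   then show ?thesis by blast
  qed
  have r: "s = of_int k * r" if "(frag_cmul k x, s) \<in> M" for k s
   using someI_ex[OF ex] that unfolding r_def by blast
  define M' where "M' = {(y + frag_cmul k x, s + of_int k * r) | y s k. (y, s) \<in> M}"
  have "M \<subseteq> M'"
  proof clarify
   fix y s assume "(y, s) \<in> M"
   then have "(y + frag_cmul 0 x, s + of_int 0 * r) \<in> M'" unfolding M'_def by blast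
   then show "(y, s) \<in> M'" by simp
  qed
  moreover have "M' \<in> S"
  proof -
   have "(\<lambda>x. (x, f x)) ` B \<subseteq> M'" using \<open>M \<subseteq> M'\<close> MB by blast
   moreover have "(a + b, u + v) \<in> M'" if au: "(a, u) \<in> M'" "(b, v) \<in> M'" for a b u v
   proof -
    obtain y s k where 1: "a = y + frag_cmul k x" "u = s + of_int k * r" "(y, s) \<in> M"
     using au unfolding M'_def by blast
    obtain y' s' k' where 2: "b = y' + frag_cmul k' x" "v = s' + of_int k' * r" "(y', s') \<in> M"
     using au unfolding M'_def by blast
    have "a + b = (y + y') + frag_cmul (k + k') x" "u + v = (s + s') + of_int (k + k') * r"
     by (simp_all add: 1 2 frag_cmul_distrib algebra_simps)
    then show ?thesis using Madd[OF 1(3) 2(3)] unfolding M'_def by blast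
   qed
   moreover have "(frag_cmul l a, of_int l * u) \<in> M'" if au: "(a, u) \<in> M'" for a u l
   proof -
    obtain y s k where 1: "a = y + frag_cmul k x" "u = s + of_int k * r" "(y, s) \<in> M"
     using au unfolding M'_def by blast
    have "frag_cmul l a = frag_cmul l y + frag_cmul (l * k) x" "of_int l * u = of_int l * s + of_int (l * k) * r"
     by (simp_all add: 1 frag_cmul_distrib2 algebra_simps)
    then show ?thesis using Mcmul[OF 1(3), of l] unfolding M'_def by blast
   qed
   moreover have "u = 0" if au: "(0, u) \<in> M'" for u
   proof -
    obtain y s k where 1: "0 = y + frag_cmul k x" "u = s + of_int k * r" "(y, s) \<in> M"
     using au unfolding M'_def by blast
    have "y = frag_cmul (-k) x"
     using 1(1) frag_cmul_distrib[of k "-k" x] by (simp add: eq_neg_iff_add_eq_0 add.commute)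
       (metis add.inverse_unique add.commute)
    then show ?thesis using r[of "-k" s] 1 by simp
   qed
   ultimately show ?thesis unfolding S_def mem_Collect_eq by (intro conjI allI impI)
  qed
  ultimately have "M' = M" by (intro max)
  have "(0, 0) \<in> M" using MB[OF B0] f0 by simp
  then have "(0 + frag_cmul 1 x, 0 + of_int 1 * r) \<in> M'" unfolding M'_def by blast
  then show ?thesis using \<open>M' = M\<close> by auto
 qed
 define H where "H x = (THE s. (x, s) \<in> M)" for x
 have H: "H x = s" if "(x, s) \<in> M" for x s
  unfolding H_def using that by (intro the_equality) (auto dest: uniq)
 have HM: "(x, H x) \<in> M" for x using total[of x] H by metis
 show ?thesis
 proof (intro exI conjI allI ballI)
  show "H (x + y) = H x + H y" for x y by (rule H[OF Madd[OF HM HM]])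
  show "H x = f x" if "x \<in> B" for x by (rule H[OF MB[OF that]])
 qed
qed

lemma additive_real:
 fixes H :: "('a \<Rightarrow>\<^sub>0 int) \<Rightarrow> real"
 assumes "\<And>x y. H (x + y) = H x + H y"
 shows "H (frag_cmul k x) = of_int k * H x" "H 0 = 0" "H (x - y) = H x - H y"
proof -
 show "H (frag_cmul k x) = of_int k * H x"
  by (rule additive_frag_cmul[where B = UNIV]) (auto simp: assms)
 show "H 0 = 0" using assms[of 0 0] by simp
 show "H (x - y) = H x - H y" using assms[of "x - y" y] by simp
qed

section \<open>Evaluation of real cocycles on a cycle\<close>

lemma carrier_singular_cochains:
 "\<phi> \<in> carrier (singular_cochains X (int q)) \<longleftrightarrow> \<phi> \<in> extensional (singular_chain_set q X) \<and>
   (\<forall>x y. singular_chain q X x \<longrightarrow> singular_chain q X y \<longrightarrow> \<phi> (x + y) = \<phi> x + \<phi> y)"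
 by (auto simp: singular_cochains_def Let_def)

lemma singular_cochains_ops:
 "\<zero>\<^bsub>singular_cochains X p\<^esub> = (\<lambda>x\<in>singular_chain_set (nat p) X. 0)"
 "\<phi> \<oplus>\<^bsub>singular_cochains X p\<^esub> \<psi> = (\<lambda>x\<in>singular_chain_set (nat p) X. \<phi> x + \<psi> x)"
 "r \<odot>\<^bsub>singular_cochains X p\<^esub> \<phi> = (\<lambda>x\<in>singular_chain_set (nat p) X. r * \<phi> x)"
 by (simp_all add: singular_cochains_def Let_def)

text \<open>A cochain is constrained only on the subgroup of singular chains. An extension to all
  formal sums allows calculations without side conditions.\<close>

lemma cochain_total:
 assumes "\<phi> \<in> carrier (singular_cochains X (int q))"
 shows "\<exists>H. (\<forall>x y. H (x + y) = H x + H y) \<and> (\<forall>x\<in>singular_chain_set q X. H x = \<phi> x)"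
proof (rule additive_extension)
 show "\<phi> (x + y) = \<phi> x + \<phi> y" if "x \<in> singular_chain_set q X" "y \<in> singular_chain_set q X" for x y
  using assms that unfolding carrier_singular_cochains by simp
qed (simp_all add: singular_chain_add singular_chain_cmul)

definition cochain_coords :: "'a topology \<Rightarrow> nat \<Rightarrow> ('a chain \<Rightarrow> real) \<Rightarrow> 'a chain \<Rightarrow> real" where
 "cochain_coords X q \<phi> c = (if singular_chain q X c then \<phi> c else 0)"

lemma real_coordinates_cochains:
 "real_coordinates (singular_cochains X p) (cochain_coords X (nat p))"
 "inj_on (cochain_coords X (nat p)) (carrier (singular_cochains X p))"
proof -
 show "real_coordinates (singular_cochains X p) (cochain_coords X (nat p))"
  unfolding real_coordinates_def singular_cochains_ops
  by (auto simp: singular_cochains_def Let_def cochain_coords_def singular_chain_add algebra_simps)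
 show "inj_on (cochain_coords X (nat p)) (carrier (singular_cochains X p))"
 proof (rule inj_onI)
  fix \<phi> \<psi>
  assume *: "\<phi> \<in> carrier (singular_cochains X p)" "\<psi> \<in> carrier (singular_cochains X p)"
   "cochain_coords X (nat p) \<phi> = cochain_coords X (nat p) \<psi>"
  show "\<phi> = \<psi>"
  proof (rule extensionalityI[of _ "singular_chain_set (nat p) X"])
   fix x assume "x \<in> singular_chain_set (nat p) X"
   then show "\<phi> x = \<psi> x" using fun_cong[OF *(3), of x] by (simp add: cochain_coords_def)
  qed (use * in \<open>auto simp: singular_cochains_def Let_def\<close>)
 qed
qed

lemma singular_coboundary_zero_iff:
 assumes "\<phi> \<in> carrier (singular_cochains X (int q))"
 shows "singular_coboundary X (int q) \<phi> = \<zero>\<^bsub>singular_cochains X (int q + 1)\<^esub> \<longleftrightarrow>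
  (\<forall>d. singular_chain (Suc q) X d \<longrightarrow> \<phi> (chain_boundary (Suc q) d) = 0)"
proof -
 have n: "nat (int q + 1) = Suc q" by simp
 show ?thesis
  unfolding singular_coboundary_def singular_cochains_ops n carrier_chain_group
  by (auto simp: fun_eq_iff restrict_def)
qed

lemma chain_boundary_twice:
 assumes "singular_chain (Suc q) X d"
 shows "chain_boundary q (chain_boundary (Suc q) d) = 0"
 using chain_boundary_boundary[OF assms] by simp

text \<open>The functional is evaluation at \<open>z\<close>. A cocycle that kills \<open>z\<close>
  kills every cycle, since some nonzero multiple of a cycle is homologous to a multiple of
  \<open>z\<close>; it then factors through the boundary map and, \<real> being injective, is a
  coboundary. If \<open>z\<close> has infinite order modulo boundaries, every real value at
  \<open>z\<close> occurs.\<close>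

lemma real_range_singular_cohomology:
 assumes z: "zcycle q X z"
  and gen: "\<And>c. zcycle q X c \<Longrightarrow>
    \<exists>k l. k \<noteq> 0 \<and> zboundary q X (frag_cmul k c - frag_cmul l z)"
  and I: "I = UNIV \<and> (\<forall>k. zboundary q X (frag_cmul k z) \<longrightarrow> k = 0) \<or> I = {0} \<and> z = 0"
 shows "real_range (singular_cohomology X (int q)) I"
proof -
 let ?C = "singular_cochains X" and ?\<delta> = "singular_coboundary X"
 let ?Z = "{\<phi> \<in> carrier (?C (int q)). ?\<delta> (int q) \<phi> = \<zero>\<^bsub>?C (int q + 1)\<^esub>}"
 let ?l = "\<lambda>\<phi>. \<phi> z"
 have zc: "singular_chain q X z" "chain_boundary q z = 0" using z by (auto simp: singular_cycle)
 have Z: "\<phi> \<in> ?Z \<longleftrightarrow> \<phi> \<in> carrier (?C (int q)) \<and>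
   (\<forall>d. singular_chain (Suc q) X d \<longrightarrow> \<phi> (chain_boundary (Suc q) d) = 0)" for \<phi>
  using singular_coboundary_zero_iff by blast
 have bd: "singular_chain (Suc q) X d \<Longrightarrow> singular_chain q X (chain_boundary (Suc q) d)" for d
  by (rule singular_chain_boundary_alt)
 have mkC: "restrict H (singular_chain_set q X) \<in> carrier (?C (int q))"
  if "\<And>x y. H (x + y) = H x + H y" for H
  by (simp add: carrier_singular_cochains that singular_chain_add)
 have vanish: "\<phi> c = 0" if \<phi>: "\<phi> \<in> ?Z" and l: "\<phi> z = 0" and c: "zcycle q X c" for \<phi> c
 proof -
  have "\<phi> \<in> carrier (?C (int q))" using \<phi> by simp
  from cochain_total[OF this] obtain H where H':
   "(\<forall>x y. H (x + y) = H x + H y) \<and> (\<forall>x\<in>singular_chain_set q X. H x = \<phi> x)" ..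
  have H: "H (x + y) = H x + H y" "singular_chain q X x \<Longrightarrow> \<phi> x = H x" for x y
   using H' by simp_all
  obtain k l where k: "k \<noteq> 0" "zboundary q X (frag_cmul k c - frag_cmul l z)"
   using gen[OF c] by blast
  then obtain d where d: "singular_chain (Suc q) X d" "chain_boundary (Suc q) d = frag_cmul k c - frag_cmul l z"
   by (auto simp: singular_boundary)
  have "\<phi> (chain_boundary (Suc q) d) = 0" using \<phi> d(1) Z by blast
  then have "H (frag_cmul k c - frag_cmul l z) = 0" using H(2)[OF bd[OF d(1)]] d(2) by simp
  moreover have "H z = 0" using H(2)[OF zc(1)] l by simp
  ultimately have "of_int k * H c = 0" by (simp add: additive_real[OF H(1)])
  then have "H c = 0" using k by simp
  then show ?thesis using H(2)[of c] c by (simp add: singular_cycle)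
 qed
 have l: "real_coordinates ((?C (int q))\<lparr>carrier := ?Z\<rparr>) (\<lambda>\<phi> (k::unit). ?l \<phi>)"
 proof -
  have "?Z = {\<phi> \<in> carrier (?C (int q)). \<forall>d. singular_chain (Suc q) X d \<longrightarrow> \<phi> (chain_boundary (Suc q) d) = 0}"
   using singular_coboundary_zero_iff by (intro Collect_cong conj_cong refl)
  then show ?thesis
   unfolding real_coordinates_def using zc bd
   by (auto simp: singular_cochains_ops carrier_singular_cochains singular_chain_add algebra_simps)
 qed
 have lz: "?l ` ?Z = I"
  using I
 proof (elim disjE conjE)
  assume I: "I = {0}" "z = 0"
  have l0: "\<phi> z = 0" if "\<phi> \<in> ?Z" for \<phi>
  proof -
   have "\<phi> \<in> carrier (?C (int q))" using that by simp
   then have "\<phi> (0 + 0) = \<phi> 0 + \<phi> 0"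
    unfolding carrier_singular_cochains using singular_chain_0[of q X] by blast
   then show ?thesis by (simp add: I)
  qed
  have "(\<lambda>x\<in>singular_chain_set q X. 0) \<in> ?Z"
   using real_coordinatesD(5)[OF l] by (simp add: singular_cochains_ops)
  then have "?Z \<noteq> {}" by (metis empty_iff)
  have "?l ` ?Z = (\<lambda>_. 0) ` ?Z" by (rule image_cong[OF refl]) (rule l0)
  also have "\<dots> = {0}" using \<open>?Z \<noteq> {}\<close> unfolding image_constant_conv by (simp only: if_False)
  finally show "?l ` ?Z = I" unfolding I .
 next
  assume I: "I = UNIV" and nt: "\<forall>k. zboundary q X (frag_cmul k z) \<longrightarrow> k = 0"
  \<comment> \<open>The subgroup generated by \<open>z\<close> and the boundaries, on which
    \<open>f\<close> reads off the coefficient of \<open>z\<close>; this is well defined because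
    \<open>z\<close> has infinite order.\<close>
  define B where "B = {x. \<exists>k. zboundary q X (x - frag_cmul k z)}"
  define f where "f x = real_of_int (THE k. zboundary q X (x - frag_cmul k z))" for x
  have f: "f x = of_int k" if "zboundary q X (x - frag_cmul k z)" for x k
  proof -
   have "j = k" if "zboundary q X (x - frag_cmul j z)" for j
   proof -
    have "zboundary q X ((x - frag_cmul j z) - (x - frag_cmul k z))"
     by (rule singular_relboundary_diff) fact+
    moreover have "(a - b) - (a - c) = c - b" for a b c :: "'a chain" by simp
    ultimately have "zboundary q X (frag_cmul (k - j) z)"
     unfolding frag_cmul_diff_distrib by (simp only:)
    then show ?thesis using nt[rule_format, of "k - j"] by simp
   qed
   then have "(THE k. zboundary q X (x - frag_cmul k z)) = k"
    using \<open>zboundary q X (x - frag_cmul k z)\<close> by (intro the_equality)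
   then show ?thesis by (simp add: f_def)
  qed
  have sum: "zboundary q X (x + y - frag_cmul (j + k) z)"
   if "zboundary q X (x - frag_cmul j z)" "zboundary q X (y - frag_cmul k z)"
   for x y j k
   using singular_relboundary_add[OF that] by (simp add: frag_cmul_distrib algebra_simps)
  have scale: "zboundary q X (frag_cmul j x - frag_cmul (j * k) z)"
   if "zboundary q X (x - frag_cmul k z)" for x j k
  proof -
   have "frag_cmul j (x - frag_cmul k z) + frag_cmul j (frag_cmul k z) = frag_cmul j x"
    by (simp only: frag_cmul_distrib2[symmetric] diff_add_cancel)
   then have "frag_cmul j (x - frag_cmul k z) = frag_cmul j x - frag_cmul (j * k) z"
    by (simp add: eq_diff_eq)
   then show ?thesis using singular_relboundary_cmul[OF that, of j] by simp
  qed
  have "\<exists>H. (\<forall>x y. H (x + y) = H x + H y) \<and> (\<forall>x\<in>B. H x = f x)"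
  proof (rule additive_extension[of B f])
   show "f (x + y) = f x + f y" "x + y \<in> B" if xy: "x \<in> B" "y \<in> B" for x y
   proof -
    obtain j k where *: "zboundary q X (x - frag_cmul j z)"
     "zboundary q X (y - frag_cmul k z)" using xy unfolding B_def by blast
    show "f (x + y) = f x + f y" using f[OF sum[OF *]] f[OF *(1)] f[OF *(2)] by simp
    show "x + y \<in> B" using sum[OF *] unfolding B_def by blast
   qed
   show "0 \<in> B" unfolding B_def by (intro CollectI exI[of _ 0]) simp
   show "frag_cmul k x \<in> B" if "x \<in> B" for k x using that scale unfolding B_def by blast
  qed
  then obtain H where H': "(\<forall>x y. H (x + y) = H x + H y) \<and> (\<forall>x\<in>B. H x = f x)" ..
  have H: "H (x + y) = H x + H y" "x \<in> B \<Longrightarrow> H x = f x" for x y using H' by simp_all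
  have surj: "r \<in> ?l ` ?Z" for r
  proof
   let ?H = "\<lambda>x. r * H x"
   let ?\<phi> = "restrict ?H (singular_chain_set q X)"
   have "H z = 1"
   proof -
    have "zboundary q X (z - frag_cmul 1 z)" by simp
    then have "z \<in> B" "f z = of_int 1" using f[of z 1] unfolding B_def by blast+
    then show ?thesis using H by simp
   qed
   then show "r = ?\<phi> z" using zc by simp
   have "H (chain_boundary (Suc q) d) = 0" if "singular_chain (Suc q) X d" for d
   proof -
    have "zboundary q X (chain_boundary (Suc q) d - frag_cmul 0 z)"
     using that by (auto simp: singular_boundary)
    then have "chain_boundary (Suc q) d \<in> B" "f (chain_boundary (Suc q) d) = of_int 0"
     using f unfolding B_def by blast+
    then show ?thesis using H by simp
   qed
   moreover have "?\<phi> \<in> carrier (?C (int q))" by (rule mkC) (simp add: H algebra_simps)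
   ultimately show "?\<phi> \<in> ?Z" unfolding Z by (simp add: bd)
  qed
  show "?l ` ?Z = I" unfolding I by (intro equalityI subsetI) (simp, rule surj)
 qed
 have B: "?\<delta> (int q - 1) ` carrier (?C (int q - 1)) = {\<phi> \<in> ?Z. ?l \<phi> = 0}"
 proof (cases q)
  \<comment> \<open>Nothing but zero comes from degree -1, so it has to be shown that a cocycle
    vanishing at \<open>z\<close> is zero: every 0-chain is a cycle.\<close>
  case 0
  have zero: "(\<lambda>x\<in>singular_chain_set q X. 0) \<in> ?Z"
   using real_coordinatesD(5)[OF l] by (simp add: singular_cochains_ops)
  have "?\<delta> (int q - 1) \<psi> = (\<lambda>x\<in>singular_chain_set q X. 0)" if "\<psi> \<in> carrier (?C (int q - 1))" for \<psi>
   using that 0 by (auto simp: singular_coboundary_def singular_cochains_def Let_def chain_boundary_def)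
  moreover have "carrier (?C (int q - 1)) \<noteq> {}"
   using real_coordinatesD(5)[OF real_coordinates_cochains(1)] by blast
  ultimately have img: "?\<delta> (int q - 1) ` carrier (?C (int q - 1)) = {\<lambda>x\<in>singular_chain_set q X. 0}"
   by (force simp: image_iff)
  have zero_only: "\<phi> = (\<lambda>x\<in>singular_chain_set q X. 0)" if "\<phi> \<in> ?Z" "\<phi> z = 0" for \<phi>
  proof (rule extensionalityI[of _ "singular_chain_set q X"])
   show "\<phi> \<in> extensional (singular_chain_set q X)" using that by (simp add: carrier_singular_cochains)
   show "\<phi> x = (\<lambda>x\<in>singular_chain_set q X. 0) x" if "x \<in> singular_chain_set q X" for x
    using vanish[of \<phi> x] that \<open>\<phi> \<in> ?Z\<close> \<open>\<phi> z = 0\<close>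
    by (simp add: singular_cycle chain_boundary_def 0 del: mem_Collect_eq) auto
  qed simp
  have z0: "(\<lambda>x\<in>singular_chain_set q X. 0) z = (0::real)" using zc by simp
  show ?thesis
   unfolding img
  proof (intro equalityI subsetI)
   fix \<phi> assume "\<phi> \<in> {\<lambda>x\<in>singular_chain_set q X. 0::real}"
   then have "\<phi> = (\<lambda>x\<in>singular_chain_set q X. 0)" by (rule singletonD)
   then show "\<phi> \<in> {\<phi> \<in> ?Z. ?l \<phi> = 0}" using zero z0 by (simp only: mem_Collect_eq)
  next
   fix \<phi> assume "\<phi> \<in> {\<phi> \<in> ?Z. ?l \<phi> = 0}"
   then have "\<phi> \<in> ?Z" "\<phi> z = 0" by (simp_all only: mem_Collect_eq)
   then show "\<phi> \<in> {\<lambda>x\<in>singular_chain_set q X. 0::real}" using zero_only by (simp only: singleton_iff)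
  qed
 next
  case (Suc m)
  have nm: "int q - 1 = int m" "nat (int m + 1) = q" using Suc by simp_all
  have \<delta>: "?\<delta> (int q - 1) \<psi> = (\<lambda>x\<in>singular_chain_set q X. \<psi> (chain_boundary q x))" for \<psi>
   by (simp add: singular_coboundary_def nm)
  have bdq: "singular_chain q X c \<Longrightarrow> singular_chain m X (chain_boundary q c)" for c
   using singular_chain_boundary_alt[of m] Suc by simp
  have dd: "chain_boundary q (chain_boundary (Suc q) d) = 0" if "singular_chain (Suc q) X d" for d
   using that by (rule chain_boundary_twice)
  show ?thesis
  proof (intro equalityI subsetI)
   fix \<phi> assume "\<phi> \<in> ?\<delta> (int q - 1) ` carrier (?C (int q - 1))"
   then obtain \<psi> where \<psi>: "\<psi> \<in> carrier (?C (int m))" "\<phi> = ?\<delta> (int q - 1) \<psi>" unfolding nm by blast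
   have \<psi>0: "\<psi> 0 = 0" and \<psi>a: "\<And>x y. singular_chain m X x \<Longrightarrow> singular_chain m X y \<Longrightarrow> \<psi> (x + y) = \<psi> x + \<psi> y"
    using \<psi>(1) unfolding carrier_singular_cochains by (metis add_cancel_left_left singular_chain_0, blast)
   have "\<phi> \<in> carrier (?C (int q))"
    unfolding \<psi>(2) \<delta> by (simp add: carrier_singular_cochains singular_chain_add chain_boundary_add \<psi>a bdq)
   then have "\<phi> \<in> ?Z" unfolding Z using dd \<psi>0 bd by (simp add: \<psi>(2) \<delta>)
   moreover have "\<phi> z = 0" using zc \<psi>0 by (simp add: \<psi>(2) \<delta>)
   ultimately show "\<phi> \<in> {\<phi> \<in> ?Z. ?l \<phi> = 0}" by (simp only: mem_Collect_eq)
  next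
   fix \<phi> assume "\<phi> \<in> {\<phi> \<in> ?Z. ?l \<phi> = 0}"
   then have \<phi>: "\<phi> \<in> ?Z" "\<phi> z = 0" by auto
   have \<phi>C: "\<phi> \<in> carrier (?C (int q))" using \<phi> by simp
   from cochain_total[OF this] obtain G where G':
    "(\<forall>x y. G (x + y) = G x + G y) \<and> (\<forall>x\<in>singular_chain_set q X. G x = \<phi> x)" ..
   have G: "G (x + y) = G x + G y" "singular_chain q X x \<Longrightarrow> \<phi> x = G x" for x y
    using G' by simp_all
   define B where "B = chain_boundary q ` singular_chain_set q X"
   \<comment> \<open>The primitive on boundaries: the value of the cocycle on any filling. Two
     fillings differ by a cycle, on which the cocycle vanishes.\<close>
   define f where "f x = G (SOME c. singular_chain q X c \<and> chain_boundary q c = x)" for x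
   have f: "f (chain_boundary q c) = G c" if c: "singular_chain q X c" for c
   proof -
    let ?c = "SOME c'. singular_chain q X c' \<and> chain_boundary q c' = chain_boundary q c"
    have c': "singular_chain q X ?c" "chain_boundary q ?c = chain_boundary q c"
     using someI[of "\<lambda>c'. singular_chain q X c' \<and> chain_boundary q c' = chain_boundary q c" c] c by auto
    have "\<phi> (?c - c) = 0"
     using c c' by (intro vanish[OF \<phi>]) (simp add: singular_cycle chain_boundary_diff singular_chain_diff)
    then have "G (?c - c) = 0" using G(2)[of "?c - c"] c c' by (simp add: singular_chain_diff)
    then show ?thesis unfolding f_def by (simp add: additive_real[OF G(1)])
   qed
   have "\<exists>H. (\<forall>x y. H (x + y) = H x + H y) \<and> (\<forall>x\<in>B. H x = f x)"
   proof (rule additive_extension[of B f])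
    show "f (x + y) = f x + f y" "x + y \<in> B" if xy: "x \<in> B" "y \<in> B" for x y
    proof -
     obtain a b where ab: "singular_chain q X a" "singular_chain q X b"
      "x = chain_boundary q a" "y = chain_boundary q b" using xy unfolding B_def by blast
     then have s: "x + y = chain_boundary q (a + b)" "singular_chain q X (a + b)"
      by (simp_all add: chain_boundary_add singular_chain_add)
     show "x + y \<in> B" using s unfolding B_def by blast
     show "f (x + y) = f x + f y"
      unfolding s(1) f[OF s(2)] unfolding ab(3,4) f[OF ab(1)] f[OF ab(2)] by (rule G)
    qed
    show "0 \<in> B" unfolding B_def by (intro image_eqI[of _ _ 0]) auto
    show "frag_cmul k x \<in> B" if "x \<in> B" for k x
     using that unfolding B_def by (auto simp flip: chain_boundary_cmul intro!: imageI singular_chain_cmul)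
   qed
   then obtain H where H': "(\<forall>x y. H (x + y) = H x + H y) \<and> (\<forall>x\<in>B. H x = f x)" ..
   have H: "H (x + y) = H x + H y" "x \<in> B \<Longrightarrow> H x = f x" for x y using H' by simp_all
   let ?\<psi> = "restrict H (singular_chain_set m X)"
   have "?\<psi> \<in> carrier (?C (int m))" by (simp add: carrier_singular_cochains H singular_chain_add)
   moreover have "\<phi> = ?\<delta> (int q - 1) ?\<psi>"
   proof (rule extensionalityI[of _ "singular_chain_set q X"])
    show "\<phi> \<in> extensional (singular_chain_set q X)" using \<phi>C by (simp add: carrier_singular_cochains)
    show "\<phi> x = ?\<delta> (int q - 1) ?\<psi> x" if "x \<in> singular_chain_set q X" for x
     using that f[of x] H(2)[of "chain_boundary q x"] G(2)[of x] bdq[of x] by (auto simp: \<delta> B_def)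
   qed (simp add: \<delta>)
   ultimately show "\<phi> \<in> ?\<delta> (int q - 1) ` carrier (?C (int q - 1))" unfolding nm by blast
  qed
 qed
 show ?thesis
  unfolding singular_cohomology_def
  by (rule real_range_cohomology[OF _ _ l B lz, where \<kappa> = "cochain_coords X q"])
   (use real_coordinates_cochains[of X "int q"] in simp_all)
qed

text \<open>For negative \<open>p\<close> the truncation \<open>nat p\<close> is 0, so the cochains
  live on 0-chains, where the clause for negative degrees leaves only the zero functional.\<close>

lemma real_range_singular_cohomology_neg:
 assumes "p < 0"
 shows "real_range (singular_cohomology X p) {0}"
proof -
 let ?C = "singular_cochains X" and ?\<delta> = "singular_coboundary X"
 let ?zero = "\<lambda>x\<in>singular_chain_set 0 X. 0::real"
 let ?Z = "{\<phi> \<in> carrier (?C p). ?\<delta> p \<phi> = \<zero>\<^bsub>?C (p + 1)\<^esub>}"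
 have carr: "carrier (?C p) = {?zero}" if "p < 0" for p
 proof (intro equalityI subsetI)
  fix \<phi> assume \<phi>: "\<phi> \<in> carrier (?C p)"
  have "\<phi> = ?zero"
   by (rule extensionalityI[of _ "singular_chain_set 0 X"])
    (use \<phi> that in \<open>auto simp: singular_cochains_def Let_def\<close>)
  then show "\<phi> \<in> {?zero}" by simp
 qed (use that in \<open>auto simp: singular_cochains_def Let_def singular_chain_add\<close>)
 have \<delta>: "?\<delta> p ?zero = ?zero" if "p < 0" for p
  using that by (auto simp: singular_coboundary_def chain_boundary_def fun_eq_iff)
 have z1: "\<zero>\<^bsub>?C (p + 1)\<^esub> = ?zero" using assms by (simp add: singular_cochains_ops)
 have Z: "?Z = {?zero}" using carr[OF assms] \<delta>[OF assms] z1 by auto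
 show ?thesis
  unfolding singular_cohomology_def
 proof (rule real_range_cohomology[where \<kappa> = "cochain_coords X (nat p)" and l = "\<lambda>_. 0"])
  show "real_coordinates ((?C p)\<lparr>carrier := ?Z\<rparr>) (\<lambda>x (k::unit). 0)"
   unfolding Z real_coordinates_def using assms by (auto simp: singular_cochains_ops fun_eq_iff)
  show "?\<delta> (p - 1) ` carrier (?C (p - 1)) = {x \<in> ?Z. (0::real) = 0}"
   unfolding Z using carr[of "p - 1"] \<delta>[of "p - 1"] assms by simp
  show "(\<lambda>_. 0) ` ?Z = {0::real}" unfolding Z by simp
 qed (rule real_coordinates_cochains)+
qed

text \<open>The factor \<open>k\<close> allows torsion, which makes the notion applicable to
  projective space: each cycle is a multiple of \<open>z\<close> only after multiplication by a
  nonzero integer.\<close>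

definition sphere_like :: "'a topology \<Rightarrow> nat \<Rightarrow> bool" where
 "sphere_like X n \<longleftrightarrow> (\<forall>q. \<exists>z. zcycle q X z \<and>
   (\<forall>c. zcycle q X c \<longrightarrow>
    (\<exists>k l. k \<noteq> 0 \<and> zboundary q X (frag_cmul k c - frag_cmul l z))) \<and>
   (if q = 0 \<or> q = n then \<forall>k. zboundary q X (frag_cmul k z) \<longrightarrow> k = 0 else z = 0))"

lemma real_range_sphere_like:
 assumes "sphere_like X n"
 shows "real_range (singular_cohomology X p) (if p = 0 \<or> p = int n then UNIV else {0})"
proof (cases "p < 0")
 case True
 then show ?thesis using real_range_singular_cohomology_neg by auto
next
 case False
 then obtain q where q: "p = int q" by (metis nat_eq_iff2 not_le)
 obtain z where z: "zcycle q X z \<and> (\<forall>c. zcycle q X c \<longrightarrow>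
    (\<exists>k l. k \<noteq> 0 \<and> zboundary q X (frag_cmul k c - frag_cmul l z))) \<and>
   (if q = 0 \<or> q = n then \<forall>k. zboundary q X (frag_cmul k z) \<longrightarrow> k = 0 else z = 0)"
  using spec[OF assms[unfolded sphere_like_def], of q] ..
 show ?thesis
  unfolding q
 proof (rule real_range_singular_cohomology)
  show "zcycle q X z" using z by (rule conjunct1)
  show "\<exists>k l. k \<noteq> 0 \<and> zboundary q X (frag_cmul k c - frag_cmul l z)"
   if "zcycle q X c" for c
   using conjunct1[OF conjunct2[OF z]] that by blast
  show "(if int q = 0 \<or> int q = int n then UNIV else {0::real}) = UNIV \<and>
    (\<forall>k. zboundary q X (frag_cmul k z) \<longrightarrow> k = 0)
   \<or> (if int q = 0 \<or> int q = int n then UNIV else {0::real}) = {0} \<and> z = 0"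
   using conjunct2[OF conjunct2[OF z]] by (cases "q = 0 \<or> q = n") simp_all
 qed
qed

section \<open>From homology groups to cycles and boundaries\<close>

lemma homology_class_eq_one:
 assumes "zcycle q X c"
 shows "homologous_rel_set q X {} c = \<one>\<^bsub>homology_group (int q) X\<^esub> \<longleftrightarrow> zboundary q X c"
proof -
 have "singular_relboundary_set q X {} = homologous_rel_set q X {} 0"
  by (auto simp: homologous_rel_def singular_relboundary_minus)
 then show ?thesis
  by (simp add: homologous_rel_set_eq) (simp add: homologous_rel_def)
qed

lemma homology_class_add:
 assumes "zcycle q X c" "zcycle q X d"
 shows "homologous_rel_set q X {} (c + d)
  = homologous_rel_set q X {} c \<otimes>\<^bsub>homology_group (int q) X\<^esub> homologous_rel_set q X {} d"
proof (intro equalityI subsetI)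
 fix x assume "x \<in> homologous_rel_set q X {} (c + d)"
 then have "zboundary q X (c + d - x)" by (simp add: homologous_rel_def)
 then have "homologous_rel q X {} d (x - c)" by (simp add: homologous_rel_def algebra_simps)
 moreover have "x = c + (x - c)" by simp
 ultimately show "x \<in> homologous_rel_set q X {} c \<otimes>\<^bsub>homology_group (int q) X\<^esub> homologous_rel_set q X {} d"
  unfolding mult_relative_homology_group using homologous_rel_refl[of q X "{}" c] by blast
next
 fix x assume "x \<in> homologous_rel_set q X {} c \<otimes>\<^bsub>homology_group (int q) X\<^esub> homologous_rel_set q X {} d"
 then obtain r s where "homologous_rel q X {} c r" "homologous_rel q X {} d s" "x = r + s"
  unfolding mult_relative_homology_group by blast
 then show "x \<in> homologous_rel_set q X {} (c + d)" by (simp add: homologous_rel_add)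
qed

lemma sphere_like_cycle_trivial:
 assumes "trivial_group (homology_group (int q) X)" "zcycle q X c"
 shows "zboundary q X c"
proof -
 have "homologous_rel_set q X {} c \<in> carrier (homology_group (int q) X)"
  using assms(2) by (auto simp: carrier_relative_homology_group)
 then have "homologous_rel_set q X {} c = \<one>\<^bsub>homology_group (int q) X\<^esub>"
  using assms(1) by (auto simp: trivial_group_def)
 then show ?thesis using homology_class_eq_one[OF assms(2)] by simp
qed

text \<open>A cycle representing a generator serves as \<open>z\<close>; the isomorphism composed
  with the class map is additive on cycles and vanishes exactly on boundaries, so it measures the
  multiple of \<open>z\<close>.\<close>

lemma sphere_like_cycle_integer:
 assumes "homology_group (int q) X \<cong> integer_group"
 obtains z where "zcycle q X z"
  "\<And>c. zcycle q X c \<Longrightarrow> \<exists>l. zboundary q X (c - frag_cmul l z)"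
  "\<And>k. zboundary q X (frag_cmul k z) \<Longrightarrow> k = 0"
proof -
 let ?G = "homology_group (int q) X"
 obtain h where h: "h \<in> iso ?G integer_group" using assms by (auto simp: is_iso_def)
 have hh: "h (x \<otimes>\<^bsub>?G\<^esub> y) = h x + h y" if "x \<in> carrier ?G" "y \<in> carrier ?G" for x y
  using h that by (auto simp: iso_def hom_def)
 have bij: "bij_betw h (carrier ?G) UNIV" using h by (auto simp: iso_def)
 have cls: "homologous_rel_set q X {} c \<in> carrier ?G" if "zcycle q X c" for c
  using that by (auto simp: carrier_relative_homology_group)
 interpret G: group ?G by (rule group_relative_homology_group)
 have h1: "h \<one>\<^bsub>?G\<^esub> = 0" using hh[OF G.one_closed G.one_closed] G.l_one[OF G.one_closed]
  by (simp del: one_relative_homology_group)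
 define \<eta> where "\<eta> c = h (homologous_rel_set q X {} c)" for c
 have add: "\<eta> (c + d) = \<eta> c + \<eta> d" if "zcycle q X c" "zcycle q X d" for c d
  unfolding \<eta>_def homology_class_add[OF that] by (rule hh[OF cls cls]) fact+
 have cm: "\<eta> (frag_cmul k c) = k * \<eta> c" if "zcycle q X c" for k c
  using additive_frag_cmul[where f = \<eta> and B = "singular_relcycle_set q X {}" and x = c and k = k] that
  by (simp add: add singular_relcycle_cmul)
 have ker: "\<eta> c = 0 \<longleftrightarrow> zboundary q X c" if c: "zcycle q X c" for c
 proof -
  have "\<eta> c = 0 \<longleftrightarrow> homologous_rel_set q X {} c = \<one>\<^bsub>?G\<^esub>"
   unfolding \<eta>_def using inj_onD[OF bij_betw_imp_inj_on[OF bij], of _ "\<one>\<^bsub>?G\<^esub>"] cls[OF c] h1 G.one_closed by metis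
  then show ?thesis using homology_class_eq_one[OF c] by simp
 qed
 have "1 \<in> h ` carrier ?G" using bij by (auto simp: bij_betw_def)
 then obtain z where z: "zcycle q X z" "\<eta> z = 1"
  unfolding carrier_relative_homology_group \<eta>_def by force
 show ?thesis
 proof
  show "zcycle q X z" by (rule z)
  show "\<exists>l. zboundary q X (c - frag_cmul l z)" if c: "zcycle q X c" for c
  proof -
   have e: "c - frag_cmul (\<eta> c) z = c + frag_cmul (- \<eta> c) z"
    by (metis add.right_inverse diff_conv_add_uminus frag_cmul_distrib frag_cmul_zero neg_eq_iff_add_eq_0)
   have "\<eta> (c + frag_cmul (- \<eta> c) z) = 0"
    using c z by (simp add: add singular_relcycle_cmul cm)
   then have "zboundary q X (c + frag_cmul (- \<eta> c) z)"
    using c z by (subst ker[symmetric]) (auto intro: singular_relcycle_add singular_relcycle_cmul)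
   then show ?thesis unfolding e[symmetric] ..
  qed
  show "k = 0" if "zboundary q X (frag_cmul k z)" for k
   using that ker[of "frag_cmul k z"] z by (simp add: cm singular_relcycle_cmul)
 qed
qed

section \<open>Spheres and projective spaces\<close>

definition antipode :: "(nat \<Rightarrow> real) \<Rightarrow> nat \<Rightarrow> real" where
 "antipode x = (\<lambda>i. - x i)"

text \<open>Multiplication by the imaginary unit on pairs of coordinates
  \<open>(2 k, 2 k + 1)\<close>; for odd \<open>n\<close> all coordinates up to \<open>n\<close> are
  paired.\<close>

definition turn :: "nat \<Rightarrow> (nat \<Rightarrow> real) \<Rightarrow> nat \<Rightarrow> real" where
 "turn n x i = (if i > n then 0 else if even i then - x (i + 1) else x (i - 1))"

text \<open>Multiplication by the unit complex number of angle \<open>pi * t\<close>: the identity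
  at 0, the antipode at 1.\<close>

definition rotation :: "nat \<Rightarrow> real \<Rightarrow> (nat \<Rightarrow> real) \<Rightarrow> nat \<Rightarrow> real" where
 "rotation n t x i = cos (pi * t) * x i + sin (pi * t) * turn n x i"

lemma topspace_nsphere: "x \<in> topspace (nsphere n) \<longleftrightarrow> (\<Sum>i\<le>n. (x i)\<^sup>2) = 1 \<and> (\<forall>i>n. x i = 0)"
 by (simp add: nsphere)

lemma sum_pairs:
 fixes g :: "nat \<Rightarrow> real"
 assumes "odd n"
 shows "(\<Sum>i\<le>n. g i) = (\<Sum>k\<le>n div 2. g (2 * k) + g (2 * k + 1))"
proof -
 have "(\<Sum>i\<le>2 * m + 1. g i) = (\<Sum>k\<le>m. g (2 * k) + g (2 * k + 1))" for m
  by (induction m) simp_all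
 moreover obtain m where "n = 2 * m + 1" using assms by (auto elim: oddE)
 ultimately show ?thesis by simp
qed

text \<open>The vectors \<open>x\<close> and \<open>turn n x\<close> are orthogonal and of equal
  norm, so the mixed term drops out.\<close>

lemma rotation_sphere:
 assumes n: "odd n" and x: "x \<in> topspace (nsphere n)"
 shows "rotation n t x \<in> topspace (nsphere n)"
proof -
 have le: "2 * k + 1 \<le> n" if "k \<le> n div 2" for k
  using n that by (auto elim!: oddE)
 have t: "turn n x (2 * k) = - x (2 * k + 1)" "turn n x (2 * k + 1) = x (2 * k)" if "k \<in> {..n div 2}" for k
  using le[of k] that by (auto simp: turn_def)
 have 1: "(\<Sum>i\<le>n. x i * turn n x i) = 0"
  unfolding sum_pairs[OF n]
 proof (intro sum.neutral ballI)
  fix k assume k: "k \<in> {..n div 2}"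
  show "x (2 * k) * turn n x (2 * k) + x (2 * k + 1) * turn n x (2 * k + 1) = 0"
   unfolding t[OF k] by simp
 qed
 have 2: "(\<Sum>i\<le>n. (turn n x i)\<^sup>2) = (\<Sum>i\<le>n. (x i)\<^sup>2)"
  unfolding sum_pairs[OF n] by (intro sum.cong refl) (simp only: t, simp)
 have "(\<Sum>i\<le>n. (rotation n t x i)\<^sup>2) = (\<Sum>i\<le>n. (cos (pi * t))\<^sup>2 * (x i)\<^sup>2
   + 2 * cos (pi * t) * sin (pi * t) * (x i * turn n x i) + (sin (pi * t))\<^sup>2 * (turn n x i)\<^sup>2)"
  by (intro sum.cong refl) (simp add: rotation_def power2_eq_square algebra_simps)
 also have "\<dots> = (cos (pi * t))\<^sup>2 * (\<Sum>i\<le>n. (x i)\<^sup>2)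
   + 2 * cos (pi * t) * sin (pi * t) * (\<Sum>i\<le>n. x i * turn n x i) + (sin (pi * t))\<^sup>2 * (\<Sum>i\<le>n. (turn n x i)\<^sup>2)"
  by (simp only: sum.distrib sum_distrib_left)
 also have "\<dots> = 1" using x unfolding 1 2 by (simp add: topspace_nsphere)
 finally show ?thesis using x by (simp add: topspace_nsphere rotation_def turn_def)
qed

lemma continuous_map_rotation:
 assumes n: "odd n"
 shows "continuous_map (prod_topology (top_of_set {0..1}) (nsphere n)) (nsphere n)
  (\<lambda>z. rotation n (fst z) (snd z))"
proof -
 let ?P = "prod_topology (top_of_set {0..1::real}) (nsphere n)"
 have f: "continuous_map ?P euclideanreal (\<lambda>z. g (fst z))" if "continuous_on {0..1} g" for g
 proof -
  have "continuous_map ?P euclideanreal (g \<circ> fst)"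
   by (rule continuous_map_compose[OF continuous_map_fst]) (simp add: that)
  then show ?thesis by (simp add: o_def)
 qed
 have s: "continuous_map ?P euclideanreal (\<lambda>z. snd z i)" for i
 proof -
  have "continuous_map ?P euclideanreal ((\<lambda>x. x i) \<circ> snd)"
   by (rule continuous_map_compose[OF continuous_map_snd]) (rule continuous_map_nsphere_projection)
  then show ?thesis by (simp add: o_def)
 qed
 have t: "continuous_map ?P euclideanreal (\<lambda>z. turn n (snd z) i)" for i
  unfolding turn_def by (cases "i > n"; cases "even i") (simp_all add: s continuous_map_minus)
 have "continuous_map ?P euclideanreal (\<lambda>z. rotation n (fst z) (snd z) i)" for i
  unfolding rotation_def
  by (intro continuous_map_add continuous_map_real_mult s t f continuous_intros)
 moreover have "rotation n (fst z) (snd z) \<in> topspace (nsphere n)" if "z \<in> topspace ?P" for z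
  using that by (intro rotation_sphere[OF n]) (auto simp: mem_Times_iff)
 ultimately show ?thesis
  unfolding nsphere by (auto simp: continuous_map_in_subtopology continuous_map_componentwise_UNIV nsphere)
qed

text \<open>The side condition on maps is vacuous; it has the shape that homotopy invariance of
  homology takes relative to the empty subspace.\<close>

lemma antipode_homotopic:
 assumes n: "odd n"
 shows "homotopic_with (\<lambda>h. h \<in> {} \<rightarrow> {}) (nsphere n) (nsphere n) id antipode"
 unfolding homotopic_with_def
proof (intro exI conjI)
 show "continuous_map (prod_topology (top_of_set {0..1}) (nsphere n)) (nsphere n)
  (\<lambda>z. rotation n (fst z) (snd z))" by (rule continuous_map_rotation[OF n])
qed (auto simp: rotation_def antipode_def)

text \<open>Two points that are not antipodal are joined by the normalised segment; antipodal ones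
  by the half turn.\<close>

lemma path_connected_nsphere:
 assumes n: "odd n"
 shows "path_connected_space (nsphere n)"
 unfolding path_connected_space_def
proof (intro ballI)
 fix x y assume x: "x \<in> topspace (nsphere n)" and y: "y \<in> topspace (nsphere n)"
 have path: "pathin (nsphere n) g" if "\<And>i. continuous_on {0..1} (\<lambda>t. g t i)"
  "\<And>t. t \<in> {0..1} \<Longrightarrow> g t \<in> topspace (nsphere n)" for g
  using that unfolding pathin_def nsphere
  by (auto simp: continuous_map_in_subtopology continuous_map_componentwise_UNIV nsphere)
 show "\<exists>g. pathin (nsphere n) g \<and> g 0 = x \<and> g 1 = y"
 proof (cases "y = antipode x")
  case True
  have "pathin (nsphere n) (\<lambda>t. rotation n t x)"
  proof (rule path)
   show "continuous_on {0..1} (\<lambda>t. rotation n t x i)" for i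
    unfolding rotation_def by (intro continuous_intros)
  qed (rule rotation_sphere[OF n x])
  moreover have "rotation n 0 x = x" "rotation n 1 x = y"
   by (auto simp: True rotation_def antipode_def)
  ultimately show ?thesis by blast
 next
  case False
  define v where "v t i = (1 - t) * x i + t * y i" for t i
  define D where "D t = (\<Sum>i\<le>n. (v t i)\<^sup>2)" for t
  define g where "g t i = v t i / sqrt (D t)" for t i
  have Dpos: "D t > 0" for t
  proof -
   have "D t \<noteq> 0"
   proof
    assume "D t = 0"
    then have v0: "v t i = 0" if "i \<le> n" for i
     using that by (simp add: D_def sum_nonneg_eq_0_iff)
    then have e: "(1 - t)\<^sup>2 * (x i)\<^sup>2 = t\<^sup>2 * (y i)\<^sup>2" if "i \<le> n" for i
    proof -
     have "(1 - t) * x i = - (t * y i)" using v0[OF that] by (simp add: v_def)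
     then have "((1 - t) * x i)\<^sup>2 = (t * y i)\<^sup>2" by simp
     then show ?thesis by (simp add: power_mult_distrib)
    qed
    have "(1 - t)\<^sup>2 * (\<Sum>i\<le>n. (x i)\<^sup>2) = t\<^sup>2 * (\<Sum>i\<le>n. (y i)\<^sup>2)"
     unfolding sum_distrib_left by (intro sum.cong refl e) simp
    \<comment> \<open>Both points have norm 1, so a zero of the segment requires
      \<open>1 - t\<close> and \<open>t\<close> to have the same square; the zero then makes the
      points antipodal, which is excluded.\<close>
    then have "t = 1 / 2" using x y by (simp add: topspace_nsphere power2_eq_square algebra_simps)
    then have "(1 - 1/2) * x i + 1/2 * y i = 0" if "i \<le> n" for i
     using v0[OF that] by (simp only: v_def)
    then have "y i = - x i" if "i \<le> n" for i using that by fastforce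
    then have "y i = - x i" for i
     using x y by (cases "i \<le> n") (auto simp: topspace_nsphere)
    then show False using False by (auto simp: antipode_def)
   qed
   moreover have "D t \<ge> 0" by (simp add: D_def sum_nonneg)
   ultimately show ?thesis by simp
  qed
  have "pathin (nsphere n) g"
  proof (rule path)
   show "continuous_on {0..1} (\<lambda>t. g t i)" for i
    unfolding g_def v_def D_def using Dpos unfolding v_def D_def
    by (intro continuous_intros) (simp add: less_imp_neq[symmetric])
   fix t
   have "(\<Sum>i\<le>n. (g t i)\<^sup>2) = D t / D t"
    using Dpos[of t] by (simp add: g_def power_divide D_def flip: sum_divide_distrib)
   then have "(\<Sum>i\<le>n. (g t i)\<^sup>2) = 1" using Dpos[of t] by simp
   then show "g t \<in> topspace (nsphere n)"
    using x y by (simp add: topspace_nsphere g_def v_def)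
  qed
  moreover have "g 0 = x" "g 1 = y" using x y by (auto simp: g_def v_def D_def topspace_nsphere)
  ultimately show ?thesis by blast
 qed
qed

lemma sphere_like_nsphere:
 assumes n: "odd n"
 shows "sphere_like (nsphere n) n"
 unfolding sphere_like_def
proof
 fix q
 have n0: "n \<noteq> 0" using n by (cases n) auto
 show "\<exists>z. singular_relcycle q (nsphere n) {} z \<and>
   (\<forall>c. singular_relcycle q (nsphere n) {} c \<longrightarrow>
    (\<exists>k l. k \<noteq> 0 \<and> singular_relboundary q (nsphere n) {} (frag_cmul k c - frag_cmul l z))) \<and>
   (if q = 0 \<or> q = n then \<forall>k. singular_relboundary q (nsphere n) {} (frag_cmul k z) \<longrightarrow> k = 0 else z = 0)"
 proof (cases "q = 0 \<or> q = n")
  case True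
  have "homology_group (int q) (nsphere n) \<cong> integer_group"
  proof (cases "q = 0")
   case True
   have "topspace (nsphere n) \<noteq> {}" using in_topspace_nsphere by blast
   from isomorphic_integer_zeroth_homology_group[OF path_connected_nsphere[OF n] this] True show ?thesis by simp
  next
   case False
   then have "q = n" using \<open>q = 0 \<or> q = n\<close> by simp
   then show ?thesis using reduced_homology_group_nsphere(1)[of n] n0 by (simp add: un_reduced_homology_group)
  qed
  then show ?thesis
  proof (rule sphere_like_cycle_integer)
   fix z assume z: "singular_relcycle q (nsphere n) {} z"
    "\<And>c. singular_relcycle q (nsphere n) {} c \<Longrightarrow> \<exists>l. singular_relboundary q (nsphere n) {} (c - frag_cmul l z)"
    "\<And>k. singular_relboundary q (nsphere n) {} (frag_cmul k z) \<Longrightarrow> k = 0"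
  show ?thesis
  proof (intro exI[of _ z] conjI allI impI)
   fix c assume "singular_relcycle q (nsphere n) {} c"
   then obtain l where "singular_relboundary q (nsphere n) {} (c - frag_cmul l z)" using z(2) by blast
   then have "(1::int) \<noteq> 0 \<and> singular_relboundary q (nsphere n) {} (frag_cmul 1 c - frag_cmul l z)" by simp
   then show "\<exists>k l. k \<noteq> 0 \<and> singular_relboundary q (nsphere n) {} (frag_cmul k c - frag_cmul l z)" by blast
  qed (use z True in simp_all)
  qed
 next
  case False
  have "trivial_group (homology_group (int q) (nsphere n))"
   using False reduced_homology_group_nsphere(2)[of "int q" n] by (simp add: un_reduced_homology_group)
  then have "singular_relboundary q (nsphere n) {} c" if "singular_relcycle q (nsphere n) {} c" for c
   using that sphere_like_cycle_trivial by blast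
  then have b: "(1::int) \<noteq> 0 \<and> singular_relboundary q (nsphere n) {} (frag_cmul 1 c - frag_cmul 0 0)"
   if "singular_relcycle q (nsphere n) {} c" for c
   using that by simp
  show ?thesis
  proof (rule exI[of _ 0], intro conjI allI impI)
   fix c assume c: "singular_relcycle q (nsphere n) {} c"
   show "\<exists>k l. k \<noteq> 0 \<and> singular_relboundary q (nsphere n) {} (frag_cmul k c - frag_cmul l 0)"
    by (rule exI[of _ 1], rule exI[of _ 0], rule b[OF c])
  qed (use False in simp_all)
 qed
qed

section \<open>The double cover of projective space\<close>

lemma antipodal_class_eq: "antipodal_class x = antipodal_class y \<longleftrightarrow> x = y \<or> x = antipode y"
proof -
 have "(\<lambda>i. - (- y i)) = y" by simp
 then show ?thesis
  unfolding antipodal_class_def antipode_def by (auto simp: doubleton_eq_iff fun_eq_iff)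
qed

lemma antipodal_class_antipode: "antipodal_class \<circ> antipode = antipodal_class"
 by (rule ext) (simp add: antipodal_class_eq)

lemma continuous_map_antipode: "continuous_map (nsphere n) (nsphere n) antipode"
proof -
 have "continuous_map (nsphere n) euclideanreal (\<lambda>x. antipode x i)" for i
  unfolding antipode_def by (intro continuous_map_minus continuous_map_nsphere_projection)
 moreover have "antipode x \<in> topspace (nsphere n)" if "x \<in> topspace (nsphere n)" for x
  using that by (simp add: topspace_nsphere antipode_def)
 ultimately show ?thesis
  by (subst (2) nsphere)
   (auto simp: continuous_map_in_subtopology continuous_map_componentwise_UNIV topspace_nsphere)
qed

lemma topspace_projective_space: "topspace (projective_space n) = antipodal_class ` topspace (nsphere n)"
 using quotient_imp_surjective_map[OF quotient_map_antipodal_class] by simp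

text \<open>The entries of the projector onto the line spanned by a point are continuous on projective space.\<close>

definition line_entry :: "nat \<Rightarrow> nat \<Rightarrow> (nat \<Rightarrow> real) set \<Rightarrow> real" where
 "line_entry i j A = (SOME x. x \<in> A) i * (SOME x. x \<in> A) j"

lemma line_entry: "line_entry i j (antipodal_class x) = x i * x j"
proof -
 have "(SOME y. y \<in> antipodal_class x) \<in> antipodal_class x"
  by (rule someI[of _ x]) (simp add: antipodal_class_def)
 then have "(SOME y. y \<in> antipodal_class x) = x \<or> (SOME y. y \<in> antipodal_class x) = (\<lambda>i. - x i)"
  by (simp add: antipodal_class_def)
 then show ?thesis unfolding line_entry_def by (elim disjE) simp_all
qed

lemma continuous_map_line_entry: "continuous_map (projective_space n) euclideanreal (line_entry i j)"
proof (rule continuous_compose_quotient_map[OF quotient_map_antipodal_class])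
 have "line_entry i j \<circ> antipodal_class = (\<lambda>x. x i * x j)" by (auto simp: line_entry)
 then show "continuous_map (nsphere n) euclideanreal (line_entry i j \<circ> antipodal_class)"
  by (simp add: continuous_map_real_mult continuous_map_nsphere_projection)
qed

lemma singular_simplex_nsphereI:
 assumes "\<And>i. continuous_on (standard_simplex p) (\<lambda>t. F t i)"
  and "\<And>t. t \<in> standard_simplex p \<Longrightarrow> F t \<in> topspace (nsphere n)"
 shows "singular_simplex p (nsphere n) (restrict F (standard_simplex p))"
proof -
 have "continuous_map (top_of_set (standard_simplex p)) (nsphere n) F"
  using assms unfolding nsphere
  by (auto simp: continuous_map_in_subtopology continuous_map_componentwise_UNIV nsphere)
 then have "continuous_map (top_of_set (standard_simplex p)) (nsphere n) (restrict F (standard_simplex p))"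
  by (rule continuous_map_eq) auto
 then show ?thesis by (simp add: singular_simplex_def euclidean_product_topology)
qed

lemma singular_simplex_nsphereD:
 assumes "singular_simplex p (nsphere n) F"
 shows "continuous_on (standard_simplex p) (\<lambda>t. F t i)"
  "t \<in> standard_simplex p \<Longrightarrow> F t \<in> topspace (nsphere n)" "F \<in> extensional (standard_simplex p)"
proof -
 have F: "continuous_map (top_of_set (standard_simplex p)) (nsphere n) F" "F \<in> extensional (standard_simplex p)"
  using assms by (simp_all add: singular_simplex_def euclidean_product_topology)
 show "continuous_on (standard_simplex p) (\<lambda>t. F t i)"
  using continuous_map_compose[OF F(1) continuous_map_nsphere_projection[of n i]] by (simp add: o_def)
 show "t \<in> standard_simplex p \<Longrightarrow> F t \<in> topspace (nsphere n)"
  using continuous_map_image_subset_topspace[OF F(1)] by auto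
 show "F \<in> extensional (standard_simplex p)" by (rule F)
qed

text \<open>
 A singular simplex of projective space lifts along its contraction to a vertex: in small steps,
 the next lift is the representative that has positive inner product with the previous one.
\<close>

lemma projective_lift:
 assumes \<sigma>: "singular_simplex p (projective_space n) \<sigma>"
 shows "\<exists>F. singular_simplex p (nsphere n) F \<and> simplex_map p antipodal_class F = \<sigma>"
proof -
 let ?S = "standard_simplex p"
 have c\<sigma>: "continuous_map (top_of_set ?S) (projective_space n) \<sigma>" and ext: "\<sigma> \<in> extensional ?S"
  using \<sigma> by (simp_all add: singular_simplex_def euclidean_product_topology)
 have pm: "continuous_on ?S (\<lambda>t. line_entry i j (\<sigma> t))" for i j
  using continuous_map_compose[OF c\<sigma> continuous_map_line_entry[of n i j]] by (simp add: o_def)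
 have rep: "\<exists>x\<in>topspace (nsphere n). \<sigma> t = antipodal_class x" if "t \<in> ?S" for t
  using continuous_map_image_subset_topspace[OF c\<sigma>] that by (auto simp: topspace_projective_space)
 have cS: "compact ?S"
  using compactin_standard_simplex[of p] by (simp add: euclidean_product_topology)
 define c where "c = (\<lambda>j::nat. if j = 0 then 1 else (0::real))"
 have c: "c \<in> ?S" unfolding c_def by simp
 \<comment> \<open>The contraction of the simplex to its vertex \<open>c\<close>, with
   \<open>u\<close> as time: constant at 0, the identity at 1.\<close>
 define w where "w u t = (\<lambda>k. (1 - u) * c k + u * t k)" for u t
 have w: "w u t \<in> ?S" if "u \<in> {0..1}" "t \<in> ?S" for u t
  unfolding w_def using convex_standard_simplex[OF c] that by simp
 have w1: "w 1 t = t" for t by (simp add: w_def)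
 have cw: "continuous_on ({0..1} \<times> ?S) (\<lambda>z. w (fst z) (snd z))"
  unfolding w_def
  by (intro continuous_on_coordinatewise_then_product continuous_intros
    continuous_on_product_then_coordinatewise[OF continuous_on_snd[OF continuous_on_id]])
 define G where "G i j u t = line_entry i j (\<sigma> (w u t))" for i j u t
 have cG: "continuous_on ({0..1} \<times> ?S) (\<lambda>z. G i j (fst z) (snd z))" for i j
  unfolding G_def by (rule continuous_on_compose2[OF pm cw]) (auto intro: w)
 \<comment> \<open>The trace of the product of two line projectors, which is the squared inner
   product of any representatives. It is thus available before lifts are chosen.\<close>
 define E where "E = (\<lambda>((u, v), t). \<Sum>i\<le>n. \<Sum>j\<le>n. G i j u t * G i j v t)"
 let ?K = "({0..1::real} \<times> {0..1::real}) \<times> ?S"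
 have cE: "continuous_on ?K E"
 proof -
  have "continuous_on ?K (\<lambda>z. (fst (fst z), snd z))" "(\<lambda>z. (fst (fst z), snd z)) ` ?K \<subseteq> {0..1} \<times> ?S"
   by (intro continuous_intros) auto
  from continuous_on_compose2[OF cG this]
  have "continuous_on ?K (\<lambda>z. G i j (fst (fst z)) (snd z))" for i j by simp
  moreover
  have "continuous_on ?K (\<lambda>z. (snd (fst z), snd z))" "(\<lambda>z. (snd (fst z), snd z)) ` ?K \<subseteq> {0..1} \<times> ?S"
   by (intro continuous_intros) auto
  from continuous_on_compose2[OF cG this]
  have "continuous_on ?K (\<lambda>z. G i j (snd (fst z)) (snd z))" for i j by simp
  ultimately show ?thesis
   unfolding E_def case_prod_unfold by (intro continuous_on_sum continuous_on_mult)
 qed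
 have Eval: "E ((u, v), t) = (\<Sum>i\<le>n. x i * y i)\<^sup>2"
  if "\<sigma> (w u t) = antipodal_class x" "\<sigma> (w v t) = antipodal_class y" for u v t x y
  using that by (simp add: E_def G_def line_entry power2_eq_square sum_product ac_simps)
 have "uniformly_continuous_on ?K E"
  using cE cS by (intro compact_uniformly_continuous compact_Times compact_Icc)
 \<comment> \<open>At equal times \<open>E\<close> is 1, so by uniform continuity it stays positive
   over a sufficiently short time step, uniformly in the simplex.\<close>
 then obtain \<delta> where \<delta>: "\<delta> > 0" "\<And>a b. a \<in> ?K \<Longrightarrow> b \<in> ?K \<Longrightarrow> dist b a < \<delta> \<Longrightarrow> dist (E b) (E a) < 1"
  unfolding uniformly_continuous_on_def by (metis zero_less_one)
 obtain m where m: "inverse (real (Suc m)) < \<delta>" using reals_Archimedean[OF \<delta>(1)] by blast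
 let ?M = "real (Suc m)"
 have "\<exists>F. (\<forall>i. continuous_on ?S (\<lambda>t. F t i)) \<and>
   (\<forall>t\<in>?S. F t \<in> topspace (nsphere n) \<and> \<sigma> (w (real k / ?M) t) = antipodal_class (F t))"
  if "k \<le> Suc m" for k
  using that
 proof (induction k)
  case 0
  have "w 0 t = c" for t by (simp add: w_def)
  moreover obtain x where "x \<in> topspace (nsphere n)" "\<sigma> c = antipodal_class x" using rep[OF c] by blast
  ultimately show ?case by (intro exI[of _ "\<lambda>_. x"]) simp
 next
  case (Suc k)
  let ?u = "real k / ?M" and ?v = "real (Suc k) / ?M"
  obtain F where F: "\<And>i. continuous_on ?S (\<lambda>t. F t i)"
   "\<And>t. t \<in> ?S \<Longrightarrow> F t \<in> topspace (nsphere n)"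
   "\<And>t. t \<in> ?S \<Longrightarrow> \<sigma> (w ?u t) = antipodal_class (F t)" using Suc by auto
  have uv: "?u \<in> {0..1}" "?v \<in> {0..1}" using Suc.prems by (simp_all add: divide_le_eq_1)
  have Epos: "E ((?u, ?v), t) > 0" if t: "t \<in> ?S" for t
  proof -
   have "dist ((a, b), t) ((a, a), t) = \<bar>b - a\<bar>" for a b :: real
    by (simp add: dist_Pair_Pair dist_real_def)
   moreover have "\<bar>?v - ?u\<bar> = inverse ?M" by (simp add: field_simps)
   ultimately have "dist ((?u, ?v), t) ((?u, ?u), t) = inverse ?M" by metis
   then have "dist (E ((?u, ?v), t)) (E ((?u, ?u), t)) < 1"
    using uv t m by (intro \<delta>(2)) simp_all
   moreover have "E ((?u, ?u), t) = 1"
    using Eval[OF F(3)[OF t] F(3)[OF t]] F(2)[OF t] by (simp add: topspace_nsphere flip: power2_eq_square)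
   ultimately show ?thesis by (simp add: dist_real_def abs_less_iff)
  qed
  \<comment> \<open>The projector at the new time applied to the old lift, scaled to unit length.
    This formula is continuous and selects the representative with positive inner product.\<close>
  define F' where "F' t i = (if i \<le> n then (\<Sum>j\<le>n. G i j ?v t * F t j) / sqrt (E ((?u, ?v), t)) else 0)" for t i
  have "continuous_on ?S (\<lambda>t. F' t i)" for i
  proof (cases "i \<le> n")
   case True
   have c1: "continuous_on ?S (\<lambda>t. (?v, t))" by (intro continuous_intros)
   have "(\<lambda>t. (?v, t)) ` ?S \<subseteq> {0..1} \<times> ?S" using uv(2) by blast
   from continuous_on_compose2[OF cG c1 this]
   have 1: "continuous_on ?S (\<lambda>t. G i j ?v t)" for j by (simp only: fst_conv snd_conv)
   have c2: "continuous_on ?S (\<lambda>t. ((?u, ?v), t))" by (intro continuous_intros)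
   have "(\<lambda>t. ((?u, ?v), t)) ` ?S \<subseteq> ?K" using uv by blast
   from continuous_on_compose2[OF cE c2 this]
   have 2: "continuous_on ?S (\<lambda>t. E ((?u, ?v), t))" .
   have "continuous_on ?S (\<lambda>t. (\<Sum>j\<le>n. G i j ?v t * F t j) / sqrt (E ((?u, ?v), t)))"
    by (intro continuous_on_divide continuous_on_sum continuous_on_mult continuous_on_real_sqrt 1 2 F(1))
     (use Epos in \<open>simp add: less_imp_neq[symmetric]\<close>)
   then show ?thesis unfolding F'_def using True by simp
  qed (simp add: F'_def)
  moreover have "F' t \<in> topspace (nsphere n) \<and> \<sigma> (w ?v t) = antipodal_class (F' t)" if t: "t \<in> ?S" for t
  proof -
   obtain y where y: "y \<in> topspace (nsphere n)" "\<sigma> (w ?v t) = antipodal_class y"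
    using rep[OF w[OF uv(2) t]] by blast
   define s where "s = (\<Sum>i\<le>n. F t i * y i)"
   have E: "E ((?u, ?v), t) = s\<^sup>2" using Eval[OF F(3)[OF t] y(2)] by (simp add: s_def)
   then have s0: "s \<noteq> 0" using Epos[OF t] by auto
   have "F' t i = y i * (s / \<bar>s\<bar>)" for i
   proof (cases "i \<le> n")
    case True
    have "(\<Sum>j\<le>n. G i j ?v t * F t j) = y i * s"
     unfolding G_def y(2) line_entry s_def sum_distrib_left by (simp only: ac_simps)
    then show ?thesis unfolding F'_def E using True by (simp only: if_True real_sqrt_abs times_divide_eq_right)
   next
    case False
    then show ?thesis using y(1) by (simp add: F'_def topspace_nsphere)
   qed
   then have "F' t = y \<or> F' t = antipode y"
    using s0 by (cases "s > 0") (auto simp: antipode_def fun_eq_iff)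
   moreover have "antipode y \<in> topspace (nsphere n)"
    using y(1) by (simp add: topspace_nsphere antipode_def)
   ultimately show ?thesis using y by (auto simp: antipodal_class_eq antipode_def)
  qed
  ultimately show ?case by (intro exI[of _ F']) simp
 qed
 from this[of "Suc m"] obtain F where F: "\<And>i. continuous_on ?S (\<lambda>t. F t i)"
  "\<And>t. t \<in> ?S \<Longrightarrow> F t \<in> topspace (nsphere n)" "\<And>t. t \<in> ?S \<Longrightarrow> \<sigma> t = antipodal_class (F t)"
  by (auto simp: w1)
 have "simplex_map p antipodal_class (restrict F ?S) = \<sigma>"
  by (rule extensionalityI[OF _ ext]) (simp_all add: simplex_map_def F(3))
 then show ?thesis using singular_simplex_nsphereI[OF F(1,2)] by blast
qed

text \<open>The inner product of two lifts is continuous with values 1 and -1 on a connected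
  simplex, hence constant.\<close>

lemma projective_lift_unique:
 assumes F: "singular_simplex p (nsphere n) F" and F': "singular_simplex p (nsphere n) F'"
  and eq: "simplex_map p antipodal_class F = simplex_map p antipodal_class F'"
 shows "F' = F \<or> F' = simplex_map p antipode F"
proof -
 let ?S = "standard_simplex p"
 note D = singular_simplex_nsphereD[OF F] and D' = singular_simplex_nsphereD[OF F']
 have pt: "F' t = F t \<or> F' t = antipode (F t)" if "t \<in> ?S" for t
  using fun_cong[OF eq, of t] that antipodal_class_eq[of "F' t" "F t"] by (simp add: simplex_map_def)
 define f where "f t = (\<Sum>i\<le>n. F t i * F' t i)" for t
 have f: "F' t = F t \<and> f t = 1 \<or> F' t = antipode (F t) \<and> f t = -1" if t: "t \<in> ?S" for t
  using pt[OF t] D(2)[OF t] by (auto simp: f_def antipode_def topspace_nsphere sum_negf simp flip: power2_eq_square)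
 have "connected ?S"
  using connectedin_standard_simplex[of p] by (simp add: euclidean_product_topology)
 moreover have "continuous_on ?S f" unfolding f_def by (intro continuous_on_sum continuous_on_mult D D')
 moreover have "finite (f ` ?S)" by (rule finite_subset[of _ "{1, -1}"]) (use f in auto)
 ultimately have "f constant_on ?S" by (rule continuous_finite_range_constant)
 then obtain a where a: "\<And>t. t \<in> ?S \<Longrightarrow> f t = a" by (auto simp: constant_on_def)
 show ?thesis
 proof (cases "a = 1")
  case True
  have "F' = F" by (rule extensionalityI[OF D'(3) D(3)]) (use f a True in force)
  then show ?thesis ..
 next
  case False
  have "F' = simplex_map p antipode F"
   by (rule extensionalityI[OF D'(3)]) (use f a False in \<open>force simp: simplex_map_def\<close>)+
  then show ?thesis ..
 qed
qed

section \<open>The transfer of the double cover\<close>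

definition lift_simplex :: "nat \<Rightarrow> nat \<Rightarrow> ((nat \<Rightarrow> real) \<Rightarrow> (nat \<Rightarrow> real) set) \<Rightarrow> (nat \<Rightarrow> real) \<Rightarrow> nat \<Rightarrow> real" where
 "lift_simplex n p \<sigma> = (SOME F. singular_simplex p (nsphere n) F \<and> simplex_map p antipodal_class F = \<sigma>)"

lemma lift_simplex:
 assumes "singular_simplex p (projective_space n) \<sigma>"
 shows "singular_simplex p (nsphere n) (lift_simplex n p \<sigma>)"
  "simplex_map p antipodal_class (lift_simplex n p \<sigma>) = \<sigma>"
 using someI_ex[OF projective_lift[OF assms]] unfolding lift_simplex_def by blast+

definition transfer_chain :: "nat \<Rightarrow> nat \<Rightarrow> (nat \<Rightarrow> real) set chain \<Rightarrow> (nat \<Rightarrow> real) chain" where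
 "transfer_chain n p = frag_extend (\<lambda>\<sigma>. frag_of (lift_simplex n p \<sigma>)
   + frag_of (simplex_map p antipode (lift_simplex n p \<sigma>)))"

lemma continuous_map_antipodal_class: "continuous_map (nsphere n) (projective_space n) antipodal_class"
 by (rule quotient_imp_continuous_map[OF quotient_map_antipodal_class])

text \<open>The chosen lift of a projected simplex is the simplex itself or its antipode, so the sum
  over both lifts does not depend on the choice.\<close>

lemma transfer_chain_map:
 assumes "singular_chain p (nsphere n) d"
 shows "transfer_chain n p (chain_map p antipodal_class d) = d + chain_map p antipode d"
 using assms[unfolded singular_chain_def]
proof (induction d rule: frag_induction)
 case zero
 show ?case by (simp add: transfer_chain_def)
next
 case (one F)
 let ?F = "lift_simplex n p (simplex_map p antipodal_class F)"
 have F: "singular_simplex p (nsphere n) F" using one by simp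
 have "singular_simplex p (projective_space n) (simplex_map p antipodal_class F)"
  by (rule singular_simplex_simplex_map[OF F continuous_map_antipodal_class])
 note L = lift_simplex[OF this]
 have "simplex_map p antipode (simplex_map p antipode F) = F"
  by (rule extensionalityI[OF _ singular_simplex_nsphereD(3)[OF F]])
   (simp_all add: simplex_map_def antipode_def)
 moreover have "?F = F \<or> ?F = simplex_map p antipode F"
  using projective_lift_unique[OF F L(1)] L(2) by simp
 ultimately show ?case by (auto simp: transfer_chain_def add.commute)
next
 case (diff a b)
 then show ?case by (simp add: transfer_chain_def chain_map_diff frag_extend_diff)
qed

lemma lift_chain:
 assumes "singular_chain p (projective_space n) c"
 shows "\<exists>d. singular_chain p (nsphere n) d \<and> chain_map p antipodal_class d = c"
 using assms[unfolded singular_chain_def]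
proof (induction c rule: frag_induction)
 case zero
 show ?case by (intro exI[of _ 0]) simp
next
 case (one \<sigma>)
 then show ?case using lift_simplex[of p n \<sigma>]
  by (intro exI[of _ "frag_of (lift_simplex n p \<sigma>)"]) (simp add: singular_chain_of)
next
 case (diff a b)
 then show ?case by (metis chain_map_diff singular_chain_diff)
qed

text \<open>Every chain is the projection of some \<open>d\<close>, and the transfer of a projection
  is \<open>d\<close> plus its antipode. All three claims are then properties of chain maps.\<close>

lemma transfer_chain:
 assumes c: "singular_chain p (projective_space n) c"
 shows "singular_chain p (nsphere n) (transfer_chain n p c)"
  "chain_map p antipodal_class (transfer_chain n p c) = frag_cmul 2 c"
  "chain_boundary p (transfer_chain n p c) = transfer_chain n (p - Suc 0) (chain_boundary p c)"
proof -
 obtain d where d: "singular_chain p (nsphere n) d" "chain_map p antipodal_class d = c"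
  using lift_chain[OF c] by blast
 note t = transfer_chain_map[OF d(1), unfolded d(2)]
 show "singular_chain p (nsphere n) (transfer_chain n p c)"
  unfolding t by (intro singular_chain_add d(1) singular_chain_chain_map[OF d(1) continuous_map_antipode])
 have "chain_map p antipodal_class (chain_map p antipode d) = c"
  using chain_map_compose[of p antipodal_class antipode] d(2) unfolding antipodal_class_antipode
  by (simp add: fun_eq_iff)
 then show "chain_map p antipodal_class (transfer_chain n p c) = frag_cmul 2 c"
  unfolding t using frag_cmul_distrib[of 1 1 c] by (simp add: chain_map_add d(2))
 have "chain_boundary p c = chain_map (p - Suc 0) antipodal_class (chain_boundary p d)"
  using chain_boundary_chain_map[OF d(1), of antipodal_class] d(2) by simp
 then show "chain_boundary p (transfer_chain n p c) = transfer_chain n (p - Suc 0) (chain_boundary p c)"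
  using transfer_chain_map[OF singular_chain_boundary[OF d(1)]]
  unfolding t by (simp add: chain_boundary_add chain_boundary_chain_map[OF d(1)])
qed

lemma transfer_boundary:
 assumes "singular_relboundary p (projective_space n) {} c"
 shows "singular_relboundary p (nsphere n) {} (transfer_chain n p c)"
proof -
 obtain d where d: "singular_chain (Suc p) (projective_space n) d" "chain_boundary (Suc p) d = c"
  using assms by (auto simp: singular_boundary)
 have "chain_boundary (Suc p) (transfer_chain n (Suc p) d) = transfer_chain n p c"
  using transfer_chain(3)[OF d(1)] d(2) by simp
 then show ?thesis using transfer_chain(1)[OF d(1)] unfolding singular_boundary by blast
qed

lemma transfer_cmul: "transfer_chain n p (frag_cmul k c) = frag_cmul k (transfer_chain n p c)"
 by (simp add: transfer_chain_def frag_extend_cmul)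

text \<open>Projecting the transfer doubles a chain, so twice a cycle comes from the sphere.
  Conversely the transfer of a projected cycle is the cycle plus its antipode, homologous to twice
  the cycle for odd \<open>n\<close>, so the projected generator keeps infinite order.\<close>

lemma sphere_like_projective_space:
 assumes n: "odd n"
 shows "sphere_like (projective_space n) n"
 unfolding sphere_like_def
proof
 fix q
 let ?X = "nsphere n" and ?P = "projective_space n" and ?\<pi> = "chain_map q antipodal_class"
 obtain z where "zcycle q ?X z \<and> (\<forall>c. zcycle q ?X c \<longrightarrow>
    (\<exists>k l. k \<noteq> 0 \<and> zboundary q ?X (frag_cmul k c - frag_cmul l z))) \<and>
   (if q = 0 \<or> q = n then \<forall>k. zboundary q ?X (frag_cmul k z) \<longrightarrow> k = 0 else z = 0)"
  using spec[OF sphere_like_nsphere[OF n, unfolded sphere_like_def], of q] ..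
 then have z: "zcycle q ?X z"
  "\<And>c. zcycle q ?X c \<Longrightarrow>
    (\<exists>k l. k \<noteq> 0 \<and> zboundary q ?X (frag_cmul k c - frag_cmul l z))"
  "if q = 0 \<or> q = n then \<forall>k. zboundary q ?X (frag_cmul k z) \<longrightarrow> k = 0 else z = 0"
  by auto
 have zc: "singular_chain q ?X z" using z(1) by (simp add: singular_cycle)
 have \<pi>b: "zboundary q ?P (?\<pi> c)" if "zboundary q ?X c" for c
  using that continuous_map_antipodal_class by (rule singular_relboundary_chain_map) auto
 show "\<exists>z. zcycle q ?P z \<and> (\<forall>c. zcycle q ?P c \<longrightarrow>
    (\<exists>k l. k \<noteq> 0 \<and> zboundary q ?P (frag_cmul k c - frag_cmul l z))) \<and>
   (if q = 0 \<or> q = n then \<forall>k. zboundary q ?P (frag_cmul k z) \<longrightarrow> k = 0 else z = 0)"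
 proof (intro exI[of _ "?\<pi> z"] conjI allI impI)
  show "zcycle q ?P (?\<pi> z)"
   using z(1) continuous_map_antipodal_class by (rule singular_relcycle_chain_map) auto
  fix c assume c: "zcycle q ?P c"
  then have cc: "singular_chain q ?P c" "chain_boundary q c = 0" by (auto simp: singular_cycle)
  have "chain_boundary q (transfer_chain n q c) = 0"
   using transfer_chain(3)[OF cc(1)] by (simp add: cc(2)) (simp add: transfer_chain_def)
  then have "zcycle q ?X (transfer_chain n q c)"
   using transfer_chain(1)[OF cc(1)] by (simp add: singular_cycle)
  then obtain k l where kl: "k \<noteq> 0"
   "zboundary q ?X (frag_cmul k (transfer_chain n q c) - frag_cmul l z)"
   using z(2) by blast
  have "zboundary q ?P (frag_cmul (k * 2) c - frag_cmul l (?\<pi> z))"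
   using \<pi>b[OF kl(2)] transfer_chain(2)[OF cc(1)] by (simp add: chain_map_diff)
  moreover have "k * 2 \<noteq> 0" using kl(1) by simp
  ultimately show "\<exists>k l. k \<noteq> 0 \<and> zboundary q ?P (frag_cmul k c - frag_cmul l (?\<pi> z))" by blast
 next
  have "k = 0" if zk: "\<forall>k. zboundary q ?X (frag_cmul k z) \<longrightarrow> k = 0"
   and k: "zboundary q ?P (frag_cmul k (?\<pi> z))" for k
  proof -
   have 1: "zboundary q ?X (frag_cmul k (z + chain_map q antipode z))"
    using transfer_boundary[OF k] unfolding transfer_cmul transfer_chain_map[OF zc] .
   \<comment> \<open>Here the homotopy from the identity to the antipode enters; without it the two
     summands could cancel in degree \<open>n\<close>.\<close>
   have "homologous_rel q ?X {} (chain_map q id z) (chain_map q antipode z)"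
    by (rule homotopic_imp_homologous_rel_chain_maps[OF antipode_homotopic[OF n] z(1)])
   then have "zboundary q ?X (z - chain_map q antipode z)"
    by (simp add: homologous_rel_def chain_map_ident[OF zc])
   from singular_relboundary_add[OF 1 singular_relboundary_cmul[OF this, of k]]
   have "zboundary q ?X (frag_cmul k ((z + chain_map q antipode z) + (z - chain_map q antipode z)))"
    by (simp only: frag_cmul_distrib2)
   moreover have "(z + chain_map q antipode z) + (z - chain_map q antipode z) = frag_cmul 2 z"
    using frag_cmul_distrib[of 1 1 z] by simp
   ultimately have "zboundary q ?X (frag_cmul (k * 2) z)" by simp
   then have "k * 2 = 0" using zk by blast
   then show ?thesis by simp
  qed
  then show "if q = 0 \<or> q = n then \<forall>k. zboundary q ?P (frag_cmul k (?\<pi> z)) \<longrightarrow> k = 0 else ?\<pi> z = 0"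
   using z(3) by (cases "q = 0 \<or> q = n") auto
 qed
qed

section \<open>Graded series\<close>

notation fls_nth (infixl "$$" 75)

definition graded_finite :: "('m \<Rightarrow> int) \<Rightarrow> ('m \<Rightarrow> real) \<Rightarrow> bool" where
 "graded_finite gr F \<longleftrightarrow> (\<forall>p. finite {a. F a \<noteq> 0 \<and> gr a \<le> p})"

text \<open>A formal sum of monomials \<open>a\<close> becomes a Laurent series in the grade whose
  coefficients lie in the semigroup algebra of the exponents. The map \<open>\<theta>\<close> may
  identify monomials, which is how relations between them are imposed.\<close>

definition series :: "('m \<Rightarrow> int) \<Rightarrow> ('m \<Rightarrow> 'k) \<Rightarrow> ('m \<Rightarrow> real) \<Rightarrow> ('k \<Rightarrow>\<^sub>0 real) fls" where
 "series gr \<theta> F = Abs_fls (\<lambda>p. \<Sum>a\<in>{a. F a \<noteq> 0 \<and> gr a = p}. single (\<theta> a) (F a))"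

text \<open>Only pairs of nonzero coefficients are summed, so that the index set is finite for
  graded finite factors.\<close>

definition conv :: "('m::comm_monoid_add \<Rightarrow> real) \<Rightarrow> ('m \<Rightarrow> real) \<Rightarrow> 'm \<Rightarrow> real" where
 "conv F G c = (\<Sum>(a, b)\<in>{(a, b). a + b = c \<and> F a \<noteq> 0 \<and> G b \<noteq> 0}. F a * G b)"

lemma sum_nonzero: "(\<Sum>x\<in>A. f x) \<noteq> 0 \<Longrightarrow> \<exists>x\<in>A. f x \<noteq> 0"
 by (meson sum.neutral)

lemma graded_finite_bound:
 assumes "graded_finite gr F"
 shows "\<exists>B. \<forall>a. F a \<noteq> 0 \<longrightarrow> B \<le> gr a"
proof -
 have f: "finite (gr ` {a. F a \<noteq> 0 \<and> gr a \<le> 0})"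
  using assms by (auto simp: graded_finite_def)
 define B where "B = Min (insert 0 (gr ` {a. F a \<noteq> 0 \<and> gr a \<le> 0}))"
 have "B \<le> gr a" if "F a \<noteq> 0" for a
 proof (cases "gr a \<le> 0")
  case True
  then show ?thesis unfolding B_def using f that by (intro Min_le) auto
 next
  case False
  have "B \<le> 0" unfolding B_def using f by (intro Min_le) auto
  then show ?thesis using False by simp
 qed
 then show ?thesis by blast
qed

lemma graded_finite_eq: "graded_finite gr F \<Longrightarrow> finite {a. F a \<noteq> 0 \<and> gr a = p}"
 unfolding graded_finite_def by (drule spec[of _ p], erule finite_subset[rotated]) auto

lemma series_nth:
 assumes F: "graded_finite gr F" and U: "finite U" "{a. F a \<noteq> 0 \<and> gr a = p} \<subseteq> U" "\<And>a. a \<in> U \<Longrightarrow> gr a = p"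
 shows "series gr \<theta> F $$ p = (\<Sum>a\<in>U. single (\<theta> a) (F a))"
proof -
 obtain B where B: "\<And>a. F a \<noteq> 0 \<Longrightarrow> B \<le> gr a" using graded_finite_bound[OF F] by blast
 have "\<exists>N. \<forall>q<N. (\<Sum>a\<in>{a. F a \<noteq> 0 \<and> gr a = q}. single (\<theta> a) (F a)) = 0"
 proof (intro exI[of _ B] allI impI)
  fix q assume "q < B"
  then have e: "{a. F a \<noteq> 0 \<and> gr a = q} = {}" using B by force
  show "(\<Sum>a\<in>{a. F a \<noteq> 0 \<and> gr a = q}. single (\<theta> a) (F a)) = 0" unfolding e by simp
 qed
 then have "series gr \<theta> F $$ p = (\<Sum>a\<in>{a. F a \<noteq> 0 \<and> gr a = p}. single (\<theta> a) (F a))"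
  unfolding series_def by (rule nth_Abs_fls_ex_lower_bound)
 also have "\<dots> = (\<Sum>a\<in>U. single (\<theta> a) (F a))"
  by (rule sum.mono_neutral_left) (use U in auto)
 finally show ?thesis .
qed

lemma series_nth': "graded_finite gr F \<Longrightarrow>
  series gr \<theta> F $$ p = (\<Sum>a\<in>{a. F a \<noteq> 0 \<and> gr a = p}. single (\<theta> a) (F a))"
 by (rule series_nth) (auto intro: graded_finite_eq)

lemma graded_finite_add:
 assumes "graded_finite gr F" "graded_finite gr G"
 shows "graded_finite gr (\<lambda>a. F a + G a)"
 unfolding graded_finite_def
proof
 fix p
 have "finite ({a. F a \<noteq> 0 \<and> gr a \<le> p} \<union> {a. G a \<noteq> 0 \<and> gr a \<le> p})"
  using assms by (auto simp: graded_finite_def)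
 then show "finite {a. F a + G a \<noteq> 0 \<and> gr a \<le> p}" by (rule finite_subset[rotated]) auto
qed

lemma series_add:
 assumes "graded_finite gr F" "graded_finite gr G"
 shows "series gr \<theta> (\<lambda>a. F a + G a) = series gr \<theta> F + series gr \<theta> G"
proof (rule fls_eqI)
 fix p
 let ?U = "{a. F a \<noteq> 0 \<and> gr a = p} \<union> {a. G a \<noteq> 0 \<and> gr a = p}"
 have U: "finite ?U" using assms by (auto intro: graded_finite_eq)
 show "series gr \<theta> (\<lambda>a. F a + G a) $$ p = (series gr \<theta> F + series gr \<theta> G) $$ p"
  unfolding fls_plus_nth
  by (subst (1 2 3) series_nth[OF _ U])
   (auto simp: assms graded_finite_add single_add sum.distrib)
qed

lemma single_sum: "single k (\<Sum>x\<in>A. f x) = (\<Sum>x\<in>A. single k (f x))"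
 by (induction A rule: infinite_finite_induct) (simp_all add: single_add)

lemma fls_times_nth_support:
 fixes f g :: "'a::comm_ring_1 fls"
 assumes "finite J" "{i. f $$ i \<noteq> 0 \<and> g $$ (p - i) \<noteq> 0} \<subseteq> J"
 shows "(f * g) $$ p = (\<Sum>i\<in>J. f $$ i * g $$ (p - i))"
proof -
 let ?I = "{fls_subdegree f..p - fls_subdegree g}"
 have out: "f $$ i * g $$ (p - i) = 0" if "i \<notin> ?I \<or> i \<notin> J" for i
 proof -
  have "f $$ i = 0 \<or> g $$ (p - i) = 0" using that assms(2) by (cases "i \<in> ?I") (auto simp: not_le)
  then show ?thesis by auto
 qed
 have "(f * g) $$ p = (\<Sum>i\<in>?I. f $$ i * g $$ (p - i))" by (rule fls_times_nth(2))
 also have "\<dots> = (\<Sum>i\<in>?I \<union> J. f $$ i * g $$ (p - i))"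
  using assms(1) out by (intro sum.mono_neutral_left) auto
 also have "\<dots> = (\<Sum>i\<in>J. f $$ i * g $$ (p - i))"
  using assms(1) out by (intro sum.mono_neutral_right) auto
 finally show ?thesis .
qed

context
 fixes gr :: "'m::comm_monoid_add \<Rightarrow> int" and \<theta> :: "'m \<Rightarrow> 'k::comm_monoid_add"
  and F G :: "'m \<Rightarrow> real"
 assumes F: "graded_finite gr F" and G: "graded_finite gr G"
  and gr: "\<And>a b. gr (a + b) = gr a + gr b" and \<theta>: "\<And>a b. \<theta> (a + b) = \<theta> a + \<theta> b"
begin

text \<open>Both supports are bounded below in the grading, so a bound on the sum of the grades
  bounds each of them above.\<close>

lemma finite_conv_pairs: "finite {(a, b). F a \<noteq> 0 \<and> G b \<noteq> 0 \<and> gr a + gr b \<le> p}"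
proof -
 obtain B C where B: "\<And>a. F a \<noteq> 0 \<Longrightarrow> B \<le> gr a" and C: "\<And>a. G a \<noteq> 0 \<Longrightarrow> C \<le> gr a"
  using graded_finite_bound[OF F] graded_finite_bound[OF G] by blast
 have "finite ({a. F a \<noteq> 0 \<and> gr a \<le> p - C} \<times> {b. G b \<noteq> 0 \<and> gr b \<le> p - B})"
  using F G by (auto simp: graded_finite_def)
 then show ?thesis
  by (rule finite_subset[rotated]) (use B C in force)
qed

lemma graded_finite_conv: "graded_finite gr (conv F G)"
 unfolding graded_finite_def
proof
 fix p
 have "{c. conv F G c \<noteq> 0 \<and> gr c \<le> p}
   \<subseteq> (\<lambda>(a, b). a + b) ` {(a, b). F a \<noteq> 0 \<and> G b \<noteq> 0 \<and> gr a + gr b \<le> p}"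
 proof
  fix c assume c: "c \<in> {c. conv F G c \<noteq> 0 \<and> gr c \<le> p}"
  then have "conv F G c \<noteq> 0" by simp
  then obtain x where "x \<in> {(a, b). a + b = c \<and> F a \<noteq> 0 \<and> G b \<noteq> 0}"
   unfolding conv_def by (meson sum.not_neutral_contains_not_neutral)
  then show "c \<in> (\<lambda>(a, b). a + b) ` {(a, b). F a \<noteq> 0 \<and> G b \<noteq> 0 \<and> gr a + gr b \<le> p}"
   using c by (intro image_eqI[of _ _ x]) (auto simp: gr)
 qed
 then show "finite {c. conv F G c \<noteq> 0 \<and> gr c \<le> p}"
  using finite_conv_pairs[of p] finite_subset by blast
qed

text \<open>The pairs of monomials with total grade \<open>p\<close> are summed twice: grouped by
  the grade of the first factor they give the product of series, grouped by their sum they give the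
  convolution.\<close>

lemma series_mult: "series gr \<theta> (conv F G) = series gr \<theta> F * series gr \<theta> G"
proof (rule fls_eqI)
 fix p
 define P where "P = {(a, b). F a \<noteq> 0 \<and> G b \<noteq> 0 \<and> gr a + gr b = p}"
 have P: "finite P"
  unfolding P_def by (rule finite_subset[OF _ finite_conv_pairs[of p]]) auto
 let ?t = "\<lambda>(a, b). single (\<theta> a + \<theta> b) (F a * G b)"
 let ?J = "(\<lambda>x. gr (fst x)) ` P"
 have "(series gr \<theta> F * series gr \<theta> G) $$ p = (\<Sum>i\<in>?J. series gr \<theta> F $$ i * series gr \<theta> G $$ (p - i))"
 proof (rule fls_times_nth_support)
  show "finite ?J" using P by simp
  show "{i. series gr \<theta> F $$ i \<noteq> 0 \<and> series gr \<theta> G $$ (p - i) \<noteq> 0} \<subseteq> ?J"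
  proof clarify
   fix i assume "series gr \<theta> F $$ i \<noteq> 0" "series gr \<theta> G $$ (p - i) \<noteq> 0"
   then obtain a b where "F a \<noteq> 0" "gr a = i" "G b \<noteq> 0" "gr b = p - i"
    unfolding series_nth'[OF F] series_nth'[OF G] by (fastforce dest!: sum_nonzero)
   then show "i \<in> ?J" unfolding P_def by (intro image_eqI[of _ _ "(a, b)"]) auto
  qed
 qed
 also have "\<dots> = (\<Sum>i\<in>?J. \<Sum>x\<in>{x\<in>P. gr (fst x) = i}. ?t x)"
 proof (intro sum.cong refl)
  fix i
  have "series gr \<theta> F $$ i * series gr \<theta> G $$ (p - i)
   = (\<Sum>x\<in>{a. F a \<noteq> 0 \<and> gr a = i} \<times> {b. G b \<noteq> 0 \<and> gr b = p - i}. ?t x)"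
   unfolding series_nth'[OF F] series_nth'[OF G] sum_product sum.cartesian_product
   by (intro sum.cong refl) (auto simp: mult_single)
  also have "{a. F a \<noteq> 0 \<and> gr a = i} \<times> {b. G b \<noteq> 0 \<and> gr b = p - i} = {x\<in>P. gr (fst x) = i}"
   by (auto simp: P_def)
  finally show "series gr \<theta> F $$ i * series gr \<theta> G $$ (p - i) = (\<Sum>x\<in>{x\<in>P. gr (fst x) = i}. ?t x)" .
 qed
 also have "\<dots> = (\<Sum>x\<in>P. ?t x)" by (rule sum.image_gen[OF P, symmetric])
 also have "\<dots> = (\<Sum>c\<in>(\<lambda>(a, b). a + b) ` P. \<Sum>x\<in>{x\<in>P. (\<lambda>(a, b). a + b) x = c}. ?t x)"
  by (rule sum.image_gen[OF P])
 also have "\<dots> = (\<Sum>c\<in>(\<lambda>(a, b). a + b) ` P. single (\<theta> c) (conv F G c))"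
 proof (intro sum.cong refl)
  fix c assume c: "c \<in> (\<lambda>(a, b). a + b) ` P"
  then have "gr c = p" by (auto simp: P_def gr)
  then have e: "{x\<in>P. (\<lambda>(a, b). a + b) x = c} = {(a, b). a + b = c \<and> F a \<noteq> 0 \<and> G b \<noteq> 0}"
   by (auto simp: P_def gr)
  show "(\<Sum>x\<in>{x\<in>P. (\<lambda>(a, b). a + b) x = c}. ?t x) = single (\<theta> c) (conv F G c)"
   unfolding e conv_def single_sum by (intro sum.cong refl) (auto simp: \<theta>)
 qed
 also have "\<dots> = series gr \<theta> (conv F G) $$ p"
 proof (rule series_nth[OF graded_finite_conv, symmetric])
  show "finite ((\<lambda>(a, b). a + b) ` P)" using P by simp
  show "{c. conv F G c \<noteq> 0 \<and> gr c = p} \<subseteq> (\<lambda>(a, b). a + b) ` P"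
  proof
   fix c assume c: "c \<in> {c. conv F G c \<noteq> 0 \<and> gr c = p}"
   then have "conv F G c \<noteq> 0" by simp
   then obtain x where "x \<in> {(a, b). a + b = c \<and> F a \<noteq> 0 \<and> G b \<noteq> 0}"
    unfolding conv_def by (meson sum.not_neutral_contains_not_neutral)
   then show "c \<in> (\<lambda>(a, b). a + b) ` P"
    using c by (intro image_eqI[of _ _ x]) (auto simp: gr P_def)
  qed
 qed (auto simp: P_def gr)
 finally show "series gr \<theta> (conv F G) $$ p = (series gr \<theta> F * series gr \<theta> G) $$ p" by simp
qed

end

lemma series_lookup:
 assumes F: "graded_finite gr F" and inj: "\<And>b. F b \<noteq> 0 \<Longrightarrow> \<theta> b = \<theta> a \<Longrightarrow> b = a"
 shows "lookup (series gr \<theta> F $$ gr a) (\<theta> a) = F a"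
proof -
 let ?A = "{b. F b \<noteq> 0 \<and> gr b = gr a}"
 have "lookup (series gr \<theta> F $$ gr a) (\<theta> a) = (\<Sum>b\<in>?A. if b = a then F b else 0)"
  unfolding series_nth'[OF F] lookup_sum using inj
  by (intro sum.cong refl) (auto simp: lookup_single when_def)
 then show ?thesis using graded_finite_eq[OF F] by simp
qed

lemma series_lookup_nonzero:
 assumes F: "graded_finite gr F" and "lookup (series gr \<theta> F $$ p) v \<noteq> 0"
 obtains a where "F a \<noteq> 0" "gr a = p" "\<theta> a = v"
proof -
 have "(\<Sum>b\<in>{b. F b \<noteq> 0 \<and> gr b = p}. lookup (single (\<theta> b) (F b)) v) \<noteq> 0"
  using assms(2) unfolding series_nth'[OF F] lookup_sum .
 then obtain a where "F a \<noteq> 0" "gr a = p" "lookup (single (\<theta> a) (F a)) v \<noteq> 0"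
  by (fastforce dest!: sum_nonzero)
 then show ?thesis by (intro that[of a]) (auto simp: lookup_single when_def split: if_splits)
qed

text \<open>Spares a direct check of associativity for convolution products: all identities hold in
  the target ring.\<close>

lemma cring_of_injection:
 fixes R :: "('a, 'm) ring_scheme" and h :: "'a \<Rightarrow> 'c::comm_ring_1"
 assumes inj: "inj_on h (carrier R)"
  and add: "\<And>x y. x \<in> carrier R \<Longrightarrow> y \<in> carrier R \<Longrightarrow> x \<oplus>\<^bsub>R\<^esub> y \<in> carrier R \<and> h (x \<oplus>\<^bsub>R\<^esub> y) = h x + h y"
  and mult: "\<And>x y. x \<in> carrier R \<Longrightarrow> y \<in> carrier R \<Longrightarrow> x \<otimes>\<^bsub>R\<^esub> y \<in> carrier R \<and> h (x \<otimes>\<^bsub>R\<^esub> y) = h x * h y"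
  and zero: "\<zero>\<^bsub>R\<^esub> \<in> carrier R \<and> h \<zero>\<^bsub>R\<^esub> = 0" and one: "\<one>\<^bsub>R\<^esub> \<in> carrier R \<and> h \<one>\<^bsub>R\<^esub> = 1"
  and neg: "\<And>x. x \<in> carrier R \<Longrightarrow> \<exists>y\<in>carrier R. h y = - h x"
 shows "cring R"
proof -
 have eq: "x = y" if "x \<in> carrier R" "y \<in> carrier R" "h x = h y" for x y
  using inj that by (auto simp: inj_on_def)
 show ?thesis
 proof (rule cringI)
  show "abelian_group R"
  proof (rule abelian_groupI)
   fix x assume x: "x \<in> carrier R"
   then obtain y where "y \<in> carrier R" "h y = - h x" using neg by blast
   then show "\<exists>y\<in>carrier R. y \<oplus>\<^bsub>R\<^esub> x = \<zero>\<^bsub>R\<^esub>" using x by (intro bexI[of _ y] eq) (simp_all add: add zero)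
  qed (auto intro!: eq simp: add zero algebra_simps)
  show "comm_monoid R"
   by (rule comm_monoidI) (auto intro!: eq simp: mult one algebra_simps)
 qed (auto intro!: eq simp: mult add algebra_simps)
qed

lemma a_r_coset_fiber:
 fixes K :: "'b \<Rightarrow> 'c::ab_group_add"
 assumes V: "abelian_group V"
  and add: "\<And>x y. x \<in> carrier V \<Longrightarrow> y \<in> carrier V \<Longrightarrow> K (x \<oplus>\<^bsub>V\<^esub> y) = K x + K y"
  and N: "N = {x \<in> carrier V. K x = 0}" and x: "x \<in> carrier V"
 shows "N +>\<^bsub>V\<^esub> x = {y \<in> carrier V. K y = K x}"
proof -
 interpret abelian_group V by (rule V)
 have K0: "K \<zero>\<^bsub>V\<^esub> = 0" using add[of "\<zero>\<^bsub>V\<^esub>" "\<zero>\<^bsub>V\<^esub>"] by simp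
 have neg: "K (\<ominus>\<^bsub>V\<^esub> x) = - K x"
  using add[of "\<ominus>\<^bsub>V\<^esub> x" x] x by (simp add: l_neg K0 eq_neg_iff_add_eq_0)
 show ?thesis
 proof (intro equalityI subsetI)
  fix y assume "y \<in> {y \<in> carrier V. K y = K x}"
  then have y: "y \<in> carrier V" "K y = K x" by auto
  have "y = (y \<ominus>\<^bsub>V\<^esub> x) \<oplus>\<^bsub>V\<^esub> x" using x y by (simp add: minus_eq a_assoc l_neg)
  moreover have "y \<ominus>\<^bsub>V\<^esub> x \<in> N" using x y by (simp add: N minus_eq add neg)
  ultimately show "y \<in> N +>\<^bsub>V\<^esub> x" unfolding mem_a_r_coset by blast
 qed (use x in \<open>auto simp: mem_a_r_coset N add\<close>)
qed

section \<open>The Tate algebra and its quotient\<close>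

lemma lookup_sum_single:
 "lookup (\<Sum>i\<le>(n::nat). single i (g i)) m = (if m \<le> n then g m else 0)"
 by (simp add: lookup_sum lookup_single when_def)

lemma finite_sum_pairs: "finite {(a, b). a + b = (d :: nat \<Rightarrow>\<^sub>0 nat)}"
proof -
 let ?A = "{a. \<exists>b. a + b = d}"
 let ?r = "\<lambda>a. restrict (lookup a) (keys d)"
 have le: "lookup a i \<le> lookup d i" if "a \<in> ?A" for a i
  using that by (auto simp: lookup_add)
 have "?r ` ?A \<subseteq> PiE (keys d) (\<lambda>i. {..lookup d i})"
  using le by auto
 moreover have "finite (PiE (keys d) (\<lambda>i. {..lookup d i}))"
  by (intro finite_PiE) auto
 ultimately have "finite (?r ` ?A)" by (rule finite_subset)
 moreover have "inj_on ?r ?A"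
 proof (rule inj_onI)
  fix a a' assume a: "a \<in> ?A" "a' \<in> ?A" "?r a = ?r a'"
  show "a = a'"
  proof (rule poly_mapping_eqI)
   fix i
   show "lookup a i = lookup a' i"
   proof (cases "i \<in> keys d")
    case True
    then show ?thesis using fun_cong[OF a(3), of i] by simp
   next
    case False
    then show ?thesis using le[OF a(1), of i] le[OF a(2), of i] by (simp add: in_keys_iff)
   qed
  qed
 qed
 ultimately have "finite ?A" by (rule finite_imageD)
 then have "finite ((\<lambda>a. (a, d - a)) ` ?A)" by simp
 then show ?thesis by (rule finite_subset[rotated]) auto
qed

definition dgr :: "nat \<Rightarrow> (nat \<Rightarrow>\<^sub>0 int) \<Rightarrow> int" where
 "dgr n v = (\<Sum>i\<le>n. lookup v i)"

text \<open>The factor \<open>n + 1\<close> makes this the sum of the components of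
  \<open>tvec\<close>, so Laurent degree and exponent are consistent.\<close>

definition tgr :: "nat \<Rightarrow> int \<times> (nat \<Rightarrow>\<^sub>0 nat) \<Rightarrow> int" where
 "tgr n = (\<lambda>(k, d). int (n + 1) * (k + int (\<Sum>i\<le>n. lookup d i)))"

text \<open>
 The exponent of the monomial \<open>X\<^sup>k z\<^sup>d\<close>: its valuation at \<open>\<zeta>\<close> is the inner product of this vector
 with \<open>\<zeta> / (n + 1)\<close>.
\<close>

definition tvec :: "nat \<Rightarrow> int \<times> (nat \<Rightarrow>\<^sub>0 nat) \<Rightarrow> nat \<Rightarrow>\<^sub>0 int" where
 "tvec n = (\<lambda>(k, d). \<Sum>i\<le>n. single i (k + int (n + 1) * int (lookup d i)))"

definition simplex_sign :: "nat \<Rightarrow> real" where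
 "simplex_sign n = (-1) ^ (n * (n + 1) div 2)"

lemma simplex_sign: "simplex_sign n * simplex_sign n = 1" "simplex_sign n \<noteq> 0"
 "simplex_sign n = 1 \<or> simplex_sign n = -1"
 by (auto simp: simplex_sign_def minus_one_power_iff)

lemma tgr_add: "tgr n (a + b) = tgr n a + tgr n b"
 by (simp add: tgr_def case_prod_unfold lookup_add sum.distrib algebra_simps)

lemma lookup_tvec: "lookup (tvec n (k, d)) i
  = (if i \<le> n then k + int (n + 1) * int (lookup d i) else 0)"
 unfolding tvec_def prod.case lookup_sum_single ..

lemma tvec_add: "tvec n (a + b) = tvec n a + tvec n b"
 by (cases a; cases b; rule poly_mapping_eqI) (simp add: lookup_tvec lookup_add algebra_simps)

lemma dgr_tvec: "dgr n (tvec n a) = tgr n a"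
 by (cases a) (simp add: dgr_def tgr_def lookup_tvec sum.distrib sum_distrib_left algebra_simps)

lemma nu_R_less_iff:
 "nu_R n r < ereal c \<longleftrightarrow> (\<exists>k. fls_nth r k \<noteq> 0 \<and> of_int k / of_nat (n + 1) < c)"
 unfolding nu_R_def INF_less_iff by auto

lemma tate_carrier:
 "f \<in> TC n \<longleftrightarrow> (\<forall>d. f d \<noteq> 0 \<longrightarrow> keys d \<subseteq> {..n}) \<and>
   (\<forall>K. finite {d. \<exists>k<K. f d $$ k \<noteq> 0})"
proof -
 have "(\<forall>c::real. finite {d. nu_R n (f d) < ereal c}) \<longleftrightarrow> (\<forall>K. finite {d. \<exists>k<K. f d $$ k \<noteq> 0})"
 proof (intro iffI allI)
  fix K assume a: "\<forall>c::real. finite {d. nu_R n (f d) < ereal c}"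
  show "finite {d. \<exists>k<K. f d $$ k \<noteq> 0}"
   by (rule finite_subset[OF _ spec[OF a, of "of_int K / of_nat (n + 1)"]])
    (auto simp: nu_R_less_iff divide_less_cancel)
 next
  fix c :: real assume a: "\<forall>K. finite {d. \<exists>k<K. f d $$ k \<noteq> 0}"
  show "finite {d. nu_R n (f d) < ereal c}"
  proof (rule finite_subset[OF _ spec[OF a, of "\<lceil>c * of_nat (n + 1)\<rceil>"]], clarify)
   fix d assume "nu_R n (f d) < ereal c"
   then obtain k where k: "f d $$ k \<noteq> 0" "of_int k / of_nat (n + 1) < c" unfolding nu_R_less_iff by blast
   then have "of_int k < c * of_nat (n + 1)" by (simp add: pos_divide_less_eq)
   then have "k < \<lceil>c * of_nat (n + 1)\<rceil>" by (simp only: less_ceiling_iff)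
   then show "\<exists>k<\<lceil>c * of_nat (n + 1)\<rceil>. f d $$ k \<noteq> 0" using k by blast
  qed
 qed
 then show ?thesis by (simp add: tate_algebra_def)
qed

lemma tate_ops:
 "\<one>\<^bsub>TA n\<^esub> = (\<lambda>d. if d = 0 then 1 else 0)" "\<zero>\<^bsub>TA n\<^esub> = (\<lambda>d. 0)"
 "f \<oplus>\<^bsub>TA n\<^esub> g = (\<lambda>d. f d + g d)"
 "f \<otimes>\<^bsub>TA n\<^esub> g = (\<lambda>d. \<Sum>(a, b)\<in>{(a, b). a + b = d}. f a * g b)"
 by (simp_all add: tate_algebra_def)

lemma tate_keys: "f \<in> TC n \<Longrightarrow> f d \<noteq> 0 \<Longrightarrow> keys d \<subseteq> {..n}"
 and tate_finite: "f \<in> TC n \<Longrightarrow> finite {d. \<exists>k<K. f d $$ k \<noteq> 0}"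
 by (simp_all add: tate_carrier)

lemma tate_bound:
 assumes "f \<in> TC n"
 shows "\<exists>B. \<forall>d k. f d $$ k \<noteq> 0 \<longrightarrow> B \<le> k"
proof -
 let ?D = "{d. \<exists>k<0. f d $$ k \<noteq> 0}"
 have fin: "finite (insert 0 ((\<lambda>d. fls_subdegree (f d)) ` ?D))" using tate_finite[OF assms] by simp
 have "Min (insert 0 ((\<lambda>d. fls_subdegree (f d)) ` ?D)) \<le> k" if k: "f d $$ k \<noteq> 0" for d k
 proof (cases "k < 0")
  case True
  have "Min (insert 0 ((\<lambda>d. fls_subdegree (f d)) ` ?D)) \<le> fls_subdegree (f d)"
   using fin True k by (intro Min_le) auto
  also have "\<dots> \<le> k" using k by (rule fls_subdegree_leI)
  finally show ?thesis .
 next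
  case False
  have "Min (insert 0 ((\<lambda>d. fls_subdegree (f d)) ` ?D)) \<le> 0" using fin by (intro Min_le) auto
  then show ?thesis using False by simp
 qed
 then show ?thesis by blast
qed

text \<open>The parameter rescales \<open>z_0\<close>. With \<open>c = simplex_sign n\<close> it
  absorbs the sign of the relation, so that \<open>z_0 ... z_n\<close> and \<open>T\<close> get the
  same image; with \<open>c = 1\<close> the coefficients are unchanged.\<close>

definition tcoef :: "real \<Rightarrow> tate \<Rightarrow> int \<times> (nat \<Rightarrow>\<^sub>0 nat) \<Rightarrow> real" where
 "tcoef c f = (\<lambda>(k, d). c ^ lookup d 0 * f d $$ k)"

text \<open>Exponents of the \<open>z_i\<close> are nonnegative, so a bound on the grade bounds
  \<open>k\<close> from above. Convergence then leaves finitely many \<open>d\<close>, and each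
  coefficient is a Laurent series bounded below.\<close>

lemma graded_finite_tcoef:
 assumes f: "f \<in> TC n"
 shows "graded_finite (tgr n) (tcoef c f)"
 unfolding graded_finite_def
proof
 fix p
 let ?D = "{d. \<exists>k<\<bar>p\<bar> + 1. f d $$ k \<noteq> 0}"
 have "finite (Sigma ?D (\<lambda>d. {fls_subdegree (f d)..\<bar>p\<bar>}))"
  by (rule finite_SigmaI[OF tate_finite[OF f]]) simp
 then have "finite ((\<lambda>(d, k). (k, d)) ` Sigma ?D (\<lambda>d. {fls_subdegree (f d)..\<bar>p\<bar>}))" by simp
 then show "finite {a. tcoef c f a \<noteq> 0 \<and> tgr n a \<le> p}"
 proof (rule finite_subset[rotated], clarify)
  fix k d assume a: "tcoef c f (k, d) \<noteq> 0" "tgr n (k, d) \<le> p"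
  then have fk: "f d $$ k \<noteq> 0" by (simp add: tcoef_def)
  have "k \<le> \<bar>p\<bar>"
  proof (rule ccontr)
   assume "\<not> k \<le> \<bar>p\<bar>"
   then have "\<bar>p\<bar> < k + int (\<Sum>i\<le>n. lookup d i)" by linarith
   also have "\<dots> \<le> tgr n (k, d)"
   proof -
    have "1 * x \<le> int (n + 1) * x" if "0 \<le> x" for x using that by (intro mult_right_mono) auto
    moreover have "0 \<le> k + int (\<Sum>i\<le>n. lookup d i)" using calculation \<open>\<not> k \<le> \<bar>p\<bar>\<close> by linarith
    ultimately show ?thesis by (simp add: tgr_def)
   qed
   finally show False using a(2) by linarith
  qed
  then show "(k, d) \<in> (\<lambda>(d, k). (k, d)) ` Sigma ?D (\<lambda>d. {fls_subdegree (f d)..\<bar>p\<bar>})"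
   using fk fls_subdegree_leI[OF fk] by (intro image_eqI[of _ _ "(d, k)"]) (auto intro!: exI[of _ k])
 qed
qed

lemma tcoef_mult:
 assumes f: "f \<in> TC n" and g: "g \<in> TC n" and c: "c \<noteq> 0"
 shows "tcoef c (f \<otimes>\<^bsub>TA n\<^esub> g) = conv (tcoef c f) (tcoef c g)"
proof (rule ext, clarify)
 fix k d
 let ?D = "{(a, b). a + b = (d :: nat \<Rightarrow>\<^sub>0 nat)}"
 let ?I = "\<lambda>(a, b). {i. f a $$ i \<noteq> 0 \<and> g b $$ (k - i) \<noteq> 0}"
 have fin: "finite (?I x)" for x
  by (cases x, rule finite_subset[of _ "{fls_subdegree (f (fst x))..k - fls_subdegree (g (snd x))}"])
   (auto intro: fls_subdegree_leI dest!: fls_subdegree_leI)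
 have "tcoef c (f \<otimes>\<^bsub>TA n\<^esub> g) (k, d)
   = (\<Sum>x\<in>?D. \<Sum>i\<in>?I x. c ^ lookup d 0 * (f (fst x) $$ i * g (snd x) $$ (k - i)))"
  unfolding tcoef_def tate_ops prod.case fls_nth_sum sum_distrib_left
 proof (intro sum.cong refl)
  fix x :: "(nat \<Rightarrow>\<^sub>0 nat) \<times> (nat \<Rightarrow>\<^sub>0 nat)"
  have "(f (fst x) * g (snd x)) $$ k = (\<Sum>i\<in>?I x. f (fst x) $$ i * g (snd x) $$ (k - i))"
   by (rule fls_times_nth_support[OF fin]) (auto simp: case_prod_unfold)
  then show "c ^ lookup d 0 * (case x of (a, b) \<Rightarrow> f a * g b) $$ k
    = (\<Sum>i\<in>?I x. c ^ lookup d 0 * (f (fst x) $$ i * g (snd x) $$ (k - i)))"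
   by (simp add: case_prod_unfold sum_distrib_left)
 qed
 also have "\<dots> = (\<Sum>(x, i)\<in>Sigma ?D ?I. c ^ lookup d 0 * (f (fst x) $$ i * g (snd x) $$ (k - i)))"
  by (rule sum.Sigma) (use finite_sum_pairs fin in auto)
 also have "\<dots> = conv (tcoef c f) (tcoef c g) (k, d)"
  unfolding conv_def
  by (rule sum.reindex_bij_witness[where i = "\<lambda>((i, a), (j, b)). ((a, b), i)"
     and j = "\<lambda>((a, b), i). ((i, a), (k - i, b))"])
   (use c in \<open>auto simp: tcoef_def lookup_add power_add\<close>)
 finally show "tcoef c (f \<otimes>\<^bsub>TA n\<^esub> g) (k, d) = conv (tcoef c f) (tcoef c g) (k, d)" .
qed

lemma tate_add_closed:
 assumes f: "f \<in> TC n" and g: "g \<in> TC n"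
 shows "(\<lambda>d. f d + g d) \<in> TC n"
 unfolding tate_carrier
proof (intro conjI allI impI)
 fix d assume "f d + g d \<noteq> 0"
 then show "keys d \<subseteq> {..n}" using tate_keys[OF f] tate_keys[OF g] by (cases "f d = 0") auto
next
 fix K
 have "finite ({d. \<exists>k<K. f d $$ k \<noteq> 0} \<union> {d. \<exists>k<K. g d $$ k \<noteq> 0})"
  using tate_finite[OF f] tate_finite[OF g] by simp
 then show "finite {d. \<exists>k<K. (f d + g d) $$ k \<noteq> 0}" by (rule finite_subset[rotated]) auto
qed

lemma tate_neg_closed: "f \<in> TC n \<Longrightarrow> (\<lambda>d. - f d) \<in> TC n"
 by (simp add: tate_carrier)

lemma tate_mult_closed:
 assumes f: "f \<in> TC n" and g: "g \<in> TC n"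
 shows "f \<otimes>\<^bsub>TA n\<^esub> g \<in> TC n"
 unfolding tate_carrier
proof (intro conjI allI impI)
 fix d assume "(f \<otimes>\<^bsub>TA n\<^esub> g) d \<noteq> 0"
 then obtain a b where ab: "a + b = d" "f a * g b \<noteq> 0" unfolding tate_ops by (fastforce dest!: sum_nonzero)
 then have "f a \<noteq> 0" "g b \<noteq> 0" by auto
 then show "keys d \<subseteq> {..n}"
  using tate_keys[OF f, of a] tate_keys[OF g, of b] keys_add[of a b] ab(1) by blast
next
 fix K
 obtain B C where B: "\<And>d k. f d $$ k \<noteq> 0 \<Longrightarrow> B \<le> k" and C: "\<And>d k. g d $$ k \<noteq> 0 \<Longrightarrow> C \<le> k"
  using tate_bound[OF f] tate_bound[OF g] by blast
 let ?S = "{d. \<exists>k<K - C. f d $$ k \<noteq> 0} \<times> {d. \<exists>k<K - B. g d $$ k \<noteq> 0}"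
 have "finite ((\<lambda>(a, b). a + b) ` ?S)" using tate_finite[OF f] tate_finite[OF g] by simp
 then show "finite {d. \<exists>k<K. (f \<otimes>\<^bsub>TA n\<^esub> g) d $$ k \<noteq> 0}"
 proof (rule finite_subset[rotated], clarify)
  fix d k assume k: "k < K" "(f \<otimes>\<^bsub>TA n\<^esub> g) d $$ k \<noteq> 0"
  then have "conv (tcoef 1 f) (tcoef 1 g) (k, d) \<noteq> 0"
   unfolding tcoef_mult[OF f g one_neq_zero, symmetric] by (simp add: tcoef_def)
  then obtain x where "x \<in> {(a, b). a + b = (k, d) \<and> tcoef 1 f a \<noteq> 0 \<and> tcoef 1 g b \<noteq> 0}"
   unfolding conv_def by (meson sum_nonzero)
  then obtain k1 d1 k2 d2 where *: "k1 + k2 = k" "d1 + d2 = d" "f d1 $$ k1 \<noteq> 0" "g d2 $$ k2 \<noteq> 0"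
   by (cases x) (auto simp: tcoef_def)
  have "k1 < K - C" "k2 < K - B" using *(1) k(1) B[OF *(3)] C[OF *(4)] by linarith+
  then show "d \<in> (\<lambda>(a, b). a + b) ` ?S" using * by (intro image_eqI[of _ _ "(d1, d2)"]) auto
 qed
qed

lemma series_if:
 "series gr \<theta> (\<lambda>b. if b = a then c else 0) $$ p = (if p = gr a then single (\<theta> a) c else 0)"
proof -
 have fin: "graded_finite gr (\<lambda>b. if b = a then c else 0)"
  unfolding graded_finite_def by (auto intro: finite_subset[of _ "{a}"])
 have e: "{b. (if b = a then c else 0) \<noteq> 0 \<and> gr b = p} = (if c \<noteq> 0 \<and> p = gr a then {a} else {})" by auto
 show ?thesis unfolding series_nth'[OF fin] e by auto
qed

definition tser :: "nat \<Rightarrow> real \<Rightarrow> (int \<times> (nat \<Rightarrow>\<^sub>0 nat) \<Rightarrow> 'k::comm_monoid_add) \<Rightarrow> tate \<Rightarrow> ('k \<Rightarrow>\<^sub>0 real) fls" where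
 "tser n c \<theta> f = series (tgr n) \<theta> (tcoef c f)"

lemma tser_add:
 assumes "f \<in> TC n" "g \<in> TC n"
 shows "tser n c \<theta> (\<lambda>d. f d + g d) = tser n c \<theta> f + tser n c \<theta> g"
proof -
 have "tcoef c (\<lambda>d. f d + g d) = (\<lambda>a. tcoef c f a + tcoef c g a)"
  by (auto simp: tcoef_def algebra_simps)
 then show ?thesis
  unfolding tser_def by (simp add: series_add[OF graded_finite_tcoef graded_finite_tcoef] assms)
qed

lemma tser_mult:
 assumes "f \<in> TC n" "g \<in> TC n" "c \<noteq> 0"
  and \<theta>: "\<And>a b. \<theta> (a + b) = \<theta> a + \<theta> b"
 shows "tser n c \<theta> (f \<otimes>\<^bsub>TA n\<^esub> g) = tser n c \<theta> f * tser n c \<theta> g"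
 unfolding tser_def tcoef_mult[OF assms(1-3)]
 by (rule series_mult[OF graded_finite_tcoef graded_finite_tcoef]) (use assms tgr_add in auto)

lemma tser_zero: "tser n c \<theta> (\<lambda>d. 0) = 0"
 by (rule fls_eqI) (simp add: tser_def tcoef_def series_def case_prod_unfold zero_fls.abs_eq[symmetric])

lemma tser_monom:
 assumes "\<And>j. r $$ j = (if j = k then a else 0)"
 shows "tser n c \<theta> (tate_monom r d) $$ p
  = (if p = tgr n (k, d) then single (\<theta> (k, d)) (c ^ lookup d 0 * a) else 0)"
proof -
 have "tcoef c (tate_monom r d) = (\<lambda>b. if b = (k, d) then c ^ lookup d 0 * a else 0)"
 proof (rule ext, clarify)
  fix j e
  show "tcoef c (tate_monom r d) (j, e) = (if (j, e) = (k, d) then c ^ lookup d 0 * a else 0)"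
   by (cases "e = d") (auto simp: tcoef_def tate_monom_def assms)
 qed
 then show ?thesis unfolding tser_def by (simp only: series_if)
qed

lemma tate_monom_carrier:
 assumes "keys d \<subseteq> {..n}"
 shows "tate_monom r d \<in> TC n"
 unfolding tate_carrier
proof (intro conjI allI impI)
 show "finite {e. \<exists>k<K. tate_monom r d e $$ k \<noteq> 0}" for K
  by (rule finite_subset[of _ "{d}"]) (auto simp: tate_monom_def)
qed (use assms in \<open>auto simp: tate_monom_def split: if_splits\<close>)

lemma tate_one: "\<one>\<^bsub>TA n\<^esub> = tate_monom 1 0"
 by (auto simp: tate_ops tate_monom_def)

lemma tser_one: "\<theta> 0 = 0 \<Longrightarrow> tser n c \<theta> \<one>\<^bsub>TA n\<^esub> = 1"
 unfolding tate_one
 by (rule fls_eqI, subst tser_monom[where k = 0 and a = 1]) (auto simp: tgr_def zero_prod_def)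

lemma tser_inj:
 assumes f: "f \<in> TC n" and g: "g \<in> TC n" and c: "c \<noteq> 0"
  and inj: "\<And>k d k' d'. f d $$ k \<noteq> 0 \<or> g d $$ k \<noteq> 0 \<Longrightarrow> f d' $$ k' \<noteq> 0 \<or> g d' $$ k' \<noteq> 0 \<Longrightarrow>
    \<theta> (k, d) = \<theta> (k', d') \<Longrightarrow> (k, d) = (k', d')"
  and eq: "tser n c \<theta> f = tser n c \<theta> g"
 shows "f = g"
proof (rule ext, rule fls_eqI)
 fix d k
 show "f d $$ k = g d $$ k"
 proof (cases "f d $$ k \<noteq> 0 \<or> g d $$ k \<noteq> 0")
  case True
  have inj': "b = (k, d)" if b: "tcoef c f b \<noteq> 0 \<or> tcoef c g b \<noteq> 0" "\<theta> b = \<theta> (k, d)" for b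
  proof (cases b)
   case (Pair k' d')
   then show ?thesis using inj[OF True, of d' k'] b by (auto simp: tcoef_def)
  qed
  have "tcoef c f (k, d) = tcoef c g (k, d)"
   using series_lookup[OF graded_finite_tcoef[OF f], of c \<theta> "(k, d)"]
    series_lookup[OF graded_finite_tcoef[OF g], of c \<theta> "(k, d)"] inj' eq
   unfolding tser_def by auto
  then show ?thesis using c by (simp add: tcoef_def)
 qed auto
qed

text \<open>With \<open>\<theta>\<close> the identity, distinct monomials stay distinct, so the Tate
  algebra embeds into a ring of series.\<close>

lemma cring_tate: "cring (TA n)"
proof (rule cring_of_injection[where h = "tser n 1 (\<lambda>a. a)"])
 show "inj_on (tser n 1 (\<lambda>a. a)) (TC n)"
  by (rule inj_onI, rule tser_inj[where c = 1 and \<theta> = "\<lambda>a. a"]) auto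
 fix x assume x: "x \<in> TC n"
 show "\<exists>y\<in>TC n. tser n 1 (\<lambda>a. a) y = - tser n 1 (\<lambda>a. a) x"
  using tser_add[OF x tate_neg_closed[OF x], of 1 "\<lambda>a. a"] tser_zero[of n 1 "\<lambda>a. a"]
  by (intro bexI[OF _ tate_neg_closed[OF x]]) (simp add: eq_neg_iff_add_eq_0 add.commute)
next
 show "\<zero>\<^bsub>TA n\<^esub> \<in> TC n \<and> tser n 1 (\<lambda>a. a) \<zero>\<^bsub>TA n\<^esub> = 0"
  by (simp add: tate_ops tser_zero tate_carrier)
 show "\<one>\<^bsub>TA n\<^esub> \<in> TC n \<and> tser n 1 (\<lambda>a. a) \<one>\<^bsub>TA n\<^esub> = 1"
 proof
  show "\<one>\<^bsub>TA n\<^esub> \<in> TC n"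
   unfolding tate_one by (rule tate_monom_carrier) simp
 qed (rule tser_one, simp)
next
 fix x y assume xy: "x \<in> TC n" "y \<in> TC n"
 show "x \<oplus>\<^bsub>TA n\<^esub> y \<in> TC n \<and>
   tser n 1 (\<lambda>a. a) (x \<oplus>\<^bsub>TA n\<^esub> y) = tser n 1 (\<lambda>a. a) x + tser n 1 (\<lambda>a. a) y"
  unfolding tate_ops using tate_add_closed[OF xy] tser_add[OF xy] by blast
 show "x \<otimes>\<^bsub>TA n\<^esub> y \<in> TC n \<and>
   tser n 1 (\<lambda>a. a) (x \<otimes>\<^bsub>TA n\<^esub> y) = tser n 1 (\<lambda>a. a) x * tser n 1 (\<lambda>a. a) y"
  using tate_mult_closed[OF xy] tser_mult[OF xy, of 1 "\<lambda>a. a"] by simp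
qed

lemma tate_minus:
 assumes "f \<in> TC n" "g \<in> TC n"
 shows "f \<ominus>\<^bsub>TA n\<^esub> g = (\<lambda>d. f d - g d)"
proof -
 interpret cring "TA n" by (rule cring_tate)
 have "\<ominus>\<^bsub>TA n\<^esub> g = (\<lambda>d. - g d)"
  by (rule minus_equality) (use assms tate_neg_closed in \<open>auto simp: tate_ops\<close>)
 then show ?thesis by (simp add: minus_eq tate_ops)
qed

lemma tate_mult_monom:
 "(f \<otimes>\<^bsub>TA n\<^esub> tate_monom r e) (a + e) = f a * r"
 "\<nexists>a. d = a + e \<Longrightarrow> (f \<otimes>\<^bsub>TA n\<^esub> tate_monom r e) d = 0"
proof -
 have "(\<Sum>(x, y)\<in>{(x, y). x + y = a + e}. f x * tate_monom r e y)
   = (\<Sum>z\<in>{(x, y). x + y = a + e}. if z = (a, e) then f a * r else 0)"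
  by (intro sum.cong refl) (auto simp: tate_monom_def split: if_splits)
 then show "(f \<otimes>\<^bsub>TA n\<^esub> tate_monom r e) (a + e) = f a * r"
  unfolding tate_ops using finite_sum_pairs[of "a + e"] by simp
 assume d: "\<nexists>a. d = a + e"
 show "(f \<otimes>\<^bsub>TA n\<^esub> tate_monom r e) d = 0"
  unfolding tate_ops using d by (intro sum.neutral) (auto simp: tate_monom_def)
qed

section \<open>Division by the simplex relation\<close>

definition up :: "nat \<Rightarrow> nat \<Rightarrow> (nat \<Rightarrow>\<^sub>0 nat) \<Rightarrow> nat \<Rightarrow>\<^sub>0 nat" where
 "up n i d = d + (\<Sum>m\<le>n. single m i)"

lemma lookup_up: "lookup (up n i d) m = lookup d m + (if m \<le> n then i else 0)"
 by (simp only: up_def lookup_add lookup_sum_single)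

lemma up_simps [simp]: "up n 0 d = d" "up n i (up n j d) = up n (i + j) d"
 by (rule poly_mapping_eqI; simp add: lookup_up)+

lemma up_inj: "up n i d = up n j d \<longleftrightarrow> i = j"
proof
 assume "up n i d = up n j d"
 then have "lookup (up n i d) 0 = lookup (up n j d) 0" by simp
 then show "i = j" by (simp add: lookup_up)
qed simp

lemma keys_up: "keys d \<subseteq> keys (up n i d)"
 by (auto simp: in_keys_iff lookup_up)

lemma up_cases:
 "(\<exists>i\<le>n. lookup d i = 0) \<or> (\<exists>d'. d = up n 1 d')"
proof (cases "\<exists>i\<le>n. lookup d i = 0")
 case False
 have "d = up n 1 (d - (\<Sum>m\<le>n. single m 1))"
 proof (rule poly_mapping_eqI)
  fix m
  have "m \<le> n \<longrightarrow> lookup d m \<noteq> 0" using False by auto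
  then show "lookup d m = lookup (up n 1 (d - (\<Sum>m\<le>n. single m 1))) m"
   unfolding lookup_up lookup_minus lookup_sum_single by auto
 qed
 then show ?thesis by blast
qed simp

text \<open>
 Since \<open>z\<^sub>0 \<cdots> z\<^sub>n = \<plusminus> T\<close> in the quotient, the normal form of \<open>f\<close> collects the coefficients along
 the diagonals \<open>d + i (1, \<dots>, 1)\<close>; the same sums give the quotient by the relation.
\<close>

definition diag_sum :: "nat \<Rightarrow> tate \<Rightarrow> (nat \<Rightarrow>\<^sub>0 nat) \<Rightarrow> int \<Rightarrow> real" where
 "diag_sum n f d k = (\<Sum>i\<in>{i. f (up n i d) $$ (k - int (n + 1) * int i) \<noteq> 0}.
   simplex_sign n ^ i * f (up n i d) $$ (k - int (n + 1) * int i))"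

lemma diag_sum_finite:
 assumes f: "f \<in> TC n"
 shows "finite {i. f (up n i d) $$ (k - int (n + 1) * int i) \<noteq> 0}"
proof (rule finite_imageD)
 show "finite ((\<lambda>i. up n i d) ` {i. f (up n i d) $$ (k - int (n + 1) * int i) \<noteq> 0})"
 proof (rule finite_subset[OF _ tate_finite[OF f, of "k + 1"]], clarify)
  fix i assume "f (up n i d) $$ (k - int (n + 1) * int i) \<noteq> 0"
  moreover have "k - int (n + 1) * int i < k + 1" by (simp add: add_strict_increasing)
  ultimately show "\<exists>ka<k + 1. f (up n i d) $$ ka \<noteq> 0" by blast
 qed
qed (simp add: inj_on_def up_inj)

text \<open>Splitting off the first term of the diagonal; this one-step recursion is exactly the
  identity of division with remainder.\<close>

lemma diag_sum_rec:
 assumes f: "f \<in> TC n"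
 shows "diag_sum n f d k = f d $$ k + simplex_sign n * diag_sum n f (up n 1 d) (k - int (n + 1))"
proof -
 let ?t = "\<lambda>i. simplex_sign n ^ i * f (up n i d) $$ (k - int (n + 1) * int i)"
 let ?u = "\<lambda>i. simplex_sign n ^ i * f (up n i (up n 1 d)) $$ (k - int (n + 1) - int (n + 1) * int i)"
 let ?A = "{i. f (up n i d) $$ (k - int (n + 1) * int i) \<noteq> 0}"
 let ?B = "{i. f (up n i (up n 1 d)) $$ (k - int (n + 1) - int (n + 1) * int i) \<noteq> 0}"
 have "finite (?A \<union> ?B)" using diag_sum_finite[OF f] by blast
 then obtain M where M: "?A \<union> ?B \<subseteq> {..M}" using finite_nat_iff_bounded_le by blast
 have "diag_sum n f d k = sum ?t {..Suc M}"
  unfolding diag_sum_def by (rule sum.mono_neutral_left) (use M in auto)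
 also have "\<dots> = ?t 0 + (\<Sum>i\<le>M. ?t (Suc i))" by (rule sum.atMost_Suc_shift)
 also have "(\<Sum>i\<le>M. ?t (Suc i)) = (\<Sum>i\<le>M. simplex_sign n * ?u i)"
  by (intro sum.cong refl) (simp add: algebra_simps)
 also have "\<dots> = simplex_sign n * sum ?u {..M}" by (simp only: sum_distrib_left)
 also have "sum ?u {..M} = diag_sum n f (up n 1 d) (k - int (n + 1))"
  unfolding diag_sum_def by (rule sum.mono_neutral_right) (use M in auto)
 finally show ?thesis by simp
qed

lemma diag_sum_nonzero:
 "diag_sum n f d k \<noteq> 0 \<Longrightarrow> \<exists>i. f (up n i d) $$ (k - int (n + 1) * int i) \<noteq> 0"
 unfolding diag_sum_def by (drule sum_nonzero) auto

definition diag_fls :: "nat \<Rightarrow> tate \<Rightarrow> (nat \<Rightarrow>\<^sub>0 nat) \<Rightarrow> real fls" where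
 "diag_fls n f d = Abs_fls (diag_sum n f d)"

lemma diag_fls_nth:
 assumes f: "f \<in> TC n"
 shows "diag_fls n f d $$ k = diag_sum n f d k"
proof -
 obtain B where B: "\<And>d k. f d $$ k \<noteq> 0 \<Longrightarrow> B \<le> k" using tate_bound[OF f] by blast
 have "diag_sum n f d k = 0" if "k < B" for k
 proof (rule ccontr)
  assume "diag_sum n f d k \<noteq> 0"
  then obtain i where "f (up n i d) $$ (k - int (n + 1) * int i) \<noteq> 0" using diag_sum_nonzero by blast
  then have "B \<le> k - int (n + 1) * int i" by (rule B)
  also have "\<dots> \<le> k" by simp
  finally show False using that by simp
 qed
 then show ?thesis unfolding diag_fls_def by (intro nth_Abs_fls_ex_lower_bound) blast
qed

text \<open>Serves both results of the division: the remainder with \<open>j = 0\<close>, the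
  quotient with \<open>j = 1\<close>. A nonzero diagonal sum stems from a coefficient of
  \<open>f\<close> of no larger order further up, and only finitely many \<open>d\<close> lie below
  those.\<close>

lemma diag_fls_carrier:
 assumes f: "f \<in> TC n"
  and h: "\<And>d k. h d $$ k \<noteq> 0 \<Longrightarrow> diag_sum n f (up n j d) k \<noteq> 0"
 shows "h \<in> TC n"
proof -
 have h': "\<exists>i. f (up n i d) $$ (k - int (n + 1) * int (i - j)) \<noteq> 0 \<and> j \<le> i" if hk: "h d $$ k \<noteq> 0" for d k
  using diag_sum_nonzero[OF h[OF hk]] by (metis add_diff_cancel_right' le_add2 up_simps(2))
 show ?thesis
  unfolding tate_carrier
 proof (intro conjI allI impI)
  fix d assume "h d \<noteq> 0"
  then obtain k where "h d $$ k \<noteq> 0" using nth_fls_subdegree_nonzero by blast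
  then obtain i where "f (up n i d) \<noteq> 0" using h' by force
  then show "keys d \<subseteq> {..n}" using tate_keys[OF f] keys_up by blast
 next
  fix K
  let ?D = "{d. \<exists>k<K. f d $$ k \<noteq> 0}"
  have "finite (\<Union>d\<in>?D. fst ` {(a, b). a + b = d})"
   using tate_finite[OF f] finite_sum_pairs by (intro finite_UN_I finite_imageI) auto
  then show "finite {d. \<exists>k<K. h d $$ k \<noteq> 0}"
  proof (rule finite_subset[rotated], clarify)
   fix d k assume "k < K" "h d $$ k \<noteq> 0"
   then obtain i where i: "f (up n i d) $$ (k - int (n + 1) * int (i - j)) \<noteq> 0" using h' by blast
   have "k - int (n + 1) * int (i - j) \<le> k" by simp
   then have "k - int (n + 1) * int (i - j) < K" using \<open>k < K\<close> by (rule le_less_trans)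
   then have "up n i d \<in> ?D" using i by blast
   moreover have "d \<in> fst ` {(a, b). a + b = up n i d}"
    by (intro image_eqI[of _ _ "(d, \<Sum>m\<le>n. single m i)"]) (auto simp: up_def)
   ultimately show "d \<in> (\<Union>d\<in>?D. fst ` {(a, b). a + b = d})" by blast
  qed
 qed
qed

definition normal_tate :: "nat \<Rightarrow> tate \<Rightarrow> bool" where
 "normal_tate n f \<longleftrightarrow> (\<forall>d. f d \<noteq> 0 \<longrightarrow> (\<exists>i\<le>n. lookup d i = 0))"

definition tate_nf :: "nat \<Rightarrow> tate \<Rightarrow> tate" where
 "tate_nf n f d = (if \<exists>i\<le>n. lookup d i = 0 then diag_fls n f d else 0)"

definition simplex_relation :: "nat \<Rightarrow> tate" where
 "simplex_relation n = tate_monom ((-1) ^ (n * (n + 1) div 2)) (\<Sum>i\<le>n. single i 1)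
    \<ominus>\<^bsub>TA n\<^esub> tate_monom (T_R n) 0"

lemma keys_ones: "keys (\<Sum>i\<le>n. single i (1::nat)) \<subseteq> {..n::nat}"
proof
 fix m assume "m \<in> keys (\<Sum>i\<le>n. single i (1::nat))"
 then show "m \<in> {..n}"
  using lookup_sum_single[where g = "\<lambda>_. 1::nat" and n = n and m = m] by (auto simp: in_keys_iff split: if_splits)
qed

lemma const_sign: "((-1) ^ (n * (n + 1) div 2) :: real fls) = fls_const (simplex_sign n)"
proof -
 have "(-1 :: real fls) = fls_const (-1)" by (rule fls_eqI) simp
 then show ?thesis by (simp add: simplex_sign_def minus_one_power_iff)
qed

lemma simplex_relation_carrier: "simplex_relation n \<in> TC n"
proof -
 interpret cring "TA n" by (rule cring_tate)
 show ?thesis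
  unfolding simplex_relation_def by (intro minus_closed tate_monom_carrier keys_ones) simp
qed

lemma tate_nf:
 assumes f: "f \<in> TC n"
 shows "tate_nf n f \<in> TC n" "normal_tate n (tate_nf n f)"
  "\<exists>h\<in>TC n. f = tate_nf n f \<oplus>\<^bsub>TA n\<^esub> h \<otimes>\<^bsub>TA n\<^esub> simplex_relation n"
proof -
 let ?s = "simplex_sign n" and ?Z = "\<Sum>i\<le>n. single i (1::nat)"
 let ?x = "tate_monom (fls_const ?s) ?Z" and ?y = "tate_monom (T_R n) 0"
 show nc: "tate_nf n f \<in> TC n"
  by (rule diag_fls_carrier[OF f, where j = 0])
   (auto simp: tate_nf_def diag_fls_nth[OF f] split: if_splits)
 show "normal_tate n (tate_nf n f)" by (auto simp: normal_tate_def tate_nf_def)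
 \<comment> \<open>The quotient consists of the diagonal sums started one step higher; the sign is
   its own inverse and compensates the coefficient of \<open>z_0 ... z_n\<close>.\<close>
 define h where "h d = fls_const ?s * diag_fls n f (up n 1 d)" for d
 have hn: "h d $$ k = ?s * diag_sum n f (up n 1 d) k" for d k
  by (simp add: h_def diag_fls_nth[OF f])
 have hc: "h \<in> TC n"
  by (rule diag_fls_carrier[OF f, where j = 1]) (auto simp: hn)
 have g0: "simplex_relation n = (\<lambda>d. ?x d - ?y d)"
  unfolding simplex_relation_def const_sign by (intro tate_minus tate_monom_carrier keys_ones) simp
 have prod: "(h \<otimes>\<^bsub>TA n\<^esub> simplex_relation n) d
   = (h \<otimes>\<^bsub>TA n\<^esub> ?x) d - (h \<otimes>\<^bsub>TA n\<^esub> ?y) d" for d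
  unfolding g0 tate_ops by (simp add: case_prod_unfold right_diff_distrib sum_subtractf)
 have y: "(h \<otimes>\<^bsub>TA n\<^esub> ?y) d $$ k = ?s * diag_sum n f (up n 1 d) (k - int (n + 1))" for d k
 proof -
  have "(h \<otimes>\<^bsub>TA n\<^esub> ?y) d = h d * fls_X ^ (n + 1)"
   using tate_mult_monom(1)[of n h "T_R n" 0 d] unfolding T_R_def add_0_right .
  moreover have "k + - int (n + 1) = k - int (n + 1)" by simp
  ultimately show ?thesis by (simp only: fls_X_power_times_conv_shift(2) fls_shift_nth hn)
 qed
 have "f d $$ k = (tate_nf n f \<oplus>\<^bsub>TA n\<^esub> h \<otimes>\<^bsub>TA n\<^esub> simplex_relation n) d $$ k" for d k
 proof (cases "\<exists>i\<le>n. lookup d i = 0")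
  case True
  then obtain i where i: "i \<le> n" "lookup d i = 0" by blast
  have "\<nexists>a. d = a + ?Z"
  proof
   assume "\<exists>a. d = a + ?Z"
   then obtain a where "d = a + ?Z" ..
   then show False using i lookup_up[of n 1 a i] by (simp add: up_def)
  qed
  then have "(h \<otimes>\<^bsub>TA n\<^esub> ?x) d = 0" by (rule tate_mult_monom(2))
  then show ?thesis
   using True diag_sum_rec[OF f, of d k] y[of d k]
   by (simp add: tate_ops(3) prod tate_nf_def diag_fls_nth[OF f])
 next
  case False
  then obtain d' where d': "d = up n 1 d'" using up_cases by blast
  have "(h \<otimes>\<^bsub>TA n\<^esub> ?x) d = h d' * fls_const ?s"
   using tate_mult_monom(1)[of n h "fls_const ?s" ?Z d'] by (simp add: d' up_def)
  then have "(h \<otimes>\<^bsub>TA n\<^esub> ?x) d $$ k = diag_sum n f d k"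
   using simplex_sign(1)[of n] by (simp add: hn d' mult.assoc[symmetric] mult.commute)
  moreover have "tate_nf n f d = 0" using False by (simp only: tate_nf_def if_False)
  ultimately show ?thesis
   using diag_sum_rec[OF f, of d k] y[of d k] by (simp add: tate_ops(3) prod)
 qed
 then have "f = tate_nf n f \<oplus>\<^bsub>TA n\<^esub> h \<otimes>\<^bsub>TA n\<^esub> simplex_relation n"
  by (intro ext fls_eqI)
 then show "\<exists>h\<in>TC n. f = tate_nf n f \<oplus>\<^bsub>TA n\<^esub> h \<otimes>\<^bsub>TA n\<^esub> simplex_relation n"
  using hc by blast
qed

section \<open>Laurent series with exponents in the lattice\<close>

type_synonym amb = "((nat \<Rightarrow>\<^sub>0 int) \<Rightarrow>\<^sub>0 real) fls"

definition cf :: "nat \<Rightarrow> amb \<Rightarrow> (nat \<Rightarrow>\<^sub>0 int) \<Rightarrow> real" where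
 "cf n a v = lookup (a $$ dgr n v) v"

definition mon :: "nat \<Rightarrow> (nat \<Rightarrow>\<^sub>0 int) \<Rightarrow> real \<Rightarrow> amb" where
 "mon n v c = fls_shift (- dgr n v) (fls_const (single v c))"

text \<open>The Laurent variable merely records the total degree of the exponent, to make infinite
  sums and products meaningful. For such elements the coefficients \<open>cf\<close> contain
  everything.\<close>

definition diag :: "nat \<Rightarrow> amb \<Rightarrow> bool" where
 "diag n a \<longleftrightarrow> (\<forall>p v. lookup (a $$ p) v \<noteq> 0 \<longrightarrow> p = dgr n v)"

lemma dgr_add: "dgr n (v + w) = dgr n v + dgr n w" and dgr_diff: "dgr n (v - w) = dgr n v - dgr n w"
 and dgr_zero: "dgr n 0 = 0"
 by (simp_all add: dgr_def lookup_add lookup_minus sum.distrib sum_subtractf)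

lemma cf_add: "cf n (a + b) v = cf n a v + cf n b v"
 and cf_diff: "cf n (a - b) v = cf n a v - cf n b v"
 and cf_uminus: "cf n (- a) v = - cf n a v"
 and cf_zero: "cf n 0 v = 0"
 by (simp_all add: cf_def lookup_add lookup_minus)

lemma cf_sum: "cf n (\<Sum>x\<in>A. f x) v = (\<Sum>x\<in>A. cf n (f x) v)"
 by (simp add: cf_def fls_nth_sum lookup_sum)

lemma diag_zero: "diag n 0"
 by (simp add: diag_def)

lemma diag_add: "diag n a \<Longrightarrow> diag n b \<Longrightarrow> diag n (a + b)"
 unfolding diag_def fls_plus_nth lookup_add by (metis add.left_neutral)

lemma diag_sum: "(\<And>x. x \<in> A \<Longrightarrow> diag n (f x)) \<Longrightarrow> diag n (\<Sum>x\<in>A. f x)"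
 by (induction A rule: infinite_finite_induct) (auto intro: diag_zero diag_add)

lemma diag_eqI:
 assumes "diag n a" "diag n b" "\<And>v. cf n a v = cf n b v"
 shows "a = b"
proof (rule fls_eqI, rule poly_mapping_eqI)
 fix p v
 show "lookup (a $$ p) v = lookup (b $$ p) v"
  using assms(1,2)[unfolded diag_def, rule_format, of p v] assms(3)[of v] unfolding cf_def by metis
qed

lemma lookup_single_times:
 fixes q :: "(nat \<Rightarrow>\<^sub>0 int) \<Rightarrow>\<^sub>0 real"
 shows "lookup (single v c * q) x = c * lookup q (x - v)"
proof -
 have "single v c * q = single v c * (\<Sum>a\<in>keys q. single a (lookup q a))"
 proof -
  have "(\<Sum>a\<in>keys q. single a (lookup q a)) = q"
   by (rule poly_mapping_eqI) (simp add: lookup_sum lookup_single when_def in_keys_iff)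
  then show ?thesis by simp
 qed
 also have "lookup \<dots> x
   = (\<Sum>a\<in>keys q. if a = x - v then c * lookup q a else 0)"
  unfolding sum_distrib_left lookup_sum mult_single lookup_single
  by (intro sum.cong refl) (auto simp: when_def algebra_simps)
 also have "\<dots> = c * lookup q (x - v)"
  by (simp add: in_keys_iff)
 finally show ?thesis .
qed

lemma mon_times_nth: "(mon n v c * a) $$ p = single v c * a $$ (p - dgr n v)"
 by (simp add: mon_def fls_shifted_times_simps)

lemma cf_mon_times: "cf n (mon n v c * a) x = c * cf n a (x - v)"
 unfolding cf_def mon_times_nth lookup_single_times dgr_diff ..

lemma diag_mon_times: "diag n a \<Longrightarrow> diag n (mon n v c * a)"
 unfolding diag_def mon_times_nth lookup_single_times
 by (metis diff_add_cancel dgr_diff mult_zero_right add_diff_cancel)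

lemma mon_nth: "mon n v c $$ p = (if p = dgr n v then single v c else 0)"
 by (simp add: mon_def)

lemma mon_times_mon: "mon n v c * mon n w d = mon n (v + w) (c * d)"
 by (rule fls_eqI) (auto simp: mon_times_nth mon_nth mult_single dgr_add)

lemma mon_0_1: "mon n 0 1 = 1"
 by (rule fls_eqI) (simp add: mon_nth dgr_zero)

lemma cf_mon: "cf n (mon n v c) x = (if x = v then c else 0)"
 by (auto simp: cf_def mon_nth lookup_single)

lemma mon_add: "mon n v (c + d) = mon n v c + mon n v d"
 by (rule fls_eqI) (simp add: mon_nth single_add)

lemma mon_uminus: "mon n v (- c) = - mon n v c"
 by (rule fls_eqI) (simp add: mon_nth single_uminus)

definition ev :: "nat \<Rightarrow> tate \<Rightarrow> amb" where
 "ev n = tser n (simplex_sign n) (tvec n)"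

lemma ev_ring:
 assumes "f \<in> TC n" "g \<in> TC n"
 shows "ev n (f \<oplus>\<^bsub>TA n\<^esub> g) = ev n f + ev n g"
  "ev n (f \<otimes>\<^bsub>TA n\<^esub> g) = ev n f * ev n g"
proof -
 show "ev n (f \<oplus>\<^bsub>TA n\<^esub> g) = ev n f + ev n g"
  unfolding ev_def tate_ops(3) by (rule tser_add[OF assms])
 show "ev n (f \<otimes>\<^bsub>TA n\<^esub> g) = ev n f * ev n g"
  unfolding ev_def by (rule tser_mult[OF assms simplex_sign(2)]) (rule tvec_add)
qed

lemma tvec_0: "tvec n 0 = 0"
 by (rule poly_mapping_eqI) (simp add: zero_prod_def lookup_tvec)

lemma ev_one: "ev n \<one>\<^bsub>TA n\<^esub> = 1"
 unfolding ev_def by (rule tser_one) (rule tvec_0)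

lemma ev_zero: "ev n \<zero>\<^bsub>TA n\<^esub> = 0"
 unfolding ev_def tate_ops by (rule tser_zero)

lemma ev_monom:
 assumes "\<And>j. r $$ j = (if j = k then a else 0)"
 shows "ev n (tate_monom r d) = mon n (tvec n (k, d)) (simplex_sign n ^ lookup d 0 * a)"
 by (rule fls_eqI) (simp add: ev_def tser_monom[OF assms] mon_nth dgr_tvec)

lemma diag_ev: "f \<in> TC n \<Longrightarrow> diag n (ev n f)"
 unfolding diag_def ev_def tser_def
proof (intro allI impI)
 fix p v assume f: "f \<in> TC n"
  and nz: "lookup (series (tgr n) (tvec n) (tcoef (simplex_sign n) f) $$ p) v \<noteq> 0"
 from graded_finite_tcoef[OF f] nz show "p = dgr n v"
 proof (rule series_lookup_nonzero)
  fix a assume "tgr n a = p" "tvec n a = v"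
  then show "p = dgr n v" using dgr_tvec[of n a] by simp
 qed
qed

lemma cf_ev_nonzero:
 assumes f: "f \<in> TC n" and "cf n (ev n f) v \<noteq> 0"
 shows "\<exists>k d. f d $$ k \<noteq> 0 \<and> tvec n (k, d) = v"
proof -
 have "lookup (series (tgr n) (tvec n) (tcoef (simplex_sign n) f) $$ dgr n v) v \<noteq> 0"
  using assms(2) by (simp add: cf_def ev_def tser_def)
 from graded_finite_tcoef[OF f] this show ?thesis
 proof (rule series_lookup_nonzero)
  fix a assume a: "tcoef (simplex_sign n) f a \<noteq> 0" "tvec n a = v"
  then have "f (snd a) $$ fst a \<noteq> 0" by (auto simp: tcoef_def case_prod_unfold)
  then show ?thesis using a(2) by (intro exI[of _ "fst a"] exI[of _ "snd a"]) simp
 qed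
qed

text \<open>When some \<open>d i\<close> with \<open>i\<close> at most \<open>n\<close> vanishes,
  \<open>k\<close> is the least component of the exponent, and then \<open>d\<close> is
  determined.\<close>

lemma tvec_inj:
 assumes eq: "tvec n (k, d) = tvec n (k', d')"
  and d: "keys d \<subseteq> {..n}" "\<exists>i\<le>n. lookup d i = 0"
  and d': "keys d' \<subseteq> {..n}" "\<exists>i\<le>n. lookup d' i = 0"
 shows "(k, d) = (k', d')"
proof -
 have e: "k + int (n + 1) * int (lookup d i) = k' + int (n + 1) * int (lookup d' i)"
  if "i \<le> n" for i
  using arg_cong[OF eq, of "\<lambda>v. lookup v i"] that by (simp add: lookup_tvec)
 obtain i j where i: "i \<le> n" "lookup d i = 0" and j: "j \<le> n" "lookup d' j = 0"
  using d d' by blast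
 have nn: "0 \<le> int (n + 1) * int m" for m by simp
 have "k = k' + int (n + 1) * int (lookup d' i)"
  using e[OF i(1)] unfolding i(2) by (simp only: of_nat_0 mult_zero_right add_0_right)
 moreover have "k + int (n + 1) * int (lookup d j) = k'"
  using e[OF j(1)] unfolding j(2) by (simp only: of_nat_0 mult_zero_right add_0_right)
 ultimately have k: "k = k'" using nn[of "lookup d' i"] nn[of "lookup d j"] by linarith
 have "d = d'"
 proof (rule poly_mapping_eqI)
  fix i
  show "lookup d i = lookup d' i"
  proof (cases "i \<le> n")
   case True
   have "int (n + 1) * int (lookup d i) = int (n + 1) * int (lookup d' i)"
    using e[OF True] unfolding k by simp
   then show ?thesis unfolding mult_cancel_left by simp
  next
   case False
   then have "i \<notin> keys d" "i \<notin> keys d'" using d d' by auto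
   then show ?thesis by (simp add: in_keys_iff)
  qed
 qed
 then show ?thesis using k by simp
qed

lemma normal_support:
 assumes "f \<in> TC n" "normal_tate n f" "f d $$ k \<noteq> 0"
 shows "keys d \<subseteq> {..n}" "\<exists>i\<le>n. lookup d i = 0"
proof -
 have "f d \<noteq> 0" using assms(3) by auto
 then show "keys d \<subseteq> {..n}" "\<exists>i\<le>n. lookup d i = 0"
  using tate_keys[OF assms(1)] assms(2) by (auto simp: normal_tate_def)
qed

lemma ev_inj_normal:
 assumes f: "f \<in> TC n" "normal_tate n f"
  and g: "g \<in> TC n" "normal_tate n g" and eq: "ev n f = ev n g"
 shows "f = g"
proof (rule tser_inj[OF f(1) g(1) simplex_sign(2)[of n], where \<theta> = "tvec n"])
 show "tser n (simplex_sign n) (tvec n) f = tser n (simplex_sign n) (tvec n) g"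
  using eq by (simp add: ev_def)
 fix k d k' d'
 assume a: "f d $$ k \<noteq> 0 \<or> g d $$ k \<noteq> 0" "f d' $$ k' \<noteq> 0 \<or> g d' $$ k' \<noteq> 0" "tvec n (k, d) = tvec n (k', d')"
 have "keys d \<subseteq> {..n} \<and> (\<exists>i\<le>n. lookup d i = 0)"
  using a(1) normal_support[OF f, of d k] normal_support[OF g, of d k] by blast
 moreover have "keys d' \<subseteq> {..n} \<and> (\<exists>i\<le>n. lookup d' i = 0)"
  using a(2) normal_support[OF f, of d' k'] normal_support[OF g, of d' k'] by blast
 ultimately show "(k, d) = (k', d')" using tvec_inj[OF a(3)] by blast
qed

lemma cf_ev_normal:
 assumes f: "f \<in> TC n" "normal_tate n f"
  and d: "keys d \<subseteq> {..n}" "\<exists>i\<le>n. lookup d i = 0"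
 shows "cf n (ev n f) (tvec n (k, d)) = simplex_sign n ^ lookup d 0 * f d $$ k"
proof -
 have "b = (k, d)" if b: "tcoef (simplex_sign n) f b \<noteq> 0" "tvec n b = tvec n (k, d)" for b
 proof (cases b)
  case (Pair k' d')
  then have "f d' $$ k' \<noteq> 0" using b by (auto simp: tcoef_def)
  then show ?thesis using tvec_inj[of n k' d' k d] normal_support[OF f, of d' k'] b(2) d unfolding Pair by blast
 qed
 from series_lookup[OF graded_finite_tcoef[OF f(1)], of "simplex_sign n" "tvec n" "(k, d)", OF this]
 show ?thesis by (simp add: cf_def ev_def tser_def dgr_tvec tcoef_def)
qed

text \<open>Both monomials have exponent \<open>(n + 1, ..., n + 1)\<close>; the sign in the
  relation and the one from rescaling \<open>z_0\<close> multiply to 1.\<close>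

lemma ev_simplex_relation: "ev n (simplex_relation n) = 0"
proof -
 interpret cring "TA n" by (rule cring_tate)
 let ?Z = "\<Sum>i\<le>n. single i (1::nat)"
 let ?x = "tate_monom (fls_const (simplex_sign n)) ?Z" and ?y = "tate_monom (T_R n) 0"
 have xy: "?x \<in> TC n" "?y \<in> TC n"
  by (rule tate_monom_carrier, rule keys_ones) (rule tate_monom_carrier, simp)
 have "tvec n (0, ?Z) = tvec n (int (n + 1), 0)"
  by (rule poly_mapping_eqI) (simp add: lookup_tvec lookup_sum_single)
 moreover have "lookup ?Z 0 = 1" by (simp add: lookup_sum_single)
 moreover have "T_R n $$ j = (if j = int (n + 1) then 1 else 0)" for j
  unfolding T_R_def by (rule fls_X_power_nth)
 ultimately have "ev n ?x = ev n ?y"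
  using ev_monom[of "fls_const (simplex_sign n)" 0 "simplex_sign n" n ?Z]
   ev_monom[of "T_R n" "int (n + 1)" 1 n 0] by (simp add: simplex_sign(1))
 moreover have "ev n (?x \<ominus>\<^bsub>TA n\<^esub> ?y) + ev n ?y = ev n ?x"
  using ev_ring(1)[OF minus_closed[OF xy] xy(2)] xy by (simp add: minus_eq a_assoc l_neg)
 ultimately show ?thesis unfolding simplex_relation_def const_sign by simp
qed

text \<open>Modulo the relation every element has a normal form, and \<open>ev\<close> is injective
  on normal forms, so the kernel contains nothing but multiples of the relation.\<close>

lemma S_ideal_eq: "S_ideal n = {f \<in> TC n. ev n f = 0}"
proof -
 interpret cring "TA n" by (rule cring_tate)
 have I: "S_ideal n = PIdl\<^bsub>TA n\<^esub> (simplex_relation n)"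
  unfolding S_ideal_def simplex_relation_def[symmetric]
  by (rule cgenideal_eq_genideal[OF simplex_relation_carrier, symmetric])
 show ?thesis
  unfolding I cgenideal_def
 proof (intro equalityI subsetI)
  fix f assume "f \<in> {x \<otimes>\<^bsub>TA n\<^esub> simplex_relation n |x. x \<in> TC n}"
  then obtain x where x: "x \<in> TC n" "f = x \<otimes>\<^bsub>TA n\<^esub> simplex_relation n" by blast
  then show "f \<in> {f \<in> TC n. ev n f = 0}"
   using simplex_relation_carrier by (simp add: ev_ring(2) ev_simplex_relation)
 next
  fix f assume "f \<in> {f \<in> TC n. ev n f = 0}"
  then have f: "f \<in> TC n" "ev n f = 0" by auto
  obtain h where h: "h \<in> TC n"
   "f = tate_nf n f \<oplus>\<^bsub>TA n\<^esub> h \<otimes>\<^bsub>TA n\<^esub> simplex_relation n"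
   using tate_nf(3)[OF f(1)] by blast
  have hc: "h \<otimes>\<^bsub>TA n\<^esub> simplex_relation n \<in> TC n"
   using h(1) simplex_relation_carrier by simp
  have "ev n f = ev n (tate_nf n f) + ev n h * ev n (simplex_relation n)"
   by (subst h(2), subst ev_ring(1)[OF tate_nf(1)[OF f(1)] hc], subst ev_ring(2)[OF h(1) simplex_relation_carrier]) (rule refl)
  then have "ev n (tate_nf n f) = ev n \<zero>\<^bsub>TA n\<^esub>" using f(2) by (simp add: ev_simplex_relation ev_zero)
  moreover have "normal_tate n \<zero>\<^bsub>TA n\<^esub>" by (simp add: normal_tate_def tate_ops)
  ultimately have "tate_nf n f = \<zero>\<^bsub>TA n\<^esub>"
   using ev_inj_normal[OF tate_nf(1,2)[OF f(1)] zero_closed] by blast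
  then have "f = h \<otimes>\<^bsub>TA n\<^esub> simplex_relation n" using h(2) hc by simp
  then show "f \<in> {x \<otimes>\<^bsub>TA n\<^esub> simplex_relation n |x. x \<in> TC n}" using h(1) by blast
 qed
qed

section \<open>The ring \<open>S\<close> inside the ambient series\<close>

definition S_cls :: "nat \<Rightarrow> tate \<Rightarrow> tate set" where
 "S_cls n f = S_ideal n +>\<^bsub>TA n\<^esub> f"

definition iota :: "nat \<Rightarrow> tate set \<Rightarrow> amb" where
 "iota n X = ev n (SOME f. f \<in> X)"

lemma ideal_S_ideal: "ideal (S_ideal n) (TA n)"
proof -
 interpret cring "TA n" by (rule cring_tate)
 show ?thesis unfolding S_ideal_def by (rule genideal_ideal) (use simplex_relation_carrier in \<open>simp add: simplex_relation_def\<close>)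
qed

lemma cring_S: "cring (S_ring n)"
 unfolding S_ring_def by (rule ideal.quotient_is_cring[OF ideal_S_ideal cring_tate])

lemma S_cls_eq: "f \<in> TC n \<Longrightarrow> S_cls n f = {g \<in> TC n. ev n g = ev n f}"
 unfolding S_cls_def
 by (rule a_r_coset_fiber[where K = "ev n"])
  (use S_ideal_eq ev_ring cring_tate[of n] in \<open>auto simp: cring_def ring_def\<close>)

lemma S_carrier: "X \<in> SC n \<longleftrightarrow> (\<exists>f\<in>TC n. X = S_cls n f)"
 by (auto simp: S_ring_def FactRing_def A_RCOSETS_def' S_cls_def)

lemma iota_S_cls:
 assumes "f \<in> TC n"
 shows "iota n (S_cls n f) = ev n f"
proof -
 have "(SOME g. g \<in> S_cls n f) \<in> S_cls n f" by (rule someI[of _ f]) (simp add: S_cls_eq assms)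
 then show ?thesis unfolding iota_def by (simp add: S_cls_eq assms)
qed

lemma S_cls_ring:
 assumes f: "f \<in> TC n" and g: "g \<in> TC n"
 shows "S_cls n f \<oplus>\<^bsub>S_ring n\<^esub> S_cls n g = S_cls n (f \<oplus>\<^bsub>TA n\<^esub> g)"
  "S_cls n f \<otimes>\<^bsub>S_ring n\<^esub> S_cls n g = S_cls n (f \<otimes>\<^bsub>TA n\<^esub> g)"
 using ring_hom_add[OF ideal.rcos_ring_hom[OF ideal_S_ideal] f g]
  ring_hom_mult[OF ideal.rcos_ring_hom[OF ideal_S_ideal] f g]
 by (simp_all add: S_cls_def S_ring_def)

lemma iota_ring:
 assumes "s \<in> SC n" "t \<in> SC n"
 shows "iota n (s \<oplus>\<^bsub>S_ring n\<^esub> t) = iota n s + iota n t" "iota n (s \<otimes>\<^bsub>S_ring n\<^esub> t) = iota n s * iota n t"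
proof -
 interpret T: cring "TA n" by (rule cring_tate)
 obtain f g where "f \<in> TC n" "s = S_cls n f" "g \<in> TC n" "t = S_cls n g"
  using assms unfolding S_carrier by blast
 then show "iota n (s \<oplus>\<^bsub>S_ring n\<^esub> t) = iota n s + iota n t" "iota n (s \<otimes>\<^bsub>S_ring n\<^esub> t) = iota n s * iota n t"
  by (simp_all add: S_cls_ring iota_S_cls ev_ring)
qed

lemma iota_inj:
 assumes "s \<in> SC n" "t \<in> SC n" "iota n s = iota n t"
 shows "s = t"
proof -
 obtain f g where fg: "f \<in> TC n" "s = S_cls n f" "g \<in> TC n" "t = S_cls n g"
  using assms unfolding S_carrier by blast
 then have "ev n f = ev n g" using assms(3) by (simp add: iota_S_cls)
 then show ?thesis using fg by (simp add: S_cls_eq)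
qed

lemma iota_zero: "iota n \<zero>\<^bsub>S_ring n\<^esub> = 0"
proof -
 interpret cring "S_ring n" by (rule cring_S)
 show ?thesis using iota_ring(1)[OF zero_closed zero_closed] by simp
qed

lemma iota_eq_0_iff: "s \<in> SC n \<Longrightarrow> iota n s = 0 \<longleftrightarrow> s = \<zero>\<^bsub>S_ring n\<^esub>"
 using iota_inj[of s n "\<zero>\<^bsub>S_ring n\<^esub>"] iota_zero[of n] cring.cring_simprules(2)[OF cring_S] by auto

lemma iota_uminus: "s \<in> SC n \<Longrightarrow> iota n (\<ominus>\<^bsub>S_ring n\<^esub> s) = - iota n s"
proof -
 interpret cring "S_ring n" by (rule cring_S)
 assume s: "s \<in> SC n"
 show ?thesis using iota_ring(1)[OF a_inv_closed[OF s] s] s by (simp add: l_neg iota_zero eq_neg_iff_add_eq_0)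
qed

lemma diag_iota: "s \<in> SC n \<Longrightarrow> diag n (iota n s)"
 unfolding S_carrier by (auto simp: iota_S_cls diag_ev)

lemma iota_one: "iota n \<one>\<^bsub>S_ring n\<^esub> = 1"
proof -
 interpret T: cring "TA n" by (rule cring_tate)
 have "\<one>\<^bsub>S_ring n\<^esub> = S_cls n \<one>\<^bsub>TA n\<^esub>" by (simp add: S_ring_def FactRing_def S_cls_def)
 then show ?thesis by (simp add: iota_S_cls ev_one)
qed

lemma S_const: "S_const n r = S_cls n (tate_monom r 0)" "S_const n r \<in> SC n"
proof -
 show e: "S_const n r = S_cls n (tate_monom r 0)" by (simp add: S_const_def S_cls_def)
 show "S_const n r \<in> SC n" unfolding e S_carrier using tate_monom_carrier[of 0 n r] by auto
qed

lemma iota_const: "iota n (S_const n (fls_const c)) = mon n 0 c"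
proof -
 have "tvec n (0, 0) = 0" using tvec_0 by (simp add: zero_prod_def)
 then show ?thesis
  using ev_monom[of "fls_const c" 0 c n 0] by (simp add: S_const iota_S_cls tate_monom_carrier)
qed

lemma iota_sqrt_T:
 "iota n (S_const n (sqrt_T_R n)) = mon n (\<Sum>i\<le>n. single i (half n)) 1"
proof -
 have "tvec n (half n, 0) = (\<Sum>i\<le>n. single i (half n))"
  by (rule poly_mapping_eqI) (simp add: lookup_tvec lookup_sum_single)
 then show ?thesis
  using ev_monom[of "sqrt_T_R n" "half n" 1 n 0]
  by (simp add: S_const iota_S_cls tate_monom_carrier sqrt_T_R_def)
qed

lemma S_var:
 assumes "i \<le> n"
 shows "S_var n i \<in> SC n"
  "iota n (S_var n i) = mon n (single i (int (n + 1))) (if i = 0 then simplex_sign n else 1)"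
proof -
 have c: "tate_monom 1 (single i 1) \<in> TC n"
  using assms by (intro tate_monom_carrier) simp
 have e: "S_var n i = S_cls n (tate_monom 1 (single i 1))" by (simp add: S_var_def S_cls_def)
 show "S_var n i \<in> SC n" unfolding e S_carrier using c by blast
 have "tvec n (0, single i 1) = single i (int (n + 1))"
  by (rule poly_mapping_eqI) (use assms in \<open>auto simp: lookup_tvec lookup_single when_def\<close>)
 then show "iota n (S_var n i) = mon n (single i (int (n + 1))) (if i = 0 then simplex_sign n else 1)"
  using ev_monom[of 1 0 1 n "single i 1"] c by (simp add: e iota_S_cls lookup_single)
qed

lemma S_support:
 assumes "s \<in> SC n" "cf n (iota n s) v \<noteq> 0"
 shows "\<exists>k d. v = tvec n (k, d)"
proof -
 obtain f where f: "f \<in> TC n" "s = S_cls n f" using assms unfolding S_carrier by blast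
 then have "cf n (ev n f) v \<noteq> 0" using assms(2) by (simp add: iota_S_cls)
 from cf_ev_nonzero[OF f(1) this] show ?thesis by blast
qed

lemma S_normal:
 assumes "s \<in> SC n"
 obtains f where "f \<in> TC n" "normal_tate n f" "s = S_cls n f" "S_coords n s = f"
proof -
 interpret T: cring "TA n" by (rule cring_tate)
 obtain g where g: "g \<in> TC n" "s = S_cls n g" using assms unfolding S_carrier by blast
 obtain h where h: "h \<in> TC n"
  "g = tate_nf n g \<oplus>\<^bsub>TA n\<^esub> h \<otimes>\<^bsub>TA n\<^esub> simplex_relation n"
  using tate_nf(3)[OF g(1)] by blast
 note f = tate_nf(1,2)[OF g(1)]
 have "ev n g = ev n (tate_nf n g) + ev n h * ev n (simplex_relation n)"
  by (subst h(2), subst ev_ring(1)[OF f(1)], simp add: h simplex_relation_carrier,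
    subst ev_ring(2)[OF h(1) simplex_relation_carrier]) (rule refl)
 then have e: "ev n g = ev n (tate_nf n g)" by (simp add: ev_simplex_relation)
 then have s: "s = S_cls n (tate_nf n g)" using g f by (simp add: S_cls_eq)
 have "S_coords n s = tate_nf n g"
  unfolding S_coords_def normal_tate_def[symmetric]
 proof (rule the_equality)
  show "tate_nf n g \<in> s \<and> normal_tate n (tate_nf n g)" using f by (simp add: s S_cls_eq)
  show "f' = tate_nf n g" if "f' \<in> s \<and> normal_tate n f'" for f'
   using that f ev_inj_normal[of f' n "tate_nf n g"] by (auto simp: s S_cls_eq)
 qed
 then show ?thesis using f s by (intro that)
qed

section \<open>Valuation and grading of \<open>S\<close>\<close>

definition val :: "nat \<Rightarrow> (nat \<Rightarrow> real) \<Rightarrow> (nat \<Rightarrow>\<^sub>0 int) \<Rightarrow> real" where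
 "val n \<zeta> v = (\<Sum>i\<le>n. of_int (lookup v i) * \<zeta> i / of_nat (n + 1))"

definition nu_amb :: "nat \<Rightarrow> (nat \<Rightarrow> real) \<Rightarrow> amb \<Rightarrow> ereal" where
 "nu_amb n \<zeta> a = (INF v\<in>{v. cf n a v \<noteq> 0}. ereal (val n \<zeta> v))"

text \<open>The components of \<zeta> add up to 1, so the common shift by \<open>k\<close>
  contributes \<open>k / (n + 1)\<close>.\<close>

lemma val_tvec:
 assumes "\<zeta> \<in> open_simplex n"
 shows "val n \<zeta> (tvec n (k, d)) = of_int k / of_nat (n + 1) + (\<Sum>i\<le>n. real (lookup d i) * \<zeta> i)"
proof -
 have "val n \<zeta> (tvec n (k, d)) = (\<Sum>i\<le>n. of_int k / of_nat (n + 1) * \<zeta> i + real (lookup d i) * \<zeta> i)"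
  unfolding val_def by (intro sum.cong refl) (simp add: lookup_tvec field_simps)
 also have "\<dots> = of_int k / of_nat (n + 1) * (\<Sum>i\<le>n. \<zeta> i) + (\<Sum>i\<le>n. real (lookup d i) * \<zeta> i)"
  by (simp only: sum.distrib sum_distrib_left)
 finally show ?thesis using assms by (simp add: open_simplex_def)
qed

lemma nu_R_eq_subdegree: "r \<noteq> 0 \<Longrightarrow> nu_R n r = ereal (of_int (fls_subdegree r) / of_nat (n + 1))"
 unfolding nu_R_def
 by (intro antisym INF_lower INF_greatest) (auto intro!: divide_right_mono fls_subdegree_leI)

lemma nu_R_zero: "nu_R n 0 = \<infinity>"
 by (simp add: nu_R_def top_ereal_def)

text \<open>For the normal form no two monomials share an exponent, so its coefficients are visible
  in the series up to sign; the infimum over each coefficient in \<open>R\<close> is attained at the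
  subdegree.\<close>

lemma nu_S_eq:
 assumes s: "s \<in> SC n" and \<zeta>: "\<zeta> \<in> open_simplex n"
 shows "nu_S n \<zeta> s = nu_amb n \<zeta> (iota n s)"
proof -
 obtain f where f: "f \<in> TC n" "normal_tate n f" "s = S_cls n f" "S_coords n s = f"
  using S_normal[OF s] .
 have i: "iota n s = ev n f" using f by (simp add: iota_S_cls)
 show ?thesis
  unfolding nu_S_def nu_amb_def i f(4)
 proof (rule antisym)
  show "(INF d. nu_R n (f d) + ereal (\<Sum>i\<le>n. real (lookup d i) * \<zeta> i))
    \<le> (INF v\<in>{v. cf n (ev n f) v \<noteq> 0}. ereal (val n \<zeta> v))"
  proof (rule INF_greatest)
   fix v assume "v \<in> {v. cf n (ev n f) v \<noteq> 0}"
   then obtain k d where kd: "f d $$ k \<noteq> 0" "tvec n (k, d) = v" using cf_ev_nonzero[OF f(1)] by blast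
   have "(INF d. nu_R n (f d) + ereal (\<Sum>i\<le>n. real (lookup d i) * \<zeta> i))
     \<le> nu_R n (f d) + ereal (\<Sum>i\<le>n. real (lookup d i) * \<zeta> i)" by (rule INF_lower) simp
   also have "nu_R n (f d) \<le> ereal (of_int k / of_nat (n + 1))"
    unfolding nu_R_def using kd(1) by (intro INF_lower) simp
   finally show "(INF d. nu_R n (f d) + ereal (\<Sum>i\<le>n. real (lookup d i) * \<zeta> i)) \<le> ereal (val n \<zeta> v)"
    by (simp add: kd(2)[symmetric] val_tvec[OF \<zeta>] add_right_mono)
  qed
  show "(INF v\<in>{v. cf n (ev n f) v \<noteq> 0}. ereal (val n \<zeta> v))
    \<le> (INF d. nu_R n (f d) + ereal (\<Sum>i\<le>n. real (lookup d i) * \<zeta> i))"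
  proof (rule INF_greatest)
   fix d
   show "(INF v\<in>{v. cf n (ev n f) v \<noteq> 0}. ereal (val n \<zeta> v))
     \<le> nu_R n (f d) + ereal (\<Sum>i\<le>n. real (lookup d i) * \<zeta> i)"
   proof (cases "f d = 0")
    case False
    let ?k = "fls_subdegree (f d)"
    have k: "f d $$ ?k \<noteq> 0" using False by simp
    have "cf n (ev n f) (tvec n (?k, d)) \<noteq> 0"
     using cf_ev_normal[OF f(1,2) normal_support[OF f(1,2) k]] k simplex_sign(2)[of n] by simp
    then have "(INF v\<in>{v. cf n (ev n f) v \<noteq> 0}. ereal (val n \<zeta> v)) \<le> ereal (val n \<zeta> (tvec n (?k, d)))"
     by (intro INF_lower) simp
    then show ?thesis using False by (simp add: nu_R_eq_subdegree val_tvec[OF \<zeta>])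
   qed (simp add: nu_R_zero)
  qed
 qed
qed

text \<open>Degrees are \<open>2 / (n + 1)\<close> times the sum of the exponent; the factors are
  cleared to remain in the integers.\<close>

lemma hom_S_iff:
 "hom_S n p s \<longleftrightarrow> s \<in> SC n \<and>
  (\<forall>v. cf n (iota n s) v \<noteq> 0 \<longrightarrow> 2 * dgr n v = int (n + 1) * p)"
proof -
 have tg: "2 * dgr n (tvec n (k, d)) = int (n + 1) * p \<longleftrightarrow> 2 * k = p - 2 * int (\<Sum>i\<le>n. lookup d i)"
  for k d
 proof -
  have "2 * dgr n (tvec n (k, d)) = int (n + 1) * (2 * k + 2 * int (\<Sum>i\<le>n. lookup d i))"
   by (simp add: dgr_tvec tgr_def algebra_simps)
  moreover have "int (n + 1) * a = int (n + 1) * b \<longleftrightarrow> a = b" for a b by simp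
  ultimately show ?thesis by (simp only:) linarith
 qed
 show ?thesis
 proof
  assume "hom_S n p s"
  then obtain f where s: "s \<in> SC n" and f: "f \<in> s" "hom_tate n p f" by (auto simp: hom_S_def)
  have fc: "f \<in> TC n" using f by (simp add: hom_tate_def)
  have "s = S_cls n f" using s f fc unfolding S_carrier by (auto simp: S_cls_eq)
  then have i: "iota n s = ev n f" using fc by (simp add: iota_S_cls)
  have "2 * dgr n v = int (n + 1) * p" if v: "cf n (iota n s) v \<noteq> 0" for v
  proof -
   obtain k d where "f d $$ k \<noteq> 0" "tvec n (k, d) = v" using cf_ev_nonzero[OF fc] v unfolding i by blast
   then show ?thesis using f(2) tg[of k d] by (auto simp: hom_tate_def hom_R_def)
  qed
  then show "s \<in> SC n \<and> (\<forall>v. cf n (iota n s) v \<noteq> 0 \<longrightarrow> 2 * dgr n v = int (n + 1) * p)"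
   using s by blast
 next
  assume a: "s \<in> SC n \<and> (\<forall>v. cf n (iota n s) v \<noteq> 0 \<longrightarrow> 2 * dgr n v = int (n + 1) * p)"
  then have s: "s \<in> SC n" by simp
  obtain f where f: "f \<in> TC n" "normal_tate n f" "s = S_cls n f" "S_coords n s = f"
   using S_normal[OF s] .
  have "2 * k = p - 2 * int (\<Sum>i\<le>n. lookup d i)" if k: "f d $$ k \<noteq> 0" for d k
  proof -
   have "cf n (iota n s) (tvec n (k, d)) \<noteq> 0"
    using cf_ev_normal[OF f(1,2) normal_support[OF f(1,2) k]] k simplex_sign(2)[of n] f by (simp add: iota_S_cls)
   then show ?thesis using a tg[of k d] by blast
  qed
  then have "hom_tate n p f" using f(1) by (simp add: hom_tate_def hom_R_def)
  moreover have "f \<in> s" using f by (simp add: S_cls_eq)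
  ultimately show "hom_S n p s" using s unfolding hom_S_def by blast
 qed
qed

section \<open>The free algebra\<close>

abbreviation FA :: "nat \<Rightarrow> free ring" where "FA n \<equiv> free_algebra (S_ring n) n"

abbreviation FC where "FC n \<equiv> carrier (FA n)"

definition supp :: "nat \<Rightarrow> free \<Rightarrow> nat list set" where
 "supp n f = {w. f w \<noteq> \<zero>\<^bsub>S_ring n\<^esub>}"

lemma FA_carrier: "f \<in> FC n \<longleftrightarrow>
  (\<forall>w. f w \<in> SC n) \<and> finite (supp n f) \<and> (\<forall>w\<in>supp n f. set w \<subseteq> {..n})"
 by (auto simp: free_algebra_def supp_def)

lemma FA_val: "f \<in> FC n \<Longrightarrow> f w \<in> SC n"
 and FA_finite: "f \<in> FC n \<Longrightarrow> finite (supp n f)"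
 and FA_letters: "f \<in> FC n \<Longrightarrow> w \<in> supp n f \<Longrightarrow> set w \<subseteq> {..n}"
 by (simp_all add: FA_carrier)

lemma supp_iota: "f \<in> FC n \<Longrightarrow> w \<in> supp n f \<longleftrightarrow> iota n (f w) \<noteq> 0"
 using iota_eq_0_iff[OF FA_val] by (auto simp: supp_def)

lemma FA_ops:
 "\<zero>\<^bsub>FA n\<^esub> = (\<lambda>w. \<zero>\<^bsub>S_ring n\<^esub>)" "\<one>\<^bsub>FA n\<^esub> = fw n \<one>\<^bsub>S_ring n\<^esub> []"
 "f \<oplus>\<^bsub>FA n\<^esub> g = (\<lambda>w. f w \<oplus>\<^bsub>S_ring n\<^esub> g w)"
 "(f \<otimes>\<^bsub>FA n\<^esub> g) w = (\<Oplus>\<^bsub>S_ring n\<^esub>k\<in>{..length w}. f (take k w) \<otimes>\<^bsub>S_ring n\<^esub> g (drop k w))"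
 by (simp_all add: free_algebra_def free_word_def)

lemma iota_finsum:
 assumes "finite A" "\<And>a. a \<in> A \<Longrightarrow> f a \<in> SC n"
 shows "(\<Oplus>\<^bsub>S_ring n\<^esub>a\<in>A. f a) \<in> SC n \<and> iota n (\<Oplus>\<^bsub>S_ring n\<^esub>a\<in>A. f a) = (\<Sum>a\<in>A. iota n (f a))"
proof -
 interpret cring "S_ring n" by (rule cring_S)
 show ?thesis using assms
 proof (induction A rule: finite_induct)
  case (insert x A)
  then show ?case by (subst (1 2) finsum_insert) (auto simp: iota_ring)
 qed (simp add: iota_zero)
qed

lemma FA_mult_val:
 assumes f: "f \<in> FC n" and g: "g \<in> FC n"
 shows "(f \<otimes>\<^bsub>FA n\<^esub> g) w \<in> SC n"
  "iota n ((f \<otimes>\<^bsub>FA n\<^esub> g) w) = (\<Sum>k\<le>length w. iota n (f (take k w)) * iota n (g (drop k w)))"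
proof -
 interpret cring "S_ring n" by (rule cring_S)
 have "\<And>k. k \<in> {..length w} \<Longrightarrow> f (take k w) \<otimes>\<^bsub>S_ring n\<^esub> g (drop k w) \<in> SC n"
  using FA_val[OF f] FA_val[OF g] by simp
 from iota_finsum[of "{..length w}" "\<lambda>k. f (take k w) \<otimes>\<^bsub>S_ring n\<^esub> g (drop k w)", OF _ this] FA_val[OF f] FA_val[OF g]
 show "(f \<otimes>\<^bsub>FA n\<^esub> g) w \<in> SC n"
  "iota n ((f \<otimes>\<^bsub>FA n\<^esub> g) w) = (\<Sum>k\<le>length w. iota n (f (take k w)) * iota n (g (drop k w)))"
  by (simp_all add: FA_ops iota_ring)
qed

lemma FA_mult_closed:
 assumes f: "f \<in> FC n" and g: "g \<in> FC n"
 shows "f \<otimes>\<^bsub>FA n\<^esub> g \<in> FC n" "supp n (f \<otimes>\<^bsub>FA n\<^esub> g) \<subseteq> (\<lambda>(u, v). u @ v) ` (supp n f \<times> supp n g)"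
proof -
 show s: "supp n (f \<otimes>\<^bsub>FA n\<^esub> g) \<subseteq> (\<lambda>(u, v). u @ v) ` (supp n f \<times> supp n g)"
 proof
  fix w assume "w \<in> supp n (f \<otimes>\<^bsub>FA n\<^esub> g)"
  then have "iota n ((f \<otimes>\<^bsub>FA n\<^esub> g) w) \<noteq> 0"
   using iota_eq_0_iff[OF FA_mult_val(1)[OF f g]] by (simp add: supp_def)
  then obtain k where "iota n (f (take k w)) * iota n (g (drop k w)) \<noteq> 0"
   unfolding FA_mult_val(2)[OF f g] by (auto dest!: sum_nonzero)
  then have "take k w \<in> supp n f" "drop k w \<in> supp n g" using f g by (auto simp: supp_iota)
  then show "w \<in> (\<lambda>(u, v). u @ v) ` (supp n f \<times> supp n g)"
   by (intro image_eqI[of _ _ "(take k w, drop k w)"]) auto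
 qed
 have "finite ((\<lambda>(u, v). u @ v) ` (supp n f \<times> supp n g))" using FA_finite[OF f] FA_finite[OF g] by simp
 then show "f \<otimes>\<^bsub>FA n\<^esub> g \<in> FC n"
  unfolding FA_carrier using FA_mult_val(1)[OF f g] finite_subset[OF s] s FA_letters[OF f] FA_letters[OF g]
  by fastforce
qed

lemma FA_add_closed:
 assumes f: "f \<in> FC n" and g: "g \<in> FC n"
 shows "f \<oplus>\<^bsub>FA n\<^esub> g \<in> FC n" "supp n (f \<oplus>\<^bsub>FA n\<^esub> g) \<subseteq> supp n f \<union> supp n g"
proof -
 interpret cring "S_ring n" by (rule cring_S)
 show s: "supp n (f \<oplus>\<^bsub>FA n\<^esub> g) \<subseteq> supp n f \<union> supp n g" by (auto simp: supp_def FA_ops)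
 show "f \<oplus>\<^bsub>FA n\<^esub> g \<in> FC n"
  unfolding FA_carrier
 proof (intro conjI allI ballI)
  show "(f \<oplus>\<^bsub>FA n\<^esub> g) w \<in> SC n" for w using FA_val[OF f] FA_val[OF g] by (simp add: FA_ops)
  show "finite (supp n (f \<oplus>\<^bsub>FA n\<^esub> g))" using finite_subset[OF s] FA_finite[OF f] FA_finite[OF g] by simp
  show "set w \<subseteq> {..n}" if "w \<in> supp n (f \<oplus>\<^bsub>FA n\<^esub> g)" for w
   using that s FA_letters[OF f, of w] FA_letters[OF g, of w] by blast
 qed
qed

lemma FA_eqI:
 assumes "f \<in> FC n" "g \<in> FC n" "\<And>w. iota n (f w) = iota n (g w)"
 shows "f = g"
 using assms iota_inj[OF FA_val FA_val] by (intro ext) blast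

lemma free_word_carrier: "s \<in> SC n \<Longrightarrow> set w \<subseteq> {..n} \<Longrightarrow> fw n s w \<in> FC n"
proof -
 interpret cring "S_ring n" by (rule cring_S)
 assume a: "s \<in> SC n" "set w \<subseteq> {..n}"
 have s: "supp n (fw n s w) \<subseteq> {w}" by (auto simp: supp_def free_word_def)
 show ?thesis unfolding FA_carrier using a s finite_subset[OF s] by (auto simp: free_word_def)
qed

text \<open>Both sides sum over the ways to cut the word into three consecutive pieces.\<close>

lemma convolution_assoc:
 fixes f g h :: "'a list \<Rightarrow> 'c::comm_ring_1"
 shows "(\<Sum>k\<le>length w. (\<Sum>j\<le>length (take k w). f (take j (take k w)) * g (drop j (take k w))) * h (drop k w))
  = (\<Sum>j\<le>length w. f (take j w) * (\<Sum>i\<le>length (drop j w). g (take i (drop j w)) * h (drop i (drop j w))))"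
proof -
 let ?m = "length w"
 have "(\<Sum>k\<le>?m. (\<Sum>j\<le>length (take k w). f (take j (take k w)) * g (drop j (take k w))) * h (drop k w))
   = (\<Sum>k\<le>?m. \<Sum>j\<le>k. f (take j w) * g (drop j (take k w)) * h (drop k w))"
  by (intro sum.cong refl) (simp add: sum_distrib_right min_def)
 also have "\<dots> = (\<Sum>(k, j)\<in>Sigma {..?m} (\<lambda>k. {..k}). f (take j w) * g (drop j (take k w)) * h (drop k w))"
  by (rule sum.Sigma) auto
 also have "\<dots> = (\<Sum>(j, i)\<in>Sigma {..?m} (\<lambda>j. {..?m - j}). f (take j w) * (g (take i (drop j w)) * h (drop i (drop j w))))"
  by (rule sum.reindex_bij_witness[where i = "\<lambda>(j, i). (i + j, j)" and j = "\<lambda>(k, j). (j, k - j)"])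
   (auto simp: take_drop ac_simps)
 also have "\<dots> = (\<Sum>j\<le>?m. \<Sum>i\<le>?m - j. f (take j w) * (g (take i (drop j w)) * h (drop i (drop j w))))"
  by (rule sum.Sigma[symmetric]) auto
 also have "\<dots> = (\<Sum>j\<le>?m. f (take j w) * (\<Sum>i\<le>length (drop j w). g (take i (drop j w)) * h (drop i (drop j w))))"
  by (simp add: sum_distrib_left)
 finally show ?thesis .
qed

lemma iota_free_word: "iota n (fw n s w v) = (if v = w then iota n s else 0)"
 by (simp add: free_word_def iota_zero)

lemma ring_FA: "ring (FA n)"
proof -
 interpret S: cring "S_ring n" by (rule cring_S)
 note closed = FA_mult_closed(1) FA_add_closed(1)
 have one: "\<one>\<^bsub>FA n\<^esub> \<in> FC n" unfolding FA_ops by (rule free_word_carrier) auto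
 have zero: "\<zero>\<^bsub>FA n\<^esub> \<in> FC n" by (simp add: FA_carrier FA_ops supp_def)
 have i_add: "iota n ((f \<oplus>\<^bsub>FA n\<^esub> g) w) = iota n (f w) + iota n (g w)"
  if "f \<in> FC n" "g \<in> FC n" for f g w
  using that FA_val by (simp add: FA_ops iota_ring)
 have i_zero: "iota n (\<zero>\<^bsub>FA n\<^esub> w) = 0" for w by (simp add: FA_ops iota_zero)
 have i_one: "iota n (\<one>\<^bsub>FA n\<^esub> w) = (if w = [] then 1 else 0)" for w
  by (simp add: FA_ops iota_free_word iota_one)
 show ?thesis
 proof (rule ringI)
  show "abelian_group (FA n)"
  proof (rule abelian_groupI)
   fix f assume f: "f \<in> FC n"
   let ?g = "\<lambda>w. \<ominus>\<^bsub>S_ring n\<^esub> f w"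
   have "supp n ?g = supp n f" using FA_val[OF f] by (auto simp: supp_def)
   then have g: "?g \<in> FC n" using f unfolding FA_carrier by simp
   moreover have "?g \<oplus>\<^bsub>FA n\<^esub> f = \<zero>\<^bsub>FA n\<^esub>" using FA_val[OF f] by (simp add: FA_ops S.l_neg)
   ultimately show "\<exists>g\<in>FC n. g \<oplus>\<^bsub>FA n\<^esub> f = \<zero>\<^bsub>FA n\<^esub>" by blast
  next
   show "f \<oplus>\<^bsub>FA n\<^esub> g \<in> FC n" if "f \<in> FC n" "g \<in> FC n" for f g
    using that by (rule closed)
   show "f \<oplus>\<^bsub>FA n\<^esub> g \<oplus>\<^bsub>FA n\<^esub> h = f \<oplus>\<^bsub>FA n\<^esub> (g \<oplus>\<^bsub>FA n\<^esub> h)"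
    if "f \<in> FC n" "g \<in> FC n" "h \<in> FC n" for f g h
    by (rule FA_eqI[where n = n]) (simp_all add: that closed i_add algebra_simps)
   show "f \<oplus>\<^bsub>FA n\<^esub> g = g \<oplus>\<^bsub>FA n\<^esub> f" if "f \<in> FC n" "g \<in> FC n" for f g
    by (rule FA_eqI[where n = n]) (simp_all add: that closed i_add algebra_simps)
   show "\<zero>\<^bsub>FA n\<^esub> \<oplus>\<^bsub>FA n\<^esub> f = f" if "f \<in> FC n" for f
    by (rule FA_eqI[where n = n]) (simp_all add: that closed zero i_add i_zero)
  qed (rule zero)
  show "monoid (FA n)"
  proof (rule monoidI)
   fix f g h assume fgh: "f \<in> FC n" "g \<in> FC n" "h \<in> FC n"
   show "f \<otimes>\<^bsub>FA n\<^esub> g \<in> FC n" using fgh by (simp add: closed)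
   show "f \<otimes>\<^bsub>FA n\<^esub> g \<otimes>\<^bsub>FA n\<^esub> h = f \<otimes>\<^bsub>FA n\<^esub> (g \<otimes>\<^bsub>FA n\<^esub> h)"
   proof (rule FA_eqI[where n = n])
    fix w
    show "iota n ((f \<otimes>\<^bsub>FA n\<^esub> g \<otimes>\<^bsub>FA n\<^esub> h) w) = iota n ((f \<otimes>\<^bsub>FA n\<^esub> (g \<otimes>\<^bsub>FA n\<^esub> h)) w)"
     unfolding FA_mult_val(2)[OF closed(1)[OF fgh(1,2)] fgh(3)] FA_mult_val(2)[OF fgh(1) closed(1)[OF fgh(2,3)]]
      FA_mult_val(2)[OF fgh(1,2)] FA_mult_val(2)[OF fgh(2,3)]
     by (rule convolution_assoc)
   qed (use fgh in \<open>simp_all add: closed\<close>)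
   have "(\<Sum>k\<le>length w. (if take k w = [] then 1 else 0) * iota n (f (drop k w))) = iota n (f w)" for w
   proof -
    have "(\<Sum>k\<le>length w. (if take k w = [] then 1 else 0) * iota n (f (drop k w)))
      = (\<Sum>k\<le>length w. if k = 0 then iota n (f w) else 0)"
     by (intro sum.cong refl) (cases w, auto)
    then show ?thesis by simp
   qed
   then show "\<one>\<^bsub>FA n\<^esub> \<otimes>\<^bsub>FA n\<^esub> f = f"
    using fgh one by (intro FA_eqI[where n = n]) (simp_all add: closed FA_mult_val(2) i_one)
   have "(\<Sum>k\<le>length w. iota n (f (take k w)) * (if drop k w = [] then 1 else 0)) = iota n (f w)" for w
   proof -
    have "(\<Sum>k\<le>length w. iota n (f (take k w)) * (if drop k w = [] then 1 else 0))
      = (\<Sum>k\<le>length w. if k = length w then iota n (f w) else 0)"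
     by (intro sum.cong refl) auto
    then show ?thesis by simp
   qed
   then show "f \<otimes>\<^bsub>FA n\<^esub> \<one>\<^bsub>FA n\<^esub> = f"
    using fgh one by (intro FA_eqI[where n = n]) (simp_all add: closed FA_mult_val(2) i_one)
  qed (rule one)
 qed (auto intro!: FA_eqI[where n = n] closed simp: FA_mult_val(2) i_add closed sum.distrib algebra_simps)
qed

lemma free_word_mult:
 assumes "s \<in> SC n" "t \<in> SC n" "set v \<subseteq> {..n}" "set w \<subseteq> {..n}"
 shows "fw n s v \<otimes>\<^bsub>FA n\<^esub> fw n t w = fw n (s \<otimes>\<^bsub>S_ring n\<^esub> t) (v @ w)"
proof -
 interpret S: cring "S_ring n" by (rule cring_S)
 note c = free_word_carrier[OF assms(1,3)] free_word_carrier[OF assms(2,4)]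
 show ?thesis
 proof (rule FA_eqI[where n = n])
  show "fw n s v \<otimes>\<^bsub>FA n\<^esub> fw n t w \<in> FC n"
   by (rule FA_mult_closed[OF c])
  show "fw n (s \<otimes>\<^bsub>S_ring n\<^esub> t) (v @ w) \<in> FC n"
   using assms by (intro free_word_carrier) auto
  fix x
  have "(\<Sum>k\<le>length x. (if take k x = v then iota n s else 0) * (if drop k x = w then iota n t else 0))
    = (\<Sum>k\<le>length x. if k = length v \<and> x = v @ w then iota n s * iota n t else 0)"
  proof (intro sum.cong refl)
   fix k assume "k \<in> {..length x}"
   then have "take k x = v \<and> drop k x = w \<longleftrightarrow> k = length v \<and> x = v @ w"
    by (metis append_eq_conv_conj append_take_drop_id atMost_iff length_take min.absorb2)
   then show "(if take k x = v then iota n s else 0) * (if drop k x = w then iota n t else 0)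
     = (if k = length v \<and> x = v @ w then iota n s * iota n t else 0)" by auto
  qed
  also have "\<dots> = (if x = v @ w then iota n s * iota n t else 0)" by (cases "x = v @ w") simp_all
  finally show "iota n ((fw n s v \<otimes>\<^bsub>FA n\<^esub> fw n t w) x)
    = iota n (fw n (s \<otimes>\<^bsub>S_ring n\<^esub> t) (v @ w) x)"
   unfolding FA_mult_val(2)[OF c] iota_free_word using assms by (simp add: iota_ring)
 qed
qed

section \<open>The spin representation\<close>

text \<open>
 A word acts on the monomials by translation by its exponent, up to a sign. The product
 \<open>e\<^sub>0 \<cdots> e\<^sub>n\<close> then acts as \<open>\<epsilon> T\<^bsup>1/2\<^esup>\<close>; the two values \<open>\<epsilon> = \<plusminus>1\<close> together are faithful on the Clifford
 algebra, and \<open>\<epsilon> = 1\<close> alone on the Dirac module.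
\<close>

fun lam :: "nat \<Rightarrow> nat list \<Rightarrow> nat \<Rightarrow>\<^sub>0 int" where
 "lam n [] = 0" |
 "lam n (i # w) = single i (half n) + lam n w"

text \<open>For positive \<open>i\<close> this is the usual sign of inserting \<open>e_i\<close>
  into an ordered product over the parity set. The count of the letter 0 is added because
  \<open>e_0\<close> acts like the complement of the parity set. In the sign of \<open>e_0\<close>
  the weights \<open>j\<close> yield anticommutation with the other generators, and the prefactor
  makes \<open>e_0 ... e_n\<close> act with sign \<open>\<epsilon>\<close>.\<close>

definition letter_sign :: "nat \<Rightarrow> real \<Rightarrow> nat \<Rightarrow> nat list \<Rightarrow> real" where
 "letter_sign n \<epsilon> i w = (if i = 0
   then \<epsilon> * simplex_sign n * (-1) ^ (\<Sum>j=1..n. j * (count_list w j + count_list w 0))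
   else (-1) ^ (\<Sum>j=1..<i. count_list w j + count_list w 0))"

fun word_sign :: "nat \<Rightarrow> real \<Rightarrow> nat list \<Rightarrow> real" where
 "word_sign n \<epsilon> [] = 1" |
 "word_sign n \<epsilon> (i # w) = letter_sign n \<epsilon> i w * word_sign n \<epsilon> w"

definition word_mon :: "nat \<Rightarrow> real \<Rightarrow> nat list \<Rightarrow> amb" where
 "word_mon n \<epsilon> w = mon n (lam n w) (word_sign n \<epsilon> w)"

definition parity_set :: "nat \<Rightarrow> nat list \<Rightarrow> nat set" where
 "parity_set n w = {j\<in>{1..n}. odd (count_list w j + count_list w 0)}"

lemma lam_append: "lam n (v @ w) = lam n v + lam n w"
 by (induction v) (simp_all add: ac_simps)

lemma lookup_lam: "lookup (lam n w) i = half n * int (count_list w i)"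
 by (induction w) (auto simp: lookup_add lookup_single when_def algebra_simps)

lemma minus_one_power_cong: "even (a + b) \<Longrightarrow> (-1::real) ^ a = (-1) ^ b"
 by (auto simp: minus_one_power_iff)

text \<open>The exponents of both signs are sums over \<open>j\<close> in \<open>{1..n}\<close> of
  terms whose parity is recorded by \<open>parity_set\<close>.\<close>

lemma letter_sign_cong:
 assumes "parity_set n v = parity_set n w" "i \<le> n"
 shows "letter_sign n \<epsilon> i v = letter_sign n \<epsilon> i w"
proof -
 have p: "even (count_list v j + count_list v 0 + (count_list w j + count_list w 0))" if "j \<in> {1..n}" for j
  using assms(1) that unfolding parity_set_def by (auto simp: set_eq_iff)
 have ev: "even (\<Sum>j\<in>J. c j * (count_list v j + count_list v 0) + c j * (count_list w j + count_list w 0))"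
  if "J \<subseteq> {1..n}" for J and c :: "nat \<Rightarrow> nat"
 proof (intro dvd_sum)
  fix j assume "j \<in> J"
  then have "even (c j * (count_list v j + count_list v 0 + (count_list w j + count_list w 0)))"
   using p[of j] that by (intro dvd_mult) blast
  then show "even (c j * (count_list v j + count_list v 0) + c j * (count_list w j + count_list w 0))"
   by (simp only: distrib_left)
 qed
 have e1: "even ((\<Sum>j=1..n. j * (count_list v j + count_list v 0)) + (\<Sum>j=1..n. j * (count_list w j + count_list w 0)))"
  unfolding sum.distrib[symmetric] by (rule ev) simp
 have "even (\<Sum>j=1..<i. 1 * (count_list v j + count_list v 0) + 1 * (count_list w j + count_list w 0))"
  by (rule ev) (use assms(2) in auto)
 then have e2: "even ((\<Sum>j=1..<i. count_list v j + count_list v 0) + (\<Sum>j=1..<i. count_list w j + count_list w 0))"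
  unfolding mult_1 sum.distrib .
 show ?thesis
  unfolding letter_sign_def minus_one_power_cong[OF e1] minus_one_power_cong[OF e2] ..
qed

lemma sum_nat_upto: "(\<Sum>j=1..n. j) = n * (n + 1) div 2" for n :: nat
 using Sum_Icc_nat[of 1 n] by (simp add: algebra_simps)

text \<open>For \<open>i = 0\<close> the first factor sees all parities reversed, which changes the
  weighted sum by \<open>1 + ... + n\<close>; this is the sign of the relation, which
  \<open>iota\<close> puts on \<open>z_0\<close>.\<close>

lemma letter_sign_square:
 assumes "\<epsilon> * \<epsilon> = 1"
 shows "letter_sign n \<epsilon> i (i # w) * letter_sign n \<epsilon> i w = (if i = 0 then simplex_sign n else 1)"
proof (cases "i = 0")
 case True
 have e: "(\<Sum>j=1..n. j * (count_list (0 # w) j + count_list (0 # w) 0))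
   = (\<Sum>j=1..n. j * (count_list w j + count_list w 0)) + n * (n + 1) div 2"
  unfolding sum_nat_upto[symmetric] sum.distrib[symmetric] by (intro sum.cong refl) (auto simp: algebra_simps)
 let ?k = "\<Sum>j=1..n. j * (count_list w j + count_list w 0)"
 have "letter_sign n \<epsilon> 0 (0 # w) * letter_sign n \<epsilon> 0 w
   = (\<epsilon> * \<epsilon>) * (simplex_sign n * simplex_sign n) * ((-1) ^ ?k * (-1) ^ ?k) * (-1) ^ (n * (n + 1) div 2)"
  unfolding letter_sign_def e by (simp add: power_add)
 also have "(-1::real) ^ ?k * (-1) ^ ?k = 1" by (simp flip: power_mult_distrib)
 finally show ?thesis using True assms simplex_sign(1)[of n] by (simp add: simplex_sign_def)
next
 case False
 have "(\<Sum>j=1..<i. count_list (i # w) j + count_list (i # w) 0) = (\<Sum>j=1..<i. count_list w j + count_list w 0)"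
  using False by (intro sum.cong refl) auto
 then show ?thesis using False by (simp add: letter_sign_def flip: power_mult_distrib)
qed

text \<open>For \<open>i = 0\<close> a letter \<open>j\<close> changes the sign of
  \<open>e_0\<close> by the weight \<open>j\<close>, and a letter 0 changes the sign of
  \<open>e_j\<close> through \<open>j - 1\<close> positions; the total is odd. For positive
  \<open>i\<close> only the larger generator notices the smaller one.\<close>

lemma letter_sign_swap_aux:
 assumes "i < j" "j \<le> n"
 shows "letter_sign n \<epsilon> i (j # w) * letter_sign n \<epsilon> j w = - (letter_sign n \<epsilon> j (i # w) * letter_sign n \<epsilon> i w)"
proof (cases "i = 0")
 case True
 have 1: "(\<Sum>k=1..n. k * (count_list (j # w) k + count_list (j # w) 0))
   = (\<Sum>k=1..n. k * (count_list w k + count_list w 0)) + j"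
 proof -
  have "(\<Sum>k=1..n. k * (count_list (j # w) k + count_list (j # w) 0))
   = (\<Sum>k=1..n. k * (count_list w k + count_list w 0) + (if k = j then j else 0))"
   using assms by (intro sum.cong refl) auto
  then show ?thesis using assms by (simp add: sum.distrib)
 qed
 have 2: "(\<Sum>k=1..<j. count_list (0 # w) k + count_list (0 # w) 0)
   = (\<Sum>k=1..<j. count_list w k + count_list w 0) + (j - 1)"
 proof -
  have "(\<Sum>k=1..<j. count_list (0 # w) k + count_list (0 # w) 0)
   = (\<Sum>k=1..<j. (count_list w k + count_list w 0) + 1)"
   by (intro sum.cong refl) auto
  then show ?thesis by (simp only: sum.distrib) simp
 qed
 obtain m where m: "j = Suc m" using assms by (cases j) auto
 have i0: "letter_sign n \<epsilon> 0 v = \<epsilon> * simplex_sign n * (-1) ^ (\<Sum>k=1..n. k * (count_list v k + count_list v 0))" for v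
  by (simp add: letter_sign_def)
 have j0: "letter_sign n \<epsilon> j v = (-1) ^ (\<Sum>k=1..<j. count_list v k + count_list v 0)" for v
  using m by (simp add: letter_sign_def)
 show ?thesis unfolding True i0 j0 1 2 by (simp add: m power_add)
next
 case False
 have 1: "letter_sign n \<epsilon> i (j # w) = letter_sign n \<epsilon> i w"
  using assms False unfolding letter_sign_def by (auto intro!: arg_cong[of _ _ "\<lambda>k. (-1) ^ k"] sum.cong)
 have "(\<Sum>k=1..<j. count_list (i # w) k + count_list (i # w) 0)
   = (\<Sum>k=1..<j. (count_list w k + count_list w 0) + (if k = i then 1 else 0))"
  using assms False by (intro sum.cong refl) auto
 also have "\<dots> = (\<Sum>k=1..<j. count_list w k + count_list w 0) + 1"
  using assms False by (simp add: sum.distrib)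
 finally have 2: "letter_sign n \<epsilon> j (i # w) = - letter_sign n \<epsilon> j w"
  using assms False by (simp add: letter_sign_def)
 show ?thesis unfolding 1 2 by simp
qed

lemma letter_sign_swap:
 assumes "i \<noteq> j" "i \<le> n" "j \<le> n"
 shows "letter_sign n \<epsilon> i (j # w) * letter_sign n \<epsilon> j w = - (letter_sign n \<epsilon> j (i # w) * letter_sign n \<epsilon> i w)"
 using letter_sign_swap_aux[of i j n \<epsilon> w] letter_sign_swap_aux[of j i n \<epsilon> w] assms
 by (cases "i < j") auto

lemma word_mon_Cons:
 "word_mon n \<epsilon> (i # w) = mon n (single i (half n)) (letter_sign n \<epsilon> i w) * word_mon n \<epsilon> w"
 by (simp add: word_mon_def mon_times_mon)

text \<open>Further letters on the left look only at the parity set of what follows, so a scalar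
  relation between two words of equal parity set persists.\<close>

lemma word_mon_prefix:
 assumes "word_mon n \<epsilon> v = a * word_mon n \<epsilon> w" "parity_set n v = parity_set n w" "set u \<subseteq> {..n}"
  and count: "\<And>x. parity_set n (x @ v) = parity_set n (x @ w)"
 shows "word_mon n \<epsilon> (u @ v) = a * word_mon n \<epsilon> (u @ w)"
 using assms(3)
proof (induction u)
 case (Cons i u)
 then have "letter_sign n \<epsilon> i (u @ v) = letter_sign n \<epsilon> i (u @ w)"
  using count by (intro letter_sign_cong) auto
 then show ?case using Cons by (simp add: word_mon_Cons)
qed (use assms in simp)

lemma parity_set_append_cong:
 assumes "\<And>j. j \<le> n \<Longrightarrow> even (count_list v j + count_list w j)"
 shows "parity_set n (x @ v) = parity_set n (x @ w)"
proof -
 have "odd (count_list (x @ v) j + count_list (x @ v) 0) \<longleftrightarrow> odd (count_list (x @ w) j + count_list (x @ w) 0)"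
  if "j \<le> n" for j
  using assms[OF that] assms[of 0] by auto
 then show ?thesis unfolding parity_set_def by auto
qed

lemma word_mon_swap:
 assumes "i \<noteq> j" "i \<le> n" "j \<le> n" "set u \<subseteq> {..n}"
 shows "word_mon n \<epsilon> (u @ i # j # w) = - word_mon n \<epsilon> (u @ j # i # w)"
proof -
 have "word_mon n \<epsilon> (i # j # w) = - word_mon n \<epsilon> (j # i # w)"
 proof -
  have "lam n (i # j # w) = lam n (j # i # w)" by (simp add: ac_simps)
  moreover have "word_sign n \<epsilon> (i # j # w) = - word_sign n \<epsilon> (j # i # w)"
   by (simp only: word_sign.simps mult.assoc[symmetric] letter_sign_swap[OF assms(1-3)] mult_minus_left)
  ultimately show ?thesis by (simp only: word_mon_def mon_uminus)
 qed
 then have "word_mon n \<epsilon> (i # j # w) = (-1) * word_mon n \<epsilon> (j # i # w)" by simp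
 from word_mon_prefix[OF this _ assms(4)] parity_set_append_cong[of n "i # j # w" "j # i # w"]
 have "word_mon n \<epsilon> (u @ i # j # w) = (-1) * word_mon n \<epsilon> (u @ j # i # w)"
  using parity_set_append_cong[of n "i # j # w" "j # i # w" "[]"] by simp
 then show ?thesis by simp
qed

lemma word_mon_square:
 assumes "odd n" "\<epsilon> * \<epsilon> = 1" "i \<le> n" "set u \<subseteq> {..n}"
 shows "word_mon n \<epsilon> (u @ i # i # w) = iota n (S_var n i) * word_mon n \<epsilon> (u @ w)"
proof -
 have "2 * ((n + 1) div 2) = n + 1" using assms(1) by simp
 then have "half n + half n = int (n + 1)" by linarith
 then have "single i (half n) + single i (half n)
   = single i (int (n + 1))" by (simp only: single_add[symmetric])
 then have "word_mon n \<epsilon> (i # i # w) = iota n (S_var n i) * word_mon n \<epsilon> w"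
  using letter_sign_square[OF assms(2), of n i w]
  by (simp add: word_mon_Cons S_var(2)[OF assms(3)] mult.assoc[symmetric] mon_times_mon)
 then show ?thesis
  by (rule word_mon_prefix) (use assms(4) parity_set_append_cong[of n "i # i # w" w] parity_set_append_cong[of n "i # i # w" w "[]"] in auto)
qed

section \<open>The Clifford algebra\<close>

text \<open>The words \<open>u\<close> and \<open>v\<close> on both sides are needed since the
  action of a letter depends on what is already there: vanishing has to be tested in all
  surroundings to give a two-sided ideal.\<close>

definition act :: "nat \<Rightarrow> real \<Rightarrow> nat list \<Rightarrow> free \<Rightarrow> nat list \<Rightarrow> amb" where
 "act n \<epsilon> u f v = (\<Sum>w\<in>supp n f. iota n (f w) * word_mon n \<epsilon> (u @ w @ v))"

definition spin :: "nat \<Rightarrow> real \<Rightarrow> free \<Rightarrow> amb" where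
 "spin n \<epsilon> f = act n \<epsilon> [] f []"

lemma act_superset:
 assumes "f \<in> FC n" "finite U" "supp n f \<subseteq> U"
 shows "act n \<epsilon> u f v = (\<Sum>w\<in>U. iota n (f w) * word_mon n \<epsilon> (u @ w @ v))"
 unfolding act_def using assms by (intro sum.mono_neutral_left) (auto simp: supp_iota)

lemma act_add:
 assumes f: "f \<in> FC n" and g: "g \<in> FC n"
 shows "act n \<epsilon> u (f \<oplus>\<^bsub>FA n\<^esub> g) v = act n \<epsilon> u f v + act n \<epsilon> u g v"
proof -
 let ?U = "supp n f \<union> supp n g"
 have U: "finite ?U" using FA_finite[OF f] FA_finite[OF g] by simp
 have i: "iota n ((f \<oplus>\<^bsub>FA n\<^esub> g) w) = iota n (f w) + iota n (g w)" for w
  using FA_val[OF f] FA_val[OF g] by (simp add: FA_ops iota_ring)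
 show ?thesis
  unfolding act_superset[OF FA_add_closed(1)[OF f g] U FA_add_closed(2)[OF f g]]
   act_superset[OF f U Un_upper1] act_superset[OF g U Un_upper2] i
  by (simp add: algebra_simps sum.distrib)
qed

text \<open>A pair of words corresponds to their concatenation together with the place of the
  cut.\<close>

lemma act_mult:
 assumes f: "f \<in> FC n" and g: "g \<in> FC n"
 shows "act n \<epsilon> u (f \<otimes>\<^bsub>FA n\<^esub> g) v
  = (\<Sum>w\<in>supp n f. \<Sum>y\<in>supp n g. iota n (f w) * iota n (g y) * word_mon n \<epsilon> (u @ w @ y @ v))"
proof -
 let ?U = "(\<lambda>(w, y). w @ y) ` (supp n f \<times> supp n g)"
 let ?t = "\<lambda>(x, k). iota n (f (take k x)) * iota n (g (drop k x)) * word_mon n \<epsilon> (u @ x @ v)"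
 have U: "finite ?U" using FA_finite[OF f] FA_finite[OF g] by simp
 have td: "take k x @ drop k x @ v = x @ v" for k and x :: "nat list"
  by (simp only: append_assoc[symmetric] append_take_drop_id)
 have "act n \<epsilon> u (f \<otimes>\<^bsub>FA n\<^esub> g) v = (\<Sum>x\<in>?U. \<Sum>k\<le>length x. ?t (x, k))"
  unfolding act_superset[OF FA_mult_closed(1)[OF f g] U FA_mult_closed(2)[OF f g]] FA_mult_val(2)[OF f g]
  by (simp add: sum_distrib_right)
 also have "\<dots> = (\<Sum>z\<in>Sigma ?U (\<lambda>x. {..length x}). ?t z)"
  by (subst sum.Sigma) (use U in \<open>auto simp: case_prod_unfold\<close>)
 also have "\<dots> = (\<Sum>z\<in>{(x, k)\<in>Sigma ?U (\<lambda>x. {..length x}). take k x \<in> supp n f \<and> drop k x \<in> supp n g}. ?t z)"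
  by (rule sum.mono_neutral_right) (use U in \<open>auto simp: supp_iota[OF f] supp_iota[OF g]\<close>)
 also have "\<dots> = (\<Sum>(w, y)\<in>supp n f \<times> supp n g. iota n (f w) * iota n (g y) * word_mon n \<epsilon> (u @ w @ y @ v))"
  by (rule sum.reindex_bij_witness[where i = "\<lambda>(w, y). (w @ y, length w)" and j = "\<lambda>(x, k). (take k x, drop k x)"])
   (force simp: min_def td | simp only: case_prod_unfold fst_conv snd_conv td)+
 finally show ?thesis by (simp add: sum.cartesian_product)
qed

lemma act_free_word:
 assumes "s \<in> SC n" "set w \<subseteq> {..n}"
 shows "act n \<epsilon> u (fw n s w) v = iota n s * word_mon n \<epsilon> (u @ w @ v)"
 by (subst act_superset[OF free_word_carrier[OF assms], of "{w}"])
  (auto simp: supp_def iota_free_word free_word_def)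

lemma act_zero: "act n \<epsilon> u \<zero>\<^bsub>FA n\<^esub> v = 0"
 by (simp add: act_def supp_def FA_ops)

lemma act_neg:
 assumes f: "f \<in> FC n"
 shows "act n \<epsilon> u (\<ominus>\<^bsub>FA n\<^esub> f) v = - act n \<epsilon> u f v"
proof -
 interpret ring "FA n" by (rule ring_FA)
 show ?thesis
  using act_add[OF a_inv_closed[OF f] f, of \<epsilon> u v] f by (simp add: l_neg act_zero eq_neg_iff_add_eq_0)
qed

lemma FA_neg:
 assumes f: "f \<in> FC n"
 shows "\<ominus>\<^bsub>FA n\<^esub> f = (\<lambda>w. \<ominus>\<^bsub>S_ring n\<^esub> f w)"
proof -
 interpret ring "FA n" by (rule ring_FA)
 interpret S: cring "S_ring n" by (rule cring_S)
 let ?g = "\<lambda>w. \<ominus>\<^bsub>S_ring n\<^esub> f w"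
 have "supp n ?g = supp n f" using FA_val[OF f] by (auto simp: supp_def)
 then have "?g \<in> FC n" using f unfolding FA_carrier by simp
 moreover have "?g \<oplus>\<^bsub>FA n\<^esub> f = \<zero>\<^bsub>FA n\<^esub>" using FA_val[OF f] by (simp add: FA_ops S.l_neg)
 ultimately show ?thesis using f by (intro minus_equality)
qed

definition spin_kernel :: "nat \<Rightarrow> free set" where
 "spin_kernel n = {f \<in> FC n. \<forall>\<epsilon> u v. \<epsilon> * \<epsilon> = 1 \<longrightarrow> set u \<subseteq> {..n} \<longrightarrow> set v \<subseteq> {..n} \<longrightarrow> act n \<epsilon> u f v = 0}"

lemma ideal_spin_kernel: "ideal (spin_kernel n) (FA n)"
proof (rule idealI)
 interpret ring "FA n" by (rule ring_FA)
 show "ring (FA n)" by (rule ring_FA)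
 show "subgroup (spin_kernel n) (add_monoid (FA n))"
 proof (rule add.subgroupI)
  show "spin_kernel n \<subseteq> FC n" by (auto simp: spin_kernel_def)
  show "spin_kernel n \<noteq> {}" using act_zero zero_closed by (auto simp: spin_kernel_def)
  show "\<ominus>\<^bsub>FA n\<^esub> a \<in> spin_kernel n" if "a \<in> spin_kernel n" for a
   using that by (auto simp: spin_kernel_def act_neg)
  show "a \<oplus>\<^bsub>FA n\<^esub> b \<in> spin_kernel n" if "a \<in> spin_kernel n" "b \<in> spin_kernel n" for a b
   using that by (auto simp: spin_kernel_def act_add)
 qed
 fix f g assume f: "f \<in> spin_kernel n" and g: "g \<in> FC n"
 have fc: "f \<in> FC n" using f by (simp add: spin_kernel_def)
 have f0: "act n \<epsilon> u f v = 0" if "\<epsilon> * \<epsilon> = 1" "set u \<subseteq> {..n}" "set v \<subseteq> {..n}" for \<epsilon> u v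
  using f that by (simp add: spin_kernel_def)
 show "g \<otimes>\<^bsub>FA n\<^esub> f \<in> spin_kernel n"
  unfolding spin_kernel_def
 proof (intro CollectI conjI allI impI)
  fix \<epsilon> :: real and u v assume *: "\<epsilon> * \<epsilon> = 1" "set u \<subseteq> {..n}" "set v \<subseteq> {..n}"
  have "act n \<epsilon> u (g \<otimes>\<^bsub>FA n\<^esub> f) v = (\<Sum>w\<in>supp n g. iota n (g w) * act n \<epsilon> (u @ w) f v)"
   unfolding act_mult[OF g fc] by (simp add: act_def sum_distrib_left mult.assoc)
  also have "\<dots> = 0" using * FA_letters[OF g] by (intro sum.neutral ballI) (simp add: f0)
  finally show "act n \<epsilon> u (g \<otimes>\<^bsub>FA n\<^esub> f) v = 0" .
 qed (use fc g in simp)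
 show "f \<otimes>\<^bsub>FA n\<^esub> g \<in> spin_kernel n"
  unfolding spin_kernel_def
 proof (intro CollectI conjI allI impI)
  fix \<epsilon> :: real and u v assume *: "\<epsilon> * \<epsilon> = 1" "set u \<subseteq> {..n}" "set v \<subseteq> {..n}"
  have "act n \<epsilon> u (f \<otimes>\<^bsub>FA n\<^esub> g) v = (\<Sum>y\<in>supp n g. iota n (g y) * act n \<epsilon> u f (y @ v))"
   unfolding act_mult[OF fc g] by (subst sum.swap) (simp add: act_def sum_distrib_left ac_simps)
  also have "\<dots> = 0" using * FA_letters[OF g] by (intro sum.neutral ballI) (simp add: f0)
  finally show "act n \<epsilon> u (f \<otimes>\<^bsub>FA n\<^esub> g) v = 0" .
 qed (use fc g in simp)
qed

lemma clifford_relation_carrier: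
 assumes "i \<le> n" "j \<le> n"
 shows "clifford_relation n i j \<in> FC n"
proof -
 interpret ring "FA n" by (rule ring_FA)
 interpret S: cring "S_ring n" by (rule cring_S)
 show ?thesis
  unfolding clifford_relation_def Let_def
  using assms S_var(1) by (intro minus_closed add.m_closed free_word_carrier) auto
qed

text \<open>The relation is checked inside arbitrary words, by \<open>word_mon_square\<close> for
  equal and \<open>word_mon_swap\<close> for distinct indices.\<close>

lemma clifford_relation_kernel:
 assumes n: "odd n" and ij: "i \<le> n" "j \<le> n"
 shows "clifford_relation n i j \<in> spin_kernel n"
 unfolding spin_kernel_def
proof (intro CollectI conjI allI impI)
 interpret ring "FA n" by (rule ring_FA)
 interpret S: cring "S_ring n" by (rule cring_S)
 show "clifford_relation n i j \<in> FC n" by (rule clifford_relation_carrier[OF ij])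
 fix \<epsilon> :: real and u v :: "nat list" assume *: "\<epsilon> * \<epsilon> = 1" "set u \<subseteq> {..n}" "set v \<subseteq> {..n}"
 let ?c = "if i = j then S_var n i \<oplus>\<^bsub>S_ring n\<^esub> S_var n i else \<zero>\<^bsub>S_ring n\<^esub>"
 have c: "?c \<in> SC n" using S_var(1)[OF ij(1)] by (cases "i = j") auto
 have w: "fw n \<one>\<^bsub>S_ring n\<^esub> [i, j] \<in> FC n"
  "fw n \<one>\<^bsub>S_ring n\<^esub> [j, i] \<in> FC n" "fw n ?c [] \<in> FC n"
  using ij c by (auto intro!: free_word_carrier)
 have "act n \<epsilon> u (clifford_relation n i j) v
   = word_mon n \<epsilon> (u @ i # j # v) + word_mon n \<epsilon> (u @ j # i # v) - iota n ?c * word_mon n \<epsilon> (u @ v)"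
  unfolding clifford_relation_def Let_def minus_eq
  using w ij c by (simp add: act_add act_neg act_free_word iota_one del: if_split)
 also have "\<dots> = 0"
 proof (cases "i = j")
  case True
  then show ?thesis
   using word_mon_square[OF n *(1) ij(1) *(2)] S_var(1)[OF ij(1)] by (simp add: iota_ring algebra_simps)
 next
  case False
  then show ?thesis using word_mon_swap[OF False ij *(2)] by (simp add: iota_zero)
 qed
 finally show "act n \<epsilon> u (clifford_relation n i j) v = 0" .
qed

lemma ideal_clifford_ideal: "ideal (clifford_ideal n) (FA n)"
proof -
 interpret ring "FA n" by (rule ring_FA)
 show ?thesis unfolding clifford_ideal_def
  by (rule genideal_ideal) (use clifford_relation_carrier in auto)
qed

lemma clifford_ideal_kernel: "odd n \<Longrightarrow> clifford_ideal n \<subseteq> spin_kernel n"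
 unfolding clifford_ideal_def
 by (rule ring.genideal_minimal[OF ring_FA ideal_spin_kernel]) (use clifford_relation_kernel in auto)

lemma ring_clifford: "ring (clifford n)"
 unfolding clifford_def by (rule ideal.quotient_is_ring[OF ideal_clifford_ideal])

definition cl :: "nat \<Rightarrow> free \<Rightarrow> free set" where
 "cl n f = clifford_ideal n +>\<^bsub>FA n\<^esub> f"

lemma clifford_carrier: "x \<in> carrier (clifford n) \<longleftrightarrow> (\<exists>f\<in>FC n. x = cl n f)"
 by (auto simp: clifford_def FactRing_def A_RCOSETS_def' cl_def)

lemma cl_ring:
 assumes f: "f \<in> FC n" and g: "g \<in> FC n"
 shows "cl n f \<oplus>\<^bsub>clifford n\<^esub> cl n g = cl n (f \<oplus>\<^bsub>FA n\<^esub> g)"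
  "cl n f \<otimes>\<^bsub>clifford n\<^esub> cl n g = cl n (f \<otimes>\<^bsub>FA n\<^esub> g)"
 using ring_hom_add[OF ideal.rcos_ring_hom[OF ideal_clifford_ideal] f g]
  ring_hom_mult[OF ideal.rcos_ring_hom[OF ideal_clifford_ideal] f g]
 by (simp_all add: cl_def clifford_def)

lemma cl_closed: "f \<in> FC n \<Longrightarrow> cl n f \<in> carrier (clifford n)"
 unfolding clifford_carrier by blast

lemma cl_neg:
 assumes f: "f \<in> FC n"
 shows "cl n (\<ominus>\<^bsub>FA n\<^esub> f) = \<ominus>\<^bsub>clifford n\<^esub> cl n f"
proof -
 interpret ring "FA n" by (rule ring_FA)
 interpret C: ring "clifford n" by (rule ring_clifford)
 have z: "cl n \<zero>\<^bsub>FA n\<^esub> = \<zero>\<^bsub>clifford n\<^esub>"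
  using cl_ring(1)[OF zero_closed zero_closed] C.add.l_cancel_one'[of "cl n \<zero>\<^bsub>FA n\<^esub>" "cl n \<zero>\<^bsub>FA n\<^esub>"]
  by (simp add: cl_closed)
 have "cl n (\<ominus>\<^bsub>FA n\<^esub> f) \<oplus>\<^bsub>clifford n\<^esub> cl n f = \<zero>\<^bsub>clifford n\<^esub>"
  using f by (simp add: cl_ring l_neg z)
 then show ?thesis using f by (intro C.minus_equality[symmetric]) (simp_all add: cl_closed)
qed

abbreviation cw :: "nat \<Rightarrow> tate set \<Rightarrow> nat list \<Rightarrow> free set" where
 "cw n s w \<equiv> cl n (fw n s w)"

lemma cw_mult:
 assumes "s \<in> SC n" "t \<in> SC n" "set v \<subseteq> {..n}" "set w \<subseteq> {..n}"
 shows "cw n s v \<otimes>\<^bsub>clifford n\<^esub> cw n t w = cw n (s \<otimes>\<^bsub>S_ring n\<^esub> t) (v @ w)"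
 using assms by (simp add: cl_ring free_word_carrier free_word_mult)

lemma free_word_neg:
 assumes "s \<in> SC n" "set w \<subseteq> {..n}"
 shows "\<ominus>\<^bsub>FA n\<^esub> fw n s w = fw n (\<ominus>\<^bsub>S_ring n\<^esub> s) w"
proof -
 interpret S: cring "S_ring n" by (rule cring_S)
 show ?thesis unfolding FA_neg[OF free_word_carrier[OF assms]] by (auto simp: free_word_def fun_eq_iff)
qed

lemma free_word_add:
 assumes "s \<in> SC n" "t \<in> SC n"
 shows "fw n s w \<oplus>\<^bsub>FA n\<^esub> fw n t w = fw n (s \<oplus>\<^bsub>S_ring n\<^esub> t) w"
proof -
 interpret S: cring "S_ring n" by (rule cring_S)
 show ?thesis using assms by (auto simp: free_word_def FA_ops fun_eq_iff)
qed

lemma cl_eqI: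
 assumes "f \<in> FC n" "g \<in> FC n" "f \<ominus>\<^bsub>FA n\<^esub> g \<in> clifford_ideal n"
 shows "cl n f = cl n g"
proof -
 interpret ring "FA n" by (rule ring_FA)
 show ?thesis unfolding cl_def
  using quotient_eq_iff_same_a_r_cos[OF ideal_clifford_ideal assms(1,2)] assms(3) by simp
qed

lemma clifford_relation_mem: "i \<le> n \<Longrightarrow> j \<le> n \<Longrightarrow> clifford_relation n i j \<in> clifford_ideal n"
proof -
 interpret ring "FA n" by (rule ring_FA)
 show "i \<le> n \<Longrightarrow> j \<le> n \<Longrightarrow> clifford_relation n i j \<in> clifford_ideal n"
  unfolding clifford_ideal_def using genideal_self[of "{clifford_relation n i j | i j. i \<le> n \<and> j \<le> n}"]
   clifford_relation_carrier by blast
qed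

lemma cw_swap:
 assumes ij: "i \<noteq> j" "i \<le> n" "j \<le> n"
 shows "cw n \<one>\<^bsub>S_ring n\<^esub> [i, j] = \<ominus>\<^bsub>clifford n\<^esub> cw n \<one>\<^bsub>S_ring n\<^esub> [j, i]"
proof -
 interpret ring "FA n" by (rule ring_FA)
 interpret S: cring "S_ring n" by (rule cring_S)
 let ?a = "fw n \<one>\<^bsub>S_ring n\<^esub> [i, j]" and ?b = "fw n \<one>\<^bsub>S_ring n\<^esub> [j, i]"
 have c: "?a \<in> FC n" "?b \<in> FC n" using ij by (auto intro!: free_word_carrier)
 have "fw n \<zero>\<^bsub>S_ring n\<^esub> [] = \<zero>\<^bsub>FA n\<^esub>" by (auto simp: free_word_def FA_ops)
 then have "clifford_relation n i j = ?a \<ominus>\<^bsub>FA n\<^esub> \<ominus>\<^bsub>FA n\<^esub> ?b"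
  using ij c unfolding clifford_relation_def Let_def by (simp add: minus_eq)
 then have "cl n ?a = cl n (\<ominus>\<^bsub>FA n\<^esub> ?b)"
  using clifford_relation_mem[OF ij(2,3)] c by (intro cl_eqI) simp_all
 then show ?thesis by (simp add: cl_neg c)
qed

text \<open>The relation only says that twice the square is \<open>2 z_i\<close>; it is halved with
  the constant 1/2 of the coefficient ring.\<close>

lemma cw_square:
 assumes i: "i \<le> n"
 shows "cw n \<one>\<^bsub>S_ring n\<^esub> [i, i] = cw n (S_var n i) []"
proof -
 interpret ring "FA n" by (rule ring_FA)
 interpret S: cring "S_ring n" by (rule cring_S)
 interpret C: ring "clifford n" by (rule ring_clifford)
 let ?a = "fw n \<one>\<^bsub>S_ring n\<^esub> [i, i]" and ?z = "S_var n i" and ?h = "S_const n (fls_const (1/2))"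
 have z: "?z \<in> SC n" and h: "?h \<in> SC n" using S_var(1)[OF i] S_const(2) by auto
 have hh: "?h \<oplus>\<^bsub>S_ring n\<^esub> ?h = \<one>\<^bsub>S_ring n\<^esub>"
  using h by (intro iota_inj[of _ n]) (simp_all add: iota_ring iota_const iota_one flip: mon_add, simp add: mon_0_1)
 have a: "?a \<in> FC n" using i by (auto intro!: free_word_carrier)
 have half: "fw n ?h [] \<otimes>\<^bsub>FA n\<^esub> (fw n s w \<oplus>\<^bsub>FA n\<^esub> fw n s w)
   = fw n s w" if "s \<in> SC n" "set w \<subseteq> {..n}" for s w
 proof -
  have "?h \<otimes>\<^bsub>S_ring n\<^esub> (s \<oplus>\<^bsub>S_ring n\<^esub> s) = (?h \<oplus>\<^bsub>S_ring n\<^esub> ?h) \<otimes>\<^bsub>S_ring n\<^esub> s"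
   using that h by (simp add: S.r_distr S.l_distr)
  then show ?thesis using that h by (simp add: free_word_add free_word_mult hh)
 qed
 have "clifford_relation n i i = (?a \<oplus>\<^bsub>FA n\<^esub> ?a) \<ominus>\<^bsub>FA n\<^esub> (fw n ?z [] \<oplus>\<^bsub>FA n\<^esub> fw n ?z [])"
  unfolding clifford_relation_def Let_def using z by (simp add: free_word_add)
 then have "cl n (?a \<oplus>\<^bsub>FA n\<^esub> ?a) = cl n (fw n ?z [] \<oplus>\<^bsub>FA n\<^esub> fw n ?z [])"
  using clifford_relation_mem[OF i i] a z by (intro cl_eqI) (simp_all add: free_word_carrier)
 then have "cl n (fw n ?h [] \<otimes>\<^bsub>FA n\<^esub> (?a \<oplus>\<^bsub>FA n\<^esub> ?a))
   = cl n (fw n ?h [] \<otimes>\<^bsub>FA n\<^esub> (fw n ?z [] \<oplus>\<^bsub>FA n\<^esub> fw n ?z []))"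
  using a z h by (simp add: free_word_carrier flip: cl_ring(2))
 then show ?thesis using half[of "\<one>\<^bsub>S_ring n\<^esub>" "[i, i]"] half[OF z, of "[]"] i by simp
qed

text \<open>One pass of insertion sort: the new letter is absorbed as a scalar when it meets an
  equal one, and costs a sign for each smaller one it passes.\<close>

lemma cw_insert:
 assumes "sorted_wrt (<) w" "s \<in> SC n" "i \<le> n" "set w \<subseteq> {..n}"
 shows "\<exists>s'\<in>SC n. \<exists>w'. cw n s (i # w) = cw n s' w' \<and> sorted_wrt (<) w' \<and> set w' \<subseteq> insert i (set w)"
 using assms
proof (induction w arbitrary: s)
 case Nil
 then show ?case by (intro bexI[of _ s] exI[of _ "[i]"]) auto
next
 case (Cons j w)
 interpret S: cring "S_ring n" by (rule cring_S)
 interpret C: ring "clifford n" by (rule ring_clifford)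
 have j: "j \<le> n" and w: "set w \<subseteq> {..n}" "sorted_wrt (<) w" and jw: "\<And>k. k \<in> set w \<Longrightarrow> j < k" using Cons.prems by auto
 have cwc: "cw n t v \<in> carrier (clifford n)" if "t \<in> SC n" "set v \<subseteq> {..n}" for t v
  using that by (intro cl_closed free_word_carrier)
 have split: "cw n s (i # j # w) = cw n \<one>\<^bsub>S_ring n\<^esub> [i, j] \<otimes>\<^bsub>clifford n\<^esub> cw n s w"
  using Cons.prems by (subst cw_mult) auto
 consider "i < j" | "i = j" | "j < i" by linarith
 then show ?case
 proof cases
  case 1
  then show ?thesis using Cons.prems by (intro bexI[of _ s] exI[of _ "i # j # w"]) auto
 next
  case 2
  have "cw n s (i # j # w) = cw n (S_var n i \<otimes>\<^bsub>S_ring n\<^esub> s) w"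
   unfolding split using 2 Cons.prems S_var(1)[of i n] by (simp add: cw_square cw_mult)
  moreover have "S_var n i \<otimes>\<^bsub>S_ring n\<^esub> s \<in> SC n" using S_var(1) Cons.prems by simp
  ultimately show ?thesis using w
   by (intro bexI[of _ "S_var n i \<otimes>\<^bsub>S_ring n\<^esub> s"] exI[of _ w] conjI) auto
 next
  case 3
  let ?s = "\<ominus>\<^bsub>S_ring n\<^esub> s"
  have s: "?s \<in> SC n" using Cons.prems by simp
  obtain s' w' where s': "s' \<in> SC n" "cw n ?s (i # w) = cw n s' w'" "sorted_wrt (<) w'"
   "set w' \<subseteq> insert i (set w)" using Cons.IH[OF w(2) s Cons.prems(3) w(1)] by blast
  have "cw n s (i # j # w) = \<ominus>\<^bsub>clifford n\<^esub> cw n s (j # i # w)"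
   unfolding split using cw_swap[of i j n] 3 Cons.prems j w
   by (simp add: C.l_minus cwc cw_mult)
  also have "\<dots> = cw n ?s (j # i # w)"
   using Cons.prems by (simp add: cl_neg[symmetric] free_word_carrier free_word_neg)
  also have "\<dots> = cw n \<one>\<^bsub>S_ring n\<^esub> [j] \<otimes>\<^bsub>clifford n\<^esub> cw n ?s (i # w)"
   using Cons.prems by (subst cw_mult) auto
  also have "\<dots> = cw n s' (j # w')"
   using s' j w Cons.prems(3) by (subst s'(2), subst cw_mult) auto
  finally have "cw n s (i # j # w) = cw n s' (j # w')" .
  moreover have "sorted_wrt (<) (j # w')" using s'(3,4) jw 3 by auto
  moreover have "set (j # w') \<subseteq> insert i (set (j # w))" using s'(4) by auto
  ultimately show ?thesis using s'(1) by (intro bexI[of _ s'] exI[of _ "j # w'"] conjI)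
 qed
qed

lemma cw_sort:
 assumes "s \<in> SC n" "set w \<subseteq> {..n}"
 shows "\<exists>s'\<in>SC n. \<exists>w'. cw n s w = cw n s' w' \<and> sorted_wrt (<) w' \<and> set w' \<subseteq> {..n}"
 using assms
proof (induction w)
 case Nil
 then show ?case by (intro bexI[of _ s] exI[of _ "[]"]) auto
next
 case (Cons i w)
 interpret S: cring "S_ring n" by (rule cring_S)
 obtain s' w' where s': "s' \<in> SC n" "cw n s w = cw n s' w'" "sorted_wrt (<) w'" "set w' \<subseteq> {..n}"
  using Cons by auto
 have "cw n s (i # w) = cw n \<one>\<^bsub>S_ring n\<^esub> [i] \<otimes>\<^bsub>clifford n\<^esub> cw n s w"
  using Cons.prems by (subst cw_mult) auto
 also have "\<dots> = cw n s' (i # w')" using s' Cons.prems by (subst s'(2), subst cw_mult) auto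
 finally have e: "cw n s (i # w) = cw n s' (i # w')" .
 have i: "i \<le> n" using Cons.prems by simp
 obtain s2 w2 where "s2 \<in> SC n" "cw n s' (i # w') = cw n s2 w2" "sorted_wrt (<) w2" "set w2 \<subseteq> insert i (set w')"
  using cw_insert[OF s'(3,1) i s'(4)] by blast
 then show ?case using e s'(4) i by (intro bexI[of _ s2] exI[of _ w2]) auto
qed

definition sorted_free :: "nat \<Rightarrow> free \<Rightarrow> bool" where
 "sorted_free n f \<longleftrightarrow> f \<in> FC n \<and> (\<forall>w\<in>supp n f. sorted_wrt (<) w)"

lemma sorted_free_add:
 assumes "sorted_free n f" "sorted_free n g"
 shows "sorted_free n (f \<oplus>\<^bsub>FA n\<^esub> g)"
 using assms FA_add_closed[of f n g] unfolding sorted_free_def by blast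

text \<open>Induction on the size of the support: one word is sorted at a time, and since sorting
  yields a single sorted word the sum stays of the required form.\<close>

lemma clifford_normal_form:
 assumes "f \<in> FC n"
 shows "\<exists>g. sorted_free n g \<and> cl n f = cl n g"
 using assms
proof (induction "card (supp n f)" arbitrary: f)
 case 0
 then have "supp n f = {}" using FA_finite by simp
 then show ?case using 0 by (intro exI[of _ f]) (simp add: sorted_free_def)
next
 case (Suc k)
 interpret S: cring "S_ring n" by (rule cring_S)
 note f = Suc.prems
 obtain w where w: "w \<in> supp n f" using Suc.hyps(2) by (metis card.empty ex_in_conv nat.distinct(1))
 have wl: "set w \<subseteq> {..n}" by (rule FA_letters[OF f w])
 define h where "h = f(w := \<zero>\<^bsub>S_ring n\<^esub>)"
 have sh: "supp n h = supp n f - {w}" by (auto simp: h_def supp_def)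
 have h: "h \<in> FC n" using f unfolding FA_carrier sh by (auto simp: h_def)
 have "card (supp n h) = k" using Suc.hyps(2) w FA_finite[OF f] by (simp add: sh)
 then obtain g where g: "sorted_free n g" "cl n h = cl n g" using Suc.hyps(1)[OF _ h] by metis
 obtain s' w' where s': "s' \<in> SC n" "cw n (f w) w = cw n s' w'" "sorted_wrt (<) w'" "set w' \<subseteq> {..n}"
  using cw_sort[OF FA_val[OF f] wl] by blast
 have e: "f = h \<oplus>\<^bsub>FA n\<^esub> fw n (f w) w"
  using FA_val[OF f] by (auto simp: FA_ops h_def free_word_def fun_eq_iff)
 have gc: "g \<in> FC n" using g by (simp add: sorted_free_def)
 have "cl n f = cl n h \<oplus>\<^bsub>clifford n\<^esub> cw n (f w) w"
  by (subst e, subst cl_ring(1)) (simp_all add: h free_word_carrier FA_val[OF f] wl)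
 also have "\<dots> = cl n (g \<oplus>\<^bsub>FA n\<^esub> fw n s' w')"
  unfolding g(2) s'(2) by (rule cl_ring(1)[OF gc free_word_carrier[OF s'(1,4)]])
 finally have "cl n f = cl n (g \<oplus>\<^bsub>FA n\<^esub> fw n s' w')" .
 moreover have "sorted_free n (fw n s' w')"
  using s' free_word_carrier[OF s'(1,4)] by (auto simp: sorted_free_def supp_def free_word_def split: if_splits)
 ultimately show ?case
  using sorted_free_add[OF g(1)] by (intro exI[of _ "g \<oplus>\<^bsub>FA n\<^esub> fw n s' w'"] conjI)
qed

lemma spin_def': "spin n \<epsilon> f = (\<Sum>w\<in>supp n f. iota n (f w) * word_mon n \<epsilon> w)"
 by (simp add: spin_def act_def)

lemma spin_add:
 "f \<in> FC n \<Longrightarrow> g \<in> FC n \<Longrightarrow> spin n \<epsilon> (f \<oplus>\<^bsub>FA n\<^esub> g) = spin n \<epsilon> f + spin n \<epsilon> g"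
 unfolding spin_def by (rule act_add)

lemma spin_free_word:
 "s \<in> SC n \<Longrightarrow> set w \<subseteq> {..n} \<Longrightarrow> spin n \<epsilon> (fw n s w) = iota n s * word_mon n \<epsilon> w"
 by (simp add: spin_def act_free_word)

lemma spin_mult:
 assumes "f \<in> FC n" "g \<in> FC n"
 shows "spin n \<epsilon> (f \<otimes>\<^bsub>FA n\<^esub> g) = (\<Sum>w\<in>supp n f. iota n (f w) * act n \<epsilon> w g [])"
 unfolding spin_def act_mult[OF assms] by (simp add: act_def sum_distrib_left mult.assoc)

lemma spin_word_mult:
 assumes "s \<in> SC n" "set w \<subseteq> {..n}" "g \<in> FC n"
 shows "spin n \<epsilon> (fw n s w \<otimes>\<^bsub>FA n\<^esub> g) = iota n s * act n \<epsilon> w g []"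
proof -
 have c: "fw n s w \<in> FC n" using assms by (intro free_word_carrier)
 have "spin n \<epsilon> (fw n s w \<otimes>\<^bsub>FA n\<^esub> g)
   = (\<Sum>x\<in>{w}. iota n (fw n s w x) * act n \<epsilon> x g [])"
  unfolding spin_mult[OF c assms(3)]
  by (rule sum.mono_neutral_left) (auto simp: supp_def free_word_def iota_zero)
 then show ?thesis by (simp add: iota_free_word)
qed

lemma cf_iota_word: "cf n (iota n s * word_mon n \<epsilon> w) y = word_sign n \<epsilon> w * cf n (iota n s) (y - lam n w)"
 unfolding word_mon_def by (subst mult.commute) (rule cf_mon_times)

lemma cf_spin: "cf n (spin n \<epsilon> f) y = (\<Sum>w\<in>supp n f. word_sign n \<epsilon> w * cf n (iota n (f w)) (y - lam n w))"
 by (simp add: spin_def' cf_sum cf_iota_word)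

lemma diag_spin: "f \<in> FC n \<Longrightarrow> diag n (spin n \<epsilon> f)"
 unfolding spin_def' word_mon_def
 by (intro diag_sum, subst mult.commute, intro diag_mon_times diag_iota FA_val)

lemma letter_sign_pm: "\<epsilon> * \<epsilon> = 1 \<Longrightarrow> letter_sign n \<epsilon> i w * letter_sign n \<epsilon> i w = 1"
proof -
 assume e: "\<epsilon> * \<epsilon> = 1"
 have "(\<epsilon> * simplex_sign n * (-1) ^ k) * (\<epsilon> * simplex_sign n * (-1) ^ k)
   = (\<epsilon> * \<epsilon>) * (simplex_sign n * simplex_sign n) * ((-1) ^ k * (-1) ^ k)" for k by simp
 moreover have "(-1::real) ^ k * (-1) ^ k = 1" for k by (simp flip: power_mult_distrib)
 ultimately show ?thesis using e simplex_sign(1)[of n] by (simp add: letter_sign_def)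
qed

lemma word_sign_pm: "\<epsilon> * \<epsilon> = 1 \<Longrightarrow> word_sign n \<epsilon> w * word_sign n \<epsilon> w = 1"
proof (induction w)
 case (Cons i w)
 have "word_sign n \<epsilon> (i # w) * word_sign n \<epsilon> (i # w)
   = (letter_sign n \<epsilon> i w * letter_sign n \<epsilon> i w) * (word_sign n \<epsilon> w * word_sign n \<epsilon> w)" by simp
 then show ?case using Cons letter_sign_pm[OF Cons.prems, of n i w] by simp
qed simp

lemma word_sign_nonzero: "\<epsilon> * \<epsilon> = 1 \<Longrightarrow> word_sign n \<epsilon> w \<noteq> 0"
 using word_sign_pm[of \<epsilon> n w] by auto

text \<open>The parameter occurs once for each letter 0; this is what the two spin representations
  together can distinguish.\<close>

lemma word_sign_minus: "word_sign n (-1) w = (-1) ^ count_list w 0 * word_sign n 1 w"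
proof (induction w)
 case (Cons i w)
 have "letter_sign n (-1) i w = (if i = 0 then -1 else 1) * letter_sign n 1 i w"
  by (simp add: letter_sign_def)
 then show ?case using Cons by simp
qed simp

text \<open>Exponents of \<open>S\<close> have components congruent to each other modulo
  \<open>n + 1\<close>, which is twice the step of a letter. Comparing components \<open>j\<close>
  and 0 of \<open>y\<close> therefore recovers the parity of their counts, so words of different
  parity sets contribute to different exponents.\<close>

lemma parity_set_class:
 assumes n: "odd n" and s: "s \<in> SC n" "s' \<in> SC n"
  and nz: "cf n (iota n s) (y - lam n w) \<noteq> 0" "cf n (iota n s') (y - lam n w') \<noteq> 0"
 shows "parity_set n w = parity_set n w'"
proof -
 obtain k d where kd: "y - lam n w = tvec n (k, d)" using S_support[OF s(1) nz(1)] by blast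
 obtain k' d' where kd': "y - lam n w' = tvec n (k', d')" using S_support[OF s(2) nz(2)] by blast
 let ?N = "half n"
 have N: "int (n + 1) = 2 * ?N" "?N > 0" using n by (auto elim!: oddE)
 have "odd (count_list w j + count_list w 0) \<longleftrightarrow> odd (count_list w' j + count_list w' 0)" if j: "j \<in> {1..n}" for j
 proof -
  let ?c = "\<lambda>w. int (count_list w j) - int (count_list w 0)" and ?e = "\<lambda>d. int (lookup d j) - int (lookup d 0)"
  have "lookup y i - ?N * int (count_list w i) = k + 2 * ?N * int (lookup d i)"
   "lookup y i - ?N * int (count_list w' i) = k' + 2 * ?N * int (lookup d' i)"
   if "i \<le> n" for i
   using arg_cong[OF kd, of "\<lambda>v. lookup v i"] arg_cong[OF kd', of "\<lambda>v. lookup v i"] that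
   unfolding lookup_minus lookup_lam lookup_tvec N(1) by auto
  from this[of j] this[of 0] have "?N * (?c w + 2 * ?e d) = ?N * (?c w' + 2 * ?e d')"
   using j unfolding distrib_left right_diff_distrib by (simp add: algebra_simps)
  then have "?c w + 2 * ?e d = ?c w' + 2 * ?e d'" using N(2) by simp
  then have "?c w = ?c w' + 2 * (?e d' - ?e d)" by simp
  then have "even (?c w) = even (?c w')" by (metis dvd_add_times_triv_right_iff mult.commute)
  then show ?thesis by simp
 qed
 then show ?thesis unfolding parity_set_def by auto
qed

lemma count_list_distinct: "distinct w \<Longrightarrow> count_list w j = (if j \<in> set w then 1 else 0)"
 by (induction w) auto

lemma sorted_word_eq:
 assumes w: "sorted_wrt (<) w" "set w \<subseteq> {..n}" and w': "sorted_wrt (<) w'" "set w' \<subseteq> {..n}"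
  and p: "parity_set n w = parity_set n w'" and 0: "0 \<in> set w \<longleftrightarrow> 0 \<in> set w'"
 shows "w = w'"
proof -
 have d: "distinct w" "distinct w'" using w w' by (auto simp: strict_sorted_iff)
 have "j \<in> set w \<longleftrightarrow> j \<in> set w'" for j
 proof (cases "j \<in> {1..n}")
  case True
  then have "odd (count_list w j + count_list w 0) \<longleftrightarrow> odd (count_list w' j + count_list w' 0)"
   using p unfolding parity_set_def by blast
  then show ?thesis using 0 by (simp add: count_list_distinct[OF d(1)] count_list_distinct[OF d(2)] split: if_splits)
 next
  case False
  then show ?thesis using 0 w(2) w'(2) by (cases "j = 0") auto
 qed
 then have "set w = set w'" by blast
 then show ?thesis using w w' by (simp add: strict_sorted_equal)
qed

text \<open>At a given exponent only sorted words of one parity set contribute, and among these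
  membership of the letter 0 determines the word. A suitable combination of the values
  \<open>\<epsilon> = 1\<close> and \<open>\<epsilon> = -1\<close> cancels the other word and
  isolates \<open>w0\<close>.\<close>

lemma spin_independent:
 assumes n: "odd n" and h: "sorted_free n h" and z: "spin n 1 h = 0" "spin n (-1) h = 0"
 shows "h = \<zero>\<^bsub>FA n\<^esub>"
proof -
 have hc: "h \<in> FC n" using h by (simp add: sorted_free_def)
 have "supp n h = {}"
 proof (rule ccontr)
  assume "supp n h \<noteq> {}"
  then obtain w0 where w0: "w0 \<in> supp n h" by blast
  have "iota n (h w0) \<noteq> 0" using w0 by (simp add: supp_iota[OF hc])
  then have "\<exists>v. cf n (iota n (h w0)) v \<noteq> 0"
   using diag_eqI[OF diag_iota[OF FA_val[OF hc]] diag_zero] by (metis cf_zero)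
  then obtain v where v: "cf n (iota n (h w0)) v \<noteq> 0" by blast
  let ?y = "v + lam n w0"
  let ?c = "\<lambda>w. word_sign n 1 w * cf n (iota n (h w)) (?y - lam n w)"
  let ?e = "(-1) ^ count_list w0 0 :: real"
  have "cf n (spin n 1 h) ?y + ?e * cf n (spin n (-1) h) ?y
    = (\<Sum>w\<in>supp n h. (1 + ?e * (-1) ^ count_list w 0) * ?c w)"
   unfolding cf_spin sum_distrib_left sum.distrib[symmetric] word_sign_minus
   by (intro sum.cong refl) (simp add: algebra_simps)
  also have "\<dots> = (\<Sum>w\<in>supp n h. if w = w0 then 2 * ?c w0 else 0)"
  proof (intro sum.cong refl)
   fix w assume w: "w \<in> supp n h"
   show "(1 + ?e * (-1) ^ count_list w 0) * ?c w = (if w = w0 then 2 * ?c w0 else 0)"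
   proof (cases "w = w0")
    case True
    then show ?thesis by (simp flip: power_mult_distrib)
   next
    case False
    show ?thesis
    proof (cases "cf n (iota n (h w)) (?y - lam n w) = 0")
     case nz: False
     have "parity_set n w = parity_set n w0"
      by (rule parity_set_class[OF n FA_val[OF hc] FA_val[OF hc] nz]) (use v in simp)
     moreover have s: "sorted_wrt (<) w" "sorted_wrt (<) w0" using h w w0 by (auto simp: sorted_free_def)
     ultimately have "(0 \<in> set w) \<noteq> (0 \<in> set w0)"
      using sorted_word_eq[of w n w0] FA_letters[OF hc w] FA_letters[OF hc w0] False by blast
     moreover have "distinct w" "distinct w0" using s by (auto simp: strict_sorted_iff)
     ultimately have "?e * (-1) ^ count_list w 0 = -1" by (auto simp: count_list_distinct)
     then show ?thesis using False by simp
    qed (use False in simp)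
   qed
  qed
  also have "\<dots> = 2 * (word_sign n 1 w0 * cf n (iota n (h w0)) v)"
   using w0 FA_finite[OF hc] by simp
  finally show False using v word_sign_nonzero[of 1 n w0] by (simp add: z cf_zero)
 qed
 then show ?thesis by (auto simp: supp_def FA_ops)
qed

text \<open>Passing to a sorted representative changes an element by a member of the ideal, and a
  sorted element killed by both representations is zero.\<close>

lemma clifford_ideal_eq:
 assumes n: "odd n"
 shows "clifford_ideal n = {f \<in> FC n. (spin n 1 f, spin n (-1) f) = 0}"
proof (intro equalityI subsetI)
 fix f assume "f \<in> clifford_ideal n"
 then have "f \<in> spin_kernel n" using clifford_ideal_kernel[OF n] by blast
 then show "f \<in> {f \<in> FC n. (spin n 1 f, spin n (-1) f) = 0}"
  by (simp add: spin_kernel_def spin_def zero_prod_def)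
next
 interpret ring "FA n" by (rule ring_FA)
 interpret I: ideal "clifford_ideal n" "FA n" by (rule ideal_clifford_ideal)
 fix f assume "f \<in> {f \<in> FC n. (spin n 1 f, spin n (-1) f) = 0}"
 then have f: "f \<in> FC n" "spin n 1 f = 0" "spin n (-1) f = 0" by (auto simp: zero_prod_def)
 obtain g where g: "sorted_free n g" "cl n f = cl n g" using clifford_normal_form[OF f(1)] by blast
 have gc: "g \<in> FC n" using g by (simp add: sorted_free_def)
 have fg: "f \<ominus>\<^bsub>FA n\<^esub> g \<in> clifford_ideal n"
  using quotient_eq_iff_same_a_r_cos[OF ideal_clifford_ideal f(1) gc] g(2) by (simp add: cl_def)
 then have "f \<ominus>\<^bsub>FA n\<^esub> g \<in> spin_kernel n" using clifford_ideal_kernel[OF n] by blast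
 then have "spin n \<epsilon> (f \<ominus>\<^bsub>FA n\<^esub> g) = 0" if "\<epsilon> * \<epsilon> = 1" for \<epsilon>
  using that by (simp add: spin_kernel_def spin_def)
 then have "spin n \<epsilon> f - spin n \<epsilon> g = 0" if "\<epsilon> * \<epsilon> = 1" for \<epsilon>
  using that f(1) gc unfolding spin_def minus_eq by (simp add: act_add act_neg)
 from this[of 1] this[of "-1"] have "g = \<zero>\<^bsub>FA n\<^esub>"
  using f by (intro spin_independent[OF n g(1)]) simp_all
 then show "f \<in> clifford_ideal n" using fg f(1) by (simp add: minus_eq)
qed

lemma cl_fiber:
 assumes n: "odd n" and f: "f \<in> FC n"
 shows "cl n f = {g \<in> FC n. spin n 1 g = spin n 1 f \<and> spin n (-1) g = spin n (-1) f}"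
proof -
 have "cl n f = {g \<in> FC n. (spin n 1 g, spin n (-1) g) = (spin n 1 f, spin n (-1) f)}"
  unfolding cl_def
  by (rule a_r_coset_fiber) (use ring.is_abelian_group[OF ring_FA] clifford_ideal_eq[OF n] f in \<open>simp_all add: spin_add\<close>)
 then show ?thesis by simp
qed

lemma clifford_coords_cl:
 assumes n: "odd n" and g: "sorted_free n g"
 shows "clifford_coords n (cl n g) = g"
proof -
 interpret ring "FA n" by (rule ring_FA)
 have gc: "g \<in> FC n" using g by (simp add: sorted_free_def)
 have eq: "(\<lambda>f. f \<in> cl n g \<and> (\<forall>w. f w \<noteq> \<zero>\<^bsub>S_ring n\<^esub> \<longrightarrow> sorted_wrt (<) w)) = (\<lambda>f. f \<in> cl n g \<and> sorted_free n f)"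
  using cl_fiber[OF n gc] by (auto simp: sorted_free_def supp_def fun_eq_iff)
 show ?thesis
  unfolding clifford_coords_def eq
 proof (rule the_equality)
  show "g \<in> cl n g \<and> sorted_free n g" using g gc cl_fiber[OF n gc] by simp
  fix f assume "f \<in> cl n g \<and> sorted_free n f"
  then have f: "f \<in> FC n" "sorted_free n f" "spin n 1 f = spin n 1 g" "spin n (-1) f = spin n (-1) g"
   using cl_fiber[OF n gc] by auto
  have "supp n (\<ominus>\<^bsub>FA n\<^esub> g) = supp n g"
  proof -
   interpret S: cring "S_ring n" by (rule cring_S)
   show ?thesis using FA_val[OF gc] by (auto simp: FA_neg[OF gc] supp_def)
  qed
  then have "sorted_free n (\<ominus>\<^bsub>FA n\<^esub> g)" using g gc by (simp add: sorted_free_def)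
  then have "sorted_free n (f \<ominus>\<^bsub>FA n\<^esub> g)" unfolding minus_eq by (rule sorted_free_add[OF f(2)])
  moreover have "spin n \<epsilon> (f \<ominus>\<^bsub>FA n\<^esub> g) = spin n \<epsilon> f - spin n \<epsilon> g" for \<epsilon>
   using f(1) gc unfolding spin_def minus_eq by (simp add: act_add act_neg)
  ultimately have "f \<ominus>\<^bsub>FA n\<^esub> g = \<zero>\<^bsub>FA n\<^esub>" using f by (intro spin_independent[OF n]) simp_all
  then show "f = g" using f(1) gc by (simp add: r_right_minus_eq)
 qed
qed

section \<open>The Dirac module\<close>

definition spin_cl :: "nat \<Rightarrow> free set \<Rightarrow> amb" where
 "spin_cl n x = spin n 1 (SOME f. f \<in> x)"

lemma spin_cl:
 assumes n: "odd n" and f: "f \<in> FC n"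
 shows "spin_cl n (cl n f) = spin n 1 f"
proof -
 have "(SOME g. g \<in> cl n f) \<in> cl n f" by (rule someI[of _ f]) (simp add: cl_fiber[OF n f] f)
 then show ?thesis unfolding spin_cl_def by (simp add: cl_fiber[OF n f])
qed

lemma lam_upt: "lam n [i..<n + 1] = (\<Sum>j\<in>{i..n}. single j (half n))"
proof (induction "n + 1 - i" arbitrary: i)
 case (Suc k)
 then have i: "i \<le> n" "k = n + 1 - Suc i" by simp_all
 have "[i..<n + 1] = i # [Suc i..<n + 1]" using i(1) by (simp add: upt_conv_Cons del: upt_Suc)
 then show ?case using Suc(1)[OF i(2)] i(1) by (simp add: sum.atLeast_Suc_atMost del: upt_Suc)
qed simp

text \<open>The letters from \<open>n\<close> down to 1 meet only larger letters and contribute no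
  sign; the sign of 0 is compensated by the prefactor in \<open>letter_sign\<close>.\<close>

lemma word_sign_upt: "word_sign n 1 [0..<n + 1] = 1"
proof -
 have c: "count_list [i..<Suc n] j = (if i \<le> j \<and> j \<le> n then 1 else 0)" for i j
  by (subst count_list_distinct) auto
 have 1: "word_sign n 1 [i..<n + 1] = 1" if "1 \<le> i" for i
  using that
 proof (induction "n + 1 - i" arbitrary: i)
  case (Suc k)
  then have i: "i \<le> n" "k = n + 1 - Suc i" by simp_all
  have "(\<Sum>j=1..<i. count_list [Suc i..<n + 1] j + count_list [Suc i..<n + 1] 0) = 0"
   by (intro sum.neutral ballI) (simp add: c del: upt_Suc)
  then have "letter_sign n 1 i [Suc i..<n + 1] = 1" using Suc.prems by (simp add: letter_sign_def del: upt_Suc)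
  then show ?case using Suc.hyps(1)[OF i(2)] i(1) by (simp add: upt_conv_Cons[of i] del: upt_Suc)
 qed simp
 have "(\<Sum>j=1..n. j * (count_list [1..<n + 1] j + count_list [1..<n + 1] 0)) = (\<Sum>j=1..n. j)"
  by (intro sum.cong refl) (auto simp: c simp del: upt_Suc)
 then have "letter_sign n 1 0 [1..<n + 1] = 1"
  unfolding letter_sign_def sum_nat_upto using simplex_sign(1)[of n] by (simp add: simplex_sign_def del: upt_Suc)
 moreover have "[0..<n + 1] = 0 # [1..<n + 1]" by (simp add: upt_conv_Cons del: upt_Suc)
 ultimately show ?thesis using 1[of 1] by (simp del: upt_Suc)
qed

definition volume_mon :: "nat \<Rightarrow> amb" where
 "volume_mon n = mon n (\<Sum>i\<le>n. single i (half n)) 1"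

text \<open>In the full word each letter occurs once, so every sum of counts with the letter 0 is
  even and the word is invisible to letters on its left.\<close>

lemma word_mon_volume:
 assumes "\<epsilon> = 1 \<or> \<epsilon> = -1" "set w \<subseteq> {..n}"
 shows "word_mon n \<epsilon> (w @ [0..<n + 1]) = mon n 0 \<epsilon> * volume_mon n * word_mon n \<epsilon> w"
proof -
 have c: "count_list [0..<n + 1] j = 1" if "j \<le> n" for j
  using that by (subst count_list_distinct) auto
 have "word_sign n \<epsilon> [0..<n + 1] = \<epsilon>"
  using assms(1) word_sign_upt[of n] word_sign_minus[of n "[0..<n + 1]"] c[of 0] by auto
 then have e: "word_mon n \<epsilon> [0..<n + 1] = (mon n 0 \<epsilon> * volume_mon n) * word_mon n \<epsilon> []"
  using lam_upt[of n 0] by (simp add: word_mon_def volume_mon_def mon_times_mon atMost_atLeast0 del: upt_Suc lam.simps(2) word_sign.simps(2))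
 have p: "parity_set n (x @ [0..<n + 1]) = parity_set n (x @ [])" for x
  using c[of 0] c unfolding parity_set_def by (auto simp del: upt_Suc)
 show ?thesis
  using word_mon_prefix[OF e _ assms(2)] p p[of "[]"] by simp
qed

lemma iota_sqrt_T': "iota n (S_const n (sqrt_T_R n)) = volume_mon n"
 by (simp add: iota_sqrt_T volume_mon_def)

definition volume_rel :: "nat \<Rightarrow> free" where
 "volume_rel n = fw n \<one>\<^bsub>S_ring n\<^esub> [0..<n + 1]
   \<ominus>\<^bsub>FA n\<^esub> fw n (S_const n (sqrt_T_R n)) []"

lemma volume_rel_carrier: "volume_rel n \<in> FC n"
proof -
 interpret ring "FA n" by (rule ring_FA)
 interpret S: cring "S_ring n" by (rule cring_S)
 show ?thesis unfolding volume_rel_def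
  by (intro minus_closed free_word_carrier) (auto simp: S_const(2))
qed

text \<open>The factor vanishes for \<open>\<epsilon> = 1\<close> and is \<open>-2 T^(1/2)\<close>,
  a unit, for \<open>\<epsilon> = -1\<close>.\<close>

lemma spin_volume:
 assumes \<epsilon>: "\<epsilon> = 1 \<or> \<epsilon> = -1" and f: "f \<in> FC n"
 shows "spin n \<epsilon> (f \<otimes>\<^bsub>FA n\<^esub> volume_rel n) = (mon n 0 \<epsilon> - 1) * volume_mon n * spin n \<epsilon> f"
proof -
 interpret ring "FA n" by (rule ring_FA)
 interpret S: cring "S_ring n" by (rule cring_S)
 have c: "fw n \<one>\<^bsub>S_ring n\<^esub> [0..<n + 1] \<in> FC n"
  "fw n (S_const n (sqrt_T_R n)) [] \<in> FC n"
  by (auto intro!: free_word_carrier simp: S_const(2))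
 have "act n \<epsilon> w (volume_rel n) [] = (mon n 0 \<epsilon> - 1) * volume_mon n * word_mon n \<epsilon> w" if "w \<in> supp n f" for w
 proof -
  have w: "set w \<subseteq> {..n}" by (rule FA_letters[OF f that])
  have "act n \<epsilon> w (fw n \<one>\<^bsub>S_ring n\<^esub> [0..<n + 1]) [] = word_mon n \<epsilon> (w @ [0..<n + 1])"
   by (subst act_free_word) (auto simp: iota_one)
  moreover have "act n \<epsilon> w (fw n (S_const n (sqrt_T_R n)) []) [] = volume_mon n * word_mon n \<epsilon> w"
   by (subst act_free_word) (auto simp: iota_sqrt_T' S_const(2))
  moreover have "act n \<epsilon> w (volume_rel n) [] = act n \<epsilon> w (fw n \<one>\<^bsub>S_ring n\<^esub> [0..<n + 1]) []
    - act n \<epsilon> w (fw n (S_const n (sqrt_T_R n)) []) []"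
   unfolding volume_rel_def minus_eq using act_add[OF c(1) a_inv_closed[OF c(2)]] act_neg[OF c(2)] by simp
  ultimately have "act n \<epsilon> w (volume_rel n) [] = word_mon n \<epsilon> (w @ [0..<n + 1]) - volume_mon n * word_mon n \<epsilon> w"
   by (simp only:)
  then show ?thesis unfolding word_mon_volume[OF \<epsilon> w] by (simp add: algebra_simps)
 qed
 then show ?thesis
  unfolding spin_mult[OF f volume_rel_carrier] spin_def'[of n \<epsilon> f] sum_distrib_left
  by (intro sum.cong refl) (simp add: ac_simps)
qed

text \<open>An element that vanishes for \<open>\<epsilon> = 1\<close> is determined by its value
  for \<open>\<epsilon> = -1\<close>, and there the volume relation can be divided out.\<close>

lemma dirac_ideal_eq:
 assumes n: "odd n"
 shows "dirac_ideal n = {x \<in> carrier (clifford n). spin_cl n x = 0}"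
proof -
 interpret ring "FA n" by (rule ring_FA)
 interpret S: cring "S_ring n" by (rule cring_S)
 interpret C: ring "clifford n" by (rule ring_clifford)
 have c: "fw n \<one>\<^bsub>S_ring n\<^esub> [0..<n + 1] \<in> FC n"
  "fw n (S_const n (sqrt_T_R n)) [] \<in> FC n"
  by (auto intro!: free_word_carrier simp: S_const(2))
 have rel: "clifford_word n \<one>\<^bsub>S_ring n\<^esub> [0..<n + 1] \<ominus>\<^bsub>clifford n\<^esub> clifford_scalar n (S_const n (sqrt_T_R n)) = cl n (volume_rel n)"
  unfolding clifford_word_def clifford_scalar_def cl_def[symmetric] volume_rel_def minus_eq C.minus_eq
  using c by (simp add: cl_ring(1)[symmetric] cl_neg del: upt_Suc)
 show ?thesis
  unfolding dirac_ideal_def rel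
 proof (intro equalityI subsetI)
  fix x assume "x \<in> {a \<otimes>\<^bsub>clifford n\<^esub> cl n (volume_rel n) | a. a \<in> carrier (clifford n)}"
  then obtain f where f: "f \<in> FC n" "x = cl n f \<otimes>\<^bsub>clifford n\<^esub> cl n (volume_rel n)"
   unfolding clifford_carrier by blast
  then show "x \<in> {x \<in> carrier (clifford n). spin_cl n x = 0}"
   using volume_rel_carrier[of n] spin_volume[of 1 f n]
   by (simp add: cl_ring(2) cl_closed spin_cl[OF n] mon_0_1)
 next
  fix x assume "x \<in> {x \<in> carrier (clifford n). spin_cl n x = 0}"
  then obtain f where f: "f \<in> FC n" "x = cl n f" "spin n 1 f = 0"
   unfolding clifford_carrier using spin_cl[OF n] by auto
  let ?v = "\<Sum>i\<le>n. single i (half n)"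
  \<comment> \<open>The inverse of \<open>-2 T^(1/2)\<close>, the value of the volume relation for
    \<open>\<epsilon> = -1\<close>.\<close>
  let ?r = "S_const n (fls_const (-1/2) * fls_X_intpow (- half n))"
  have r: "?r \<in> SC n" by (rule S_const)
  have "tvec n (- half n, 0) = - ?v"
   by (rule poly_mapping_eqI) (simp add: lookup_tvec lookup_sum_single)
  then have ir: "iota n ?r = mon n (- ?v) (-1/2)"
   using ev_monom[of "fls_const (-1/2) * fls_X_intpow (- half n)" "- half n" "-1/2" n 0]
   by (simp add: S_const iota_S_cls tate_monom_carrier)
  let ?g = "fw n ?r [] \<otimes>\<^bsub>FA n\<^esub> f"
  have g: "?g \<in> FC n" using r f by (simp add: free_word_carrier)
  have sg: "spin n \<epsilon> ?g = iota n ?r * spin n \<epsilon> f" for \<epsilon>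
   using spin_word_mult[OF r _ f(1), of "[]"] by (simp add: spin_def)
  have inv: "(mon n 0 (-1) - 1) * volume_mon n * iota n ?r = 1"
  proof -
   have "mon n 0 (-1) - 1 = mon n 0 (-2)"
    using mon_add[of n 0 "-1" "-1"] mon_uminus[of n 0 1] mon_0_1[of n] by simp
   then show ?thesis unfolding ir volume_mon_def by (simp add: mon_times_mon mon_0_1)
  qed
  have "(mon n 0 (-1) - 1) * volume_mon n * (iota n ?r * spin n (-1) f) = spin n (-1) f"
   unfolding mult.assoc[symmetric] inv by (rule mult_1_left)
  then have "spin n (-1) (?g \<otimes>\<^bsub>FA n\<^esub> volume_rel n) = spin n (-1) f"
   using spin_volume[of "-1", OF _ g] sg by simp
  moreover have "spin n 1 (?g \<otimes>\<^bsub>FA n\<^esub> volume_rel n) = spin n 1 f"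
   using spin_volume[of 1, OF _ g] f(3) by (simp add: mon_0_1)
  ultimately have "cl n (?g \<otimes>\<^bsub>FA n\<^esub> volume_rel n) = cl n f"
   using g volume_rel_carrier[of n] f(1) by (simp add: cl_fiber[OF n])
  then have "x = cl n ?g \<otimes>\<^bsub>clifford n\<^esub> cl n (volume_rel n)"
   using f(2) g volume_rel_carrier by (simp add: cl_ring(2))
  then show "x \<in> {a \<otimes>\<^bsub>clifford n\<^esub> cl n (volume_rel n) | a. a \<in> carrier (clifford n)}" using cl_closed[OF g] by blast
 qed
qed

section \<open>A basis of the spin representation\<close>

lemma S_monomial:
 assumes "keys d \<subseteq> {..n}"
 shows "\<exists>s\<in>SC n. iota n s = mon n (tvec n (k, d)) c"
proof -
 let ?a = "simplex_sign n ^ lookup d 0"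
 let ?r = "fls_const (?a * c) * fls_X_intpow k"
 have "?a * (?a * c) = c"
  using simplex_sign(1)[of n] by (simp flip: mult.assoc power_mult_distrib)
 moreover have "ev n (tate_monom ?r d) = mon n (tvec n (k, d)) (?a * (?a * c))"
  by (rule ev_monom) simp
 ultimately have "ev n (tate_monom ?r d) = mon n (tvec n (k, d)) c" by (simp only:)
 then have "iota n (S_cls n (tate_monom ?r d)) = mon n (tvec n (k, d)) c"
  by (simp add: iota_S_cls tate_monom_carrier[OF assms])
 moreover have "S_cls n (tate_monom ?r d) \<in> SC n"
  unfolding S_carrier using tate_monom_carrier[OF assms] by blast
 ultimately show ?thesis by blast
qed

lemma keys_sum_single: "keys (\<Sum>i\<le>n. single i (g i)) \<subseteq> {..n::nat}"
proof
 fix i assume "i \<in> keys (\<Sum>i\<le>n. single i (g i))"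
 then have "lookup (\<Sum>i\<le>n. single i (g i)) i \<noteq> 0" by (simp add: in_keys_iff)
 then show "i \<in> {..n}" unfolding lookup_sum_single by (auto split: if_splits)
qed

lemma half_double: "odd n \<Longrightarrow> int (n + 1) = 2 * half n"
 by (auto elim!: oddE)

text \<open>
 Words of equal parity class differ by a scalar: after dividing by a power of \<open>T\<^bsup>1/2\<^esup>\<close>, the
 exponents differ by nonnegative multiples of \<open>2\<close>, which are powers of the \<open>z\<^sub>i\<close>.
\<close>

lemma parity_set_scalar:
 assumes n: "odd n" and w: "set w \<subseteq> {..n}" "set w' \<subseteq> {..n}" and p: "parity_set n w = parity_set n w'"
 shows "\<exists>s\<in>SC n. iota n s = mon n (lam n w - lam n w') (word_sign n 1 w * word_sign n 1 w')"
proof -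
 let ?N = "half n"
 define \<delta> where "\<delta> i = int (count_list w i) - int (count_list w' i)" for i
 \<comment> \<open>Congruent to every \<open>\<delta> i\<close> modulo 2 because the parity sets
   agree, and low enough for the differences \<open>\<delta> i - k\<close> to be
   nonnegative.\<close>
 define k where "k = \<delta> 0 - 2 * int (length w + length w')"
 have ev: "even (\<delta> i - k)" if "i \<le> n" for i
 proof -
  have "odd (count_list w i + count_list w 0) \<longleftrightarrow> odd (count_list w' i + count_list w' 0)"
  proof (cases "i = 0")
   case False
   then have "i \<in> {1..n}" using that by simp
   then show ?thesis using p unfolding parity_set_def by blast
  qed simp
  then show ?thesis unfolding \<delta>_def k_def by auto
 qed
 have ge: "0 \<le> \<delta> i - k" for i
 proof -
  have "int (count_list v j) \<le> int (length v)" for v j by (simp add: count_le_length)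
  moreover have "0 \<le> int (count_list v j)" for v j by simp
  ultimately show ?thesis
   unfolding \<delta>_def k_def of_nat_add
   by (smt (verit, best))
 qed
 define d where "d = (\<Sum>i\<le>n. single i (nat ((\<delta> i - k) div 2)))"
 have "tvec n (?N * k, d) = lam n w - lam n w'"
 proof (rule poly_mapping_eqI)
  fix i
  show "lookup (tvec n (?N * k, d)) i = lookup (lam n w - lam n w') i"
  proof (cases "i \<le> n")
   case True
   have g: "2 * int (nat ((\<delta> i - k) div 2)) = \<delta> i - k" using ev[OF True] ge[of i] by simp
   have "?N * k + 2 * ?N * int (nat ((\<delta> i - k) div 2)) = ?N * (k + 2 * int (nat ((\<delta> i - k) div 2)))"
    by (simp only: distrib_left mult.assoc mult.left_commute)
   then have "?N * k + 2 * ?N * int (nat ((\<delta> i - k) div 2)) = ?N * \<delta> i"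
    unfolding g by simp
   then show ?thesis using True half_double[OF n]
    unfolding lookup_tvec d_def lookup_sum_single lookup_minus lookup_lam \<delta>_def by (simp add: right_diff_distrib)
  next
   case False
   then have "i \<notin> set w" "i \<notin> set w'" using w by auto
   then show ?thesis using False unfolding lookup_tvec lookup_minus lookup_lam by simp
  qed
 qed
 moreover have "keys d \<subseteq> {..n}" unfolding d_def by (rule keys_sum_single)
 ultimately show ?thesis
  using S_monomial[of d n "?N * k" "word_sign n 1 w * word_sign n 1 w'"] by (simp only:)
qed

lemma word_mon_scalar:
 assumes "iota n s = mon n (lam n w - lam n w') (word_sign n 1 w * word_sign n 1 w')"
 shows "iota n s * word_mon n 1 w' = word_mon n 1 w"
 using word_sign_pm[of 1 n w'] by (simp add: assms word_mon_def mon_times_mon mult.assoc)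

section \<open>The basis indexed by the subsets of \<open>{1..n}\<close>\<close>

abbreviation wd :: "nat set \<Rightarrow> nat list" where "wd \<equiv> sorted_list_of_set"

lemma count_wd: "finite X \<Longrightarrow> count_list (wd X) j = (if j \<in> X then 1 else 0)"
 by (subst count_list_distinct) auto

lemma set_wd: "X \<subseteq> {..n} \<Longrightarrow> set (wd X) \<subseteq> {..n::nat}"
 using finite_subset[of X "{..n}"] by simp

lemma wd_letters: "J \<in> Pow {1..n} \<Longrightarrow> set (wd J) \<subseteq> {..n::nat}"
 by (rule set_wd) auto

lemma parity_wd: "J \<in> Pow {1..n} \<Longrightarrow> parity_set n (wd J) = J"
proof -
 assume J: "J \<in> Pow {1..n}"
 have "finite J" using J finite_subset[of J "{1..n}"] by simp
 moreover have "0 \<notin> J" using J by auto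
 ultimately show ?thesis using J unfolding parity_set_def by (auto simp: count_wd split: if_splits)
qed

lemma parity_set_Pow: "parity_set n w \<in> Pow {1..n}"
 by (auto simp: parity_set_def)

definition bas :: "nat \<Rightarrow> (nat set \<Rightarrow> tate set) \<Rightarrow> amb" where
 "bas n s = (\<Sum>J\<in>Pow {1..n}. iota n (s J) * word_mon n 1 (wd J))"

definition spin_image :: "nat \<Rightarrow> amb set" where
 "spin_image n = spin n 1 ` FC n"

text \<open>Words are grouped by parity set; within a group each is a scalar multiple of the sorted
  word.\<close>

lemma spin_bas:
 assumes n: "odd n" and f: "f \<in> FC n"
 shows "\<exists>s. (\<forall>J. s J \<in> SC n) \<and> spin n 1 f = bas n s"
proof -
 interpret S: cring "S_ring n" by (rule cring_S)
 define t where "t w = (SOME t. t \<in> SC n \<and> iota n t * word_mon n 1 (wd (parity_set n w)) = word_mon n 1 w)" for w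
 have t: "t w \<in> SC n \<and> iota n (t w) * word_mon n 1 (wd (parity_set n w)) = word_mon n 1 w"
  if w: "w \<in> supp n f" for w
 proof -
  obtain t0 where t0: "t0 \<in> SC n"
   "iota n t0 = mon n (lam n w - lam n (wd (parity_set n w))) (word_sign n 1 w * word_sign n 1 (wd (parity_set n w)))"
   using parity_set_scalar[OF n FA_letters[OF f w] wd_letters[OF parity_set_Pow] parity_wd[OF parity_set_Pow, symmetric]] ..
  show ?thesis unfolding t_def by (rule someI[of _ t0]) (use t0 word_mon_scalar[OF t0(2)] in blast)
 qed
 define s where "s J = (\<Oplus>\<^bsub>S_ring n\<^esub>w\<in>{w\<in>supp n f. parity_set n w = J}. f w \<otimes>\<^bsub>S_ring n\<^esub> t w)" for J
 have s: "s J \<in> SC n \<and> iota n (s J) = (\<Sum>w\<in>{w\<in>supp n f. parity_set n w = J}. iota n (f w \<otimes>\<^bsub>S_ring n\<^esub> t w))" for J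
  unfolding s_def by (rule iota_finsum) (use FA_finite[OF f] FA_val[OF f] t in auto)
 have "bas n s = (\<Sum>J\<in>Pow {1..n}. \<Sum>w\<in>{w\<in>supp n f. parity_set n w = J}. iota n (f w) * word_mon n 1 w)"
  unfolding bas_def
 proof (intro sum.cong refl)
  fix J assume J: "J \<in> Pow {1..n}"
  show "iota n (s J) * word_mon n 1 (wd J) = (\<Sum>w\<in>{w\<in>supp n f. parity_set n w = J}. iota n (f w) * word_mon n 1 w)"
   unfolding conjunct2[OF s] sum_distrib_right
  proof (intro sum.cong refl)
   fix w assume "w \<in> {w\<in>supp n f. parity_set n w = J}"
   then have w: "w \<in> supp n f" "parity_set n w = J" by auto
   show "iota n (f w \<otimes>\<^bsub>S_ring n\<^esub> t w) * word_mon n 1 (wd J) = iota n (f w) * word_mon n 1 w"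
    using t[OF w(1)] FA_val[OF f] unfolding w(2) by (simp add: iota_ring mult.assoc)
  qed
 qed
 also have "\<dots> = spin n 1 f"
  unfolding spin_def' by (rule sum.group) (use FA_finite[OF f] parity_set_Pow in auto)
 finally show ?thesis using s by metis
qed

text \<open>The distinguished preimage, supported on sorted words without the letter 0, one for each
  parity set.\<close>

definition bas_free :: "nat \<Rightarrow> (nat set \<Rightarrow> tate set) \<Rightarrow> free" where
 "bas_free n s w = (if set w \<subseteq> {1..n} \<and> w = wd (set w) then s (set w) else \<zero>\<^bsub>S_ring n\<^esub>)"

lemma bas_free:
 assumes s: "\<And>J. s J \<in> SC n"
 shows "sorted_free n (bas_free n s)"
  "act n 1 u (bas_free n s) v = (\<Sum>J\<in>Pow {1..n}. iota n (s J) * word_mon n 1 (u @ wd J @ v))"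
  "spin n 1 (bas_free n s) = bas n s"
proof -
 interpret S: cring "S_ring n" by (rule cring_S)
 have sub: "supp n (bas_free n s) \<subseteq> wd ` Pow {1..n}"
 proof
  fix w assume "w \<in> supp n (bas_free n s)"
  then have "set w \<in> Pow {1..n}" "w = wd (set w)" by (auto simp: supp_def bas_free_def split: if_splits)
  then show "w \<in> wd ` Pow {1..n}" by (rule rev_image_eqI)
 qed
 have fin: "finite (supp n (bas_free n s))" by (rule finite_subset[OF sub]) simp
 have c: "bas_free n s \<in> FC n"
  unfolding FA_carrier
 proof (intro conjI allI ballI fin)
  show "bas_free n s w \<in> SC n" for w by (simp add: bas_free_def s)
  show "set w \<subseteq> {..n}" if "w \<in> supp n (bas_free n s)" for w
  proof -
   from that sub obtain J where "J \<in> Pow {1..n}" "w = wd J" by blast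
   then show ?thesis using wd_letters by blast
  qed
 qed
 moreover have "sorted_wrt (<) w" if "w \<in> supp n (bas_free n s)" for w
 proof -
  from that sub obtain J where "w = wd J" by blast
  then show ?thesis by simp
 qed
 ultimately show "sorted_free n (bas_free n s)" by (simp add: sorted_free_def)
 have inj: "inj_on wd (Pow {1..n})"
 proof (rule inj_onI)
  fix J K :: "nat set" assume "J \<in> Pow {1..n}" "K \<in> Pow {1..n}" "wd J = wd K"
  then show "J = K" using parity_wd by metis
 qed
 have act: "act n 1 u (bas_free n s) v = (\<Sum>J\<in>Pow {1..n}. iota n (s J) * word_mon n 1 (u @ wd J @ v))" for u v
  unfolding act_superset[OF c finite_imageI[OF finite_Pow_iff[THEN iffD2, OF finite_atLeastAtMost]] sub] sum.reindex[OF inj]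
 proof (intro sum.cong refl)
  fix J assume J: "J \<in> Pow {1..n}"
  then have "set (wd J) = J" using finite_subset[of J "{1..n}"] by simp
  then show "((\<lambda>w. iota n (bas_free n s w) * word_mon n 1 (u @ w @ v)) \<circ> wd) J = iota n (s J) * word_mon n 1 (u @ wd J @ v)"
   using J by (simp add: bas_free_def)
 qed
 then show "act n 1 u (bas_free n s) v = (\<Sum>J\<in>Pow {1..n}. iota n (s J) * word_mon n 1 (u @ wd J @ v))" .
 show "spin n 1 (bas_free n s) = bas n s" using act[of "[]" "[]"] by (simp add: spin_def bas_def)
qed

lemma spin_image_iff:
 assumes n: "odd n"
 shows "a \<in> spin_image n \<longleftrightarrow> (\<exists>s. (\<forall>J. s J \<in> SC n) \<and> a = bas n s)"
proof
 assume "a \<in> spin_image n"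
 then obtain f where f: "f \<in> FC n" "a = spin n 1 f" unfolding spin_image_def by blast
 show "\<exists>s. (\<forall>J. s J \<in> SC n) \<and> a = bas n s" unfolding f(2) by (rule spin_bas[OF n f(1)])
next
 assume "\<exists>s. (\<forall>J. s J \<in> SC n) \<and> a = bas n s"
 then obtain s where s: "\<And>J. s J \<in> SC n" "a = bas n s" by blast
 have "bas_free n s \<in> FC n" using bas_free(1)[of s n] s(1) by (simp add: sorted_free_def)
 then show "a \<in> spin_image n" unfolding spin_image_def s(2) using bas_free(3)[of s n] s(1) by (metis image_eqI)
qed

lemma diag_spin_image: "a \<in> spin_image n \<Longrightarrow> diag n a"
 unfolding spin_image_def using diag_spin by blast

lemma spin_image_zero: "0 \<in> spin_image n"
proof -
 interpret ring "FA n" by (rule ring_FA)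
 show ?thesis unfolding spin_image_def
  by (rule image_eqI[of _ _ "\<zero>\<^bsub>FA n\<^esub>"]) (simp_all add: spin_def act_zero)
qed

lemma spin_image_add: "a \<in> spin_image n \<Longrightarrow> b \<in> spin_image n \<Longrightarrow> a + b \<in> spin_image n"
proof -
 interpret ring "FA n" by (rule ring_FA)
 assume "a \<in> spin_image n" "b \<in> spin_image n"
 then obtain f g where fg: "f \<in> FC n" "g \<in> FC n" "a = spin n 1 f" "b = spin n 1 g"
  unfolding spin_image_def by blast
 then show ?thesis unfolding spin_image_def
  by (intro image_eqI[of _ _ "f \<oplus>\<^bsub>FA n\<^esub> g"]) (simp_all add: spin_add)
qed

lemma spin_image_sum: "(\<And>x. x \<in> A \<Longrightarrow> f x \<in> spin_image n) \<Longrightarrow> sum f A \<in> spin_image n"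
 by (induction A rule: infinite_finite_induct) (auto intro: spin_image_add spin_image_zero)

lemma spin_image_scale:
 assumes "s \<in> SC n" "a \<in> spin_image n"
 shows "iota n s * a \<in> spin_image n"
proof -
 interpret ring "FA n" by (rule ring_FA)
 obtain f where f: "f \<in> FC n" "a = spin n 1 f" using assms(2) unfolding spin_image_def by blast
 have "fw n s [] \<in> FC n" using assms by (intro free_word_carrier) auto
 then show ?thesis using f spin_word_mult[OF assms(1) _ f(1), of "[]" 1] unfolding spin_image_def
  by (intro image_eqI[of _ _ "fw n s [] \<otimes>\<^bsub>FA n\<^esub> f"]) (simp_all add: spin_def)
qed

lemma spin_image_word: "set w \<subseteq> {..n} \<Longrightarrow> word_mon n 1 w \<in> spin_image n"
proof -
 interpret S: cring "S_ring n" by (rule cring_S)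
 assume w: "set w \<subseteq> {..n}"
 show ?thesis unfolding spin_image_def
  by (rule image_eqI[of _ _ "fw n \<one>\<^bsub>S_ring n\<^esub> w"])
   (use w in \<open>simp_all add: spin_free_word iota_one free_word_carrier\<close>)
qed

lemma cf_bas: "cf n (bas n s) y = (\<Sum>J\<in>Pow {1..n}. word_sign n 1 (wd J) * cf n (iota n (s J)) (y - lam n (wd J)))"
 by (simp add: bas_def cf_sum cf_iota_word)

lemma parity_set_tvec:
 assumes n: "odd n" and s: "s \<in> SC n" "cf n (iota n s) (y - lam n w) \<noteq> 0"
  and d: "keys d \<subseteq> {..n}" "y - lam n w' = tvec n (k, d)"
 shows "parity_set n w = parity_set n w'"
proof -
 obtain t where t: "t \<in> SC n" "iota n t = mon n (tvec n (k, d)) 1"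
  using S_monomial[OF d(1)] ..
 have "cf n (iota n t) (y - lam n w') \<noteq> 0" unfolding t(2) d(2) by (simp add: cf_mon)
 then show ?thesis by (rule parity_set_class[OF n s(1) t(1) s(2)])
qed

lemma bas_support:
 assumes "cf n (bas n s) y \<noteq> 0"
 shows "\<exists>J\<in>Pow {1..n}. cf n (iota n (s J)) (y - lam n (wd J)) \<noteq> 0"
 using assms unfolding cf_bas by (auto dest!: sum_nonzero)

text \<open>Basis elements with different \<open>J\<close> have disjoint supports by their parity
  sets, so no cancellation occurs. Independence of the basis and the valuation formulas rest on
  this.\<close>

lemma bas_coefficient:
 assumes n: "odd n" and s: "\<And>J. s J \<in> SC n" and J: "J \<in> Pow {1..n}"
  and nz: "cf n (iota n (s J)) v \<noteq> 0"
 shows "cf n (bas n s) (v + lam n (wd J)) = word_sign n 1 (wd J) * cf n (iota n (s J)) v"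
proof -
 let ?y = "v + lam n (wd J)"
 let ?c = "\<lambda>K. word_sign n 1 (wd K) * cf n (iota n (s K)) (?y - lam n (wd K))"
 have "(\<Sum>K\<in>Pow {1..n}. ?c K) = (\<Sum>K\<in>Pow {1..n}. if K = J then ?c J else 0)"
 proof (intro sum.cong refl)
  fix K assume K: "K \<in> Pow {1..n}"
  show "?c K = (if K = J then ?c J else 0)"
  proof (cases "K = J \<or> cf n (iota n (s K)) (?y - lam n (wd K)) = 0")
   case False
   have "parity_set n (wd K) = parity_set n (wd J)"
    by (rule parity_set_class[OF n s s, of K ?y _ J]) (use False nz in auto)
   then show ?thesis using False parity_wd J K by metis
  qed auto
 qed
 then show ?thesis unfolding cf_bas using J by simp
qed

lemma bas_eqD:
 assumes n: "odd n" and s: "\<And>J. s J \<in> SC n" and t: "\<And>J. t J \<in> SC n"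
  and eq: "bas n s = bas n t" and J: "J \<in> Pow {1..n}"
 shows "s J = t J"
proof -
 interpret S: cring "S_ring n" by (rule cring_S)
 define d where "d K = s K \<ominus>\<^bsub>S_ring n\<^esub> t K" for K
 have d: "d K \<in> SC n" "iota n (d K) = iota n (s K) - iota n (t K)" for K
  using s t unfolding d_def S.minus_eq by (simp_all add: iota_ring iota_uminus)
 have z: "bas n d = 0" using eq unfolding bas_def d(2) left_diff_distrib sum_subtractf by simp
 have "iota n (d J) = 0"
 proof (rule diag_eqI[OF diag_iota[OF d(1)] diag_zero])
  fix v show "cf n (iota n (d J)) v = cf n 0 v"
  proof (rule ccontr)
   assume "cf n (iota n (d J)) v \<noteq> cf n 0 v"
   then have nz: "cf n (iota n (d J)) v \<noteq> 0" by (simp add: cf_zero)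
   have "cf n (bas n d) (v + lam n (wd J)) = word_sign n 1 (wd J) * cf n (iota n (d J)) v"
    by (rule bas_coefficient[where s = d, OF n d(1) J nz])
   then show False using nz word_sign_nonzero[of 1 n "wd J"] by (simp add: z cf_zero)
  qed
 qed
 then show ?thesis using iota_inj[OF s t] by (simp add: d(2))
qed

lemma cf_times_support:
 assumes a: "diag n a" and b: "diag n b" and nz: "cf n (a * b) y \<noteq> 0"
 shows "\<exists>u v. y = u + v \<and> cf n a u \<noteq> 0 \<and> cf n b v \<noteq> 0"
proof -
 have "\<exists>i. lookup (a $$ i * b $$ (dgr n y - i)) y \<noteq> 0"
 proof -
  obtain x where "lookup (a $$ (x - fls_subdegree b) * b $$ (fls_subdegree b + dgr n y - x)) y \<noteq> 0"
   using nz unfolding cf_def fls_times_nth(1) lookup_sum by (auto dest!: sum_nonzero)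
  moreover have "fls_subdegree b + dgr n y - x = dgr n y - (x - fls_subdegree b)" by simp
  ultimately show ?thesis by metis
 qed
 then obtain i where "lookup (a $$ i * b $$ (dgr n y - i)) y \<noteq> 0" ..
 then have "y \<in> keys (a $$ i * b $$ (dgr n y - i))" by (simp add: in_keys_iff)
 then obtain u v where uv: "y = u + v" "u \<in> keys (a $$ i)" "v \<in> keys (b $$ (dgr n y - i))"
  using keys_mult by blast
 have "i = dgr n u" "dgr n y - i = dgr n v"
  using uv(2,3) a b unfolding diag_def by (auto simp: in_keys_iff)
 then have "cf n a u \<noteq> 0" "cf n b v \<noteq> 0" using uv(2,3) by (auto simp: cf_def in_keys_iff)
 then show ?thesis using uv(1) by blast
qed

section \<open>The Dirac module as a space of series\<close>

definition Mel :: "nat \<Rightarrow> amb \<Rightarrow> free set set" where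
 "Mel n a = {x \<in> carrier (clifford n). spin_cl n x = a}"

definition psi :: "nat \<Rightarrow> free set set \<Rightarrow> amb" where
 "psi n m = spin_cl n (SOME x. x \<in> m)"

lemma spin_cl_add:
 assumes n: "odd n" and x: "x \<in> carrier (clifford n)" and y: "y \<in> carrier (clifford n)"
 shows "spin_cl n (x \<oplus>\<^bsub>clifford n\<^esub> y) = spin_cl n x + spin_cl n y"
proof -
 interpret ring "FA n" by (rule ring_FA)
 obtain f g where f: "f \<in> FC n" "x = cl n f" and g: "g \<in> FC n" "y = cl n g"
  using x y unfolding clifford_carrier by blast
 then show ?thesis by (simp add: cl_ring spin_cl[OF n] spin_add)
qed

text \<open>Elements with vanishing series form the left ideal \<open>dirac_ideal\<close>, which is
  closed under left multiplication by its definition.\<close>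

lemma spin_cl_mult_zero:
 assumes n: "odd n" and c: "c \<in> carrier (clifford n)" and x: "x \<in> carrier (clifford n)" "spin_cl n x = 0"
 shows "spin_cl n (c \<otimes>\<^bsub>clifford n\<^esub> x) = 0"
proof -
 interpret C: ring "clifford n" by (rule ring_clifford)
 interpret ring "FA n" by (rule ring_FA)
 interpret S: cring "S_ring n" by (rule cring_S)
 let ?r = "clifford_word n \<one>\<^bsub>S_ring n\<^esub> [0..<n + 1] \<ominus>\<^bsub>clifford n\<^esub> clifford_scalar n (S_const n (sqrt_T_R n))"
 have "clifford_word n s w \<in> carrier (clifford n)" if "s \<in> SC n" "set w \<subseteq> {..n}" for s w
  unfolding clifford_word_def cl_def[symmetric] using that by (intro cl_closed free_word_carrier)
 then have r: "?r \<in> carrier (clifford n)"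
  unfolding clifford_scalar_def by (intro C.minus_closed) (simp_all add: S_const(2) subset_iff del: upt_Suc)
 have "x \<in> dirac_ideal n" using x by (simp add: dirac_ideal_eq[OF n])
 then obtain a where a: "a \<in> carrier (clifford n)" "x = a \<otimes>\<^bsub>clifford n\<^esub> ?r"
  unfolding dirac_ideal_def by blast
 have "c \<otimes>\<^bsub>clifford n\<^esub> x = (c \<otimes>\<^bsub>clifford n\<^esub> a) \<otimes>\<^bsub>clifford n\<^esub> ?r"
  unfolding a(2) using c a(1) r by (simp add: C.m_assoc)
 then have "c \<otimes>\<^bsub>clifford n\<^esub> x \<in> dirac_ideal n"
  unfolding dirac_ideal_def using C.m_closed[OF c a(1)] by blast
 then show ?thesis by (simp add: dirac_ideal_eq[OF n])
qed

lemma spin_cl_uminus: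
 assumes n: "odd n" and x: "x \<in> carrier (clifford n)"
 shows "spin_cl n (\<ominus>\<^bsub>clifford n\<^esub> x) = - spin_cl n x"
proof -
 interpret C: ring "clifford n" by (rule ring_clifford)
 have "spin_cl n \<zero>\<^bsub>clifford n\<^esub> + spin_cl n \<zero>\<^bsub>clifford n\<^esub> = spin_cl n \<zero>\<^bsub>clifford n\<^esub>"
  using spin_cl_add[OF n C.zero_closed C.zero_closed] by simp
 then have z: "spin_cl n \<zero>\<^bsub>clifford n\<^esub> = 0" by simp
 have "spin_cl n (\<ominus>\<^bsub>clifford n\<^esub> x) + spin_cl n x = 0"
  using spin_cl_add[OF n C.a_inv_closed[OF x] x] x by (simp add: C.l_neg z)
 then show ?thesis by (simp add: eq_neg_iff_add_eq_0)
qed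

lemma spin_cl_mult_cong:
 assumes n: "odd n" and c: "c \<in> carrier (clifford n)" and x: "x \<in> carrier (clifford n)" "y \<in> carrier (clifford n)"
  and eq: "spin_cl n x = spin_cl n y"
 shows "spin_cl n (c \<otimes>\<^bsub>clifford n\<^esub> x) = spin_cl n (c \<otimes>\<^bsub>clifford n\<^esub> y)"
proof -
 interpret C: ring "clifford n" by (rule ring_clifford)
 let ?d = "x \<oplus>\<^bsub>clifford n\<^esub> (\<ominus>\<^bsub>clifford n\<^esub> y)"
 have "spin_cl n ?d = 0" using x eq by (simp add: spin_cl_add[OF n] spin_cl_uminus[OF n])
 then have "spin_cl n (c \<otimes>\<^bsub>clifford n\<^esub> ?d) = 0" by (intro spin_cl_mult_zero[OF n c]) (simp_all add: x)
 moreover have "c \<otimes>\<^bsub>clifford n\<^esub> ?d = (c \<otimes>\<^bsub>clifford n\<^esub> x) \<oplus>\<^bsub>clifford n\<^esub> (\<ominus>\<^bsub>clifford n\<^esub> (c \<otimes>\<^bsub>clifford n\<^esub> y))"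
  using c x by (simp add: C.r_distr C.r_minus)
 ultimately show ?thesis using c x by (simp add: spin_cl_add[OF n] spin_cl_uminus[OF n])
qed

lemma self_module_simps:
 "carrier (clifford_self_module n) = carrier (clifford n)" "\<zero>\<^bsub>clifford_self_module n\<^esub> = \<zero>\<^bsub>clifford n\<^esub>"
 "x \<oplus>\<^bsub>clifford_self_module n\<^esub> y = x \<oplus>\<^bsub>clifford n\<^esub> y" "x \<odot>\<^bsub>clifford_self_module n\<^esub> y = x \<otimes>\<^bsub>clifford n\<^esub> y"
 by (simp_all add: clifford_self_module_def)

lemma abelian_group_self_module: "abelian_group (clifford_self_module n)"
proof -
 interpret C: ring "clifford n" by (rule ring_clifford)
 show ?thesis
  by (rule abelian_groupI) (auto simp: self_module_simps C.a_ac intro: C.l_neg)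
qed

lemma dirac_coset:
 assumes n: "odd n" and x: "x \<in> carrier (clifford n)"
 shows "dirac_ideal n +>\<^bsub>clifford_self_module n\<^esub> x = Mel n (spin_cl n x)"
proof -
 have "dirac_ideal n +>\<^bsub>clifford_self_module n\<^esub> x
   = {y \<in> carrier (clifford_self_module n). spin_cl n y = spin_cl n x}"
  by (rule a_r_coset_fiber[OF abelian_group_self_module])
   (use x in \<open>simp_all add: self_module_simps spin_cl_add[OF n] dirac_ideal_eq[OF n]\<close>)
 then show ?thesis by (simp add: Mel_def self_module_simps)
qed

lemma Mel_ex:
 assumes n: "odd n" and a: "a \<in> spin_image n"
 shows "\<exists>x. x \<in> Mel n a"
proof -
 obtain f where f: "f \<in> FC n" "a = spin n 1 f" using a unfolding spin_image_def by blast
 then have "cl n f \<in> Mel n a" by (simp add: Mel_def cl_closed spin_cl[OF n])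
 then show ?thesis ..
qed

lemma dirac_carrier:
 assumes n: "odd n"
 shows "DC n = Mel n ` spin_image n"
proof -
 have "DC n = (\<lambda>x. Mel n (spin_cl n x)) ` carrier (clifford n)"
  unfolding dirac_module_def quot_module_simps self_module_simps by (intro image_cong refl dirac_coset[OF n])
 also have "\<dots> = Mel n ` spin_cl n ` carrier (clifford n)" by (simp add: image_image)
 also have "spin_cl n ` carrier (clifford n) = spin_image n"
 proof -
  have "carrier (clifford n) = cl n ` FC n" using clifford_carrier by blast
  then have "spin_cl n ` carrier (clifford n) = (\<lambda>f. spin_cl n (cl n f)) ` FC n"
   by (simp add: image_image)
  also have "\<dots> = spin_image n" unfolding spin_image_def by (intro image_cong refl spin_cl[OF n])
  finally show ?thesis .
 qed
 finally show ?thesis .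
qed

lemma Mel_carrier: "odd n \<Longrightarrow> a \<in> spin_image n \<Longrightarrow> Mel n a \<in> DC n"
 by (simp add: dirac_carrier)

lemma psi_Mel:
 assumes n: "odd n" and a: "a \<in> spin_image n"
 shows "psi n (Mel n a) = a"
proof -
 have "(SOME x. x \<in> Mel n a) \<in> Mel n a" by (rule someI_ex[OF Mel_ex[OF n a]])
 then show ?thesis unfolding psi_def by (simp add: Mel_def)
qed

lemma psi_carrier:
 assumes n: "odd n" and m: "m \<in> DC n"
 shows "psi n m \<in> spin_image n" "Mel n (psi n m) = m"
 using m psi_Mel[OF n] by (auto simp: dirac_carrier[OF n])

lemma psi_inj:
 "odd n \<Longrightarrow> x \<in> DC n \<Longrightarrow> y \<in> DC n \<Longrightarrow> psi n x = psi n y \<Longrightarrow> x = y"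
 using psi_carrier(2) by metis

lemma Mel_add:
 assumes n: "odd n" and a: "a \<in> spin_image n" and b: "b \<in> spin_image n"
 shows "Mel n a \<oplus>\<^bsub>dirac_module n\<^esub> Mel n b = Mel n (a + b)"
proof -
 interpret C: ring "clifford n" by (rule ring_clifford)
 have "Mel n a \<oplus>\<^bsub>dirac_module n\<^esub> Mel n b = (\<Union>x\<in>Mel n a. \<Union>y\<in>Mel n b. {x \<oplus>\<^bsub>clifford n\<^esub> y})"
  unfolding dirac_module_def quot_module_simps set_add_def' self_module_simps ..
 also have "\<dots> = Mel n (a + b)"
 proof (intro equalityI subsetI)
  fix z assume "z \<in> (\<Union>x\<in>Mel n a. \<Union>y\<in>Mel n b. {x \<oplus>\<^bsub>clifford n\<^esub> y})"
  then show "z \<in> Mel n (a + b)" by (auto simp: Mel_def spin_cl_add[OF n])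
 next
  fix z assume z: "z \<in> Mel n (a + b)"
  obtain y where y: "y \<in> Mel n b" using Mel_ex[OF n b] ..
  let ?x = "z \<oplus>\<^bsub>clifford n\<^esub> (\<ominus>\<^bsub>clifford n\<^esub> y)"
  have x: "?x \<in> Mel n a" using z y by (simp add: Mel_def spin_cl_add[OF n] spin_cl_uminus[OF n])
  have "z = ?x \<oplus>\<^bsub>clifford n\<^esub> y" using z y by (simp add: Mel_def C.a_assoc C.l_neg)
  then show "z \<in> (\<Union>x\<in>Mel n a. \<Union>y\<in>Mel n b. {x \<oplus>\<^bsub>clifford n\<^esub> y})" using x y by blast
 qed
 finally show ?thesis .
qed

lemma Mel_zero: "odd n \<Longrightarrow> \<zero>\<^bsub>dirac_module n\<^esub> = Mel n 0"
 unfolding dirac_module_def quot_module_simps Mel_def by (rule dirac_ideal_eq)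

lemma Mel_smult:
 assumes n: "odd n" and h: "h \<in> FC n" and f: "f \<in> FC n"
 shows "cl n h \<odot>\<^bsub>dirac_module n\<^esub> Mel n (spin n 1 f) = Mel n (spin n 1 (h \<otimes>\<^bsub>FA n\<^esub> f))"
proof -
 interpret C: ring "clifford n" by (rule ring_clifford)
 have "dirac_ideal n +>\<^bsub>clifford_self_module n\<^esub> (cl n h \<odot>\<^bsub>clifford_self_module n\<^esub> x) = Mel n (spin n 1 (h \<otimes>\<^bsub>FA n\<^esub> f))"
  if x: "x \<in> Mel n (spin n 1 f)" for x
 proof -
  have xc: "x \<in> carrier (clifford n)" "spin_cl n x = spin_cl n (cl n f)"
   using x f by (simp_all add: Mel_def spin_cl[OF n])
  have "spin_cl n (cl n h \<otimes>\<^bsub>clifford n\<^esub> x) = spin_cl n (cl n h \<otimes>\<^bsub>clifford n\<^esub> cl n f)"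
   by (rule spin_cl_mult_cong[OF n cl_closed[OF h] xc(1) cl_closed[OF f] xc(2)])
  also have "\<dots> = spin n 1 (h \<otimes>\<^bsub>FA n\<^esub> f)"
   using h f by (simp add: cl_ring(2) spin_cl[OF n] FA_mult_closed(1))
  finally have "spin_cl n (cl n h \<otimes>\<^bsub>clifford n\<^esub> x) = spin n 1 (h \<otimes>\<^bsub>FA n\<^esub> f)" .
  then show ?thesis using dirac_coset[OF n C.m_closed[OF cl_closed[OF h] xc(1)]] by (simp add: self_module_simps)
 qed
 moreover have "\<exists>x. x \<in> Mel n (spin n 1 f)" using f by (intro Mel_ex[OF n]) (auto simp: spin_image_def)
 ultimately show ?thesis unfolding dirac_module_def quot_module_simps by blast
qed

lemma abelian_group_dirac:
 assumes n: "odd n" shows "abelian_group (dirac_module n)"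
proof (rule abelian_groupI)
 show "\<zero>\<^bsub>dirac_module n\<^esub> \<in> DC n"
  using Mel_carrier[OF n spin_image_zero] by (simp add: Mel_zero[OF n])
 fix x assume x: "x \<in> DC n"
 then obtain a where a: "a \<in> spin_image n" "x = Mel n a" by (auto simp: dirac_carrier[OF n])
 show "\<zero>\<^bsub>dirac_module n\<^esub> \<oplus>\<^bsub>dirac_module n\<^esub> x = x"
  by (simp add: Mel_zero[OF n] a Mel_add[OF n] spin_image_zero)
 interpret S: cring "S_ring n" by (rule cring_S)
 have "- a \<in> spin_image n"
  using spin_image_scale[of "\<ominus>\<^bsub>S_ring n\<^esub> \<one>\<^bsub>S_ring n\<^esub>" n a] a by (simp add: iota_uminus iota_one)
 then have "Mel n (- a) \<in> DC n" "Mel n (- a) \<oplus>\<^bsub>dirac_module n\<^esub> x = \<zero>\<^bsub>dirac_module n\<^esub>"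
  using a by (simp_all add: Mel_add[OF n] Mel_carrier[OF n] Mel_zero[OF n])
 then show "\<exists>y\<in>DC n. y \<oplus>\<^bsub>dirac_module n\<^esub> x = \<zero>\<^bsub>dirac_module n\<^esub>" by blast
 fix y assume y: "y \<in> DC n"
 then obtain b where b: "b \<in> spin_image n" "y = Mel n b" by (auto simp: dirac_carrier[OF n])
 show "x \<oplus>\<^bsub>dirac_module n\<^esub> y \<in> DC n"
  using a b by (simp add: Mel_add[OF n] Mel_carrier[OF n] spin_image_add)
 show "x \<oplus>\<^bsub>dirac_module n\<^esub> y = y \<oplus>\<^bsub>dirac_module n\<^esub> x"
  using a b by (simp add: Mel_add[OF n] add.commute)
 fix z assume "z \<in> DC n"
 then obtain c where c: "c \<in> spin_image n" "z = Mel n c" by (auto simp: dirac_carrier[OF n])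
 show "x \<oplus>\<^bsub>dirac_module n\<^esub> y \<oplus>\<^bsub>dirac_module n\<^esub> z = x \<oplus>\<^bsub>dirac_module n\<^esub> (y \<oplus>\<^bsub>dirac_module n\<^esub> z)"
  using a b c by (simp add: Mel_add[OF n] spin_image_add add.assoc)
qed

lemma psi_add:
 assumes n: "odd n" and x: "x \<in> DC n" and y: "y \<in> DC n"
 shows "psi n (x \<oplus>\<^bsub>dirac_module n\<^esub> y) = psi n x + psi n y"
 using x y by (auto simp: dirac_carrier[OF n] Mel_add[OF n] psi_Mel[OF n] spin_image_add)

lemma psi_zero: "odd n \<Longrightarrow> psi n \<zero>\<^bsub>dirac_module n\<^esub> = 0"
 by (simp add: Mel_zero psi_Mel spin_image_zero)

lemma psi_minus:
 assumes n: "odd n" and x: "x \<in> DC n" and y: "y \<in> DC n"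
 shows "psi n (x \<ominus>\<^bsub>dirac_module n\<^esub> y) = psi n x - psi n y"
proof -
 interpret abelian_group "dirac_module n" by (rule abelian_group_dirac[OF n])
 have "psi n (\<ominus>\<^bsub>dirac_module n\<^esub> y) + psi n y = 0"
  using psi_add[OF n a_inv_closed[OF y] y] y by (simp add: l_neg psi_zero[OF n])
 then show ?thesis using x y unfolding minus_eq by (simp add: psi_add[OF n] eq_neg_iff_add_eq_0[symmetric])
qed

lemma dirac_scalar:
 assumes n: "odd n" and s: "s \<in> SC n" and m: "m \<in> DC n"
 shows "clifford_scalar n s \<odot>\<^bsub>dirac_module n\<^esub> m \<in> DC n"
  "psi n (clifford_scalar n s \<odot>\<^bsub>dirac_module n\<^esub> m) = iota n s * psi n m"
proof -
 obtain a where a: "a \<in> spin_image n" "m = Mel n a" using m by (auto simp: dirac_carrier[OF n])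
 then obtain f where f: "f \<in> FC n" "a = spin n 1 f" unfolding spin_image_def by blast
 have "clifford_scalar n s \<odot>\<^bsub>dirac_module n\<^esub> m = Mel n (iota n s * a)"
  unfolding clifford_scalar_def clifford_word_def cl_def[symmetric] a(2) f(2)
  using spin_word_mult[OF s _ f(1), of "[]" 1]
  by (subst Mel_smult[OF n]) (simp_all add: f s free_word_carrier spin_def)
 then show "clifford_scalar n s \<odot>\<^bsub>dirac_module n\<^esub> m \<in> DC n"
  "psi n (clifford_scalar n s \<odot>\<^bsub>dirac_module n\<^esub> m) = iota n s * psi n m"
  using spin_image_scale[OF s a(1)] a by (simp_all add: Mel_carrier[OF n] psi_Mel[OF n])
qed

text \<open>The action is read through the module since it is no multiplication by a series: its
  sign varies with the parity set.\<close>

definition gact :: "nat \<Rightarrow> nat \<Rightarrow> free set set \<Rightarrow> amb" where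
 "gact n i m = psi n (clifford_gen n i \<odot>\<^bsub>dirac_module n\<^esub> m)"

lemma gen_carrier: "i \<le> n \<Longrightarrow> fw n \<one>\<^bsub>S_ring n\<^esub> [i] \<in> FC n"
proof -
 interpret S: cring "S_ring n" by (rule cring_S)
 show "i \<le> n \<Longrightarrow> fw n \<one>\<^bsub>S_ring n\<^esub> [i] \<in> FC n" by (intro free_word_carrier) auto
qed

lemma gact_eq:
 assumes n: "odd n" and i: "i \<le> n" and f: "f \<in> FC n"
 shows "gact n i (Mel n (spin n 1 f)) = act n 1 [i] f []"
proof -
 interpret S: cring "S_ring n" by (rule cring_S)
 interpret ring "FA n" by (rule ring_FA)
 have "spin n 1 (fw n \<one>\<^bsub>S_ring n\<^esub> [i] \<otimes>\<^bsub>FA n\<^esub> f) \<in> spin_image n"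
  unfolding spin_image_def using gen_carrier[OF i] f by (intro imageI) simp
 then show ?thesis
  unfolding gact_def clifford_gen_def clifford_word_def cl_def[symmetric] Mel_smult[OF n gen_carrier[OF i] f]
  using i f by (simp add: psi_Mel[OF n] spin_word_mult iota_one)
qed

lemma dirac_op:
 assumes n: "odd n" and m: "m \<in> DC n"
 shows "dirac_op n m \<in> DC n" "psi n (dirac_op n m) = (\<Sum>i\<le>n. gact n i m)"
proof -
 interpret S: cring "S_ring n" by (rule cring_S)
 interpret ring "FA n" by (rule ring_FA)
 interpret C: ring "clifford n" by (rule ring_clifford)
 obtain a where a: "a \<in> spin_image n" "m = Mel n a" using m by (auto simp: dirac_carrier[OF n])
 then obtain f where f: "f \<in> FC n" "a = spin n 1 f" unfolding spin_image_def by blast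
 have "\<exists>h\<in>FC n. (\<Oplus>\<^bsub>clifford n\<^esub>i\<in>A. clifford_gen n i) = cl n h \<and>
   spin n 1 (h \<otimes>\<^bsub>FA n\<^esub> f) = (\<Sum>i\<in>A. gact n i m)" if "finite A" "A \<subseteq> {..n}" for A
  using that
 proof (induction A rule: finite_induct)
  case empty
  have "cl n \<zero>\<^bsub>FA n\<^esub> \<oplus>\<^bsub>clifford n\<^esub> cl n \<zero>\<^bsub>FA n\<^esub> = cl n \<zero>\<^bsub>FA n\<^esub>" by (simp add: cl_ring)
  then have "\<zero>\<^bsub>clifford n\<^esub> = cl n \<zero>\<^bsub>FA n\<^esub>"
   using C.add.l_cancel_one'[of "cl n \<zero>\<^bsub>FA n\<^esub>" "cl n \<zero>\<^bsub>FA n\<^esub>"] by (simp add: cl_closed)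
  then show ?case using f by (intro bexI[of _ "\<zero>\<^bsub>FA n\<^esub>"]) (simp_all add: spin_def act_zero)
 next
  case (insert i A)
  then obtain h where h: "h \<in> FC n" "(\<Oplus>\<^bsub>clifford n\<^esub>i\<in>A. clifford_gen n i) = cl n h"
   "spin n 1 (h \<otimes>\<^bsub>FA n\<^esub> f) = (\<Sum>i\<in>A. gact n i m)" by auto
  have i: "i \<le> n" "\<And>j. j \<in> A \<Longrightarrow> j \<le> n" using insert.prems by auto
  let ?e = "fw n \<one>\<^bsub>S_ring n\<^esub> [i]"
  have gen: "clifford_gen n j = cl n (fw n \<one>\<^bsub>S_ring n\<^esub> [j])" for j
   by (simp add: clifford_gen_def clifford_word_def cl_def)
  have gc: "clifford_gen n j \<in> carrier (clifford n)" if "j \<le> n" for j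
   unfolding gen by (rule cl_closed[OF gen_carrier[OF that]])
  have "(\<Oplus>\<^bsub>clifford n\<^esub>i\<in>insert i A. clifford_gen n i) = clifford_gen n i \<oplus>\<^bsub>clifford n\<^esub> cl n h"
   unfolding h(2)[symmetric] using insert.hyps i gc by (intro C.finsum_insert) auto
  also have "\<dots> = cl n (?e \<oplus>\<^bsub>FA n\<^esub> h)" unfolding gen by (rule cl_ring(1)[OF gen_carrier[OF i(1)] h(1)])
  finally have 1: "(\<Oplus>\<^bsub>clifford n\<^esub>i\<in>insert i A. clifford_gen n i) = cl n (?e \<oplus>\<^bsub>FA n\<^esub> h)" .
  have "spin n 1 ((?e \<oplus>\<^bsub>FA n\<^esub> h) \<otimes>\<^bsub>FA n\<^esub> f) = spin n 1 (?e \<otimes>\<^bsub>FA n\<^esub> f) + spin n 1 (h \<otimes>\<^bsub>FA n\<^esub> f)"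
   using gen_carrier[OF i(1)] h(1) f(1) by (simp add: l_distr spin_add)
  also have "spin n 1 (?e \<otimes>\<^bsub>FA n\<^esub> f) = gact n i m"
   unfolding a(2) f(2) gact_eq[OF n i(1) f(1)] using i f by (simp add: spin_word_mult iota_one)
  finally have 2: "spin n 1 ((?e \<oplus>\<^bsub>FA n\<^esub> h) \<otimes>\<^bsub>FA n\<^esub> f) = (\<Sum>j\<in>insert i A. gact n j m)"
   using insert.hyps h(3) by simp
  show ?case using 1 2 gen_carrier[OF i(1)] h(1) by (intro bexI[of _ "?e \<oplus>\<^bsub>FA n\<^esub> h"] conjI) simp_all
 qed
 from this[of "{..n}"] obtain h where h: "h \<in> FC n" "(\<Oplus>\<^bsub>clifford n\<^esub>i\<in>{..n}. clifford_gen n i) = cl n h"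
   "spin n 1 (h \<otimes>\<^bsub>FA n\<^esub> f) = (\<Sum>i\<le>n. gact n i m)" by auto
 have "dirac_op n m = Mel n (spin n 1 (h \<otimes>\<^bsub>FA n\<^esub> f))"
  unfolding dirac_op_def h(2) a(2) f(2) by (rule Mel_smult[OF n h(1) f(1)])
 moreover have "spin n 1 (h \<otimes>\<^bsub>FA n\<^esub> f) \<in> spin_image n"
  unfolding spin_image_def using h(1) f(1) by (intro imageI) simp
 ultimately show "dirac_op n m \<in> DC n" "psi n (dirac_op n m) = (\<Sum>i\<le>n. gact n i m)"
  using h(3) by (simp_all add: Mel_carrier[OF n] psi_Mel[OF n])
qed

lemma gact_add:
 assumes n: "odd n" and i: "i \<le> n" and x: "x \<in> DC n" and y: "y \<in> DC n"
 shows "gact n i (x \<oplus>\<^bsub>dirac_module n\<^esub> y) = gact n i x + gact n i y"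
proof -
 interpret ring "FA n" by (rule ring_FA)
 obtain f g where f: "f \<in> FC n" "x = Mel n (spin n 1 f)" and g: "g \<in> FC n" "y = Mel n (spin n 1 g)"
  using x y unfolding dirac_carrier[OF n] spin_image_def by blast
 have "x \<oplus>\<^bsub>dirac_module n\<^esub> y = Mel n (spin n 1 (f \<oplus>\<^bsub>FA n\<^esub> g))"
  unfolding f g spin_add[OF f(1) g(1)] by (rule Mel_add[OF n]) (simp_all add: spin_image_def f g)
 then show ?thesis using f g by (simp add: gact_eq[OF n i] act_add)
qed

lemma gact_scale:
 assumes n: "odd n" and i: "i \<le> n" and s: "s \<in> SC n" and x: "x \<in> DC n"
 shows "gact n i (clifford_scalar n s \<odot>\<^bsub>dirac_module n\<^esub> x) = iota n s * gact n i x"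
proof -
 interpret ring "FA n" by (rule ring_FA)
 obtain f where f: "f \<in> FC n" "x = Mel n (spin n 1 f)"
  using x unfolding dirac_carrier[OF n] spin_image_def by blast
 let ?w = "fw n s []"
 have w: "?w \<in> FC n" by (intro free_word_carrier s) simp
 have "act n 1 [i] (?w \<otimes>\<^bsub>FA n\<^esub> f) [] = (\<Sum>v\<in>{[]}. \<Sum>y\<in>supp n f. iota n (?w v) * iota n (f y) * word_mon n 1 ([i] @ v @ y @ []))"
  unfolding act_mult[OF w f(1)]
  by (rule sum.mono_neutral_left) (auto simp: supp_def free_word_def iota_zero)
 also have "\<dots> = iota n s * act n 1 [i] f []"
  by (simp add: iota_free_word act_def sum_distrib_left mult.assoc)
 finally show ?thesis
  unfolding clifford_scalar_def clifford_word_def cl_def[symmetric] f(2) Mel_smult[OF n w f(1)]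
  using w f(1) by (simp add: gact_eq[OF n i])
qed

lemma gact_word:
 assumes n: "odd n" and i: "i \<le> n" and w: "set w \<subseteq> {..n}"
 shows "gact n i (Mel n (word_mon n 1 w)) = word_mon n 1 (i # w)"
proof -
 interpret S: cring "S_ring n" by (rule cring_S)
 have "word_mon n 1 w = spin n 1 (fw n \<one>\<^bsub>S_ring n\<^esub> w)"
  using w by (simp add: spin_free_word iota_one)
 then show ?thesis using w by (simp add: gact_eq[OF n i] free_word_carrier act_free_word iota_one)
qed

lemma cf_gact_bas:
 assumes n: "odd n" and i: "i \<le> n" and s: "\<And>J. s J \<in> SC n"
 shows "cf n (gact n i (Mel n (bas n s))) y = (\<Sum>J\<in>Pow {1..n}. letter_sign n 1 i (wd J) *
  (word_sign n 1 (wd J) * cf n (iota n (s J)) (y - single i (half n) - lam n (wd J))))"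
proof -
 have "gact n i (Mel n (bas n s)) = (\<Sum>J\<in>Pow {1..n}. iota n (s J) * word_mon n 1 ([i] @ wd J @ []))"
  unfolding bas_free(3)[of s n, OF s, symmetric]
  using bas_free(1)[of s n, OF s] by (subst gact_eq[OF n i]) (simp_all add: sorted_free_def bas_free(2) s)
 then show ?thesis by (simp add: cf_sum cf_iota_word mult.assoc diff_diff_eq)
qed

lemma gact_support:
 assumes n: "odd n" and i: "i \<le> n" and m: "m \<in> DC n" and nz: "cf n (gact n i m) y \<noteq> 0"
 shows "cf n (psi n m) (y - single i (half n)) \<noteq> 0"
proof -
 obtain s where s: "\<And>J. s J \<in> SC n" "psi n m = bas n s"
  using psi_carrier(1)[OF n m] unfolding spin_image_iff[OF n] by blast
 have ms: "m = Mel n (bas n s)" using psi_carrier(2)[OF n m] s(2) by simp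
 let ?y = "y - single i (half n)"
 obtain J where J: "J \<in> Pow {1..n}" "cf n (iota n (s J)) (?y - lam n (wd J)) \<noteq> 0"
  using nz unfolding ms cf_gact_bas[OF n i s(1)] by (auto dest!: sum_nonzero)
 have "cf n (bas n s) (?y - lam n (wd J) + lam n (wd J)) = word_sign n 1 (wd J) * cf n (iota n (s J)) (?y - lam n (wd J))"
  by (rule bas_coefficient[where s = s, OF n s(1) J])
 then show ?thesis using J(2) word_sign_nonzero[of 1 n "wd J"] unfolding s(2) by simp
qed

text \<open>Only one parity set contributes at the exponent of \<open>v\<close>, namely that of
  \<open>v\<close>, so the letter sign can be pulled out of the sum.\<close>

lemma gact_value:
 assumes n: "odd n" and i: "i \<le> n" and m: "m \<in> DC n" and v: "set v \<subseteq> {..n}"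
 shows "cf n (gact n i m) (lam n (i # v)) = letter_sign n 1 i v * cf n (psi n m) (lam n v)"
proof -
 obtain s where s: "\<And>J. s J \<in> SC n" "psi n m = bas n s"
  using psi_carrier(1)[OF n m] unfolding spin_image_iff[OF n] by blast
 have ms: "m = Mel n (bas n s)" using psi_carrier(2)[OF n m] s(2) by simp
 have y: "lam n (i # v) - single i (half n) = lam n v" by simp
 show ?thesis
  unfolding s(2) unfolding ms cf_gact_bas[OF n i s(1)] cf_bas y sum_distrib_left
 proof (intro sum.cong refl)
  fix J assume J: "J \<in> Pow {1..n}"
  show "letter_sign n 1 i (wd J) * (word_sign n 1 (wd J) * cf n (iota n (s J)) (lam n v - lam n (wd J)))
    = letter_sign n 1 i v * (word_sign n 1 (wd J) * cf n (iota n (s J)) (lam n v - lam n (wd J)))"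
  proof (cases "cf n (iota n (s J)) (lam n v - lam n (wd J)) = 0")
   case False
   have t: "lam n v - lam n v = tvec n (0, 0)" by (rule poly_mapping_eqI) (simp add: lookup_tvec)
   have "parity_set n (wd J) = parity_set n v"
    by (rule parity_set_tvec[OF n s(1) False _ t]) simp
   then show ?thesis using letter_sign_cong[OF _ i] by metis
  qed simp
 qed
qed

section \<open>Valuation and grading of the Dirac module\<close>

lemma val_add: "val n \<zeta> (u + v) = val n \<zeta> u + val n \<zeta> v"
 by (simp add: val_def lookup_add add_divide_distrib distrib_right sum.distrib)

lemma val_diff: "val n \<zeta> (u - v) = val n \<zeta> u - val n \<zeta> v"
 using val_add[of n \<zeta> "u - v" v] by simp

lemma val_lam:
 assumes n: "odd n" and w: "set w \<subseteq> {..n}"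
 shows "val n \<zeta> (lam n w) = (\<Sum>i\<leftarrow>w. \<zeta> i / 2)"
 using w
proof (induction w)
 case (Cons i w)
 let ?N = "(n + 1) div 2"
 have N: "real (n + 1) = 2 * real ?N" "real ?N \<noteq> 0" using n by (auto elim!: oddE)
 have "val n \<zeta> (single i (int ?N)) = (\<Sum>j\<le>n. if j = i then real ?N * \<zeta> i / real (n + 1) else 0)"
  unfolding val_def by (intro sum.cong refl) (auto simp: lookup_single when_def)
 also have "\<dots> = real ?N * \<zeta> i / (2 * real ?N)" using Cons.prems N(1) by simp
 also have "\<dots> = \<zeta> i / 2" using N(2) by simp
 finally show ?case using Cons by (simp add: val_add)
qed (simp add: val_def)

lemma nu_amb_zero: "nu_amb n \<zeta> 0 = \<infinity>"
 by (simp add: nu_amb_def cf_zero top_ereal_def)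

lemma le_INF_ereal_add:
 assumes "\<And>v. v \<in> A \<Longrightarrow> X \<le> ereal (g v + c)"
 shows "X \<le> (INF v\<in>A. ereal (g v)) + ereal c"
proof -
 have "X - ereal c \<le> (INF v\<in>A. ereal (g v))"
 proof (rule INF_greatest)
  fix v assume "v \<in> A"
  from assms[OF this] show "X - ereal c \<le> ereal (g v)" by (cases X) auto
 qed
 then show ?thesis by (simp add: ereal_minus_le)
qed

lemma nu_clifford_le:
 assumes n: "odd n" and \<zeta>: "\<zeta> \<in> open_simplex n" and g: "sorted_free n g" and y: "cf n (spin n 1 g) y \<noteq> 0"
 shows "nu_clifford n \<zeta> (cl n g) \<le> ereal (val n \<zeta> y)"
proof -
 have gc: "g \<in> FC n" using g by (simp add: sorted_free_def)
 obtain w where w: "w \<in> supp n g" "cf n (iota n (g w)) (y - lam n w) \<noteq> 0"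
  using y unfolding cf_spin by (auto dest!: sum_nonzero)
 have "nu_clifford n \<zeta> (cl n g) \<le> nu_S n \<zeta> (g w) + ereal (\<Sum>i\<leftarrow>w. \<zeta> i / 2)"
  unfolding nu_clifford_def clifford_coords_cl[OF n g] by (rule INF_lower) simp
 also have "nu_S n \<zeta> (g w) \<le> ereal (val n \<zeta> (y - lam n w))"
  unfolding nu_S_eq[OF FA_val[OF gc] \<zeta>] nu_amb_def by (rule INF_lower) (use w in simp)
 finally have "nu_clifford n \<zeta> (cl n g) \<le> ereal (val n \<zeta> (y - lam n w)) + ereal (\<Sum>i\<leftarrow>w. \<zeta> i / 2)"
  by (simp add: add_right_mono)
 then show ?thesis unfolding val_diff val_lam[OF n FA_letters[OF gc w(1)]] by simp
qed

lemma nu_clifford_ge: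
 assumes n: "odd n" and \<zeta>: "\<zeta> \<in> open_simplex n" and g: "sorted_free n g"
  and X: "\<And>w v. w \<in> supp n g \<Longrightarrow> cf n (iota n (g w)) v \<noteq> 0 \<Longrightarrow> X \<le> ereal (val n \<zeta> (v + lam n w))"
 shows "X \<le> nu_clifford n \<zeta> (cl n g)"
 unfolding nu_clifford_def clifford_coords_cl[OF n g]
proof (rule INF_greatest)
 fix w
 have gc: "g \<in> FC n" using g by (simp add: sorted_free_def)
 show "X \<le> nu_S n \<zeta> (g w) + ereal (\<Sum>i\<leftarrow>w. \<zeta> i / 2)"
 proof (cases "w \<in> supp n g")
  case True
  show ?thesis
   unfolding nu_S_eq[OF FA_val[OF gc] \<zeta>] val_lam[OF n FA_letters[OF gc True], symmetric] nu_amb_def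
   by (rule le_INF_ereal_add) (use X[OF True] in \<open>simp add: val_add\<close>)
 next
  case False
  then have "iota n (g w) = 0" using supp_iota[OF gc] by blast
  then show ?thesis by (simp add: nu_S_eq[OF FA_val[OF gc] \<zeta>] nu_amb_zero)
 qed
qed

text \<open>A term of the series comes from some term of every sorted representative, possibly after
  cancellation, so no representative has a larger valuation. The representative
  \<open>bas_free n s\<close> attains the bound, because there nothing cancels.\<close>

lemma nu_dirac_eq:
 assumes n: "odd n" and \<zeta>: "\<zeta> \<in> open_simplex n" and m: "m \<in> DC n"
 shows "nu_dirac n \<zeta> m = nu_amb n \<zeta> (psi n m)"
proof (rule antisym)
 obtain s where s: "\<And>J. s J \<in> SC n" "psi n m = bas n s"
  using psi_carrier(1)[OF n m] unfolding spin_image_iff[OF n] by blast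
 have ms: "m = Mel n (bas n s)" using psi_carrier(2)[OF n m] s(2) by simp
 show "nu_dirac n \<zeta> m \<le> nu_amb n \<zeta> (psi n m)"
  unfolding nu_dirac_def nu_amb_def
 proof (intro SUP_least INF_greatest)
  fix x y assume x: "x \<in> m" and y: "y \<in> {v. cf n (psi n m) v \<noteq> 0}"
  have xc: "x \<in> carrier (clifford n)" "spin_cl n x = psi n m" using x psi_carrier(2)[OF n m] unfolding Mel_def by blast+
  then obtain f where f: "f \<in> FC n" "x = cl n f" unfolding clifford_carrier by blast
  obtain g where g: "sorted_free n g" "cl n f = cl n g" using clifford_normal_form[OF f(1)] by blast
  have gc: "g \<in> FC n" using g by (simp add: sorted_free_def)
  have "spin n 1 g = psi n m" using xc(2) f(2) g(2) spin_cl[OF n gc] by simp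
  then show "nu_clifford n \<zeta> x \<le> ereal (val n \<zeta> y)"
   unfolding f(2) g(2) by (intro nu_clifford_le[OF n \<zeta> g(1)]) (use y in simp)
 qed
 let ?g = "bas_free n s"
 have g: "sorted_free n ?g" "spin n 1 ?g = bas n s" using bas_free(1,3)[of s n] s(1) by simp_all
 have gc: "?g \<in> FC n" using g by (simp add: sorted_free_def)
 have "nu_amb n \<zeta> (psi n m) \<le> nu_clifford n \<zeta> (cl n ?g)"
 proof (rule nu_clifford_ge[OF n \<zeta> g(1)])
  fix w v assume w: "w \<in> supp n ?g" and v: "cf n (iota n (?g w)) v \<noteq> 0"
  have w': "set w \<in> Pow {1..n}" "w = wd (set w)" "?g w = s (set w)"
   using w by (auto simp: supp_def bas_free_def split: if_splits)
  have v': "cf n (iota n (s (set w))) v \<noteq> 0" using v w'(3) by simp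
  have "cf n (bas n s) (v + lam n (wd (set w))) = word_sign n 1 (wd (set w)) * cf n (iota n (s (set w))) v"
   by (rule bas_coefficient[where s = s, OF n s(1) w'(1) v'])
  then have "cf n (psi n m) (v + lam n w) \<noteq> 0"
   using v' word_sign_nonzero[of 1 n w] unfolding s(2) w'(2)[symmetric] by simp
  then show "nu_amb n \<zeta> (psi n m) \<le> ereal (val n \<zeta> (v + lam n w))"
   unfolding nu_amb_def by (intro INF_lower) simp
 qed
 also have "\<dots> \<le> nu_dirac n \<zeta> m"
  unfolding nu_dirac_def
 proof (rule SUP_upper)
  have "cl n ?g \<in> Mel n (bas n s)" using gc g by (simp add: Mel_def cl_closed spin_cl[OF n])
  then show "cl n ?g \<in> m" by (simp only: ms)
 qed
 finally show "nu_amb n \<zeta> (psi n m) \<le> nu_dirac n \<zeta> m" .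
qed

lemma dgr_lam:
 assumes "set w \<subseteq> {..n}" shows "dgr n (lam n w) = half n * int (length w)"
 using assms
proof (induction w)
 case (Cons i w)
 then show ?case by (simp add: dgr_add algebra_simps) (simp add: dgr_def lookup_single when_def)
qed (simp add: dgr_zero)

lemma hom_dirac_iff:
 assumes n: "odd n"
 shows "hom_dirac n p m \<longleftrightarrow> m \<in> DC n \<and>
  (\<forall>y. cf n (psi n m) y \<noteq> 0 \<longrightarrow> 2 * dgr n y = int (n + 1) * p)"
proof -
 have lam: "2 * dgr n (lam n w) = int (n + 1) * int (length w)" if "set w \<subseteq> {..n}" for w
  unfolding dgr_lam[OF that] half_double[OF n] by simp
 have "2 * dgr n y = int (n + 1) * p"
  if m: "m \<in> DC n" and h: "x \<in> m" "hom_clifford n p x" and y: "cf n (psi n m) y \<noteq> 0" for x y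
 proof -
  obtain f where xc: "x \<in> carrier (clifford n)" and f: "f \<in> x" "\<And>w. hom_S n (p - int (length w)) (f w)"
   using h(2) unfolding hom_clifford_def by blast
  obtain h where hf: "h \<in> FC n" "x = cl n h" using xc unfolding clifford_carrier by blast
  have "f \<in> cl n h" using f(1) hf(2) by simp
  then have fc: "f \<in> FC n" "spin n 1 f = spin n 1 h" unfolding cl_fiber[OF n hf(1)] by auto
  have "x \<in> Mel n (psi n m)" using h(1) psi_carrier(2)[OF n m] by simp
  then have "psi n m = spin n 1 f" using hf fc(2) by (simp add: Mel_def spin_cl[OF n])
  then have "cf n (spin n 1 f) y \<noteq> 0" using y by simp
  then obtain w where w: "w \<in> supp n f" "cf n (iota n (f w)) (y - lam n w) \<noteq> 0"
   unfolding cf_spin by (auto dest!: sum_nonzero)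
  have "2 * dgr n (y - lam n w) = int (n + 1) * (p - int (length w))"
   using f(2)[of w] w(2) unfolding hom_S_iff by blast
  then show ?thesis using lam[OF FA_letters[OF fc(1) w(1)]] unfolding dgr_diff right_diff_distrib by linarith
 qed
 moreover have "\<exists>x\<in>m. hom_clifford n p x"
  if m: "m \<in> DC n" and h: "\<And>y. cf n (psi n m) y \<noteq> 0 \<Longrightarrow> 2 * dgr n y = int (n + 1) * p"
 proof -
  interpret S: cring "S_ring n" by (rule cring_S)
  obtain s where s: "\<And>J. s J \<in> SC n" "psi n m = bas n s"
   using psi_carrier(1)[OF n m] unfolding spin_image_iff[OF n] by blast
  let ?g = "bas_free n s"
  have g: "sorted_free n ?g" "spin n 1 ?g = bas n s" using bas_free(1,3)[of s n] s(1) by simp_all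
  have gc: "?g \<in> FC n" using g by (simp add: sorted_free_def)
  have "hom_S n (p - int (length w)) (?g w)" for w
   unfolding hom_S_iff
  proof (intro conjI allI impI FA_val[OF gc])
   fix v assume v: "cf n (iota n (?g w)) v \<noteq> 0"
   then have "w \<in> supp n ?g" unfolding supp_iota[OF gc] by (auto simp: cf_zero)
   then have w': "set w \<in> Pow {1..n}" "w = wd (set w)" "?g w = s (set w)"
    by (auto simp: supp_def bas_free_def split: if_splits)
   have v': "cf n (iota n (s (set w))) v \<noteq> 0" using v w'(3) by simp
   have "cf n (bas n s) (v + lam n (wd (set w))) = word_sign n 1 (wd (set w)) * cf n (iota n (s (set w))) v"
    by (rule bas_coefficient[where s = s, OF n s(1) w'(1) v'])
   then have "cf n (psi n m) (v + lam n w) \<noteq> 0"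
    using v' word_sign_nonzero[of 1 n w] unfolding s(2) w'(2)[symmetric] by simp
   from h[OF this] have "2 * (dgr n v + dgr n (lam n w)) = int (n + 1) * p" by (simp only: dgr_add)
   moreover have "set w \<subseteq> {..n}" using w'(1) by auto
   ultimately show "2 * dgr n v = int (n + 1) * (p - int (length w))"
    using lam[of w] unfolding right_diff_distrib distrib_left by linarith
  qed
  moreover have "?g \<in> cl n ?g" unfolding cl_fiber[OF n gc] using gc by simp
  ultimately have "hom_clifford n p (cl n ?g)" unfolding hom_clifford_def using cl_closed[OF gc] by blast
  moreover have "cl n ?g \<in> m"
  proof -
   have "cl n ?g \<in> Mel n (psi n m)" using gc g s(2) by (simp add: Mel_def cl_closed spin_cl[OF n])
   then show ?thesis using psi_carrier(2)[OF n m] by simp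
  qed
  ultimately show ?thesis by blast
 qed
 ultimately show ?thesis unfolding hom_dirac_def by blast
qed

section \<open>Endomorphisms\<close>

definition homog :: "nat \<Rightarrow> int \<Rightarrow> amb \<Rightarrow> bool" where
 "homog n q a \<longleftrightarrow> (\<forall>y. cf n a y \<noteq> 0 \<longrightarrow> 2 * dgr n y = int (n + 1) * q)"

text \<open>Endomorphisms of the Dirac module transported to the space of series; \<open>lft\<close>
  and \<open>mk_endo\<close> pass between the two.\<close>

definition linear_hom :: "nat \<Rightarrow> int \<Rightarrow> (amb \<Rightarrow> amb) \<Rightarrow> bool" where
 "linear_hom n p F \<longleftrightarrow>
  (\<forall>a\<in>spin_image n. F a \<in> spin_image n) \<and>
  (\<forall>a\<in>spin_image n. \<forall>b\<in>spin_image n. F (a + b) = F a + F b) \<and>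
  (\<forall>s\<in>SC n. \<forall>a\<in>spin_image n. F (iota n s * a) = iota n s * F a) \<and>
  (\<forall>q. \<forall>a\<in>spin_image n. homog n q a \<longrightarrow> homog n (q + p) (F a))"

lemma linear_homD:
 assumes "linear_hom n p F"
 shows "a \<in> spin_image n \<Longrightarrow> F a \<in> spin_image n"
  "a \<in> spin_image n \<Longrightarrow> b \<in> spin_image n \<Longrightarrow> F (a + b) = F a + F b"
  "s \<in> SC n \<Longrightarrow> a \<in> spin_image n \<Longrightarrow> F (iota n s * a) = iota n s * F a"
  "a \<in> spin_image n \<Longrightarrow> homog n q a \<Longrightarrow> homog n (q + p) (F a)"
 using assms unfolding linear_hom_def by blast+

lemma linear_hom_cong:
 assumes "\<And>a. a \<in> spin_image n \<Longrightarrow> F a = G a" "linear_hom n p F"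
 shows "linear_hom n p G"
 using assms spin_image_add[of _ n] spin_image_scale[of _ n] unfolding linear_hom_def by simp

lemma homog_add: "homog n q a \<Longrightarrow> homog n q b \<Longrightarrow> homog n q (a + b)"
 unfolding homog_def cf_add by (metis add.right_neutral)

lemma homog_zero: "homog n q 0"
 by (simp add: homog_def cf_zero)

lemma homog_sum: "(\<And>x. x \<in> A \<Longrightarrow> homog n q (f x)) \<Longrightarrow> homog n q (sum f A)"
 by (induction A rule: infinite_finite_induct) (auto intro: homog_add homog_zero)

lemma homog_const: "homog n q a \<Longrightarrow> homog n q (mon n 0 r * a)"
 by (auto simp: homog_def cf_mon_times)

lemma iota_real: "\<exists>s\<in>SC n. iota n s = mon n 0 r"
 using S_const(2) iota_const by blast

lemma spin_image_const: "a \<in> spin_image n \<Longrightarrow> mon n 0 r * a \<in> spin_image n"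
 using iota_real[of n r] spin_image_scale by metis

lemma linear_hom_add:
 assumes F: "linear_hom n p F" and G: "linear_hom n p G"
 shows "linear_hom n p (\<lambda>a. F a + G a)"
 unfolding linear_hom_def
 using linear_homD[OF F] linear_homD[OF G] by (auto intro: spin_image_add homog_add simp: algebra_simps)

lemma linear_hom_const:
 assumes F: "linear_hom n p F"
 shows "linear_hom n p (\<lambda>a. mon n 0 r * F a)"
 unfolding linear_hom_def
 using linear_homD[OF F] by (auto intro: spin_image_const homog_const simp: distrib_left mult.left_commute)

lemma linear_hom_zero: "linear_hom n p (\<lambda>a. 0)"
 by (simp add: linear_hom_def spin_image_zero homog_zero)

lemma linear_hom_sum:
 assumes F: "linear_hom n p F" and f: "\<And>x. x \<in> A \<Longrightarrow> f x \<in> spin_image n" and A: "finite A"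
 shows "F (sum f A) = (\<Sum>x\<in>A. F (f x))"
 using A f
proof (induction A rule: finite_induct)
 case empty
 show ?case using linear_homD(2)[OF F spin_image_zero spin_image_zero] by simp
next
 case (insert x A)
 then show ?case using linear_homD(2)[OF F] by (simp add: spin_image_sum)
qed

definition lft :: "nat \<Rightarrow> endo \<Rightarrow> amb \<Rightarrow> amb" where
 "lft n \<Phi> a = psi n (\<Phi> (Mel n a))"

definition mk_endo :: "nat \<Rightarrow> (amb \<Rightarrow> amb) \<Rightarrow> endo" where
 "mk_endo n F = (\<lambda>m\<in>DC n. Mel n (F (psi n m)))"

lemma End_carrier_iff:
 assumes n: "odd n"
 shows "\<Phi> \<in> carrier (End_module n p) \<longleftrightarrow>
  \<Phi> \<in> DC n \<rightarrow>\<^sub>E DC n \<and> linear_hom n p (lft n \<Phi>)"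
proof -
 let ?A = "DC n" and ?M = "dirac_module n"
 interpret M: abelian_group ?M by (rule abelian_group_dirac[OF n])
 have ball: "(\<forall>x\<in>?A. P x) \<longleftrightarrow> (\<forall>a\<in>spin_image n. P (Mel n a))" for P
  by (simp add: dirac_carrier[OF n])
 have eq: "x = y \<longleftrightarrow> psi n x = psi n y" if "x \<in> ?A" "y \<in> ?A" for x y using psi_inj[OF n that] by blast
 have add: "(\<forall>x\<in>?A. \<forall>y\<in>?A. \<Phi> (x \<oplus>\<^bsub>?M\<^esub> y) = \<Phi> x \<oplus>\<^bsub>?M\<^esub> \<Phi> y) \<longleftrightarrow>
   (\<forall>a\<in>spin_image n. \<forall>b\<in>spin_image n. lft n \<Phi> (a + b) = lft n \<Phi> a + lft n \<Phi> b)"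
  if P: "\<And>x. x \<in> ?A \<Longrightarrow> \<Phi> x \<in> ?A"
  unfolding ball lft_def
  by (intro ball_cong refl) (simp add: eq P Mel_carrier[OF n] psi_add[OF n] Mel_add[OF n] spin_image_add)
 have scale: "(\<forall>s\<in>SC n. \<forall>x\<in>?A.
    \<Phi> (clifford_scalar n s \<odot>\<^bsub>?M\<^esub> x) = clifford_scalar n s \<odot>\<^bsub>?M\<^esub> \<Phi> x) \<longleftrightarrow>
   (\<forall>s\<in>SC n. \<forall>a\<in>spin_image n. lft n \<Phi> (iota n s * a) = iota n s * lft n \<Phi> a)"
  if P: "\<And>x. x \<in> ?A \<Longrightarrow> \<Phi> x \<in> ?A"
  unfolding ball lft_def
 proof (intro ball_cong refl)
  fix s a assume s: "s \<in> SC n" and a: "a \<in> spin_image n"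
  have "clifford_scalar n s \<odot>\<^bsub>?M\<^esub> Mel n a = Mel n (iota n s * a)"
   using dirac_scalar[OF n s Mel_carrier[OF n a]] a s
   by (intro psi_inj[OF n]) (simp_all add: psi_Mel[OF n] Mel_carrier[OF n] spin_image_scale)
  then show "\<Phi> (clifford_scalar n s \<odot>\<^bsub>?M\<^esub> Mel n a) = clifford_scalar n s \<odot>\<^bsub>?M\<^esub> \<Phi> (Mel n a) \<longleftrightarrow>
    psi n (\<Phi> (Mel n (iota n s * a))) = iota n s * psi n (\<Phi> (Mel n a))"
   using s a by (subst eq) (simp_all add: P Mel_carrier[OF n] dirac_scalar[OF n] spin_image_scale)
 qed
 have hom: "(\<forall>q x. hom_dirac n q x \<longrightarrow> hom_dirac n (q + p) (\<Phi> x)) \<longleftrightarrow>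
   (\<forall>q. \<forall>a\<in>spin_image n. homog n q a \<longrightarrow> homog n (q + p) (lft n \<Phi> a))"
  if P: "\<And>x. x \<in> ?A \<Longrightarrow> \<Phi> x \<in> ?A"
 proof -
  have "(\<forall>x. hom_dirac n q x \<longrightarrow> hom_dirac n (q + p) (\<Phi> x)) \<longleftrightarrow>
    (\<forall>x\<in>?A. homog n q (psi n x) \<longrightarrow> homog n (q + p) (psi n (\<Phi> x)))" for q
   using P unfolding hom_dirac_iff[OF n] homog_def by blast
  also have "\<dots> q = (\<forall>a\<in>spin_image n. homog n q a \<longrightarrow> homog n (q + p) (lft n \<Phi> a))" for q
   unfolding ball lft_def by (intro ball_cong refl) (simp add: psi_Mel[OF n])
  finally show ?thesis by simp
 qed
 show ?thesis
 proof (cases "\<Phi> \<in> ?A \<rightarrow>\<^sub>E ?A")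
  case True
  then have P: "\<Phi> x \<in> ?A" if "x \<in> ?A" for x using that by blast
  have img: "(\<forall>a\<in>spin_image n. lft n \<Phi> a \<in> spin_image n) = True"
   using P psi_carrier(1)[OF n] Mel_carrier[OF n] unfolding lft_def by blast
  show ?thesis
   using True unfolding End_module_def Let_def linear_hom_def
   by (simp only: add[OF P] scale[OF P] hom[OF P] img mem_Collect_eq partial_object.simps simp_thms)
 qed (simp add: End_module_def Let_def)
qed

lemma End_closed:
 "odd n \<Longrightarrow> \<Phi> \<in> carrier (End_module n p) \<Longrightarrow> x \<in> DC n \<Longrightarrow> \<Phi> x \<in> DC n"
 unfolding End_carrier_iff by blast

lemma End_linear: "odd n \<Longrightarrow> \<Phi> \<in> carrier (End_module n p) \<Longrightarrow> linear_hom n p (lft n \<Phi>)"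
 by (simp add: End_carrier_iff)

lemma Mel_lft:
 "odd n \<Longrightarrow> \<Phi> \<in> carrier (End_module n p) \<Longrightarrow> a \<in> spin_image n \<Longrightarrow> \<Phi> (Mel n a) = Mel n (lft n \<Phi> a)"
 by (simp add: lft_def psi_carrier(2) End_closed Mel_carrier)

lemma End_eqI:
 assumes n: "odd n" and \<Phi>: "\<Phi> \<in> carrier (End_module n p)" "\<Psi> \<in> carrier (End_module n p)"
  and eq: "\<And>a. a \<in> spin_image n \<Longrightarrow> lft n \<Phi> a = lft n \<Psi> a"
 shows "\<Phi> = \<Psi>"
proof (rule extensionalityI[of _ "DC n"])
 show "\<Phi> \<in> extensional (DC n)" "\<Psi> \<in> extensional (DC n)"
  using \<Phi> by (auto simp: End_carrier_iff[OF n] PiE_def)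
 fix x assume "x \<in> DC n"
 then obtain a where a: "a \<in> spin_image n" "x = Mel n a" by (auto simp: dirac_carrier[OF n])
 then show "\<Phi> x = \<Psi> x" using Mel_lft[OF n \<Phi>(1)] Mel_lft[OF n \<Phi>(2)] eq by simp
qed

lemma mk_endo:
 assumes n: "odd n" and F: "linear_hom n p F"
 shows "mk_endo n F \<in> carrier (End_module n p)" "a \<in> spin_image n \<Longrightarrow> lft n (mk_endo n F) a = F a"
proof -
 show l: "lft n (mk_endo n F) a = F a" if "a \<in> spin_image n" for a
  using that linear_homD(1)[OF F that] by (simp add: lft_def mk_endo_def Mel_carrier[OF n] psi_Mel[OF n])
 have "linear_hom n p (lft n (mk_endo n F))" by (rule linear_hom_cong[OF _ F]) (simp add: l)
 moreover have "mk_endo n F \<in> DC n \<rightarrow>\<^sub>E DC n"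
  unfolding mk_endo_def using psi_carrier(1)[OF n] linear_homD(1)[OF F] Mel_carrier[OF n] by auto
 ultimately show "mk_endo n F \<in> carrier (End_module n p)" by (simp add: End_carrier_iff[OF n])
qed

lemma End_ops_lft:
 assumes n: "odd n" and \<Phi>: "\<Phi> \<in> carrier (End_module n p)" and a: "a \<in> spin_image n"
 shows "\<Psi> \<in> carrier (End_module n p) \<Longrightarrow> lft n (\<Phi> \<oplus>\<^bsub>End_module n p\<^esub> \<Psi>) a = lft n \<Phi> a + lft n \<Psi> a"
  "lft n (r \<odot>\<^bsub>End_module n p\<^esub> \<Phi>) a = mon n 0 r * lft n \<Phi> a"
proof -
 note c = End_closed[OF n _ Mel_carrier[OF n a]]
 show "lft n (\<Phi> \<oplus>\<^bsub>End_module n p\<^esub> \<Psi>) a = lft n \<Phi> a + lft n \<Psi> a" if "\<Psi> \<in> carrier (End_module n p)"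
 proof -
  have "(\<Phi> \<oplus>\<^bsub>End_module n p\<^esub> \<Psi>) (Mel n a) = \<Phi> (Mel n a) \<oplus>\<^bsub>dirac_module n\<^esub> \<Psi> (Mel n a)"
   by (simp add: End_module_def Let_def Mel_carrier[OF n a])
  then show ?thesis unfolding lft_def using psi_add[OF n c[OF \<Phi>] c[OF that]] by simp
 qed
 have "(r \<odot>\<^bsub>End_module n p\<^esub> \<Phi>) (Mel n a)
   = clifford_scalar n (S_const n (fls_const r)) \<odot>\<^bsub>dirac_module n\<^esub> \<Phi> (Mel n a)"
  by (simp add: End_module_def Let_def Mel_carrier[OF n a])
 then show "lft n (r \<odot>\<^bsub>End_module n p\<^esub> \<Phi>) a = mon n 0 r * lft n \<Phi> a"
  unfolding lft_def using dirac_scalar(2)[OF n S_const(2) c[OF \<Phi>]] by (simp add: iota_const)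
qed

lemma End_ops_closed:
 assumes n: "odd n" and \<Phi>: "\<Phi> \<in> carrier (End_module n p)"
 shows "\<Psi> \<in> carrier (End_module n p) \<Longrightarrow> \<Phi> \<oplus>\<^bsub>End_module n p\<^esub> \<Psi> \<in> carrier (End_module n p)"
  "r \<odot>\<^bsub>End_module n p\<^esub> \<Phi> \<in> carrier (End_module n p)"
proof -
 interpret M: abelian_group "dirac_module n" by (rule abelian_group_dirac[OF n])
 show "\<Phi> \<oplus>\<^bsub>End_module n p\<^esub> \<Psi> \<in> carrier (End_module n p)" if \<Psi>: "\<Psi> \<in> carrier (End_module n p)"
  unfolding End_carrier_iff[OF n]
 proof
  show "linear_hom n p (lft n (\<Phi> \<oplus>\<^bsub>End_module n p\<^esub> \<Psi>))"
   by (rule linear_hom_cong[OF _ linear_hom_add[OF End_linear[OF n \<Phi>] End_linear[OF n \<Psi>]]])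
    (simp add: End_ops_lft(1)[OF n \<Phi> _ \<Psi>])
  show "\<Phi> \<oplus>\<^bsub>End_module n p\<^esub> \<Psi> \<in> DC n \<rightarrow>\<^sub>E DC n"
   using End_closed[OF n \<Phi>] End_closed[OF n \<Psi>] by (auto simp: End_module_def Let_def)
 qed
 show "r \<odot>\<^bsub>End_module n p\<^esub> \<Phi> \<in> carrier (End_module n p)"
  unfolding End_carrier_iff[OF n]
 proof
  show "linear_hom n p (lft n (r \<odot>\<^bsub>End_module n p\<^esub> \<Phi>))"
   by (rule linear_hom_cong[OF _ linear_hom_const[where r = r, OF End_linear[OF n \<Phi>]]])
    (simp add: End_ops_lft(2)[OF n \<Phi>])
  show "r \<odot>\<^bsub>End_module n p\<^esub> \<Phi> \<in> DC n \<rightarrow>\<^sub>E DC n"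
   using End_closed[OF n \<Phi>] by (auto simp: End_module_def Let_def dirac_scalar[OF n] S_const(2))
 qed
qed

lemma End_zero:
 assumes n: "odd n"
 shows "\<zero>\<^bsub>End_module n p\<^esub> \<in> carrier (End_module n p)" "a \<in> spin_image n \<Longrightarrow> lft n \<zero>\<^bsub>End_module n p\<^esub> a = 0"
proof -
 interpret M: abelian_group "dirac_module n" by (rule abelian_group_dirac[OF n])
 show l: "lft n \<zero>\<^bsub>End_module n p\<^esub> a = 0" if "a \<in> spin_image n" for a
  using that by (simp add: End_module_def Let_def lft_def Mel_carrier[OF n] psi_zero[OF n])
 have "linear_hom n p (lft n \<zero>\<^bsub>End_module n p\<^esub>)"
  by (rule linear_hom_cong[OF _ linear_hom_zero]) (simp add: l)
 then show "\<zero>\<^bsub>End_module n p\<^esub> \<in> carrier (End_module n p)"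
  unfolding End_carrier_iff[OF n] by (simp add: End_module_def Let_def)
qed

section \<open>The differential on transported endomorphisms\<close>

definition dop :: "nat \<Rightarrow> amb \<Rightarrow> amb" where
 "dop n a = (\<Sum>i\<le>n. gact n i (Mel n a))"

lemma dop:
 assumes n: "odd n" and a: "a \<in> spin_image n"
 shows "dop n a \<in> spin_image n" "dirac_op n (Mel n a) = Mel n (dop n a)"
 using dirac_op[OF n Mel_carrier[OF n a]] psi_carrier[OF n dirac_op(1)[OF n Mel_carrier[OF n a]]]
 by (simp_all add: dop_def)

lemma linear_hom_dop:
 assumes n: "odd n" shows "linear_hom n 1 (dop n)"
 unfolding linear_hom_def
proof (intro conjI ballI allI impI)
 fix a assume a: "a \<in> spin_image n"
 show "dop n a \<in> spin_image n" by (rule dop[OF n a])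
 show "dop n (a + b) = dop n a + dop n b" if b: "b \<in> spin_image n" for b
  unfolding dop_def sum.distrib[symmetric]
  by (intro sum.cong refl) (simp add: Mel_add[OF n a b, symmetric] gact_add[OF n] Mel_carrier[OF n] a b)
 show "homog n (q + 1) (dop n a)" if "homog n q a" for q
  unfolding dop_def
 proof (rule homog_sum)
  fix i assume i: "i \<in> {..n}"
  show "homog n (q + 1) (gact n i (Mel n a))"
   unfolding homog_def
  proof (intro allI impI)
   fix y assume "cf n (gact n i (Mel n a)) y \<noteq> 0"
   then have "cf n a (y - single i (half n)) \<noteq> 0"
    using gact_support[OF n _ Mel_carrier[OF n a], of i y] i by (simp add: psi_Mel[OF n a])
   then have "2 * dgr n (y - single i (half n)) = int (n + 1) * q"
    using that unfolding homog_def by blast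
   moreover have "dgr n (single i (half n)) = half n"
    using i by (simp add: dgr_def lookup_single when_def)
   moreover have "2 * x = k * (q + 1)" if "2 * (x - h) = k * q" "k = 2 * h" for x h k :: int
    using that by (simp add: algebra_simps)
   ultimately show "2 * dgr n y = int (n + 1) * (q + 1)"
    using half_double[OF n] unfolding dgr_diff by metis
  qed
 qed
next
 fix s a assume s: "s \<in> SC n" and a: "a \<in> spin_image n"
 have "clifford_scalar n s \<odot>\<^bsub>dirac_module n\<^esub> Mel n a = Mel n (iota n s * a)"
  using dirac_scalar[OF n s Mel_carrier[OF n a]] a s
  by (intro psi_inj[OF n]) (simp_all add: psi_Mel[OF n] Mel_carrier[OF n] spin_image_scale)
 then show "dop n (iota n s * a) = iota n s * dop n a"
  unfolding dop_def sum_distrib_left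
  by (intro sum.cong refl) (simp add: gact_scale[OF n _ s Mel_carrier[OF n a], symmetric])
qed

definition hom_diff :: "nat \<Rightarrow> int \<Rightarrow> (amb \<Rightarrow> amb) \<Rightarrow> amb \<Rightarrow> amb" where
 "hom_diff n p F a = dop n (F a) + mon n 0 (if even p then -1 else 1) * F (dop n a)"

lemma linear_hom_comp:
 assumes "linear_hom n p F" "linear_hom n q G"
 shows "linear_hom n (p + q) (\<lambda>a. G (F a))"
 using assms unfolding linear_hom_def by (simp add: add.assoc[symmetric])

lemma linear_hom_diff:
 assumes n: "odd n" and F: "linear_hom n p F"
 shows "linear_hom n (p + 1) (hom_diff n p F)"
 unfolding hom_diff_def
 by (intro linear_hom_add linear_hom_const linear_hom_comp[OF F linear_hom_dop[OF n]]
   linear_hom_comp[OF linear_hom_dop[OF n] F, unfolded add.commute[of 1]])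

lemma End_diff:
 assumes n: "odd n" and \<Phi>: "\<Phi> \<in> carrier (End_module n p)"
 shows "End_diff n p \<Phi> \<in> carrier (End_module n (p + 1))"
  "a \<in> spin_image n \<Longrightarrow> lft n (End_diff n p \<Phi>) a = hom_diff n p (lft n \<Phi>) a"
proof -
 interpret M: abelian_group "dirac_module n" by (rule abelian_group_dirac[OF n])
 show l: "lft n (End_diff n p \<Phi>) a = hom_diff n p (lft n \<Phi>) a" if a: "a \<in> spin_image n" for a
 proof -
  note F = linear_homD(1)[OF End_linear[OF n \<Phi>]]
  have 1: "\<Phi> (dirac_op n (Mel n a)) = Mel n (lft n \<Phi> (dop n a))"
   using dop[OF n a] by (simp add: Mel_lft[OF n \<Phi>])
  have 2: "dirac_op n (\<Phi> (Mel n a)) = Mel n (dop n (lft n \<Phi> a))"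
   using dop[OF n F[OF a]] a by (simp add: Mel_lft[OF n \<Phi>])
  have 3: "mon n 0 (- 1) = -1" "mon n 0 1 = 1" using mon_0_1[of n] mon_uminus[of n 0 1] by simp_all
  show ?thesis
   using dop(1)[OF n F[OF a]] F[OF dop(1)[OF n a]] a 3 unfolding hom_diff_def
   by (subst lft_def) (simp add: End_diff_def Mel_carrier[OF n] 1 2 psi_add[OF n] psi_minus[OF n] psi_Mel[OF n])
 qed
 have "linear_hom n (p + 1) (lft n (End_diff n p \<Phi>))"
  by (rule linear_hom_cong[OF _ linear_hom_diff[OF n End_linear[OF n \<Phi>]]]) (simp add: l)
 moreover have "End_diff n p \<Phi> \<in> DC n \<rightarrow>\<^sub>E DC n"
  using End_closed[OF n \<Phi>] dirac_op(1)[OF n] unfolding End_diff_def by (auto split: if_splits)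
 ultimately show "End_diff n p \<Phi> \<in> carrier (End_module n (p + 1))" by (simp add: End_carrier_iff[OF n])
qed

section \<open>The valuation of an endomorphism\<close>

lemma val_ge:
 assumes \<zeta>: "\<zeta> \<in> open_simplex n" and z: "\<And>i. i \<le> n \<Longrightarrow> c \<le> of_int (lookup z i)"
 shows "c / real (n + 1) \<le> val n \<zeta> z"
proof -
 have "c / real (n + 1) = (\<Sum>i\<le>n. c * \<zeta> i / real (n + 1))"
  using \<zeta> by (simp add: open_simplex_def flip: sum_divide_distrib sum_distrib_left)
 also have "\<dots> \<le> val n \<zeta> z"
  unfolding val_def using \<zeta> z
  by (intro sum_mono divide_right_mono mult_right_mono) (auto simp: open_simplex_def less_imp_le)
 finally show ?thesis .
qed

text \<open>Letting \<open>\<zeta>\<close> tend to a vertex of the simplex isolates one component of the exponent.\<close>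

lemma val_ge_component:
 assumes ge: "\<And>\<zeta>. \<zeta> \<in> open_simplex n \<Longrightarrow> c / real (n + 1) \<le> val n \<zeta> z" and j: "j \<le> n"
 shows "c \<le> of_int (lookup z j)"
proof (rule ccontr)
 let ?z = "\<lambda>i. real_of_int (lookup z i)"
 assume "\<not> c \<le> ?z j"
 then have pos: "0 < c - ?z j" by simp
 obtain L where L: "(\<Sum>i\<le>n. ?z i) - c * real (n + 1) < real L * (c - ?z j)"
  using reals_Archimedean3[OF pos] by blast
 let ?D = "real (n + 1) + real L"
 have D: "0 < ?D" by simp
 \<comment> \<open>Weight \<open>1 + L\<close> at the vertex \<open>j\<close> and 1 at the others,
   normalised; \<open>L\<close> is so large that component \<open>j\<close> outweighs the
   rest.\<close>
 define \<zeta> where "\<zeta> i = (if i \<le> n then (1 + (if i = j then real L else 0)) / ?D else 0)" for i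
 have s: "(\<Sum>i\<le>n. f i * (1 + (if i = j then real L else 0))) = (\<Sum>i\<le>n. f i) + f j * real L" for f :: "nat \<Rightarrow> real"
  using j by (simp add: distrib_left sum.distrib if_distrib[of "\<lambda>x. _ * x"] cong: if_cong)
 have "(\<Sum>i\<le>n. \<zeta> i) = (\<Sum>i\<le>n. 1 * (1 + (if i = j then real L else 0))) / ?D"
  unfolding sum_divide_distrib by (intro sum.cong refl) (simp add: \<zeta>_def)
 also have "\<dots> = 1" unfolding s using D by simp
 finally have "\<zeta> \<in> open_simplex n" using D by (simp add: open_simplex_def \<zeta>_def)
 from ge[OF this] have "c / real (n + 1) \<le> (\<Sum>i\<le>n. ?z i * \<zeta> i) / real (n + 1)"
  unfolding val_def sum_divide_distrib .
 then have "c \<le> (\<Sum>i\<le>n. ?z i * \<zeta> i)" by (simp add: divide_le_cancel)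
 also have "\<dots> = (\<Sum>i\<le>n. ?z i * (1 + (if i = j then real L else 0))) / ?D"
  unfolding sum_divide_distrib by (intro sum.cong refl) (simp add: \<zeta>_def)
 finally have "c * ?D \<le> (\<Sum>i\<le>n. ?z i) + ?z j * real L"
  unfolding s using D by (simp add: le_divide_eq del: of_nat_add)
 then show False using L by (simp add: algebra_simps)
qed

text \<open>Each component of the exponent is raised by at least \<open>c\<close>; this is the norm
  condition in terms of supports.\<close>

definition gap :: "nat \<Rightarrow> real \<Rightarrow> (amb \<Rightarrow> amb) \<Rightarrow> bool" where
 "gap n c F \<longleftrightarrow> (\<forall>w y i. set w \<subseteq> {..n} \<longrightarrow> cf n (F (word_mon n 1 w)) y \<noteq> 0 \<longrightarrow> i \<le> n \<longrightarrow>
   c \<le> of_int (lookup y i - lookup (lam n w) i))"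

lemma linear_hom_word:
 assumes n: "odd n" and F: "linear_hom n p F" and w: "set w \<subseteq> {..n}" "set w' \<subseteq> {..n}"
  and p: "parity_set n w = parity_set n w'"
 shows "cf n (F (word_mon n 1 w)) y
  = word_sign n 1 w * word_sign n 1 w' * cf n (F (word_mon n 1 w')) (y - (lam n w - lam n w'))"
proof -
 obtain s where s: "s \<in> SC n"
  "iota n s = mon n (lam n w - lam n w') (word_sign n 1 w * word_sign n 1 w')"
  using parity_set_scalar[OF n w p] ..
 have "F (word_mon n 1 w) = iota n s * F (word_mon n 1 w')"
  using linear_homD(3)[OF F s(1) spin_image_word[OF w(2)]] by (simp add: word_mon_scalar[OF s(2)])
 then show ?thesis by (simp add: s(2) cf_mon_times)
qed

lemma gap_basis:
 assumes n: "odd n" and F: "linear_hom n p F"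
  and g: "\<And>J y i. J \<in> Pow {1..n} \<Longrightarrow> cf n (F (word_mon n 1 (wd J))) y \<noteq> 0 \<Longrightarrow> i \<le> n \<Longrightarrow>
    c \<le> of_int (lookup y i - lookup (lam n (wd J)) i)"
 shows "gap n c F"
 unfolding gap_def
proof (intro allI impI)
 fix w y i assume w: "set w \<subseteq> {..n}" and y: "cf n (F (word_mon n 1 w)) y \<noteq> 0" and i: "i \<le> n"
 let ?J = "parity_set n w"
 have "cf n (F (word_mon n 1 (wd ?J))) (y - (lam n w - lam n (wd ?J))) \<noteq> 0"
  using y linear_hom_word[OF n F w wd_letters[OF parity_set_Pow] parity_wd[OF parity_set_Pow, symmetric], of y] by auto
 from g[OF parity_set_Pow this i]
 show "c \<le> of_int (lookup y i - lookup (lam n w) i)" by (simp add: lookup_minus)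
qed

lemma ereal_le_minus_right:
 assumes "B \<noteq> (\<infinity>::ereal)" "B + ereal k \<le> A" shows "ereal k \<le> A - B"
 using assms by (cases A; cases B) auto

text \<open>For the support condition it suffices to test single words, whose valuation is linear in
  \<zeta>, and to let \<zeta> approach the vertices. Conversely the summands of an element in the
  basis have disjoint supports, so its valuation is not above that of any summand, and a bound on
  words carries over.\<close>

lemma nu_End_ge_iff:
 assumes n: "odd n" and \<Phi>: "\<Phi> \<in> carrier (End_module n p)"
 shows "ereal (c / real (n + 1)) \<le> nu_End n \<Phi> \<longleftrightarrow> gap n c (lft n \<Phi>)"
proof
 let ?F = "lft n \<Phi>"
 note F = End_linear[OF n \<Phi>]
 assume ge: "ereal (c / real (n + 1)) \<le> nu_End n \<Phi>"
 show "gap n c ?F"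
  unfolding gap_def
 proof (intro allI impI)
  fix w y i assume w: "set w \<subseteq> {..n}" and y: "cf n (?F (word_mon n 1 w)) y \<noteq> 0" and i: "i \<le> n"
  let ?m = "Mel n (word_mon n 1 w)"
  note wi = spin_image_word[OF w]
  have nz: "word_sign n 1 w \<noteq> 0" by (rule word_sign_nonzero) simp
  have "c / real (n + 1) \<le> val n \<zeta> (y - lam n w)" if \<zeta>: "\<zeta> \<in> open_simplex n" for \<zeta>
  proof -
   have "cf n (psi n ?m) (lam n w) \<noteq> cf n (psi n \<zero>\<^bsub>dirac_module n\<^esub>) (lam n w)"
    unfolding psi_Mel[OF n wi] psi_zero[OF n] using nz by (simp add: cf_zero word_mon_def cf_mon)
   then have "?m \<in> DC n - {\<zero>\<^bsub>dirac_module n\<^esub>}" using Mel_carrier[OF n wi] by auto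
   then have "nu_End n \<Phi> \<le> nu_dirac n \<zeta> (\<Phi> ?m) - nu_dirac n \<zeta> ?m"
    unfolding nu_End_def using \<zeta> by (intro INF_lower2[OF \<zeta>] INF_lower)
   then have "ereal (c / real (n + 1)) \<le> nu_dirac n \<zeta> (\<Phi> ?m) - nu_dirac n \<zeta> ?m" by (rule order_trans[OF ge])
   also have "nu_dirac n \<zeta> ?m = ereal (val n \<zeta> (lam n w))"
   proof -
    have "{v. cf n (word_mon n 1 w) v \<noteq> 0} = {lam n w}" using nz by (auto simp: word_mon_def cf_mon)
    then show ?thesis by (simp add: nu_dirac_eq[OF n \<zeta> Mel_carrier[OF n wi]] psi_Mel[OF n wi] nu_amb_def)
   qed
   also have "nu_dirac n \<zeta> (\<Phi> ?m) \<le> ereal (val n \<zeta> y)"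
    unfolding nu_dirac_eq[OF n \<zeta> End_closed[OF n \<Phi> Mel_carrier[OF n wi]]] nu_amb_def
    by (rule INF_lower) (use y in \<open>simp add: lft_def\<close>)
   finally have "ereal (c / real (n + 1)) \<le> ereal (val n \<zeta> y) - ereal (val n \<zeta> (lam n w))"
    by (simp add: ereal_minus_mono)
   then show ?thesis by (simp add: val_diff)
  qed
  from val_ge_component[OF this i]
  show "c \<le> of_int (lookup y i - lookup (lam n w) i)" by (simp add: lookup_minus)
 qed
next
 let ?F = "lft n \<Phi>"
 note F = End_linear[OF n \<Phi>]
 assume g: "gap n c ?F"
 show "ereal (c / real (n + 1)) \<le> nu_End n \<Phi>"
  unfolding nu_End_def
 proof (intro INF_greatest)
  fix \<zeta> x assume \<zeta>: "\<zeta> \<in> open_simplex n" and x: "x \<in> DC n - {\<zero>\<^bsub>dirac_module n\<^esub>}"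
  have xc: "x \<in> DC n" using x by blast
  obtain s where s: "\<And>J. s J \<in> SC n" "psi n x = bas n s"
   using psi_carrier(1)[OF n xc] unfolding spin_image_iff[OF n] by blast
  have sJ: "iota n (s J) * word_mon n 1 (wd J) \<in> spin_image n" if "J \<in> Pow {1..n}" for J
   by (intro spin_image_scale s spin_image_word wd_letters that)
  have Fx: "psi n (\<Phi> x) = (\<Sum>J\<in>Pow {1..n}. iota n (s J) * ?F (word_mon n 1 (wd J)))"
  proof -
   have "psi n (\<Phi> x) = ?F (bas n s)" unfolding lft_def using psi_carrier(2)[OF n xc] s(2) by simp
   also have "\<dots> = (\<Sum>J\<in>Pow {1..n}. ?F (iota n (s J) * word_mon n 1 (wd J)))"
    unfolding bas_def by (rule linear_hom_sum[OF F sJ]) simp_all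
   also have "\<dots> = (\<Sum>J\<in>Pow {1..n}. iota n (s J) * ?F (word_mon n 1 (wd J)))"
    by (intro sum.cong refl linear_homD(3)[OF F] s spin_image_word wd_letters)
   finally show ?thesis .
  qed
  have "psi n x \<noteq> 0" using x psi_inj[OF n xc, of "\<zero>\<^bsub>dirac_module n\<^esub>"] abelian_group_dirac[OF n]
   by (auto simp: psi_zero[OF n] abelian_group_def abelian_monoid.zero_closed)
  then obtain y0 where "cf n (psi n x) y0 \<noteq> 0"
   using diag_eqI[OF diag_spin_image[OF psi_carrier(1)[OF n xc]] diag_zero] by (metis cf_zero)
  then have "nu_amb n \<zeta> (psi n x) \<le> ereal (val n \<zeta> y0)" unfolding nu_amb_def by (intro INF_lower) simp
  then have fin: "nu_amb n \<zeta> (psi n x) \<noteq> \<infinity>" by auto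
  have "nu_amb n \<zeta> (psi n x) + ereal (c / real (n + 1)) \<le> nu_amb n \<zeta> (psi n (\<Phi> x))"
   unfolding nu_amb_def[of n \<zeta> "psi n (\<Phi> x)"]
  proof (rule INF_greatest)
   fix y assume "y \<in> {v. cf n (psi n (\<Phi> x)) v \<noteq> 0}"
   then obtain J where J: "J \<in> Pow {1..n}" "cf n (iota n (s J) * ?F (word_mon n 1 (wd J))) y \<noteq> 0"
    unfolding Fx cf_sum by (auto dest!: sum_nonzero)
   have "diag n (?F (word_mon n 1 (wd J)))"
    by (intro diag_spin_image linear_homD(1)[OF F] spin_image_word wd_letters J(1))
   then obtain u v where uv: "y = u + v" "cf n (iota n (s J)) u \<noteq> 0" "cf n (?F (word_mon n 1 (wd J))) v \<noteq> 0"
    using cf_times_support[OF diag_iota[OF s(1)] _ J(2)] by blast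
   have "cf n (bas n s) (u + lam n (wd J)) = word_sign n 1 (wd J) * cf n (iota n (s J)) u"
    by (rule bas_coefficient[where s = s, OF n s(1) J(1) uv(2)])
   then have "cf n (psi n x) (u + lam n (wd J)) \<noteq> 0"
    using uv(2) word_sign_nonzero[of 1 n "wd J"] unfolding s(2) by simp
   then have 1: "nu_amb n \<zeta> (psi n x) \<le> ereal (val n \<zeta> (u + lam n (wd J)))"
    unfolding nu_amb_def by (intro INF_lower) simp
   have "c \<le> of_int (lookup (v - lam n (wd J)) i)" if "i \<le> n" for i
    using g uv(3) wd_letters[OF J(1)] that unfolding gap_def lookup_minus by blast
   then have 2: "c / real (n + 1) \<le> val n \<zeta> (v - lam n (wd J))" by (rule val_ge[OF \<zeta>])
   have "nu_amb n \<zeta> (psi n x) + ereal (c / real (n + 1))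
     \<le> ereal (val n \<zeta> (u + lam n (wd J))) + ereal (val n \<zeta> (v - lam n (wd J)))"
    using 1 2 by (intro add_mono) simp_all
   then show "nu_amb n \<zeta> (psi n x) + ereal (c / real (n + 1)) \<le> ereal (val n \<zeta> y)"
    unfolding uv(1) by (simp add: val_add val_diff)
  qed
  then show "ereal (c / real (n + 1)) \<le> nu_dirac n \<zeta> (\<Phi> x) - nu_dirac n \<zeta> x"
   unfolding nu_dirac_eq[OF n \<zeta> xc] nu_dirac_eq[OF n \<zeta> End_closed[OF n \<Phi> xc]]
   by (rule ereal_le_minus_right[OF fin])
 qed
qed

lemma End_ge0_iff:
 assumes n: "odd n"
 shows "\<Phi> \<in> End_ge0 n p \<longleftrightarrow> \<Phi> \<in> carrier (End_module n p) \<and> gap n 0 (lft n \<Phi>)"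
 using nu_End_ge_iff[OF n, of \<Phi> p 0] by (auto simp: End_ge0_def zero_ereal_def)

text \<open>Exponents are integers: a strictly positive gap in every component is at least
  1.\<close>

lemma End_gt0_iff:
 assumes n: "odd n"
 shows "\<Phi> \<in> End_gt0 n p \<longleftrightarrow> \<Phi> \<in> carrier (End_module n p) \<and> gap n 1 (lft n \<Phi>)"
proof -
 have "gap n 1 (lft n \<Phi>)" if \<Phi>: "\<Phi> \<in> carrier (End_module n p)" and pos: "0 < nu_End n \<Phi>"
 proof -
  obtain r where r: "0 < r" "ereal r \<le> nu_End n \<Phi>"
  proof (cases "nu_End n \<Phi>")
   case (real r)
   show ?thesis by (rule that[of r]) (use real pos in auto)
  next
   case PInf
   show ?thesis by (rule that[of 1]) (use PInf in auto)
  qed (use pos in auto)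
  have "gap n (r * real (n + 1)) (lft n \<Phi>)"
   using nu_End_ge_iff[OF n \<Phi>, of "r * real (n + 1)"] r(2) by simp
  moreover have "0 < r * real (n + 1)" using r(1) by simp
  ultimately have "0 < lookup y i - lookup (lam n w) i"
   if "set w \<subseteq> {..n}" "cf n (lft n \<Phi> (word_mon n 1 w)) y \<noteq> 0" "i \<le> n" for w y i
   using that unfolding gap_def by (smt (verit) of_int_0_less_iff)
  then show ?thesis unfolding gap_def by (metis int_one_le_iff_zero_less of_int_1_le_iff)
 qed
 moreover have "0 < nu_End n \<Phi>" if "\<Phi> \<in> carrier (End_module n p)" "gap n 1 (lft n \<Phi>)"
 proof -
  have "ereal (1 / real (n + 1)) \<le> nu_End n \<Phi>" using nu_End_ge_iff[OF n that(1), of 1] that(2) by blast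
  moreover have "0 < ereal (1 / real (n + 1))" by simp
  ultimately show ?thesis by (rule less_le_trans[rotated])
 qed
 ultimately show ?thesis unfolding End_gt0_def by blast
qed

section \<open>Leading coefficients\<close>

definition expword :: "nat \<Rightarrow> (nat \<Rightarrow> nat) \<Rightarrow> nat list" where
 "expword n b = concat (map (\<lambda>i. replicate (b i) i) [0..<n + 1])"

lemma word_sign_cf: "word_sign n \<epsilon> w = cf n (word_mon n \<epsilon> w) (lam n w)"
 by (simp add: word_mon_def cf_mon)

lemma lam_eqI:
 assumes "\<And>i. count_list v i = count_list w i" shows "lam n v = lam n w"
 by (rule poly_mapping_eqI) (simp add: lookup_lam assms)

lemma word_sign_swap:
 assumes "i \<noteq> j" "i \<le> n" "j \<le> n"
 shows "word_sign n \<epsilon> (i # j # w) = - word_sign n \<epsilon> (j # i # w)"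
proof -
 have l: "lam n (i # j # w) = lam n (j # i # w)" by (rule lam_eqI) simp
 show ?thesis using word_mon_swap[OF assms, of "[]" \<epsilon> w] unfolding word_sign_cf l by (simp add: cf_uminus del: lam.simps)
qed

lemma word_sign_append_cong:
 assumes p: "parity_set n v = parity_set n w" and u: "set u \<subseteq> {..n}"
 shows "word_sign n \<epsilon> (u @ v) * word_sign n \<epsilon> w = word_sign n \<epsilon> (u @ w) * word_sign n \<epsilon> v"
 using u
proof (induction u)
 case (Cons i u)
 have ev: "odd (count_list v j + count_list v 0) \<longleftrightarrow> odd (count_list w j + count_list w 0)" if "j \<in> {1..n}" for j
  using p that unfolding parity_set_def by blast
 have "parity_set n (u @ v) = parity_set n (u @ w)"
  unfolding parity_set_def
 proof (intro Collect_cong conj_cong refl)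
  fix j assume "j \<in> {1..n}"
  from ev[OF this] show "odd (count_list (u @ v) j + count_list (u @ v) 0) = odd (count_list (u @ w) j + count_list (u @ w) 0)"
   by auto
 qed
 then have "letter_sign n \<epsilon> i (u @ v) = letter_sign n \<epsilon> i (u @ w)"
  using Cons.prems by (intro letter_sign_cong) auto
 moreover have "word_sign n \<epsilon> (u @ v) * word_sign n \<epsilon> w = word_sign n \<epsilon> (u @ w) * word_sign n \<epsilon> v"
  using Cons by simp
 ultimately show ?case by (simp only: append_Cons word_sign.simps mult.assoc)
qed simp

text \<open>Every letter different from \<open>i\<close> that is passed costs a sign; equal letters
  cost none.\<close>

lemma word_sign_move:
 assumes u: "set u \<subseteq> {..n}" and i: "i \<le> n"
 shows "word_sign n \<epsilon> (u @ i # v) = (-1) ^ length (filter (\<lambda>j. j \<noteq> i) u) * word_sign n \<epsilon> (i # u @ v)"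
 using u
proof (induction u)
 case (Cons j u)
 have p: "parity_set n (u @ i # v) = parity_set n (i # u @ v)"
 proof -
  have "count_list (u @ i # v) k = count_list (i # u @ v) k" for k by simp
  then show ?thesis by (simp only: parity_set_def)
 qed
 have "letter_sign n \<epsilon> j (u @ i # v) = letter_sign n \<epsilon> j (i # u @ v)"
  using Cons.prems by (intro letter_sign_cong p) simp
 then have "word_sign n \<epsilon> (j # u @ i # v) = (-1) ^ length (filter (\<lambda>j. j \<noteq> i) u) * word_sign n \<epsilon> (j # i # u @ v)"
  using Cons by simp
 then show ?case using word_sign_swap[of i j n \<epsilon> "u @ v"] i Cons.prems by (cases "j = i") auto
qed simp

lemma count_expword: "count_list (expword n b) i = (if i \<le> n then b i else 0)"
proof -
 have r: "count_list (replicate k j) i = (if j = i then k else 0)" for k j by (induction k) auto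
 have "count_list (concat (map (\<lambda>i. replicate (b i) i) [0..<m])) i = (if i < m then b i else 0)" for m
  by (induction m) (auto simp: r)
 then show ?thesis unfolding expword_def by (simp add: less_Suc_eq_le del: upt_Suc)
qed

lemma set_expword: "set (expword n b) \<subseteq> {..n}"
proof
 fix i assume "i \<in> set (expword n b)"
 then have "count_list (expword n b) i \<noteq> 0" by (simp add: count_list_0_iff)
 then show "i \<in> {..n}" unfolding count_expword by (auto split: if_splits)
qed

lemma length_expword: "length (expword n b) = (\<Sum>i\<le>n. b i)"
proof -
 have "length (concat (map (\<lambda>i. replicate (b i) i) [0..<m])) = (\<Sum>i<m. b i)" for m
  by (induction m) auto
 then show ?thesis unfolding expword_def by (simp only: lessThan_Suc_atMost Suc_eq_plus1[symmetric])
qed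

lemma length_filter_expword:
 assumes "i \<le> n" shows "length (filter (\<lambda>j. j \<noteq> i) (expword n b)) + b i = (\<Sum>i\<le>n. b i)"
proof -
 have "count_list (expword n b) i = length (filter (\<lambda>j. \<not> j \<noteq> i) (expword n b))"
 proof -
  have "(\<lambda>j. \<not> j \<noteq> i) = (=) i" by auto
  then show ?thesis by (simp only: count_list_eq_length_filter)
 qed
 then show ?thesis
  using sum_length_filter_compl[of "\<lambda>j. j \<noteq> i" "expword n b"] assms by (simp add: count_expword length_expword)
qed

lemma expword_split:
 assumes i: "i \<le> n" and b: "1 \<le> b i"
 obtains u v where "expword n b = u @ i # v" "expword n (b(i := b i - 1)) = u @ v" "set u \<subseteq> {..n}"
  "length (filter (\<lambda>j. j \<noteq> i) u) = (\<Sum>j<i. b j)"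
proof -
 let ?c = "\<lambda>b. concat (map (\<lambda>i. replicate (b i) i) [0..<i])" and ?d = "\<lambda>b. concat (map (\<lambda>i. replicate (b i) i) [Suc i..<n + 1])"
 have "[0..<n + 1] = [0..<i] @ [i..<n + 1]" using i upt_add_eq_append[of 0 i "n + 1 - i"] by simp
 moreover have "[i..<n + 1] = i # [Suc i..<n + 1]" using i by (simp add: upt_conv_Cons del: upt_Suc)
 ultimately have e: "expword n b = ?c b @ replicate (b i) i @ ?d b" for b by (simp only: expword_def) simp
 have cd: "?c (b(i := k)) = ?c b" "?d (b(i := k)) = ?d b" for k
  by (auto intro!: arg_cong[of _ _ concat] map_cong simp del: upt_Suc)
 have r: "replicate (b i) i = i # replicate (b i - 1) i" using b by (cases "b i") auto
 have "expword n (b(i := b i - 1)) = ?c b @ (replicate (b i - 1) i @ ?d b)" unfolding e cd by simp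
 moreover have "expword n b = ?c b @ i # (replicate (b i - 1) i @ ?d b)" unfolding e r by simp
 moreover have "set (?c b) \<subseteq> {..n}" using i by auto
 moreover have "length (filter (\<lambda>j. j \<noteq> i) (concat (map (\<lambda>i. replicate (b i) i) [0..<m]))) = (\<Sum>j<m. b j)" if "m \<le> i" for m
  using that by (induction m) auto
 ultimately show ?thesis using that by blast
qed

text \<open>The origin of \<open>expsign\<close>: the factor \<open>e_i\<close> is taken from its
  block and moved to the front past the blocks of smaller index.\<close>

lemma word_sign_expword:
 assumes i: "i \<le> n" and b: "1 \<le> b i"
 shows "word_sign n \<epsilon> (expword n b @ w) = expsign b i * word_sign n \<epsilon> (i # expword n (b(i := b i - 1)) @ w)"
proof -
 obtain u v where uv: "expword n b = u @ i # v" "expword n (b(i := b i - 1)) = u @ v" "set u \<subseteq> {..n}"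
  "length (filter (\<lambda>j. j \<noteq> i) u) = (\<Sum>j<i. b j)" using expword_split[of i n b] i b by blast
 have "word_sign n \<epsilon> (u @ i # (v @ w)) = (-1) ^ length (filter (\<lambda>j. j \<noteq> i) u) * word_sign n \<epsilon> (i # u @ (v @ w))"
  by (rule word_sign_move[OF uv(3) i])
 then show ?thesis unfolding uv by (simp add: expsign_def)
qed

text \<open>The coefficient relative to the word \<open>v\<close> instead of its bare monomial, so
  that the sign of the word is divided out.\<close>

definition wcf :: "nat \<Rightarrow> amb \<Rightarrow> nat list \<Rightarrow> real" where
 "wcf n a v = word_sign n 1 v * cf n a (lam n v)"

text \<open>
 \<open>kap n p F b X\<close> is the coefficient of \<open>e\<^sub>0\<^bsup>b 0\<^esup> \<cdots> e\<^sub>n\<^bsup>b n\<^esup> e\<^sub>X\<close> in the image of \<open>e\<^sub>X\<close>. When some \<open>b i\<close> is \<open>0\<close>, this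
 coefficient survives at the vertex \<open>i\<close> of the simplex, and these are the only coefficients of
 valuation \<open>0\<close>.
\<close>

definition lead_index :: "nat \<Rightarrow> int \<Rightarrow> (nat \<Rightarrow> nat) \<Rightarrow> nat set \<Rightarrow> bool" where
 "lead_index n p b X \<longleftrightarrow> X \<subseteq> {..n} \<and> (\<forall>i>n. b i = 0) \<and> int (\<Sum>i\<le>n. b i) = p \<and> bdr n b"

definition kap :: "nat \<Rightarrow> int \<Rightarrow> (amb \<Rightarrow> amb) \<Rightarrow> cochain" where
 "kap n p F b X = (if lead_index n p b X then wcf n (F (word_mon n 1 (wd X))) (expword n b @ wd X) else 0)"

text \<open>Words of equal parity set differ by a scalar of \<open>S\<close>, which the linear map
  respects, and the signs on both sides agree. This gives invariance under complement and, with
  \<open>parity_wd_flip\<close>, the flips of the cubical complex.\<close>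

lemma wcf_parity:
 assumes n: "odd n" and F: "linear_hom n p F" and w: "set w \<subseteq> {..n}" "set w' \<subseteq> {..n}"
  and p: "parity_set n w = parity_set n w'" and u: "set u \<subseteq> {..n}"
 shows "wcf n (F (word_mon n 1 w)) (u @ w) = wcf n (F (word_mon n 1 w')) (u @ w')"
proof -
 have "lam n (u @ w) - (lam n w - lam n w') = lam n (u @ w')" by (simp add: lam_append)
 then have "wcf n (F (word_mon n 1 w)) (u @ w)
   = (word_sign n 1 (u @ w) * word_sign n 1 w') * word_sign n 1 w * cf n (F (word_mon n 1 w')) (lam n (u @ w'))"
  unfolding wcf_def linear_hom_word[OF n F w p] by simp
 also have "word_sign n 1 (u @ w) * word_sign n 1 w' = word_sign n 1 (u @ w') * word_sign n 1 w"
  by (rule word_sign_append_cong[OF p u])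
 finally show ?thesis using word_sign_pm[of 1 n w] unfolding wcf_def by simp
qed

lemma parity_wd_compl:
 assumes X: "X \<subseteq> {..n}" shows "parity_set n (wd ({..n} - X)) = parity_set n (wd X)"
 using finite_subset[OF X] unfolding parity_set_def by (intro Collect_cong conj_cong refl) (auto simp: count_wd)

lemma parity_wd_flip:
 assumes X: "X \<subseteq> {..n}" and i: "i \<le> n" shows "parity_set n (i # wd X) = parity_set n (wd (flip i X))"
proof -
 have fin: "finite X" "finite (flip i X)" using finite_subset[OF X] by (simp_all add: flip_def)
 have "even (count_list (i # wd X) j + count_list (wd (flip i X)) j)" for j
  using fin by (auto simp: count_wd flip_def)
 then show ?thesis using parity_set_append_cong[of n "i # wd X" "wd (flip i X)" "[]"] by simp
qed

lemma qcub_kap: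
 assumes n: "odd n" and F: "linear_hom n p F"
 shows "qcub n p (kap n p F)"
 unfolding qcub_def
proof (intro conjI cubI allI impI)
 fix b X assume "kap n p F b X \<noteq> 0"
 then have "lead_index n p b X" by (simp add: kap_def split: if_splits)
 then show "X \<subseteq> {..n}" "\<And>i. i > n \<Longrightarrow> b i = 0" "int (\<Sum>i\<le>n. b i) = p" "\<And>i. 0 \<le> b i"
  by (auto simp: lead_index_def)
next
 fix b X assume X: "X \<subseteq> {..n}"
 have "wcf n (F (word_mon n 1 (wd ({..n} - X)))) (expword n b @ wd ({..n} - X))
   = wcf n (F (word_mon n 1 (wd X))) (expword n b @ wd X)"
  by (intro wcf_parity[OF n F] set_wd parity_wd_compl set_expword) (use X in auto)
 moreover have "lead_index n p b ({..n} - X) = lead_index n p b X" using X by (auto simp: lead_index_def)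
 ultimately show "kap n p F b ({..n} - X) = kap n p F b X" by (simp only: kap_def)
next
 fix b X assume "\<not> bdr n b"
 then show "kap n p F b X = 0" by (simp add: kap_def lead_index_def)
qed

lemma half_pos: "odd n \<Longrightarrow> 0 < half n"
 by (auto elim!: oddE)

lemma kap_gap1:
 assumes n: "odd n" and g: "gap n 1 F"
 shows "kap n p F b X = 0"
proof (rule ccontr)
 assume nz: "kap n p F b X \<noteq> 0"
 then have l: "lead_index n p b X" and y: "cf n (F (word_mon n 1 (wd X))) (lam n (expword n b @ wd X)) \<noteq> 0"
  by (auto simp: kap_def wcf_def split: if_splits)
 obtain j where j: "j \<le> n" "b j = 0" using l by (auto simp: lead_index_def bdr_def)
 have "set (wd X) \<subseteq> {..n}" using l by (intro set_wd) (simp add: lead_index_def)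
 then have "1 \<le> real_of_int (lookup (lam n (expword n b @ wd X)) j - lookup (lam n (wd X)) j)"
  using g y j(1) unfolding gap_def by blast
 then show False using j by (simp add: lookup_lam count_expword)
qed

text \<open>If one component is unchanged, the power of \<open>X\<close> in the
  \<open>S\<close>-coefficient is a multiple of \<open>half n\<close>, hence all shifts are, and
  their quotients form the exponent \<open>b\<close>. Its sum is the degree \<open>p\<close> by
  homogeneity.\<close>

lemma lead_exponent:
 assumes n: "odd n" and F: "linear_hom n p F" and g: "gap n 0 F" and w: "set w \<subseteq> {..n}"
  and y: "cf n (F (word_mon n 1 w)) y \<noteq> 0" and j: "j \<le> n" "lookup y j = lookup (lam n w) j"
 shows "\<exists>b. y = lam n (expword n b @ w) \<and> (\<forall>i>n. b i = 0) \<and> int (\<Sum>i\<le>n. b i) = p \<and> b j = 0"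
proof -
 let ?N = "half n"
 note N = half_pos[OF n]
 define z where "z i = lookup y i - lookup (lam n w) i" for i
 have z0: "0 \<le> z i" if "i \<le> n" for i
  using g w y that unfolding gap_def z_def by (metis of_int_0_le_iff)
 have "F (word_mon n 1 w) \<in> spin_image n" by (intro linear_homD(1)[OF F] spin_image_word w)
 then obtain s where s: "\<And>J. s J \<in> SC n" "F (word_mon n 1 w) = bas n s"
  unfolding spin_image_iff[OF n] by blast
 obtain J where J: "J \<in> Pow {1..n}" "cf n (iota n (s J)) (y - lam n (wd J)) \<noteq> 0"
  using bas_support[of n s y] y s(2) by auto
 obtain k d where kd: "y - lam n (wd J) = tvec n (k, d)" using S_support[OF s(1) J(2)] by blast
 have ly: "lookup y i = (if i \<le> n then k + 2 * ?N * int (lookup d i) else 0) + ?N * int (count_list (wd J) i)" for i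
  using arg_cong[OF kd, of "\<lambda>v. lookup v i"] unfolding lookup_minus lookup_tvec lookup_lam half_double[OF n] by simp
 have zz: "z i = k + ?N * (2 * int (lookup d i) + int (count_list (wd J) i) - int (count_list w i))" if "i \<le> n" for i
  unfolding z_def ly lookup_lam using that by (simp add: algebra_simps)
 have "?N dvd k"
 proof -
  have "m dvd k" if "0 = k + m * t" for m t :: int
  proof -
   have "k = m * (- t)" using that by (simp only: mult_minus_right)
   then show ?thesis by (rule dvdI)
  qed
  moreover have "z j = 0" using j(2) by (simp add: z_def)
  ultimately show ?thesis using zz[OF j(1)] by metis
 qed
 then have dv: "?N dvd z i" if "i \<le> n" for i unfolding zz[OF that] by simp
 define b where "b i = (if i \<le> n then nat (z i div ?N) else 0)" for i
 have bz: "?N * int (b i) = z i" if "i \<le> n" for i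
  using dv[OF that] z0[OF that] N that by (simp add: b_def pos_imp_zdiv_nonneg_iff)
 have y_eq: "y = lam n (expword n b @ w)"
 proof (rule poly_mapping_eqI)
  fix i show "lookup y i = lookup (lam n (expword n b @ w)) i"
  proof (cases "i \<le> n")
   case True
   then show ?thesis using bz[OF True] by (simp add: z_def lookup_lam lam_append lookup_add count_expword)
  next
   case False
   have "i \<notin> set (wd J)" "i \<notin> set w" using False w wd_letters[OF J(1)] by auto
   then show ?thesis using False ly[of i] by (simp add: lookup_lam count_expword)
  qed
 qed
 have lw: "set (expword n b @ w) \<subseteq> {..n}" using w set_expword[of n b] by simp
 have "homog n (int (length w)) (word_mon n 1 w)"
  unfolding homog_def word_mon_def cf_mon using dgr_lam[OF w] half_double[OF n] by auto
 then have "homog n (int (length w) + p) (F (word_mon n 1 w))"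
  by (rule linear_homD(4)[OF F spin_image_word[OF w]])
 then have "2 * dgr n y = int (n + 1) * (int (length w) + p)" using y unfolding homog_def by blast
 then have "2 * (?N * int (length (expword n b @ w))) = (2 * ?N) * (int (length w) + p)"
  unfolding y_eq dgr_lam[OF lw] half_double[OF n] .
 then have "int (length (expword n b @ w)) = int (length w) + p" using N by simp
 then have "int (\<Sum>i\<le>n. b i) = p" by (simp add: length_expword del: of_nat_sum)
 moreover have "b j = 0" using j by (simp add: b_def z_def)
 moreover have "\<forall>i>n. b i = 0" by (simp add: b_def)
 ultimately show ?thesis using y_eq by blast
qed

text \<open>A term of gap 0 leaves some component fixed, so by \<open>lead_exponent\<close> it is
  recorded among the leading coefficients.\<close>

lemma kap_zero_gap1:
 assumes n: "odd n" and F: "linear_hom n p F" and g: "gap n 0 F" and z: "\<And>b X. kap n p F b X = 0"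
 shows "gap n 1 F"
proof (rule gap_basis[OF n F])
 fix J y i assume J: "J \<in> Pow {1..n}" and y: "cf n (F (word_mon n 1 (wd J))) y \<noteq> 0" and i: "i \<le> n"
 let ?z = "lookup y i - lookup (lam n (wd J)) i"
 have ge: "0 \<le> real_of_int ?z" using g wd_letters[OF J] y i unfolding gap_def by blast
 have "?z \<noteq> 0"
 proof
  assume "?z = 0"
  then have "lookup y i = lookup (lam n (wd J)) i" by simp
  then obtain b where b: "y = lam n (expword n b @ wd J)" "\<forall>i>n. b i = 0" "int (\<Sum>i\<le>n. b i) = p" "b i = 0"
   using lead_exponent[OF n F g wd_letters[OF J] y i] by blast
  have "lead_index n p b J" using b i J by (auto simp: lead_index_def bdr_def)
  then have "kap n p F b J \<noteq> 0"
   using y word_sign_nonzero[of 1 n "expword n b @ wd J"] by (simp add: kap_def wcf_def b(1))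
  then show False by (simp add: z)
 qed
 then have "1 \<le> ?z" using ge by linarith
 then show "1 \<le> real_of_int ?z" by simp
qed

lemma dop_word:
 assumes n: "odd n" and w: "set w \<subseteq> {..n}"
 shows "dop n (word_mon n 1 w) = (\<Sum>i\<le>n. word_mon n 1 (i # w))"
 unfolding dop_def by (intro sum.cong refl gact_word[OF n _ w]) simp

lemma hom_diff_word:
 assumes n: "odd n" and F: "linear_hom n p F" and w: "set w \<subseteq> {..n}"
 shows "hom_diff n p F (word_mon n 1 w) = (\<Sum>i\<le>n. gact n i (Mel n (F (word_mon n 1 w)))
  + mon n 0 (if even p then -1 else 1) * F (word_mon n 1 (i # w)))"
proof -
 have "F (dop n (word_mon n 1 w)) = (\<Sum>i\<le>n. F (word_mon n 1 (i # w)))"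
  unfolding dop_word[OF n w] by (rule linear_hom_sum[OF F]) (use w in \<open>auto intro!: spin_image_word\<close>)
 then show ?thesis unfolding hom_diff_def dop_def by (simp only: sum_distrib_left sum.distrib)
qed

lemma gap_hom_diff:
 assumes n: "odd n" and F: "linear_hom n p F" and g: "gap n c F"
 shows "gap n c (hom_diff n p F)"
 unfolding gap_def
proof (intro allI impI)
 fix w y i assume w: "set w \<subseteq> {..n}" and y: "cf n (hom_diff n p F (word_mon n 1 w)) y \<noteq> 0" and i: "i \<le> n"
 let ?a = "F (word_mon n 1 w)"
 have a: "?a \<in> spin_image n" by (intro linear_homD(1)[OF F] spin_image_word w)
 obtain j where j: "j \<le> n" "cf n (gact n j (Mel n ?a)) y
   + (if even p then -1 else 1) * cf n (F (word_mon n 1 (j # w))) (y - 0) \<noteq> 0"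
  using y unfolding hom_diff_word[OF n F w] cf_sum cf_add cf_mon_times by (auto dest!: sum_nonzero)
 let ?e = "single j (half n)"
 have e: "0 \<le> lookup ?e i" by (simp add: lookup_single when_def)
 consider "cf n (gact n j (Mel n ?a)) y \<noteq> 0" | "cf n (F (word_mon n 1 (j # w))) y \<noteq> 0"
  using j(2) by (cases "cf n (F (word_mon n 1 (j # w))) y = 0") simp_all
 then show "c \<le> of_int (lookup y i - lookup (lam n w) i)"
 proof cases
  case 1
  then have "cf n ?a (y - ?e) \<noteq> 0"
   using gact_support[OF n j(1) Mel_carrier[OF n a]] by (simp add: psi_Mel[OF n a])
  then have "c \<le> of_int (lookup (y - ?e) i - lookup (lam n w) i)"
   using g w i unfolding gap_def by blast
  also have "\<dots> \<le> of_int (lookup y i - lookup (lam n w) i)"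
   using e by (simp add: lookup_minus)
  finally show ?thesis .
 next
  case 2
  then have "c \<le> of_int (lookup y i - lookup (lam n (j # w)) i)"
   using g w i j(1) unfolding gap_def by (metis atMost_iff insert_subset list.simps(15))
  also have "\<dots> \<le> of_int (lookup y i - lookup (lam n w) i)"
   using e by (simp add: lookup_add)
  finally show ?thesis .
 qed
qed

text \<open>
 Modulo terms of positive valuation, the supercommutator with \<open>e\<^sub>0 + \<dots> + e\<^sub>n\<close> is the cubical
 differential: \<open>e\<^sub>i \<Phi>\<close> raises \<open>b i\<close>, and so does \<open>\<Phi> e\<^sub>i\<close> after \<open>X\<close> is flipped at \<open>i\<close>.
\<close>

lemma kap_hom_diff_part:
 assumes n: "odd n" and F: "linear_hom n p F" and g: "gap n 0 F" and i: "i \<le> n"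
  and l: "lead_index n (p + 1) b X"
 shows "wcf n (gact n i (Mel n (F (word_mon n 1 (wd X))))) (expword n b @ wd X)
   + (if even p then -1 else 1) * wcf n (F (word_mon n 1 (i # wd X))) (expword n b @ wd X)
  = cub_part i (kap n p F) b X"
proof -
 let ?w = "wd X" and ?N = "half n"
 let ?a = "F (word_mon n 1 ?w)"
 have X: "X \<subseteq> {..n}" using l by (simp add: lead_index_def)
 have w: "set ?w \<subseteq> {..n}" by (rule set_wd[OF X])
 have iw: "set (i # ?w) \<subseteq> {..n}" using w i by simp
 have a: "?a \<in> spin_image n" by (intro linear_homD(1)[OF F] spin_image_word w)
 show ?thesis
 proof (cases "1 \<le> b i")
  \<comment> \<open>With \<open>b i = 0\<close> either order of multiplication by \<open>e_i\<close>
    would need a term that lowers component \<open>i\<close>, which the gap condition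
    forbids.\<close>
  case False
  then have b0: "b i = 0" by simp
  let ?y = "lam n (expword n b @ ?w)"
  have neg: "lookup ?y i - ?N - lookup (lam n ?w) i < 0"
   using half_pos[OF n] b0 by (simp add: lookup_lam count_expword)
  have "cf n (gact n i (Mel n ?a)) ?y = 0"
  proof (rule ccontr)
   assume "\<not> ?thesis"
   then have "cf n ?a (?y - single i ?N) \<noteq> 0"
    using gact_support[OF n i Mel_carrier[OF n a]] by (simp add: psi_Mel[OF n a])
   then have "0 \<le> real_of_int (lookup (?y - single i ?N) i - lookup (lam n ?w) i)"
    using g w i unfolding gap_def by blast
   then show False using neg by (simp add: lookup_minus)
  qed
  moreover have "cf n (F (word_mon n 1 (i # ?w))) ?y = 0"
  proof (rule ccontr)
   assume "\<not> ?thesis"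
   then have "0 \<le> real_of_int (lookup ?y i - lookup (lam n (i # ?w)) i)"
    using g iw i unfolding gap_def by blast
   then show False using neg by (simp add: lookup_add)
  qed
  ultimately show ?thesis using False by (simp add: wcf_def cub_part_def)
 next
  case True
  let ?b = "b(i := b i - 1)"
  let ?v = "expword n ?b @ ?w"
  have sum: "(\<Sum>j\<le>n. ?b j) + 1 = (\<Sum>j\<le>n. b j)"
   using sum_fun_upd_nat[OF i, of b "b i - 1"] True by linarith
  have bp: "\<forall>j>n. b j = 0" "int (\<Sum>j\<le>n. b j) = p + 1" "bdr n b" using l by (simp_all add: lead_index_def)
  have "int (\<Sum>j\<le>n. ?b j) = p" using arg_cong[OF sum, of int] bp(2) by (simp only: of_nat_add of_nat_1)
  then have lX: "lead_index n p ?b Y" if "Y \<subseteq> {..n}" for Y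
   using that bp(1) i bdr_dec[OF bp(3)] unfolding lead_index_def by (intro conjI) simp_all
  have flip: "flip i X \<subseteq> {..n}" using X i by (simp add: flip_subset_iff)
  have lams: "lam n (expword n b @ ?w) = lam n (i # ?v)" "lam n (i # ?v) = lam n (expword n ?b @ i # ?w)"
  proof -
   show "lam n (expword n b @ ?w) = lam n (i # ?v)"
    by (rule lam_eqI) (use True i in \<open>auto simp: count_expword\<close>)
   show "lam n (i # ?v) = lam n (expword n ?b @ i # ?w)" by (rule lam_eqI) simp
  qed
  have v: "set ?v \<subseteq> {..n}" using w set_expword[of n ?b] by simp
  have ws: "word_sign n 1 (expword n b @ ?w) = expsign b i * word_sign n 1 (i # ?v)"
   by (rule word_sign_expword[where b = b, OF i True])
  have 1: "wcf n (gact n i (Mel n ?a)) (expword n b @ ?w) = expsign b i * kap n p F ?b X"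
  proof -
   have "wcf n (gact n i (Mel n ?a)) (expword n b @ ?w)
     = expsign b i * word_sign n 1 (i # ?v) * (letter_sign n 1 i ?v * cf n ?a (lam n ?v))"
    unfolding wcf_def ws lams(1) gact_value[OF n i Mel_carrier[OF n a] v] psi_Mel[OF n a] ..
   also have "\<dots> = expsign b i * (letter_sign n 1 i ?v * letter_sign n 1 i ?v) * (word_sign n 1 ?v * cf n ?a (lam n ?v))"
    by simp
   also have "letter_sign n 1 i ?v * letter_sign n 1 i ?v = 1" by (rule letter_sign_pm) simp
   also have "word_sign n 1 ?v * cf n ?a (lam n ?v) = kap n p F ?b X"
    unfolding kap_def wcf_def if_P[OF lX[OF X]] ..
   finally show ?thesis by (simp only: mult_1_right)
  qed
  let ?L = "length (filter (\<lambda>j. j \<noteq> i) (expword n ?b))"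
  have 2: "wcf n (F (word_mon n 1 (i # ?w))) (expword n b @ ?w) = expsign b i * (-1) ^ ?L * kap n p F ?b (flip i X)"
  proof -
   have "word_sign n 1 (expword n ?b @ i # ?w) = (-1) ^ ?L * word_sign n 1 (i # ?v)"
    by (rule word_sign_move[OF set_expword i])
   then have "(-1) ^ ?L * word_sign n 1 (expword n ?b @ i # ?w) = ((-1) ^ ?L * (-1) ^ ?L) * word_sign n 1 (i # ?v)"
    by (simp only: mult.assoc)
   also have "(-1::real) ^ ?L * (-1) ^ ?L = 1" by (simp flip: power_mult_distrib)
   finally have wsm: "word_sign n 1 (i # ?v) = (-1) ^ ?L * word_sign n 1 (expword n ?b @ i # ?w)"
    by (simp only: mult_1)
   have "wcf n (F (word_mon n 1 (i # ?w))) (expword n b @ ?w)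
     = expsign b i * (-1) ^ ?L * wcf n (F (word_mon n 1 (i # ?w))) (expword n ?b @ i # ?w)"
    unfolding wcf_def ws lams wsm by (simp only: mult.assoc)
   also have "wcf n (F (word_mon n 1 (i # ?w))) (expword n ?b @ i # ?w)
     = wcf n (F (word_mon n 1 (wd (flip i X)))) (expword n ?b @ wd (flip i X))"
    by (rule wcf_parity[OF n F iw set_wd[OF flip] parity_wd_flip[OF X i] set_expword])
   also have "\<dots> = kap n p F ?b (flip i X)" unfolding kap_def if_P[OF lX[OF flip]] ..
   finally show ?thesis .
  qed
  \<comment> \<open>The word has \<open>p + 1\<close> letters in all, so the sign of the commutator
    and the one from moving \<open>e_i\<close> combine to \<open>(-1) ^ b i\<close>, as in
    \<open>cub_part\<close>.\<close>
  have "?L + b i = (\<Sum>j\<le>n. b j)"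
   using length_filter_expword[OF i, of ?b] sum True by simp
  then have "int ?L + int (b i) = p + 1" using bp(2) by (metis of_nat_add)
  moreover have "even x \<longleftrightarrow> (even p \<longleftrightarrow> odd y)" if "int x + int y = p + 1" for x y :: nat
   using that by presburger
  ultimately have "even ?L \<longleftrightarrow> (even p \<longleftrightarrow> odd (b i))" by blast
  then have "(if even p then -1 else 1) * (-1) ^ ?L = ((-1) ^ b i :: real)" by auto
  then have "(if even p then -1 else 1) * (expsign b i * (-1) ^ ?L * kap n p F ?b (flip i X))
    = expsign b i * ((-1) ^ b i * kap n p F ?b (flip i X))"
  proof -
   have "s * (x * l * k) = x * (m * k)" if "s * l = m" for s x l k m :: real
    unfolding that[symmetric] by (simp only: mult_ac)
   then show ?thesis using \<open>(if even p then -1 else 1) * (-1) ^ ?L = ((-1) ^ b i :: real)\<close> by blast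
  qed
  then show ?thesis unfolding 1 2 using True by (simp add: cub_part_def distrib_left)
 qed
qed

lemma kap_hom_diff:
 assumes n: "odd n" and F: "linear_hom n p F" and g: "gap n 0 F"
 shows "kap n (p + 1) (hom_diff n p F) b X = qdiff n (kap n p F) b X"
proof (cases "lead_index n (p + 1) b X")
 case True
 have w: "set (wd X) \<subseteq> {..n}" using True by (intro set_wd) (simp add: lead_index_def)
 have "kap n (p + 1) (hom_diff n p F) b X = (\<Sum>i\<le>n. wcf n (gact n i (Mel n (F (word_mon n 1 (wd X))))) (expword n b @ wd X)
   + (if even p then -1 else 1) * wcf n (F (word_mon n 1 (i # wd X))) (expword n b @ wd X))"
  unfolding kap_def hom_diff_word[OF n F w] using True
  by (simp add: wcf_def cf_sum cf_add cf_mon_times sum_distrib_left distrib_left mult.left_commute)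
 also have "\<dots> = cub_diff n (kap n p F) b X"
  unfolding cub_diff_def by (intro sum.cong refl kap_hom_diff_part[OF n F g _ True]) simp
 also have "\<dots> = qdiff n (kap n p F) b X" using True by (simp add: qdiff_def qrestr_def lead_index_def)
 finally show ?thesis .
next
 case False
 have "qdiff n (kap n p F) b X = 0"
 proof (rule ccontr)
  assume nz: "qdiff n (kap n p F) b X \<noteq> 0"
  have q: "qcub n (p + 1) (qdiff n (kap n p F))" by (rule qcub_qdiff[OF qcub_kap[OF n F]])
  have c: "cub n 0 (p + 1) (qdiff n (kap n p F))" using q by (simp add: qcub_def)
  have "bdr n b" using nz by (simp add: qdiff_def qrestr_def split: if_splits)
  moreover have "X \<subseteq> {..n}" "\<forall>i>n. b i = 0" "int (\<Sum>i\<le>n. b i) = p + 1"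
  proof -
   note d = cubD[where f = "qdiff n (kap n p F)" and b = b and X = X, OF c nz]
   show "X \<subseteq> {..n}" by (rule d(1))
   show "\<forall>i>n. b i = 0" using d(3) by blast
   show "int (\<Sum>i\<le>n. b i) = p + 1" by (rule d(4))
  qed
  ultimately have "lead_index n (p + 1) b X" unfolding lead_index_def by (intro conjI)
  with False show False by contradiction
 qed
 then show ?thesis using False by (simp add: kap_def)
qed

section \<open>Endomorphisms with prescribed leading coefficients\<close>

definition crd :: "nat \<Rightarrow> amb \<Rightarrow> nat set \<Rightarrow> tate set" where
 "crd n a = (SOME s. (\<forall>J. s J \<in> SC n) \<and> a = bas n s)"

lemma crd:
 assumes n: "odd n" and a: "a \<in> spin_image n"
 shows "crd n a J \<in> SC n" "bas n (crd n a) = a"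
proof -
 have "\<exists>s. (\<forall>J. s J \<in> SC n) \<and> a = bas n s" using a spin_image_iff[OF n] by simp
 then have "(\<forall>J. crd n a J \<in> SC n) \<and> a = bas n (crd n a)"
  unfolding crd_def by (rule someI_ex)
 then show "crd n a J \<in> SC n" "bas n (crd n a) = a" by simp_all
qed

lemma crd_unique:
 assumes n: "odd n" and s: "\<And>J. s J \<in> SC n" and J: "J \<in> Pow {1..n}"
 shows "crd n (bas n s) J = s J"
proof -
 have "bas n s \<in> spin_image n" unfolding spin_image_iff[OF n] using s by (intro exI[of _ s]) simp
 note c = crd[OF n this]
 show ?thesis by (rule bas_eqD[where s = "crd n (bas n s)" and t = s, OF n c(1) s c(2) J])
qed

definition basis_hom :: "nat \<Rightarrow> (nat set \<Rightarrow> amb) \<Rightarrow> amb \<Rightarrow> amb" where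
 "basis_hom n G a = (\<Sum>J\<in>Pow {1..n}. iota n (crd n a J) * G J)"

lemma basis_hom_word:
 assumes n: "odd n" and J: "J \<in> Pow {1..n}"
 shows "basis_hom n G (word_mon n 1 (wd J)) = G J"
proof -
 interpret S: cring "S_ring n" by (rule cring_S)
 let ?s = "\<lambda>K. if K = J then \<one>\<^bsub>S_ring n\<^esub> else \<zero>\<^bsub>S_ring n\<^esub>"
 have b: "bas n ?s = word_mon n 1 (wd J)"
  using J unfolding bas_def by (simp add: if_distrib[of "iota n"] iota_one iota_zero if_distrib[of "\<lambda>x. x * _"] cong: if_cong)
 have "iota n (crd n (bas n ?s) K) = (if K = J then 1 else 0)" if "K \<in> Pow {1..n}" for K
  using crd_unique[where s = ?s, OF n _ that] by (simp add: iota_one iota_zero)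
 then have "basis_hom n G (bas n ?s) = (\<Sum>K\<in>Pow {1..n}. if K = J then G J else 0)"
  unfolding basis_hom_def by (intro sum.cong refl) simp
 then show ?thesis unfolding b using J by simp
qed

lemma linear_hom_basis_hom:
 assumes n: "odd n" and G: "\<And>J. J \<in> Pow {1..n} \<Longrightarrow> G J \<in> spin_image n"
  and hom: "\<And>J. J \<in> Pow {1..n} \<Longrightarrow> homog n (int (length (wd J)) + p) (G J)"
 shows "linear_hom n p (basis_hom n G)"
proof -
 interpret S: cring "S_ring n" by (rule cring_S)
 show ?thesis
  unfolding linear_hom_def
 proof (intro conjI ballI allI impI)
  fix a assume a: "a \<in> spin_image n"
  show "basis_hom n G a \<in> spin_image n"
   unfolding basis_hom_def by (intro spin_image_sum spin_image_scale crd[OF n a] G)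
  show "basis_hom n G (a + b) = basis_hom n G a + basis_hom n G b" if b: "b \<in> spin_image n" for b
  proof -
   let ?s = "\<lambda>J. crd n a J \<oplus>\<^bsub>S_ring n\<^esub> crd n b J"
   have i: "iota n (?s J) = iota n (crd n a J) + iota n (crd n b J)" for J
    using crd(1)[OF n a] crd(1)[OF n b] by (simp add: iota_ring)
   have "bas n ?s = bas n (crd n a) + bas n (crd n b)"
    unfolding bas_def i distrib_right sum.distrib ..
   then have e: "a + b = bas n ?s" by (simp add: crd(2)[OF n a] crd(2)[OF n b])
   have "crd n (a + b) J = ?s J" if "J \<in> Pow {1..n}" for J
    unfolding e by (rule crd_unique[OF n _ that]) (simp add: crd(1)[OF n a] crd(1)[OF n b])
   then show ?thesis
    unfolding basis_hom_def sum.distrib[symmetric] by (intro sum.cong refl) (simp add: i distrib_right)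
  qed
  show "homog n (q + p) (basis_hom n G a)" if q: "homog n q a" for q
   unfolding basis_hom_def
  proof (rule homog_sum)
   fix J assume J: "J \<in> Pow {1..n}"
   show "homog n (q + p) (iota n (crd n a J) * G J)"
    unfolding homog_def
   proof (intro allI impI)
    fix y assume y: "cf n (iota n (crd n a J) * G J) y \<noteq> 0"
    obtain u v where uv: "y = u + v" "cf n (iota n (crd n a J)) u \<noteq> 0" "cf n (G J) v \<noteq> 0"
     using cf_times_support[OF diag_iota[OF crd(1)[OF n a]] diag_spin_image[OF G[OF J]] y] by blast
    have "cf n (bas n (crd n a)) (u + lam n (wd J)) = word_sign n 1 (wd J) * cf n (iota n (crd n a J)) u"
     by (rule bas_coefficient[where s = "crd n a", OF n crd(1)[OF n a] J uv(2)])
    then have "cf n a (u + lam n (wd J)) \<noteq> 0"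
     using uv(2) word_sign_nonzero[of 1 n "wd J"] unfolding crd(2)[OF n a] by simp
    then have "2 * dgr n (u + lam n (wd J)) = int (n + 1) * q" using q unfolding homog_def by blast
    then have 1: "2 * dgr n u + int (n + 1) * int (length (wd J)) = int (n + 1) * q"
     unfolding dgr_add dgr_lam[OF wd_letters[OF J]] half_double[OF n] by simp
    have 2: "2 * dgr n v = int (n + 1) * (int (length (wd J)) + p)" using hom[OF J] uv(3) unfolding homog_def by blast
    have "2 * (x + z) = k * (q + p)" if "2 * x + k * w = k * q" "2 * z = k * (w + p)" for x z k w :: int
     using that by (simp add: algebra_simps)
    from this[OF 1 2] show "2 * dgr n y = int (n + 1) * (q + p)" unfolding uv(1) dgr_add .
   qed
  qed
 next
  fix s a assume s: "s \<in> SC n" and a: "a \<in> spin_image n"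
  let ?s = "\<lambda>J. s \<otimes>\<^bsub>S_ring n\<^esub> crd n a J"
  have i: "iota n (?s J) = iota n s * iota n (crd n a J)" for J
   using crd(1)[OF n a] s by (simp add: iota_ring)
  have "bas n ?s = iota n s * bas n (crd n a)"
   unfolding bas_def i sum_distrib_left by (simp only: mult.assoc)
  then have e: "iota n s * a = bas n ?s" by (simp add: crd(2)[OF n a])
  have "crd n (iota n s * a) J = ?s J" if "J \<in> Pow {1..n}" for J
   unfolding e by (rule crd_unique[OF n _ that]) (simp add: crd(1)[OF n a] s)
  then show "basis_hom n G (iota n s * a) = iota n s * basis_hom n G a"
   unfolding basis_hom_def sum_distrib_left by (intro sum.cong refl) (simp add: i mult.assoc)
 qed
qed

lemma finite_exponents: "finite {b :: nat \<Rightarrow> nat. (\<forall>i>n. b i = 0) \<and> int (\<Sum>i\<le>n. b i) = p}"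
proof (rule finite_subset)
 show "finite {b. \<forall>i. (i \<in> {..n} \<longrightarrow> b i \<in> {..nat p}) \<and> (i \<notin> {..n} \<longrightarrow> b i = 0)}"
  by (rule finite_set_of_finite_funs) auto
 show "{b :: nat \<Rightarrow> nat. (\<forall>i>n. b i = 0) \<and> int (\<Sum>i\<le>n. b i) = p}
   \<subseteq> {b. \<forall>i. (i \<in> {..n} \<longrightarrow> b i \<in> {..nat p}) \<and> (i \<notin> {..n} \<longrightarrow> b i = 0)}"
 proof
  fix b :: "nat \<Rightarrow> nat" assume "b \<in> {b. (\<forall>i>n. b i = 0) \<and> int (\<Sum>i\<le>n. b i) = p}"
  then have b: "\<And>i. n < i \<Longrightarrow> b i = 0" "int (\<Sum>i\<le>n. b i) = p" by auto
  have "b i \<le> nat p" if "i \<le> n" for i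
  proof -
   have "b i \<le> (\<Sum>i\<le>n. b i)" using member_le_sum[of i "{..n}" b] that by simp
   then have "int (b i) \<le> p" using b(2) by (metis of_nat_mono)
   then show ?thesis by simp
  qed
  then show "b \<in> {b. \<forall>i. (i \<in> {..n} \<longrightarrow> b i \<in> {..nat p}) \<and> (i \<notin> {..n} \<longrightarrow> b i = 0)}"
   using b(1) by (auto simp: not_le)
 qed
qed

text \<open>The basis word of \<open>J\<close> is sent to the sum of \<open>f b J\<close> times
  \<open>e_0^(b 0) ... e_n^(b n) e_J\<close>. The sum is finite because the degree bounds the
  exponents, and it never lowers a component.\<close>

lemma kap_surj:
 assumes n: "odd n" and f: "qcub n p f"
 shows "\<exists>F. linear_hom n p F \<and> gap n 0 F \<and> (\<forall>b X. kap n p F b X = f b X)"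
proof -
 have fc: "cub n 0 p f" using f by (simp add: qcub_def)
 define B where "B = {b :: nat \<Rightarrow> nat. (\<forall>i>n. b i = 0) \<and> int (\<Sum>i\<le>n. b i) = p}"
 have B: "finite B" unfolding B_def by (rule finite_exponents)
 define G where "G J = (\<Sum>b\<in>B. mon n 0 (f b J) * word_mon n 1 (expword n b @ wd J))" for J
 have letters: "set (expword n b @ wd J) \<subseteq> {..n}" if "J \<in> Pow {1..n}" for b J
  using set_expword[of n b] wd_letters[OF that] by simp
 have cfG: "cf n (G J) y = (\<Sum>b\<in>B. f b J * (if y = lam n (expword n b @ wd J) then word_sign n 1 (expword n b @ wd J) else 0))" for J y
  by (simp add: G_def cf_sum cf_mon_times word_mon_def cf_mon)
 have supp: "\<exists>b\<in>B. y = lam n (expword n b @ wd J)" if "cf n (G J) y \<noteq> 0" for J y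
  using that unfolding cfG by (auto dest!: sum_nonzero split: if_splits)
 let ?F = "basis_hom n G"
 have F: "linear_hom n p ?F"
 proof (rule linear_hom_basis_hom[OF n])
  fix J assume J: "J \<in> Pow {1..n}"
  show "G J \<in> spin_image n"
   unfolding G_def by (intro spin_image_sum spin_image_const spin_image_word letters J)
  show "homog n (int (length (wd J)) + p) (G J)"
   unfolding homog_def
  proof (intro allI impI)
   fix y assume "cf n (G J) y \<noteq> 0"
   then obtain b where b: "b \<in> B" "y = lam n (expword n b @ wd J)" using supp by blast
   have "int (length (expword n b @ wd J)) = p + int (length (wd J))"
    using b(1) by (simp add: length_expword B_def del: of_nat_sum)
   then show "2 * dgr n y = int (n + 1) * (int (length (wd J)) + p)"
    unfolding b(2) dgr_lam[OF letters[OF J]] half_double[OF n] by simp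
  qed
 qed
 have g: "gap n 0 ?F"
 proof (rule gap_basis[OF n F])
  fix J y i assume J: "J \<in> Pow {1..n}" and y: "cf n (?F (word_mon n 1 (wd J))) y \<noteq> 0"
  obtain b where "y = lam n (expword n b @ wd J)" using supp y unfolding basis_hom_word[OF n J] by blast
  then show "0 \<le> real_of_int (lookup y i - lookup (lam n (wd J)) i)"
   by (simp add: lookup_lam lam_append lookup_add)
 qed
 have k: "kap n p ?F b J = f b J" if J: "J \<in> Pow {1..n}" for b J
 proof (cases "lead_index n p b J")
  case True
  then have b: "b \<in> B" by (simp add: lead_index_def B_def)
  have eq: "lam n (expword n b @ wd J) = lam n (expword n c @ wd J) \<longleftrightarrow> c = b" if c: "c \<in> B" for c
  proof
   assume e: "lam n (expword n b @ wd J) = lam n (expword n c @ wd J)"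
   have "b i = c i" if "i \<le> n" for i
   proof -
    have "lookup (lam n (expword n b @ wd J)) i = lookup (lam n (expword n c @ wd J)) i"
     by (simp only: e)
    then show ?thesis using half_pos[OF n] that by (auto simp: lookup_lam count_expword)
   qed
   moreover have "b i = c i" if "\<not> i \<le> n" for i using that b c by (simp add: B_def)
   ultimately show "c = b" by (metis ext)
  qed simp
  have "cf n (G J) (lam n (expword n b @ wd J)) = (\<Sum>c\<in>B. if c = b then f b J * word_sign n 1 (expword n b @ wd J) else 0)"
   unfolding cfG by (intro sum.cong refl) (simp add: eq del: append_Cons)
  also have "\<dots> = f b J * word_sign n 1 (expword n b @ wd J)" using b B by simp
  finally have "kap n p ?F b J = f b J * (word_sign n 1 (expword n b @ wd J) * word_sign n 1 (expword n b @ wd J))"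
   using True unfolding kap_def wcf_def basis_hom_word[OF n J] by simp
  then show ?thesis using word_sign_pm[of 1 n "expword n b @ wd J"] by simp
 next
  case False
  have "f b J = 0"
  proof (rule ccontr)
   assume nz: "f b J \<noteq> 0"
   have "bdr n b" using f nz by (auto simp: qcub_def)
   then show False using cubD[OF fc nz] False by (simp add: lead_index_def)
  qed
  then show ?thesis using False by (simp add: kap_def)
 qed
 have "kap n p ?F b X = f b X" for b X
 proof (cases "X \<subseteq> {..n}")
  case X: True
  show ?thesis
  \<comment> \<open>Only sets without 0 were prescribed; the others are their complements, and both
    functions are invariant under complement.\<close>
  proof (cases "0 \<in> X")
   case True
   have kc: "cub n 0 p (kap n p ?F)" using qcub_kap[OF n F] by (simp add: qcub_def)
   have "{..n} - X \<in> Pow {1..n}" using True by (auto simp: Suc_le_eq intro: gr0I)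
   then show ?thesis using k cub_compl[OF kc X, of b] cub_compl[OF fc X, of b] by simp
  next
   case False
   then have "X \<in> Pow {1..n}" using X by (auto simp: Suc_le_eq intro: gr0I)
   then show ?thesis by (rule k)
  qed
 next
  case False
  have "f b X = 0" using cubD(1)[OF fc, of b X] False by blast
  then show ?thesis using False by (simp add: kap_def lead_index_def)
 qed
 then show ?thesis using F g by blast
qed

section \<open>The reduced endomorphism complex\<close>

definition End_lattice :: "nat \<Rightarrow> int \<Rightarrow> (real, endo) module" where
 "End_lattice n p = (End_module n p)\<lparr>carrier := End_ge0 n p\<rparr>"

abbreviation End_cls where
 "End_cls n p \<Phi> \<equiv> End_gt0 n p +>\<^bsub>End_lattice n p\<^esub> \<Phi>"

definition lead :: "nat \<Rightarrow> int \<Rightarrow> endo \<Rightarrow> (nat \<Rightarrow> nat) \<times> nat set \<Rightarrow> real" where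
 "lead n p \<Phi> k = kap n p (lft n \<Phi>) (fst k) (snd k)"

lemma End_lattice_simps:
 "carrier (End_lattice n p) = End_ge0 n p" "x \<oplus>\<^bsub>End_lattice n p\<^esub> y = x \<oplus>\<^bsub>End_module n p\<^esub> y"
 "r \<odot>\<^bsub>End_lattice n p\<^esub> x = r \<odot>\<^bsub>End_module n p\<^esub> x" "\<zero>\<^bsub>End_lattice n p\<^esub> = \<zero>\<^bsub>End_module n p\<^esub>"
 by (simp_all add: End_lattice_def)

lemma kap_cong:
 assumes "\<And>a. a \<in> spin_image n \<Longrightarrow> F a = G a"
 shows "kap n p F b X = kap n p G b X"
proof (cases "lead_index n p b X")
 case True
 then have "F (word_mon n 1 (wd X)) = G (word_mon n 1 (wd X))"
  by (intro assms spin_image_word set_wd) (simp add: lead_index_def)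
 then show ?thesis by (simp only: kap_def)
qed (simp add: kap_def)

lemma gap_cong:
 assumes "\<And>a. a \<in> spin_image n \<Longrightarrow> F a = G a" "gap n c F"
 shows "gap n c G"
 using assms spin_image_word[of _ n] unfolding gap_def by simp

lemma kap_linear:
 "kap n p (\<lambda>a. F a + G a) b X = kap n p F b X + kap n p G b X"
 "kap n p (\<lambda>a. mon n 0 r * F a) b X = r * kap n p F b X"
 "kap n p (\<lambda>a. 0) b X = 0"
 by (simp_all add: kap_def wcf_def cf_add cf_mon_times cf_zero distrib_left)

lemma gap_linear:
 "gap n c F \<Longrightarrow> gap n c G \<Longrightarrow> gap n c (\<lambda>a. F a + G a)"
 "gap n c F \<Longrightarrow> gap n c (\<lambda>a. mon n 0 r * F a)"
 "gap n c (\<lambda>a. 0)"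
proof -
 show "gap n c F \<Longrightarrow> gap n c G \<Longrightarrow> gap n c (\<lambda>a. F a + G a)"
  unfolding gap_def cf_add by (metis add.right_neutral)
qed (simp_all add: gap_def cf_mon_times cf_zero)

lemma End_ge0D:
 assumes n: "odd n" and "\<Phi> \<in> End_ge0 n p"
 shows "\<Phi> \<in> carrier (End_module n p)" "gap n 0 (lft n \<Phi>)" "linear_hom n p (lft n \<Phi>)"
 using assms(2) End_linear[OF n] by (simp_all add: End_ge0_iff[OF n])

lemma End_lattice_ops:
 assumes n: "odd n" and \<Phi>: "\<Phi> \<in> End_ge0 n p"
 shows "\<Psi> \<in> End_ge0 n p \<Longrightarrow> \<Phi> \<oplus>\<^bsub>End_module n p\<^esub> \<Psi> \<in> End_ge0 n p"
  "r \<odot>\<^bsub>End_module n p\<^esub> \<Phi> \<in> End_ge0 n p"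
proof -
 note \<Phi>' = End_ge0D[OF n \<Phi>]
 show "\<Phi> \<oplus>\<^bsub>End_module n p\<^esub> \<Psi> \<in> End_ge0 n p" if \<Psi>: "\<Psi> \<in> End_ge0 n p"
 proof -
  note \<Psi>' = End_ge0D[OF n \<Psi>]
  have "gap n 0 (lft n (\<Phi> \<oplus>\<^bsub>End_module n p\<^esub> \<Psi>))"
   by (rule gap_cong[OF _ gap_linear(1)[OF \<Phi>'(2) \<Psi>'(2)]]) (simp add: End_ops_lft(1)[OF n \<Phi>'(1) _ \<Psi>'(1)])
  then show ?thesis using End_ops_closed(1)[OF n \<Phi>'(1) \<Psi>'(1)] by (simp add: End_ge0_iff[OF n])
 qed
 have "gap n 0 (lft n (r \<odot>\<^bsub>End_module n p\<^esub> \<Phi>))"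
  by (rule gap_cong[OF _ gap_linear(2)[OF \<Phi>'(2), where r = r]]) (simp add: End_ops_lft(2)[OF n \<Phi>'(1)])
 then show "r \<odot>\<^bsub>End_module n p\<^esub> \<Phi> \<in> End_ge0 n p"
  using End_ops_closed(2)[OF n \<Phi>'(1)] by (simp add: End_ge0_iff[OF n])
qed

lemma End_lattice_zero: "odd n \<Longrightarrow> \<zero>\<^bsub>End_module n p\<^esub> \<in> End_ge0 n p"
 by (simp add: End_ge0_iff End_zero(1)) (rule gap_cong[OF _ gap_linear(3)], simp add: End_zero(2))

lemma real_coordinates_lead:
 assumes n: "odd n" shows "real_coordinates (End_lattice n p) (lead n p)"
 unfolding real_coordinates_def End_lattice_simps
proof (intro conjI ballI allI)
 fix \<Phi> assume \<Phi>: "\<Phi> \<in> End_ge0 n p"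
 note \<Phi>' = End_ge0D[OF n \<Phi>]
 show "\<Phi> \<oplus>\<^bsub>End_module n p\<^esub> \<Psi> \<in> End_ge0 n p" if "\<Psi> \<in> End_ge0 n p" for \<Psi>
  by (rule End_lattice_ops(1)[OF n \<Phi> that])
 show "lead n p (\<Phi> \<oplus>\<^bsub>End_module n p\<^esub> \<Psi>) k = lead n p \<Phi> k + lead n p \<Psi> k" if \<Psi>: "\<Psi> \<in> End_ge0 n p" for \<Psi> k
  unfolding lead_def kap_linear(1)[symmetric]
  by (rule kap_cong) (rule End_ops_lft(1)[OF n \<Phi>'(1) _ End_ge0D(1)[OF n \<Psi>]])
 show "r \<odot>\<^bsub>End_module n p\<^esub> \<Phi> \<in> End_ge0 n p" for r by (rule End_lattice_ops(2)[OF n \<Phi>])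
 show "lead n p (r \<odot>\<^bsub>End_module n p\<^esub> \<Phi>) k = r * lead n p \<Phi> k" for r k
  unfolding lead_def kap_linear(2)[symmetric] by (rule kap_cong) (rule End_ops_lft(2)[OF n \<Phi>'(1)])
next
 show "\<zero>\<^bsub>End_module n p\<^esub> \<in> End_ge0 n p" by (rule End_lattice_zero[OF n])
 show "lead n p \<zero>\<^bsub>End_module n p\<^esub> k = 0" for k
  unfolding lead_def kap_linear(3)[of n p "fst k" "snd k", symmetric] by (rule kap_cong) (rule End_zero(2)[OF n])
qed

text \<open>Leading coefficients are not faithful before the quotient is taken; here all
  coefficients of all values serve as coordinates.\<close>

lemma abelian_group_End_lattice:
 assumes n: "odd n" shows "abelian_group (End_lattice n p)"
proof (rule abelian_group_of_coordinates)
 let ?\<kappa> = "\<lambda>\<Phi> (k :: amb \<times> (nat \<Rightarrow>\<^sub>0 int)). if fst k \<in> spin_image n then cf n (lft n \<Phi> (fst k)) (snd k) else 0"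
 show "real_coordinates (End_lattice n p) ?\<kappa>"
  unfolding real_coordinates_def End_lattice_simps
  using End_ge0D[OF n] by (auto simp: End_lattice_ops[OF n] End_lattice_zero[OF n] End_ops_lft[OF n] End_zero[OF n]
    cf_add cf_mon_times cf_zero)
 show "inj_on ?\<kappa> (carrier (End_lattice n p))"
  unfolding End_lattice_simps
 proof (rule inj_onI)
  fix \<Phi> \<Psi> assume \<Phi>: "\<Phi> \<in> End_ge0 n p" and \<Psi>: "\<Psi> \<in> End_ge0 n p" and eq: "?\<kappa> \<Phi> = ?\<kappa> \<Psi>"
  show "\<Phi> = \<Psi>"
  proof (rule End_eqI[OF n End_ge0D(1)[OF n \<Phi>] End_ge0D(1)[OF n \<Psi>]])
   fix a assume a: "a \<in> spin_image n"
   show "lft n \<Phi> a = lft n \<Psi> a"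
   proof (rule diag_eqI)
    show "diag n (lft n \<Phi> a)" by (intro diag_spin_image linear_homD(1)[OF End_ge0D(3)[OF n \<Phi>]] a)
    show "diag n (lft n \<Psi> a)" by (intro diag_spin_image linear_homD(1)[OF End_ge0D(3)[OF n \<Psi>]] a)
    show "cf n (lft n \<Phi> a) v = cf n (lft n \<Psi> a) v" for v using fun_cong[OF eq, of "(a, v)"] a by simp
   qed
  qed
 qed
qed

text \<open>The condition under which the leading coefficients become faithful coordinates of the
  reduced complex: a term of gap 0 is a leading term, and a gap of 1 excludes leading terms.\<close>

lemma End_gt0_kernel:
 assumes n: "odd n"
 shows "End_gt0 n p = {\<Phi> \<in> carrier (End_lattice n p). \<forall>k. lead n p \<Phi> k = 0}"
proof (intro equalityI subsetI)
 fix \<Phi> assume "\<Phi> \<in> End_gt0 n p"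
 then have \<Phi>: "\<Phi> \<in> carrier (End_module n p)" "gap n 1 (lft n \<Phi>)" by (simp_all add: End_gt0_iff[OF n])
 have "gap n 0 (lft n \<Phi>)" using \<Phi>(2) unfolding gap_def by (meson order_trans zero_le_one)
 then show "\<Phi> \<in> {\<Phi> \<in> carrier (End_lattice n p). \<forall>k. lead n p \<Phi> k = 0}"
  using \<Phi> kap_gap1[OF n \<Phi>(2)] by (simp add: End_lattice_simps lead_def End_ge0_iff[OF n])
next
 fix \<Phi> assume a: "\<Phi> \<in> {\<Phi> \<in> carrier (End_lattice n p). \<forall>k. lead n p \<Phi> k = 0}"
 then have \<Phi>: "\<Phi> \<in> End_ge0 n p" by (simp add: End_lattice_simps)
 have "kap n p (lft n \<Phi>) b X = 0" for b X using a by (auto simp: lead_def dest: spec[of _ "(b, X)"])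
 then have "gap n 1 (lft n \<Phi>)" by (rule kap_zero_gap1[OF n End_ge0D(3,2)[OF n \<Phi>]])
 then show "\<Phi> \<in> End_gt0 n p" using End_ge0D(1)[OF n \<Phi>] by (simp add: End_gt0_iff[OF n])
qed

lemma End0_eq: "End0 n p = quot_module (End_lattice n p) (End_gt0 n p)"
 by (simp add: End0_def End_lattice_def)

definition lead0 :: "nat \<Rightarrow> int \<Rightarrow> endo set \<Rightarrow> (nat \<Rightarrow> nat) \<times> nat set \<Rightarrow> real" where
 "lead0 n p A = lead n p (SOME \<Phi>. \<Phi> \<in> A)"

lemma End0_coordinates:
 assumes n: "odd n"
 shows "real_coordinates (End0 n p) (lead0 n p)" "inj_on (lead0 n p) (carrier (End0 n p))"
  "\<Phi> \<in> End_ge0 n p \<Longrightarrow> lead0 n p (End_cls n p \<Phi>) = lead n p \<Phi>"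
  "\<Phi> \<in> End_ge0 n p \<Longrightarrow> End_cls n p \<Phi> = {\<Psi> \<in> End_ge0 n p. lead n p \<Psi> = lead n p \<Phi>}"
 using quot_module_coordinates[OF abelian_group_End_lattice[OF n] real_coordinates_lead[OF n] End_gt0_kernel[OF n]]
 unfolding End0_eq lead0_def End_lattice_simps by simp_all

lemma End0_carrier: "carrier (End0 n p) = (\<lambda>\<Phi>. End_cls n p \<Phi>) ` End_ge0 n p"
 unfolding End0_eq quot_module_simps End_lattice_simps ..

lemma End_diff_ge0:
 assumes n: "odd n" and \<Phi>: "\<Phi> \<in> End_ge0 n p"
 shows "End_diff n p \<Phi> \<in> End_ge0 n (p + 1)"
  "lead n (p + 1) (End_diff n p \<Phi>) = (\<lambda>k. qdiff n (\<lambda>b X. lead n p \<Phi> (b, X)) (fst k) (snd k))"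
proof -
 note \<Phi>' = End_ge0D[OF n \<Phi>]
 note d = End_diff[OF n \<Phi>'(1)]
 have "gap n 0 (lft n (End_diff n p \<Phi>))"
  by (rule gap_cong[OF _ gap_hom_diff[OF n \<Phi>'(3,2)]]) (simp add: d(2))
 then show "End_diff n p \<Phi> \<in> End_ge0 n (p + 1)" using d(1) by (simp add: End_ge0_iff[OF n])
 show "lead n (p + 1) (End_diff n p \<Phi>) = (\<lambda>k. qdiff n (\<lambda>b X. lead n p \<Phi> (b, X)) (fst k) (snd k))"
 proof
  fix k
  have "lead n (p + 1) (End_diff n p \<Phi>) k = kap n (p + 1) (hom_diff n p (lft n \<Phi>)) (fst k) (snd k)"
   unfolding lead_def by (rule kap_cong) (rule d(2))
  then show "lead n (p + 1) (End_diff n p \<Phi>) k = qdiff n (\<lambda>b X. lead n p \<Phi> (b, X)) (fst k) (snd k)"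
   by (simp add: kap_hom_diff[OF n \<Phi>'(3,2)] lead_def)
 qed
qed

text \<open>The leading coefficients of the differential depend only on those of the endomorphism,
  so all members of the union coincide.\<close>

lemma End0_diff_coset:
 assumes n: "odd n" and \<Phi>: "\<Phi> \<in> End_ge0 n p"
 shows "End0_diff n p (End_cls n p \<Phi>) = End_cls n (p + 1) (End_diff n p \<Phi>)"
proof -
 have c: "End_gt0 n (p + 1) +>\<^bsub>End_module n (p + 1)\<^esub> \<Psi> = End_cls n (p + 1) \<Psi>" for \<Psi>
  by (intro equalityI subsetI) (simp_all add: mem_a_r_coset End_lattice_simps)
 have d: "End_cls n (p + 1) (End_diff n p \<Psi>) = End_cls n (p + 1) (End_diff n p \<Phi>)"
  if "\<Psi> \<in> End_ge0 n p" "lead n p \<Psi> = lead n p \<Phi>" for \<Psi>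
  unfolding End0_coordinates(4)[OF n End_diff_ge0(1)[OF n that(1)]] End0_coordinates(4)[OF n End_diff_ge0(1)[OF n \<Phi>]]
   End_diff_ge0(2)[OF n that(1)] End_diff_ge0(2)[OF n \<Phi>] that(2) ..
 have union: "(\<Union>\<Psi>\<in>D. T \<Psi>) = T \<Phi>" if "\<Phi> \<in> D" "\<And>\<Psi>. \<Psi> \<in> D \<Longrightarrow> T \<Psi> = T \<Phi>" for D :: "endo set" and T :: "endo \<Rightarrow> endo set"
  using that by blast
 show ?thesis
  unfolding End0_diff_def c
 proof (rule union)
  show "\<Phi> \<in> End_cls n p \<Phi>" unfolding End0_coordinates(4)[OF n \<Phi>] using \<Phi> by simp
  fix \<Psi> assume "\<Psi> \<in> End_cls n p \<Phi>"
  then have "\<Psi> \<in> End_ge0 n p" "lead n p \<Psi> = lead n p \<Phi>" unfolding End0_coordinates(4)[OF n \<Phi>] by simp_all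
  then show "End_cls n (p + 1) (End_diff n p \<Psi>) = End_cls n (p + 1) (End_diff n p \<Phi>)"
   by (rule d)
 qed
qed

definition coch :: "nat \<Rightarrow> int \<Rightarrow> endo set \<Rightarrow> cochain" where
 "coch n p A b X = lead0 n p A (b, X)"

lemma coch_coset:
 assumes n: "odd n" and \<Phi>: "\<Phi> \<in> End_ge0 n p"
 shows "coch n p (End_cls n p \<Phi>) = kap n p (lft n \<Phi>)"
 by (intro ext) (simp add: coch_def End0_coordinates(3)[OF n \<Phi>] lead_def)

lemma coch_qcub:
 assumes n: "odd n" and A: "A \<in> carrier (End0 n p)"
 shows "qcub n p (coch n p A)"
proof -
 obtain \<Phi> where \<Phi>: "\<Phi> \<in> End_ge0 n p" "A = End_cls n p \<Phi>" using A unfolding End0_carrier by blast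
 show ?thesis unfolding \<Phi>(2) coch_coset[OF n \<Phi>(1)] by (rule qcub_kap[OF n End_ge0D(3)[OF n \<Phi>(1)]])
qed

lemma coch_surj:
 assumes n: "odd n" and f: "qcub n p f"
 shows "\<exists>A\<in>carrier (End0 n p). coch n p A = f"
proof -
 obtain F where F: "linear_hom n p F" "gap n 0 F" "\<forall>b X. kap n p F b X = f b X" using kap_surj[OF n f] by blast
 let ?\<Phi> = "mk_endo n F"
 have "gap n 0 (lft n ?\<Phi>)" by (rule gap_cong[OF _ F(2)]) (simp add: mk_endo(2)[OF n F(1)])
 then have \<Phi>: "?\<Phi> \<in> End_ge0 n p" using mk_endo(1)[OF n F(1)] by (simp add: End_ge0_iff[OF n])
 have "kap n p (lft n ?\<Phi>) = f"
  using F(3) kap_cong[of n "lft n ?\<Phi>" F, OF mk_endo(2)[OF n F(1)]] by (intro ext) simp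
 then show ?thesis using \<Phi> by (intro bexI[of _ "End_cls n p ?\<Phi>"]) (simp_all add: coch_coset[OF n] End0_carrier)
qed

lemma coch_inj:
 assumes n: "odd n" and A: "A \<in> carrier (End0 n p)" "B \<in> carrier (End0 n p)" and eq: "coch n p A = coch n p B"
 shows "A = B"
proof (rule inj_onD[OF End0_coordinates(2)[OF n] _ A])
 show "lead0 n p A = lead0 n p B"
 proof
  fix k show "lead0 n p A k = lead0 n p B k"
   using fun_cong[OF fun_cong[OF eq, of "fst k"], of "snd k"] by (simp add: coch_def)
 qed
qed

lemma coch_diff:
 assumes n: "odd n" and A: "A \<in> carrier (End0 n p)"
 shows "End0_diff n p A \<in> carrier (End0 n (p + 1))" "coch n (p + 1) (End0_diff n p A) = qdiff n (coch n p A)"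
proof -
 obtain \<Phi> where \<Phi>: "\<Phi> \<in> End_ge0 n p" "A = End_cls n p \<Phi>" using A unfolding End0_carrier by blast
 note d = End_diff_ge0[OF n \<Phi>(1)]
 show "End0_diff n p A \<in> carrier (End0 n (p + 1))"
  unfolding \<Phi>(2) End0_diff_coset[OF n \<Phi>(1)] End0_carrier using d(1) by blast
 show "coch n (p + 1) (End0_diff n p A) = qdiff n (coch n p A)"
 proof (intro ext)
  fix b X
  have "coch n (p + 1) (End0_diff n p A) b X = lead n (p + 1) (End_diff n p \<Phi>) (b, X)"
   unfolding \<Phi>(2) End0_diff_coset[OF n \<Phi>(1)] coch_def End0_coordinates(3)[OF n d(1)] ..
  moreover have "coch n p A = (\<lambda>b X. lead n p \<Phi> (b, X))"
   by (intro ext) (simp add: \<Phi>(2) coch_def End0_coordinates(3)[OF n \<Phi>(1)])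
  ultimately show "coch n (p + 1) (End0_diff n p A) b X = qdiff n (coch n p A) b X"
   by (simp add: d(2))
 qed
qed

lemma qdiff_combination:
 assumes "\<And>b X. f b X = r * g b X + s * h b X"
 shows "qdiff n f b X = r * qdiff n g b X + s * qdiff n h b X" "qfun n p f = r * qfun n p g + s * qfun n p h"
proof -
 have "f = (\<lambda>b X. r * g b X + s * h b X)" by (intro ext) (rule assms)
 then show "qdiff n f b X = r * qdiff n g b X + s * qdiff n h b X" "qfun n p f = r * qfun n p g + s * qfun n p h"
  by (simp_all only: qdiff_linear qfun_linear)
qed

text \<open>The map \<open>coch\<close> identifies the reduced complex with the boundary quotient of
  the cubical complex; \<open>qfun\<close> is the functional that separates cocycles from
  coboundaries.\<close>

lemma real_range_End0:
 assumes n: "odd n"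
 shows "real_range (cohomology (End0 n) (End0_diff n) p) (if p = 0 \<or> p = int n then UNIV else {0})"
proof -
 let ?E = "End0 n p" and ?c = "coch n p"
 let ?l = "\<lambda>A. qfun n p (?c A)"
 define Z where "Z = {A \<in> carrier ?E. End0_diff n p A = \<zero>\<^bsub>End0 n (p + 1)\<^esub>}"
 note C = End0_coordinates(1)[OF n, of p] and C' = End0_coordinates(1)[OF n, of "p + 1"]
 have coch0: "coch n q \<zero>\<^bsub>End0 n q\<^esub> b X = 0" for q b X
  using real_coordinatesD(6)[OF End0_coordinates(1)[OF n]] by (simp add: coch_def)
 have Z: "A \<in> Z \<longleftrightarrow> A \<in> carrier ?E \<and> (\<forall>b X. qdiff n (?c A) b X = 0)" for A
 proof -
  have "End0_diff n p A = \<zero>\<^bsub>End0 n (p + 1)\<^esub> \<longleftrightarrow> (\<forall>b X. qdiff n (?c A) b X = 0)" if A: "A \<in> carrier ?E"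
  proof
   assume "End0_diff n p A = \<zero>\<^bsub>End0 n (p + 1)\<^esub>"
   then show "\<forall>b X. qdiff n (?c A) b X = 0" using coch_diff(2)[OF n A] coch0[of "p + 1"] by simp
  next
   assume z: "\<forall>b X. qdiff n (?c A) b X = 0"
   have "coch n (p + 1) (End0_diff n p A) = coch n (p + 1) \<zero>\<^bsub>End0 n (p + 1)\<^esub>"
    unfolding coch_diff(2)[OF n A] using z coch0[of "p + 1"] by (intro ext) simp
   then show "End0_diff n p A = \<zero>\<^bsub>End0 n (p + 1)\<^esub>"
    by (rule coch_inj[OF n coch_diff(1)[OF n A] real_coordinatesD(5)[OF C']])
  qed
  then show ?thesis unfolding Z_def by blast
 qed
 have add: "?c (A \<oplus>\<^bsub>?E\<^esub> B) b X = 1 * ?c A b X + 1 * ?c B b X" if "A \<in> carrier ?E" "B \<in> carrier ?E" for A B b X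
  using real_coordinatesD(2)[OF C that] by (simp add: coch_def)
 have smult: "?c (r \<odot>\<^bsub>?E\<^esub> A) b X = r * ?c A b X + 0 * ?c A b X" if "A \<in> carrier ?E" for r A b X
  using real_coordinatesD(4)[OF C that] by (simp add: coch_def)
 have zero: "?c \<zero>\<^bsub>?E\<^esub> b X = 0 * ?c \<zero>\<^bsub>?E\<^esub> b X + 0 * ?c \<zero>\<^bsub>?E\<^esub> b X" for b X
  using coch0 by simp
 have l: "real_coordinates (?E\<lparr>carrier := Z\<rparr>) (\<lambda>A (k :: unit). ?l A)"
  unfolding real_coordinates_def
 proof (intro conjI ballI allI)
  fix A assume "A \<in> carrier (?E\<lparr>carrier := Z\<rparr>)"
  then have A: "A \<in> carrier ?E" "\<And>b X. qdiff n (?c A) b X = 0" using Z by auto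
  show "r \<odot>\<^bsub>?E\<lparr>carrier := Z\<rparr>\<^esub> A \<in> carrier (?E\<lparr>carrier := Z\<rparr>)" for r
   using A real_coordinatesD(3)[OF C A(1)] qdiff_combination(1)[OF smult[OF A(1)]] by (simp add: Z)
  show "?l (r \<odot>\<^bsub>?E\<lparr>carrier := Z\<rparr>\<^esub> A) = r * ?l A" for r
   using qdiff_combination(2)[OF smult[OF A(1)]] by simp
  fix B assume "B \<in> carrier (?E\<lparr>carrier := Z\<rparr>)"
  then have B: "B \<in> carrier ?E" "\<And>b X. qdiff n (?c B) b X = 0" using Z by auto
  show "A \<oplus>\<^bsub>?E\<lparr>carrier := Z\<rparr>\<^esub> B \<in> carrier (?E\<lparr>carrier := Z\<rparr>)"
   using A B real_coordinatesD(1)[OF C A(1) B(1)] qdiff_combination(1)[OF add[OF A(1) B(1)]] by (simp add: Z)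
  show "?l (A \<oplus>\<^bsub>?E\<lparr>carrier := Z\<rparr>\<^esub> B) = ?l A + ?l B"
   using qdiff_combination(2)[OF add[OF A(1) B(1)]] by simp
 next
  show "\<zero>\<^bsub>?E\<lparr>carrier := Z\<rparr>\<^esub> \<in> carrier (?E\<lparr>carrier := Z\<rparr>)"
   using real_coordinatesD(5)[OF C] qdiff_combination(1)[OF zero] by (simp add: Z)
  show "?l \<zero>\<^bsub>?E\<lparr>carrier := Z\<rparr>\<^esub> = 0" using qdiff_combination(2)[OF zero] by simp
 qed
 have B: "End0_diff n (p - 1) ` carrier (End0 n (p - 1)) = {A \<in> Z. ?l A = 0}"
 proof (intro equalityI subsetI)
  fix A assume "A \<in> End0_diff n (p - 1) ` carrier (End0 n (p - 1))"
  then obtain B where B: "B \<in> carrier (End0 n (p - 1))" "A = End0_diff n (p - 1) B" by blast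
  have A: "A \<in> carrier ?E" "?c A = qdiff n (coch n (p - 1) B)" using coch_diff[OF n B(1)] B(2) by simp_all
  show "A \<in> {A \<in> Z. ?l A = 0}"
   using A(1) qfun_qdiff[OF coch_qcub[OF n B(1)]] by (simp add: Z A(2) qdiff_square)
 next
  fix A assume "A \<in> {A \<in> Z. ?l A = 0}"
  then have A: "A \<in> carrier ?E" "\<And>b X. qdiff n (?c A) b X = 0" "?l A = 0" by (auto simp: Z)
  obtain w where w: "qcub n (p - 1) w" "\<And>b X. ?c A b X = qdiff n w b X"
   using qfun_exact[OF n coch_qcub[OF n A(1)] A(2,3)] by metis
  obtain B where B: "B \<in> carrier (End0 n (p - 1))" "coch n (p - 1) B = w" using coch_surj[OF n w(1)] ..
  have d: "End0_diff n (p - 1) B \<in> carrier ?E" "?c (End0_diff n (p - 1) B) = qdiff n w"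
   using coch_diff[OF n B(1)] B(2) by simp_all
  have "?c A = ?c (End0_diff n (p - 1) B)" unfolding d(2) by (intro ext) (rule w(2))
  then have "A = End0_diff n (p - 1) B" by (rule coch_inj[OF n A(1) d(1)])
  then show "A \<in> End0_diff n (p - 1) ` carrier (End0 n (p - 1))" using B(1) by blast
 qed
 have I: "?l ` Z = (if p = 0 \<or> p = int n then UNIV else {0})"
 proof (cases "p = 0 \<or> p = int n")
  case True
  obtain x where x: "qcub n p x" "\<And>b X. qdiff n x b X = 0" "qfun n p x = 1" using qfun_surj[OF n True] by metis
  obtain A where A: "A \<in> carrier ?E" "?c A = x" using coch_surj[OF n x(1)] ..
  have "r \<in> ?l ` Z" for r
  proof (rule image_eqI)
   show "r \<odot>\<^bsub>?E\<^esub> A \<in> Z"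
    using x(2) real_coordinatesD(3)[OF C A(1)] qdiff_combination(1)[OF smult[OF A(1)]] by (simp add: Z A(2))
   show "r = ?l (r \<odot>\<^bsub>?E\<^esub> A)" using qdiff_combination(2)[OF smult[OF A(1)]] x(3) by (simp add: A(2))
  qed
  then show ?thesis using True by auto
 next
  case False
  have "?l A = 0" if "A \<in> Z" for A
   using that False by (intro qfun_range[OF n coch_qcub[OF n]]) (simp_all add: Z)
  moreover have "\<zero>\<^bsub>?E\<^esub> \<in> Z" using real_coordinatesD(5)[OF C] qdiff_combination(1)[OF zero] by (simp add: Z)
  ultimately show ?thesis using False by auto
 qed
 show ?thesis
  by (rule real_range_cohomology[where C = "End0 n" and \<delta> = "End0_diff n" and p = p and \<kappa> = "lead0 n p" and l = ?l,
    OF End0_coordinates(1,2)[OF n] l[unfolded Z_def] B[unfolded Z_def] I[unfolded Z_def]])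
qed

theorem theorem18:
  fixes n :: nat
  assumes "odd n"
  shows "graded_module_iso (cohomology (End0 n) (End0_diff n))
           (singular_cohomology (projective_space n))
       \<and> graded_module_iso (cohomology (End0 n) (End0_diff n))
           (singular_cohomology (nsphere n))"
proof -
  \<comment> \<open>The common answer of all three computations: one dimension in degrees 0 and
    \<open>n\<close>, which are distinct for odd \<open>n\<close>.\<close>
  let ?I = "\<lambda>p. if p = 0 \<or> p = int n then UNIV else {0 :: real}"
  have E: "real_range (cohomology (End0 n) (End0_diff n) p) (?I p)" for p by (rule real_range_End0[OF assms])
  have P: "real_range (singular_cohomology (projective_space n) p) (?I p)" for p
    by (rule real_range_sphere_like[OF sphere_like_projective_space[OF assms]])
  have S: "real_range (singular_cohomology (nsphere n) p) (?I p)" for p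
    by (rule real_range_sphere_like[OF sphere_like_nsphere[OF assms]])
  show ?thesis
    using graded_module_iso_real_range[of "cohomology (End0 n) (End0_diff n)" ?I, OF E P]
      graded_module_iso_real_range[of "cohomology (End0 n) (End0_diff n)" ?I, OF E S] by (rule conjI)
qed



end
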